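(* Let $a,d\ge2$ and $k\ge1$ be integers. (1) (Here $a,d,k$ are fixed.) If $d$ is odd, then as $q\to1^-$ along the reals, $$W_{a,d}(q,k)\longrightarrow\frac{\sin(\pi/a)}{d\,\sin(\pi(a-1)/(ad))}.$$ If $d$ is even, then the meromorphic function $q\mapsto W_{a,d}(q,k)$ has simple real poles $q_j\in(0,1)$, indexed by all sufficiently large integers $j$, with $q_j\to1$ as $j\to\infty$; these contain all real poles sufficiently near $1$; and, as $j\to\infty$, $$1-q_j\sim\frac{\pi k}{3aj^2},\qquad \operatorname{Res}_{q=q_j}W_{a,d}(q,k)\sim\frac{2k\sin(\pi/a)}{3ad\,j^3}.$$ (2) Let $Q_*(k)$ be the unique solution $Q\in(0,1)$ of $Q\prod_{n\ge1}(1+Q^n)^k=1$. At each fixed real $q$ with $0<q\le Q_*(k)^{1/a}$, all sections $W_{a,d}(\cdot,k)$ ($d\ge2$) are finite (have no pole) at $q$, and $W_{a,d}(q,k)\to T(q)$ exponentially fast as $d\to\infty$. (3) Put $q_a=e^{-2\pi/\sqrt a}$ and take $k=24$. All sections $W_{a,d}(\cdot,24)$ ($d\ge2$) are finite at $q_a$, and $W_{a,d}(q_a,24)\to a^6$ exponentially fast as $d\to\infty$ (with $a$ fixed). For each fixed $d\ge2$, as the integer $a\to\infty$, $$W_{a,d}(q_a,24)-a^6\sim48\pi(-1)^{d-1}23^{d-2}a^{-1/2}e^{-4\pi(d-1)\sqrt a}.$$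
   Context: $\Phi(q)=\prod_{n\ge1}(1-q^n)$. For integers $a,d\ge2$, $k\ge1$ and $0<|q|<1$ put $$J(z,q)=\frac{\sum_{m\ge0}z^mq^{am+1}\Phi(q^{am+1})^k}{\sum_{m\ge0}z^mq^{a(m+1)}\Phi(q^{a(m+1)})^k},\qquad W_{a,d}(q,k)=\frac1d\sum_{z^d=1}J(z,q),\qquad T(q)=q^{1-a}\frac{\Phi(q)^k}{\Phi(q^a)^k},$$ where the sum in $W$ runs over all complex $d$th roots of unity. $W_{a,d}(\cdot,k)$ is regarded as a meromorphic function of $q$ on $0<|q|<1$ and is called the section of order $d$. "Exponentially" means that the error is $O(\rho^d)$ for some $\rho<1$ (depending on the fixed parameters). *)

theory Defs
  imports "HOL-Complex_Analysis.Complex_Analysis"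
begin

definition Phi :: "complex \<Rightarrow> complex" where
  "Phi q = (\<Prod>n. 1 - q ^ Suc n)"

definition J_num :: "nat \<Rightarrow> nat \<Rightarrow> complex \<Rightarrow> complex \<Rightarrow> complex" where
  "J_num a k z q = (\<Sum>m. z ^ m * q ^ (a * m + 1) * Phi (q ^ (a * m + 1)) ^ k)"

definition J_den :: "nat \<Rightarrow> nat \<Rightarrow> complex \<Rightarrow> complex \<Rightarrow> complex" where
  "J_den a k z q = (\<Sum>m. z ^ m * q ^ (a * (m + 1)) * Phi (q ^ (a * (m + 1))) ^ k)"

definition J :: "nat \<Rightarrow> nat \<Rightarrow> complex \<Rightarrow> complex \<Rightarrow> complex" where
  "J a k z q = J_num a k z q / J_den a k z q"

text \<open>
  The section of order \<open>d\<close> is a meromorphic function of \<open>q\<close>. At a point where some denominator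
  vanishes, the pointwise formula takes the junk value of division by zero, although the
  singularity of the sum may well be removable; \<^const>\<open>remove_sings\<close> gives the sum its correct
  meromorphic values there (and the value 0 at genuine poles).
\<close>
definition W :: "nat \<Rightarrow> nat \<Rightarrow> nat \<Rightarrow> complex \<Rightarrow> complex" where
  "W a d k = remove_sings (\<lambda>q. (1 / of_nat d) * (\<Sum>z | z ^ d = 1. J a k z q))"

definition T :: "nat \<Rightarrow> nat \<Rightarrow> complex \<Rightarrow> complex" where
  "T a k q = q powi (1 - int a) * Phi q ^ k / Phi (q ^ a) ^ k"

definition is_Qstar :: "nat \<Rightarrow> real \<Rightarrow> bool" where
  "is_Qstar k Q \<longleftrightarrow> 0 < Q \<and> Q < 1 \<and> Q * (\<Prod>n. (1 + Q ^ Suc n) ^ k) = 1"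

definition Qstar :: "nat \<Rightarrow> real" where
  "Qstar k = (THE Q. is_Qstar k Q)"

definition tendsto_exponentially :: "(nat \<Rightarrow> complex) \<Rightarrow> complex \<Rightarrow> bool" where
  "tendsto_exponentially f L \<longleftrightarrow>
     (\<exists>\<rho>::real. 0 < \<rho> \<and> \<rho> < 1 \<and> (\<lambda>d. norm (f d - L)) \<in> O(\<lambda>d. \<rho> ^ d))"

definition q_special :: "nat \<Rightarrow> real" where
  "q_special a = exp (- 2 * pi / sqrt (real a))"

end

theory Submission
  imports Defs "HOL-Real_Asymp.Real_Asymp"
begin

text \<open>
  At \<open>x = exp (- s)\<close>, the modular transformation of \<open>\<Phi>\<close> gives \<open>x \<Phi>(x)\<^sup>k = c s\<^bsup>-k/2\<^esup> exp (- \<beta> / s) (1 + o(1))\<close> as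
  \<open>s \<rightarrow> 0\<close>, with \<open>\<beta> = k \<pi>\<^sup>2 / 6\<close>. For \<open>z = exp (i \<theta>)\<close> both series in \<open>J\<close> have the form \<open>\<Sum> exp (i \<theta> m) H (P (m + r))\<close>. A
  residue argument of Abel--Plana type rewrites such a sum as integrals along the rays \<open>arg s = \<plusminus> \<pi> / 4\<close>, where the saddle
  points lie. For \<open>0 < \<theta> < \<pi>\<close> one ray dominates (\<open>\<theta> = 0\<close> is a Riemann sum) and the sum is asymptotic to a quantity independent of \<open>r\<close> times
  \<open>exp (- i \<theta> r)\<close>; hence \<open>J \<rightarrow> exp (i \<theta> (1 - 1 / a))\<close>, and averaging over the roots of unity gives the limit for odd \<open>d\<close>.
  At \<open>z = -1\<close> the two rays contribute complex conjugates, so the denominator is a positive amplitude times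
  \<open>- cos (\<surd>2 \<Lambda> + const) + o(1)\<close>, where \<open>\<Lambda>\<^sup>2 = \<beta> \<pi> / (a s)\<close>; its zeros are the real poles for even \<open>d\<close>.

  If \<open>Q \<Prod> (1 + Q\<^sup>n)\<^sup>k \<le> 1\<close> for \<open>Q = q\<^sup>a\<close>, the coefficients of the denominator decrease, so it has no zero in the closed unit
  disc of \<open>z\<close> (Enestrom--Kakeya). Then the Taylor coefficients of \<open>J\<close> in \<open>z\<close> decay geometrically, and averaging over the
  \<open>d\<close>th roots of unity keeps those whose index is divisible by \<open>d\<close>. At \<open>q = exp (- 2 \<pi> / \<surd>a)\<close> the modular transformation
  evaluates the constant term as \<open>a\<^sup>6\<close>, and after rescaling the further coefficients satisfy a recurrence that tends, as
  \<open>a \<rightarrow> \<infinity>\<close>, to \<open>\<kappa>\<^sub>n + 24 (\<kappa>\<^sub>2 + \<dots> + \<kappa>\<^bsub>n-1\<^esub>) = - 24\<close>, solved by \<open>\<kappa>\<^sub>n = - 24 (- 23)\<^bsup>n-2\<^esup>\<close>.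
\<close>

section \<open>Euler's function and the two series\<close>

text \<open>The saddle points come from the exponent
  \<open>\<i> \<theta> s - \<beta> / (P s)\<close> of the summand. It is stationary at
  \<open>s\<^sup>2 = \<i> \<beta> / (P \<theta>)\<close>, hence on the ray of argument pi / 4, with
  value \<open>- 2 \<Lambda> exp (- \<i> pi / 4)\<close>, where
  \<open>\<Lambda>\<^sup>2 = \<beta> \<theta> / P\<close>. The points are not real, so the modular
  transformation is needed off the real axis. The lower ray carries the frequency
  \<open>2 pi - \<theta>\<close> in place of \<theta>: it is exponentially smaller for \<theta> < pi
  and equally large at \<theta> = pi. The obstacle at z = -1 is that an asymptotic formula for the
  denominator shows neither that its zeros are simple nor how many lie close together, and it may
  not be differentiated. Therefore the ray calculus is set up for an arbitrary power \<mu> and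
  applied twice, to the coefficient function and to its Euler derivative. The derivative has \<mu>
  larger by one, which shifts its oscillation by pi / 4, so it cannot vanish near the zeros of the
  denominator; this shift enters the residues as sin (pi / 4).\<close>

lemma abs_convergent_Phi:
  assumes "norm (q::complex) < 1" shows "abs_convergent_prod (\<lambda>n. 1 - q ^ Suc n)"
proof -
  have "summable (\<lambda>n. norm q ^ Suc n)"
    using assms by (simp add: summable_geometric)
  then show ?thesis
    by (subst abs_convergent_prod_conv_summable) (simp add: norm_power norm_mult)
qed

lemma has_prod_Phi:
  assumes "norm q < 1" shows "(\<lambda>n. 1 - q ^ Suc n) has_prod Phi q"
  unfolding Phi_def
  by (intro convergent_prod_has_prod abs_convergent_prod_imp_convergent_prod abs_convergent_Phi assms)

lemma one_minus_power_nonzero: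
  assumes "norm (q::complex) < 1" shows "1 - q ^ Suc n \<noteq> 0"
proof
  assume "1 - q ^ Suc n = 0"
  then have "norm q ^ Suc n = 1" by (metis eq_iff_diff_eq_0 norm_one norm_power)
  moreover have "norm q ^ Suc n < 1" using assms by (simp add: power_less_one_iff del: power_Suc)
  ultimately show False by simp
qed

lemma Phi_nonzero: "norm q < 1 \<Longrightarrow> Phi q \<noteq> 0"
  using has_prod_eq_0_iff[OF has_prod_Phi, of q] one_minus_power_nonzero[of q] by (auto simp del: power_Suc)

lemma Phi_LIMSEQ:
  assumes "norm q < 1" shows "(\<lambda>N. \<Prod>n<N. 1 - q ^ Suc n) \<longlonglongrightarrow> Phi q"
  using has_prod_imp_tendsto[OF has_prod_Phi[OF assms]] LIMSEQ_lessThan_iff_atMost by blast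

lemma Phi_holomorphic: "Phi holomorphic_on ball 0 1"
proof (rule holomorphic_uniform_sequence[OF open_ball])
  show "(\<lambda>q. \<Prod>n<N. 1 - q ^ Suc n) holomorphic_on ball 0 1" for N
    by (intro holomorphic_intros)
  fix x :: complex assume x: "x \<in> ball 0 1"
  define d where "d = (1 - norm x) / 2"
  have d: "d > 0" "norm x + d < 1" using x by (auto simp: d_def field_simps)
  have sub: "cball x d \<subseteq> ball 0 1" "norm y \<le> norm x + d" if "y \<in> cball x d" for y
  proof -
    show "norm y \<le> norm x + d" using that norm_triangle_sub[of y x]
      by (simp add: dist_norm norm_minus_commute)
    show "cball x d \<subseteq> ball 0 1"
    proof
      fix y assume "y \<in> cball x d"
      then have "norm y \<le> norm x + d" using norm_triangle_sub[of y x]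
        by (simp add: dist_norm norm_minus_commute)
      with d show "y \<in> ball 0 1" by simp
    qed
  qed
  have "uniformly_convergent_on (cball x d) (\<lambda>N q. \<Prod>n<N. 1 - q ^ Suc n)"
  proof (rule uniformly_convergent_on_prod')
    show "continuous_on (cball x d) (\<lambda>q. 1 - q ^ Suc n)" for n
      by (intro continuous_intros)
    show "uniformly_convergent_on (cball x d) (\<lambda>N q. \<Sum>n<N. norm (1 - q ^ Suc n - 1))"
    proof (rule Weierstrass_m_test'[where M = "\<lambda>n. (norm x + d) ^ Suc n"])
      show "summable (\<lambda>n. (norm x + d) ^ Suc n)"
        using d by (subst summable_Suc_iff) (simp add: summable_geometric)
      show "norm (norm (1 - q ^ Suc n - 1)) \<le> (norm x + d) ^ Suc n" if "q \<in> cball x d" for n q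
        using power_mono[OF sub(2)[OF that], of "Suc n"] by (simp add: norm_power norm_mult)
    qed
  qed auto
  then obtain l where l: "uniform_limit (cball x d) (\<lambda>N q. \<Prod>n<N. 1 - q ^ Suc n) l sequentially"
    by (auto simp: uniformly_convergent_on_def)
  have "l q = Phi q" if "q \<in> cball x d" for q
    using tendsto_uniform_limitI[OF l that] Phi_LIMSEQ[of q] sub[OF that] that d
      LIMSEQ_unique by fastforce
  then have "uniform_limit (cball x d) (\<lambda>N q. \<Prod>n<N. 1 - q ^ Suc n) Phi sequentially"
    using l by (subst uniform_limit_cong'[where i = l and g = "\<lambda>N q. \<Prod>n<N. 1 - q ^ Suc n"]) auto
  moreover have "cball x d \<subseteq> ball 0 1" using sub(1)[of x] d by simp
  ultimately show "\<exists>d>0. cball x d \<subseteq> ball 0 1 \<and>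
      uniform_limit (cball x d) (\<lambda>N q. \<Prod>n<N. 1 - q ^ Suc n) Phi sequentially"
    using d by blast
qed

text \<open>Each factor is at most 1 + r^n \<le> exp (r^n) in modulus, so a geometric series in the
  exponent bounds all partial products at once.\<close>

lemma norm_Phi_le:
  assumes "norm q \<le> r" "r < 1" shows "norm (Phi q) \<le> exp (r / (1 - r))"
proof -
  have r: "r \<ge> 0" using assms(1) norm_ge_zero order_trans by blast
  have sm: "(\<lambda>n. r ^ Suc n) sums (r / (1 - r))"
    using sums_mult[OF geometric_sums[of r], of r] r assms by simp
  have "norm (\<Prod>n<N. 1 - q ^ Suc n) \<le> exp (r / (1 - r))" for N
  proof -
    have "norm (\<Prod>n<N. 1 - q ^ Suc n) = (\<Prod>n<N. norm (1 - q ^ Suc n))"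
      by (rule prod_norm [symmetric])
    also have "\<dots> \<le> (\<Prod>n<N. 1 + r ^ Suc n)"
    proof (intro prod_mono conjI)
      fix n
      have "norm (1 - q ^ Suc n) \<le> norm (1::complex) + norm (q ^ Suc n)" by (rule norm_triangle_ineq4)
      also have "norm (q ^ Suc n) \<le> r ^ Suc n" unfolding norm_power using assms by (intro power_mono) auto
      finally show "norm (1 - q ^ Suc n) \<le> 1 + r ^ Suc n" by simp
    qed auto
    also have "\<dots> \<le> exp (\<Sum>n<N. r ^ Suc n)"
      using r by (intro prod_le_exp_sum) auto
    also have "(\<Sum>n<N. r ^ Suc n) \<le> r / (1 - r)"
      using sum_le_suminf[OF sums_summable[OF sm], of "{..<N}"] sums_unique[OF sm] r by auto
    finally show ?thesis by simp
  qed
  then show ?thesis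
    using LIMSEQ_le_const2[OF tendsto_norm[OF Phi_LIMSEQ[of q]]] assms by auto
qed

text \<open>\<open>Re\<close> discards nothing for |x| < 1: the partial products commute with
  conjugation, so \<open>Phi\<close> is real there (\<open>Phi_of_real\<close>). The real version
  serves order arguments and logarithms.\<close>

definition phi :: "real \<Rightarrow> real" where "phi x = Re (Phi (of_real x))"

lemma Phi_cnj: assumes "norm q < 1" shows "Phi (cnj q) = cnj (Phi q)"
proof -
  have "(\<lambda>N. cnj (\<Prod>n<N. 1 - q ^ Suc n)) \<longlonglongrightarrow> cnj (Phi q)"
    by (intro tendsto_cnj Phi_LIMSEQ assms)
  then have "(\<lambda>N. (\<Prod>n<N. 1 - (cnj q) ^ Suc n)) \<longlonglongrightarrow> cnj (Phi q)"
    by simp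
  moreover have "(\<lambda>N. (\<Prod>n<N. 1 - (cnj q) ^ Suc n)) \<longlonglongrightarrow> Phi (cnj q)"
    using assms by (intro Phi_LIMSEQ) auto
  ultimately show ?thesis using LIMSEQ_unique by blast
qed

lemma Phi_of_real: assumes "\<bar>x\<bar> < 1" shows "Phi (of_real x) = of_real (phi x)"
proof -
  have "cnj (Phi (of_real x)) = Phi (of_real x)"
    using Phi_cnj[of "of_real x"] assms by simp
  then show ?thesis unfolding phi_def using Reals_cnj_iff complex_is_Real_iff
    by (metis of_real_Re)
qed

lemma phi_has_prod: assumes "\<bar>x\<bar> < 1" shows "(\<lambda>n. 1 - x ^ Suc n) has_prod phi x"
proof -
  have "(\<lambda>n. complex_of_real (1 - x ^ Suc n)) has_prod of_real (phi x)"
    using has_prod_Phi[of "of_real x"] Phi_of_real[OF assms] assms by simp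
  then show ?thesis by (simp only: has_prod_of_real_iff)
qed

lemma phi_LIMSEQ: assumes "\<bar>x\<bar> < 1" shows "(\<lambda>N. \<Prod>n<N. 1 - x ^ Suc n) \<longlonglongrightarrow> phi x"
  using has_prod_imp_tendsto[OF phi_has_prod[OF assms]] LIMSEQ_lessThan_iff_atMost by blast

lemma phi_nonneg_factor: assumes "0 \<le> x" "(x::real) < 1" shows "0 < 1 - x ^ Suc n" "1 - x ^ Suc n \<le> 1"
  using assms power_Suc_less_one[of x n] by (cases "x = 0"; simp)+

lemma phi_bounds: assumes "0 \<le> x" "x < 1" shows "0 < phi x" "phi x \<le> 1"
proof -
  have "phi x \<noteq> 0" using Phi_nonzero[of "of_real x"] Phi_of_real[of x] assms by auto
  moreover have "phi x \<ge> 0"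
  proof (rule LIMSEQ_le_const)
    show "(\<lambda>N. \<Prod>n<N. 1 - x ^ Suc n) \<longlonglongrightarrow> phi x" using assms by (intro phi_LIMSEQ) auto
    show "\<exists>N. \<forall>n\<ge>N. 0 \<le> (\<Prod>n<n. 1 - x ^ Suc n)"
      by (intro exI allI impI prod_nonneg less_imp_le phi_nonneg_factor assms)
  qed
  ultimately show "0 < phi x" by simp
  show "phi x \<le> 1"
  proof (rule LIMSEQ_le_const2)
    show "(\<lambda>N. \<Prod>n<N. 1 - x ^ Suc n) \<longlonglongrightarrow> phi x" using assms by (intro phi_LIMSEQ) auto
    show "\<exists>N. \<forall>n\<ge>N. (\<Prod>n<n. 1 - x ^ Suc n) \<le> 1"
      by (intro exI allI impI prod_le_1 conjI less_imp_le phi_nonneg_factor(1)[OF assms] phi_nonneg_factor(2)[OF assms])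
  qed
qed

lemma Phi_0: "Phi 0 = 1"
proof -
  have "(\<lambda>n. 1 - (0::complex) ^ Suc n) = (\<lambda>n. 1)" by auto
  then show ?thesis unfolding Phi_def by (simp only: prodinf_zero)
qed

text \<open>Numerator and denominator of \<open>J\<close> sample this one function, at the points
  q^(a m + 1) and q^(a (m + 1)). For k = 24 it is the modular discriminant as a function of the
  nome.\<close>

definition coef :: "nat \<Rightarrow> complex \<Rightarrow> complex" where
  "coef k x = x * Phi x ^ k"

lemma J_num_coef: "J_num a k z q = (\<Sum>m. z ^ m * coef k (q ^ (a * m + 1)))"
  unfolding J_num_def coef_def by (simp add: mult.assoc)

lemma J_den_coef: "J_den a k z q = (\<Sum>m. z ^ m * coef k (q ^ (a * (m + 1))))"
  unfolding J_den_def coef_def by (simp add: mult.assoc)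

lemma coef_holomorphic: "coef k holomorphic_on ball 0 1"
  unfolding coef_def by (intro holomorphic_intros Phi_holomorphic)

lemma norm_coef_le:
  assumes "norm x \<le> r" "r < 1" shows "norm (coef k x) \<le> norm x * exp (real k * (r / (1 - r)))"
proof -
  have "norm (Phi x) ^ k \<le> exp (r / (1 - r)) ^ k"
    by (intro power_mono norm_Phi_le assms) auto
  then have "norm (Phi x) ^ k \<le> exp (real k * (r / (1 - r)))"
    by (simp only: exp_of_nat_mult)
  then show ?thesis unfolding coef_def norm_mult norm_power
    by (rule mult_left_mono) auto
qed

lemma norm_coef_power_le:
  assumes "norm q \<le> r" "r < 1" "n \<ge> 1"
  shows "norm (coef k (q ^ n)) \<le> r ^ n * exp (real k * (r / (1 - r)))"
proof -
  have r: "r \<ge> 0" using assms(1) norm_ge_zero order_trans by blast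
  have "norm (q ^ n) \<le> r ^ n" unfolding norm_power using assms by (intro power_mono) auto
  moreover have "r ^ n \<le> r ^ 1" using assms r by (intro power_decreasing) auto
  ultimately have "norm (coef k (q ^ n)) \<le> norm (q ^ n) * exp (real k * (r / (1 - r)))"
    using assms by (intro norm_coef_le) auto
  also have "\<dots> \<le> r ^ n * exp (real k * (r / (1 - r)))"
    using \<open>norm (q ^ n) \<le> r ^ n\<close> by (intro mult_right_mono) auto
  finally show ?thesis .
qed

text \<open>Both \<open>J_num\<close> (for \<open>b = 1\<close>) and \<open>J_den\<close> (for \<open>b = a\<close>) are instances of this series.\<close>
lemma coef_series_holomorphic:
  assumes "a \<ge> 1" "b \<ge> 1" "norm z \<le> 1" "norm q < 1"
  shows "summable (\<lambda>m. z ^ m * coef k (q ^ (a * m + b)))"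
   and "((\<lambda>q. \<Sum>m. z ^ m * coef k (q ^ (a * m + b))) has_field_derivative
           (\<Sum>m. z ^ m * deriv (\<lambda>q. coef k (q ^ (a * m + b))) q)) (at q)"
   and "summable (\<lambda>m. z ^ m * deriv (\<lambda>q. coef k (q ^ (a * m + b))) q)"
proof -
  define f where "f = (\<lambda>m q. z ^ m * coef k (q ^ (a * m + b)))"
  define f' where "f' = (\<lambda>m q. z ^ m * deriv (\<lambda>q. coef k (q ^ (a * m + b))) q)"
  have inb: "q ^ (a * m + b) \<in> ball 0 1" if "norm q < 1" for q :: complex and m
    using that assms(2) by (simp add: norm_power power_less_one_iff)
  have holo: "(\<lambda>q. coef k (q ^ (a * m + b))) holomorphic_on ball 0 1" for m
    by (rule holomorphic_on_compose_gen[OF _ coef_holomorphic, unfolded o_def])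
       (use inb in \<open>auto intro!: holomorphic_intros\<close>)
  have der: "(f m has_field_derivative f' m q) (at q)" if "q \<in> ball 0 1" for m q
    unfolding f_def f'_def
    by (intro DERIV_cmult holomorphic_derivI[OF holo open_ball] that)
  have bnd: "\<exists>d (h :: nat \<Rightarrow> complex). 0 < d \<and> summable h \<and> range h \<subseteq> \<real>\<^sub>\<ge>\<^sub>0 \<and>
      (\<forall>\<^sub>F m in sequentially. \<forall>y\<in>ball x d \<inter> ball 0 1. norm (f m y) \<le> norm (h m))"
    if x: "x \<in> ball 0 1" for x
  proof -
    define d where "d = (1 - norm x) / 2"
    define r where "r = norm x + d"
    have d: "d > 0" "r < 1" "r \<ge> 0" using x by (auto simp: d_def r_def field_simps)
    define h where "h = (\<lambda>m. complex_of_real (r ^ m * exp (real k * (r / (1 - r)))))"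
    have "summable (\<lambda>m. r ^ m * exp (real k * (r / (1 - r))))"
      using d by (intro summable_mult2 summable_geometric) auto
    then have "summable h" unfolding h_def by (rule summable_of_real)
    moreover have "range h \<subseteq> \<real>\<^sub>\<ge>\<^sub>0" using d by (auto simp: h_def)
    moreover have "norm (f m y) \<le> norm (h m)" if "y \<in> ball x d" for m y
    proof -
      have y: "norm y \<le> r" using that norm_triangle_sub[of y x]
        by (simp add: dist_norm norm_minus_commute r_def)
      have "norm (f m y) = norm z ^ m * norm (coef k (y ^ (a * m + b)))"
        by (simp add: f_def norm_mult norm_power)
      also have "\<dots> \<le> 1 * norm (coef k (y ^ (a * m + b)))"
        using assms by (intro mult_right_mono power_le_one) auto
      also have "\<dots> \<le> r ^ (a * m + b) * exp (real k * (r / (1 - r)))"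
        using norm_coef_power_le[OF y d(2), of "a * m + b"] assms by simp
      also have "m \<le> a * m + b" using mult_le_mono1[OF assms(1), of m] by linarith
      then have "r ^ (a * m + b) * exp (real k * (r / (1 - r))) \<le> r ^ m * exp (real k * (r / (1 - r)))"
        using d by (intro mult_right_mono power_decreasing) auto
      finally show ?thesis using d by (simp add: h_def norm_mult norm_power)
    qed
    ultimately show ?thesis using d
      by (intro exI[of _ d] exI[of _ h] conjI always_eventually allI ballI) auto
  qed
  obtain g g' where gg: "\<forall>x\<in>ball 0 1. ((\<lambda>n. f n x) sums g x) \<and> ((\<lambda>n. f' n x) sums g' x) \<and> (g has_field_derivative g' x) (at x)"
    using series_and_derivative_comparison_complex[OF open_ball der bnd] by blast
  have g: "g q = (\<Sum>m. f m q)" if "q \<in> ball 0 1" for q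
    using gg that by (simp add: sums_iff)
  have q: "norm q < 1" by fact
  have sums: "(\<lambda>n. f n q) sums g q" "(\<lambda>n. f' n q) sums g' q" using gg q by simp_all
  show "summable (\<lambda>m. z ^ m * coef k (q ^ (a * m + b)))"
    using sums_summable[OF sums(1)] unfolding f_def .
  show "summable (\<lambda>m. z ^ m * deriv (\<lambda>q. coef k (q ^ (a * m + b))) q)"
    using sums_summable[OF sums(2)] unfolding f'_def .
  have "(g has_field_derivative g' q) (at q)" using gg q by simp
  then have "((\<lambda>q. \<Sum>m. f m q) has_field_derivative g' q) (at q)"
    by (rule has_field_derivative_transform_within_open[OF _ open_ball, of _ _ _ 0 1])
       (use q g in auto)
  moreover have "g' q = (\<Sum>m. f' m q)" using sums(2) by (simp add: sums_iff)
  ultimately show "((\<lambda>q. \<Sum>m. z ^ m * coef k (q ^ (a * m + b))) has_field_derivative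
           (\<Sum>m. z ^ m * deriv (\<lambda>q. coef k (q ^ (a * m + b))) q)) (at q)"
    by (simp add: f_def f'_def)
qed

lemma J_num_holomorphic:
  assumes "a \<ge> 1" "norm z \<le> 1" shows "J_num a k z holomorphic_on ball 0 1"
  unfolding holomorphic_on_open[OF open_ball] J_num_coef[abs_def]
  using coef_series_holomorphic(2)[of a 1 z _ k] assms by (intro ballI exI) auto

lemma J_den_holomorphic:
  assumes "a \<ge> 1" "norm z \<le> 1" shows "J_den a k z holomorphic_on ball 0 1"
proof -
  have "J_den a k z = (\<lambda>q. \<Sum>m. z ^ m * coef k (q ^ (a * m + a)))"
    by (simp add: J_den_coef[abs_def] algebra_simps)
  then show ?thesis
    unfolding holomorphic_on_open[OF open_ball]
    using coef_series_holomorphic(2)[of a a z _ k] assms by (intro ballI exI) auto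
qed

text \<open>The bare average, in which division by zero can occur. Computations are made with it and
  carried over to \<open>W\<close>, which arises from it by \<open>remove_sings\<close>.\<close>

definition section_sum :: "nat \<Rightarrow> nat \<Rightarrow> nat \<Rightarrow> complex \<Rightarrow> complex" where
  "section_sum a d k q = (1 / of_nat d) * (\<Sum>z | z ^ d = 1. J a k z q)"

lemma W_altdef: "W a d k = remove_sings (section_sum a d k)"
  unfolding W_def section_sum_def by simp

lemma norm_root_unity: assumes "(z::complex) ^ d = 1" "d \<ge> 1" shows "norm z = 1"
  using assms power_eq_1_iff[of "norm z" d] by (simp flip: norm_power)

lemma section_sum_meromorphic:
  assumes "a \<ge> 1" "d \<ge> 1" shows "section_sum a d k meromorphic_on ball 0 1"
proof -
  have "J a k z meromorphic_on ball 0 1" if "z ^ d = 1" for z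
    unfolding J_def[abs_def] using norm_root_unity[OF that] assms
    by (intro meromorphic_intros analytic_on_imp_meromorphic_on)
       (auto simp: analytic_on_open intro!: J_num_holomorphic J_den_holomorphic)
  then show ?thesis unfolding section_sum_def[abs_def]
    by (intro meromorphic_intros) auto
qed

lemma W_meromorphic:
  assumes "a \<ge> 1" "d \<ge> 1" shows "W a d k meromorphic_on {q. 0 < norm q \<and> norm q < 1}"
proof -
  have "W a d k meromorphic_on ball 0 1" unfolding W_altdef
    by (intro meromorphic_intros section_sum_meromorphic assms)
  then show ?thesis by (rule meromorphic_on_subset) auto
qed

lemma J_analytic:
  assumes "a \<ge> 1" "norm z \<le> 1" "norm q < 1" "J_den a k z q \<noteq> 0"
  shows "J a k z analytic_on {q}"
proof -
  have "J_num a k z analytic_on {q}" "J_den a k z analytic_on {q}"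
    using J_num_holomorphic[OF assms(1,2), of k] J_den_holomorphic[OF assms(1,2), of k] assms(3)
    by (auto intro!: analytic_on_subset[of _ "ball 0 1" "{q}"] simp: analytic_on_open)
  then show ?thesis unfolding J_def[abs_def] using assms by (intro analytic_intros) auto
qed

text \<open>Nonvanishing denominators make the average analytic at q, and
  \<open>remove_sings\<close> leaves analytic points alone. Every statement that a section is finite
  at a point is obtained from this.\<close>

lemma W_eq_section_sum:
  assumes "a \<ge> 1" "d \<ge> 1" "norm q < 1" "\<And>z. z ^ d = 1 \<Longrightarrow> J_den a k z q \<noteq> 0"
  shows "W a d k q = section_sum a d k q" "\<not> is_pole (W a d k) q"
proof -
  have "section_sum a d k analytic_on {q}"
    unfolding section_sum_def[abs_def] using assms norm_root_unity
    by (intro analytic_intros J_analytic) auto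
  then have "remove_sings (section_sum a d k) q = section_sum a d k q"
      "\<not> is_pole (remove_sings (section_sum a d k)) q"
    using remove_sings_analytic_on by (auto intro!: analytic_at_imp_no_pole)
  then show "W a d k q = section_sum a d k q" "\<not> is_pole (W a d k) q"
    by (simp_all only: W_altdef not_False_eq_True)
qed

section \<open>The modular transformation\<close>

text \<open>Euler's product for the sine, taken at the imaginary argument \<i> x and then under the
  logarithm.\<close>

lemma coth_partial_fractions_aux:
  assumes x: "(x::real) > 0"
  shows "(\<lambda>n. ln (1 + x\<^sup>2 / (real n + 1)\<^sup>2)) sums (ln (sinh (pi * x)) - ln (pi * x))"
proof -
  have "(\<lambda>n. complex_of_real pi * (\<i> * of_real x) * (\<Prod>k=1..n. 1 - (\<i> * of_real x)\<^sup>2 / of_nat k ^ 2))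
      \<longlonglongrightarrow> sin (complex_of_real pi * (\<i> * of_real x))"
    by (rule sin_product_formula_complex)
  moreover have "sin (complex_of_real pi * (\<i> * of_real x)) = \<i> * of_real (sinh (pi * x))"
  proof -
    have "sin (complex_of_real pi * (\<i> * of_real x)) = \<i> * sinh (of_real (pi * x))"
      using sinh_conv_sin[of "of_real (pi * x)"] by (simp add: mult_ac)
    also have "sinh (complex_of_real (pi * x)) = of_real (sinh (pi * x))"
      by (simp add: sinh_field_def flip: exp_of_real)
    finally show ?thesis .
  qed
  ultimately have "(\<lambda>n. -\<i> * (complex_of_real pi * (\<i> * of_real x) * (\<Prod>k=1..n. 1 - (\<i> * of_real x)\<^sup>2 / of_nat k ^ 2)))
      \<longlonglongrightarrow> -\<i> * (\<i> * of_real (sinh (pi * x)))"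
    by - (rule tendsto_mult_left, simp)
  then have "(\<lambda>n. complex_of_real (pi * x * (\<Prod>k=1..n. 1 + x\<^sup>2 / real k ^ 2))) \<longlonglongrightarrow> of_real (sinh (pi * x))"
    by (simp add: power_mult_distrib mult_ac)
  then have "(\<lambda>n. pi * x * (\<Prod>k=1..n. 1 + x\<^sup>2 / real k ^ 2)) \<longlonglongrightarrow> sinh (pi * x)"
    by (simp only: tendsto_of_real_iff)
  moreover have "sinh (pi * x) > 0" using x by simp
  ultimately have "(\<lambda>n. ln (pi * x * (\<Prod>k=1..n. 1 + x\<^sup>2 / real k ^ 2))) \<longlonglongrightarrow> ln (sinh (pi * x))"
    by (intro tendsto_ln) auto
  then have "(\<lambda>n. ln (pi * x * (\<Prod>k=1..n. 1 + x\<^sup>2 / real k ^ 2)) - ln (pi * x)) \<longlonglongrightarrow> ln (sinh (pi * x)) - ln (pi * x)"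
    by (intro tendsto_diff tendsto_const)
  moreover have "ln (pi * x * (\<Prod>k=1..n. 1 + x\<^sup>2 / real k ^ 2)) - ln (pi * x) =
     (\<Sum>i<n. ln (1 + x\<^sup>2 / (real i + 1)\<^sup>2))" for n
  proof -
    have pos: "0 < (\<Prod>k=1..n. 1 + x\<^sup>2 / real k ^ 2)"
      by (intro prod_pos) (auto intro!: add_pos_nonneg)
    have "ln (pi * x * (\<Prod>k=1..n. 1 + x\<^sup>2 / real k ^ 2)) = ln (pi * x) + ln (\<Prod>k=1..n. 1 + x\<^sup>2 / real k ^ 2)"
      using x pos by (intro ln_mult_pos) auto
    also have "ln (\<Prod>k=1..n. 1 + x\<^sup>2 / real k ^ 2) = (\<Sum>k=1..n. ln (1 + x\<^sup>2 / real k ^ 2))"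
    proof (intro ln_prod)
      have "0 < 1 + x\<^sup>2 / real k ^ 2" for k by (intro add_pos_nonneg) auto
      then show "1 + x\<^sup>2 / real k ^ 2 \<noteq> 0" for k by (metis less_irrefl)
    qed auto
    also have "\<dots> = (\<Sum>i<n. ln (1 + x\<^sup>2 / (real i + 1)\<^sup>2))"
      by (rule sum.reindex_bij_witness[of _ "\<lambda>i. i + 1" "\<lambda>i. i - 1"]) auto
    finally show ?thesis by simp
  qed
  ultimately show ?thesis unfolding sums_def by simp
qed

lemma summable_inverse_squares: "summable (\<lambda>n. C / (real n + 1)\<^sup>2)"
  using summable_mult[OF sums_summable[OF inverse_squares_sums], of C] by (simp add: add_ac)

lemma uniform_series_on:
  assumes "\<And>n (x::real). x \<in> S \<Longrightarrow> \<bar>f n x\<bar> \<le> C / (real n + 1)\<^sup>2"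
  shows "uniformly_convergent_on S (\<lambda>N x. \<Sum>n<N. f n x)"
  by (rule Weierstrass_m_test'[OF _ summable_inverse_squares[of C]]) (use assms in auto)

lemma coth_partial_fractions:
  assumes x: "(x::real) > 0"
  shows "(\<lambda>n. 2 * x / (x\<^sup>2 + (real n + 1)\<^sup>2)) sums (pi * cosh (pi * x) / sinh (pi * x) - 1 / x)"
proof -
  \<comment> \<open>Termwise differentiation takes place on a bounded interval, because the majorant
    2 (x + 1) / (n + 1)^2 of the derivatives requires a bounded variable.\<close>
  define S where "S = {0<..<x + 1}"
  have S: "x \<in> S" "x \<in> interior S" "convex S" "open S" using x by (auto simp: S_def interior_open)
  define f where "f = (\<lambda>n (x::real). ln (1 + x\<^sup>2 / (real n + 1)\<^sup>2))"
  define f' where "f' = (\<lambda>n (x::real). 2 * x / (x\<^sup>2 + (real n + 1)\<^sup>2))"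
  have der: "(f n has_field_derivative f' n y) (at y within S)" if "y \<in> S" for n y
  proof -
    have "1 + y\<^sup>2 / (real n + 1)\<^sup>2 > 0" by (intro add_pos_nonneg) auto
    moreover have "(real n + 1)\<^sup>2 > 0" by simp
    ultimately show ?thesis unfolding f_def f'_def
      by (auto intro!: derivative_eq_intros simp: divide_simps)
  qed
  have unif: "uniformly_convergent_on S (\<lambda>N x. \<Sum>n<N. f' n x)"
  proof (rule uniform_series_on[of _ _ "2 * (x + 1)"])
    fix n y assume y: "y \<in> S"
    have "\<bar>f' n y\<bar> = 2 * y / (y\<^sup>2 + (real n + 1)\<^sup>2)" using y by (simp add: f'_def S_def)
    also have "\<dots> \<le> 2 * (x + 1) / (real n + 1)\<^sup>2"
      using y by (intro frac_le) (auto simp: S_def)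
    finally show "\<bar>f' n y\<bar> \<le> 2 * (x + 1) / (real n + 1)\<^sup>2" .
  qed
  have sm: "summable (\<lambda>n. f n x)" unfolding f_def using coth_partial_fractions_aux[OF x] sums_summable by blast
  have "summable (\<lambda>n. f' n x)"
  proof (rule summable_comparison_test'[OF summable_inverse_squares[of "2 * (x + 1)"]])
    show "norm (f' n x) \<le> 2 * (x + 1) / (real n + 1)\<^sup>2" for n
      using x unfolding f'_def by (auto intro!: frac_le)
  qed
  have d1: "((\<lambda>x. \<Sum>n. f n x) has_field_derivative (\<Sum>n. f' n x)) (at x)"
    by (rule has_field_derivative_series'(2)[OF S(3) der unif S(1) sm S(2)])
  have d2: "((\<lambda>x. ln (sinh (pi * x)) - ln (pi * x)) has_field_derivative (pi * cosh (pi * x) / sinh (pi * x) - 1 / x)) (at x)"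
    using x by (auto intro!: derivative_eq_intros simp: field_simps)
  have "((\<lambda>x. ln (sinh (pi * x)) - ln (pi * x)) has_field_derivative (\<Sum>n. f' n x)) (at x)"
    by (rule has_field_derivative_transform_within_open[OF d1 S(4) S(1)])
       (use coth_partial_fractions_aux in \<open>simp add: f_def S_def sums_iff\<close>)
  then have "(\<Sum>n. f' n x) = pi * cosh (pi * x) / sinh (pi * x) - 1 / x"
    using d2 DERIV_unique by blast
  with \<open>summable (\<lambda>n. f' n x)\<close> show ?thesis unfolding f'_def by (simp add: sums_iff)
qed

text \<open>Termwise derivative of \<open>coth_partial_fractions\<close>, divided by -2. The
  summands are the real parts of 1 / (x + \<i> (n + 1))^2.\<close>

lemma csch_partial_fractions:
  assumes x: "(x::real) > 0"
  shows "(\<lambda>n. (x\<^sup>2 - (real n + 1)\<^sup>2) / (x\<^sup>2 + (real n + 1)\<^sup>2)\<^sup>2) sums ((pi\<^sup>2 / (sinh (pi * x))\<^sup>2 - 1 / x\<^sup>2) / 2)"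
proof -
  define S where "S = {0<..<x + 1}"
  have S: "x \<in> S" "x \<in> interior S" "convex S" "open S" using x by (auto simp: S_def interior_open)
  define f where "f = (\<lambda>n (x::real). 2 * x / (x\<^sup>2 + (real n + 1)\<^sup>2))"
  define f' where "f' = (\<lambda>n (x::real). - 2 * ((x\<^sup>2 - (real n + 1)\<^sup>2) / (x\<^sup>2 + (real n + 1)\<^sup>2)\<^sup>2))"
  have nz: "x\<^sup>2 + (real n + 1)\<^sup>2 > 0" for n and x :: real by (intro add_nonneg_pos) auto
  have der: "(f n has_field_derivative f' n y) (at y within S)" if "y \<in> S" for n y
  proof -
    have "y\<^sup>2 + (real n + 1)\<^sup>2 \<noteq> 0" using nz[of y n] by simp
    then show ?thesis unfolding f_def f'_def
      by (auto intro!: derivative_eq_intros simp: divide_simps power2_eq_square)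
  qed
  have bd: "\<bar>f' n y\<bar> \<le> 2 / (real n + 1)\<^sup>2" for n y
  proof -
    have "\<bar>y\<^sup>2 - (real n + 1)\<^sup>2\<bar> \<le> y\<^sup>2 + (real n + 1)\<^sup>2" by (simp add: abs_le_iff)
    then have "\<bar>f' n y\<bar> \<le> 2 * ((y\<^sup>2 + (real n + 1)\<^sup>2) / (y\<^sup>2 + (real n + 1)\<^sup>2)\<^sup>2)"
      unfolding f'_def abs_mult abs_divide using nz[of y n] by (simp add: divide_right_mono)
    also have "\<dots> = 2 / (y\<^sup>2 + (real n + 1)\<^sup>2)" using nz[of y n] by (simp add: power2_eq_square)
    also have "\<dots> \<le> 2 / (real n + 1)\<^sup>2" by (intro frac_le) auto
    finally show ?thesis .
  qed
  have unif: "uniformly_convergent_on S (\<lambda>N x. \<Sum>n<N. f' n x)"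
    by (rule uniform_series_on[of _ _ 2]) (use bd in auto)
  have sums: "(\<lambda>n. f n y) sums (pi * cosh (pi * y) / sinh (pi * y) - 1 / y)" if "y > 0" for y
    unfolding f_def using coth_partial_fractions[OF that] .
  have "summable (\<lambda>n. f' n x)"
    by (rule summable_comparison_test'[OF summable_inverse_squares[of 2]]) (use bd in auto)
  have d1: "((\<lambda>x. \<Sum>n. f n x) has_field_derivative (\<Sum>n. f' n x)) (at x)"
    by (rule has_field_derivative_series'(2)[OF S(3) der unif S(1) sums_summable[OF sums[OF x]] S(2)])
  have sh: "sinh (pi * x) > 0" using x by simp
  have c: "((\<lambda>x. pi * cosh (pi * x)) has_field_derivative pi * pi * sinh (pi * x)) (at x)"
    by (auto intro!: derivative_eq_intros)
  have s: "((\<lambda>x. sinh (pi * x)) has_field_derivative pi * cosh (pi * x)) (at x)"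
    by (auto intro!: derivative_eq_intros)
  have i: "((\<lambda>x. 1 / x) has_field_derivative - (1 / x\<^sup>2)) (at x)"
    using x by (auto intro!: derivative_eq_intros simp: power2_eq_square)
  have d2: "((\<lambda>x. pi * cosh (pi * x) / sinh (pi * x) - 1 / x) has_field_derivative (- pi\<^sup>2 / (sinh (pi * x))\<^sup>2 + 1 / x\<^sup>2)) (at x)"
  proof (rule DERIV_cong[OF DERIV_diff[OF DERIV_divide[OF c s] i]])
    have "pi * pi * sinh (pi * x) * sinh (pi * x) - pi * cosh (pi * x) * (pi * cosh (pi * x))
       = pi\<^sup>2 * ((sinh (pi * x))\<^sup>2 - (cosh (pi * x))\<^sup>2)" by (simp add: power2_eq_square algebra_simps)
    also have "\<dots> = - pi\<^sup>2" by (simp add: cosh_square_eq)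
    finally show "(pi * pi * sinh (pi * x) * sinh (pi * x) - pi * cosh (pi * x) * (pi * cosh (pi * x))) /
      (sinh (pi * x) * sinh (pi * x)) - - (1 / x\<^sup>2) = - pi\<^sup>2 / (sinh (pi * x))\<^sup>2 + 1 / x\<^sup>2"
      by (simp add: power2_eq_square)
  qed (use sh in auto)
  have "((\<lambda>x. pi * cosh (pi * x) / sinh (pi * x) - 1 / x) has_field_derivative (\<Sum>n. f' n x)) (at x)"
    by (rule has_field_derivative_transform_within_open[OF d1 S(4) S(1)])
       (use sums in \<open>simp add: S_def sums_iff\<close>)
  then have "(\<Sum>n. f' n x) = - pi\<^sup>2 / (sinh (pi * x))\<^sup>2 + 1 / x\<^sup>2"
    using d2 DERIV_unique by blast
  have "(\<lambda>n. f' n x) sums (- pi\<^sup>2 / (sinh (pi * x))\<^sup>2 + 1 / x\<^sup>2)"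
    using \<open>summable (\<lambda>n. f' n x)\<close> \<open>(\<Sum>n. f' n x) = _\<close> by (simp add: sums_iff)
  from sums_mult[OF this, of "- (1/2)"]
  have "(\<lambda>n. - (1/2) * f' n x) sums (- (1/2) * (- pi\<^sup>2 / (sinh (pi * x))\<^sup>2 + 1 / x\<^sup>2))" .
  moreover have "- (1/2) * f' n x = (x\<^sup>2 - (real n + 1)\<^sup>2) / (x\<^sup>2 + (real n + 1)\<^sup>2)\<^sup>2" for n
  proof -
    have aux: "- (1/2) * (- 2 * t) = t" for t :: real by simp
    show ?thesis unfolding f'_def by (rule aux)
  qed
  moreover have "- (1/2) * (- pi\<^sup>2 / (sinh (pi * x))\<^sup>2 + 1 / x\<^sup>2) = (pi\<^sup>2 / (sinh (pi * x))\<^sup>2 - 1 / x\<^sup>2) / 2"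
    by (simp add: diff_divide_distrib)
  ultimately show ?thesis by (simp only:)
qed

section \<open>The weight two lattice sum and its two orders of summation\<close>

lemma suminf_swap_dominated:
  fixes f :: "nat \<Rightarrow> nat \<Rightarrow> real"
  assumes bd: "\<And>m n. \<bar>f m n\<bar> \<le> A m * B n" and A: "summable A" and B: "summable B"
    and nn: "\<And>m. A m \<ge> 0" "\<And>n. B n \<ge> 0"
  shows "(\<Sum>m. \<Sum>n. f m n) = (\<Sum>n. \<Sum>m. f m n)" "summable (\<lambda>m. \<Sum>n. f m n)"
proof -
  have key: "(\<lambda>(m,n). g m n) summable_on UNIV \<times> UNIV"
    if bd: "\<And>m n. \<bar>g m n\<bar> \<le> X m * Y n" and XY: "summable X" "summable Y" "\<And>m. X m \<ge> 0" "\<And>n. Y n \<ge> 0"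
    for g :: "nat \<Rightarrow> nat \<Rightarrow> real" and X Y
  proof -
    have sA: "X summable_on UNIV" "Y summable_on UNIV"
      using XY by (simp_all add: summable_on_UNIV_nonneg_real_iff)
    have "Infinite_Sum.abs_summable_on (\<lambda>(m,n). X m * Y n) (UNIV \<times> UNIV)"
      by (subst Infinite_Sum.abs_summable_on_Sigma_iff)
         (use sA XY in \<open>auto simp: abs_mult infsum_cmult_right' infsum_nonneg
            intro!: summable_on_cmult_right summable_on_cmult_left\<close>)
    then have "Infinite_Sum.abs_summable_on (\<lambda>(m,n). g m n) (UNIV \<times> UNIV)"
      by (rule Infinite_Sum.abs_summable_on_comparison_test) (use bd XY in auto)
    then show ?thesis by (rule abs_summable_summable)
  qed
  have so: "(\<lambda>(m,n). f m n) summable_on UNIV \<times> UNIV" by (rule key[OF bd A B nn])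
  have row: "infsum (\<lambda>n. f m n) UNIV = (\<Sum>n. f m n)" for m
  proof -
    have "summable (\<lambda>n. norm (f m n))"
      by (rule summable_comparison_test'[OF summable_mult[OF B, of "A m"]]) (use bd in auto)
    from norm_summable_imp_has_sum[OF this summable_sums[OF summable_norm_cancel[OF this]]]
    show ?thesis by (rule infsumI)
  qed
  have col: "infsum (\<lambda>m. f m n) UNIV = (\<Sum>m. f m n)" for n
  proof -
    have "summable (\<lambda>m. norm (f m n))"
      by (rule summable_comparison_test'[OF summable_mult2[OF A, of "B n"]]) (use bd in auto)
    from norm_summable_imp_has_sum[OF this summable_sums[OF summable_norm_cancel[OF this]]]
    show ?thesis by (rule infsumI)
  qed
  have rs: "(\<lambda>m. \<Sum>n. f m n) summable_on UNIV" "(\<lambda>n. \<Sum>m. f m n) summable_on UNIV"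
  proof -
    show "(\<lambda>m. \<Sum>n. f m n) summable_on UNIV"
      using summable_on_Sigma_banach[OF so] by (simp add: row)
    have "(\<lambda>(n,m). f m n) summable_on UNIV \<times> UNIV"
      by (rule key[OF _ B A]) (use bd nn in \<open>auto simp: mult.commute\<close>)
    from summable_on_Sigma_banach[OF this] show "(\<lambda>n. \<Sum>m. f m n) summable_on UNIV"
      by (simp add: col)
  qed
  have s1: "(\<Sum>m. \<Sum>n. f m n) = infsum (\<lambda>m. \<Sum>n. f m n) UNIV"
    using has_sum_imp_sums[OF has_sum_infsum[OF rs(1)]] by (simp add: sums_iff)
  have s2: "(\<Sum>n. \<Sum>m. f m n) = infsum (\<lambda>n. \<Sum>m. f m n) UNIV"
    using has_sum_imp_sums[OF has_sum_infsum[OF rs(2)]] by (simp add: sums_iff)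
  show "(\<Sum>m. \<Sum>n. f m n) = (\<Sum>n. \<Sum>m. f m n)"
    unfolding s1 s2 using infsum_swap_banach[OF so] by (simp add: row col)
  show "summable (\<lambda>m. \<Sum>n. f m n)"
    using rs(1) by (rule summable_on_imp_summable)
qed

text \<open>The weight two Eisenstein series in disguise: expanding 1 / sinh^2 in exponentials gives
  (1 - E2(\<i> \<alpha>)) / 6. Its reciprocity below is the quasi-modularity of E2.\<close>

definition csch_sum :: "real \<Rightarrow> real" where
  "csch_sum \<alpha> = (\<Sum>m. 1 / (sinh (pi * \<alpha> * (real m + 1)))\<^sup>2)"

lemma sinh_ge_self: assumes "(x::real) \<ge> 0" shows "x \<le> sinh x"
proof -
  have "sinh 0 - 0 \<le> sinh x - x"
    by (rule DERIV_nonneg_imp_nondecreasing[OF assms, where f = "\<lambda>x. sinh x - x"])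
       (auto intro!: exI derivative_eq_intros simp: cosh_real_ge_1)
  then show ?thesis by simp
qed

lemma csch_term_le:
  assumes "0 < \<beta>" "\<beta> \<le> \<alpha>"
  shows "1 / (sinh (pi * \<alpha> * (real m + 1)))\<^sup>2 \<le> (1 / (pi * \<beta>)\<^sup>2) / (real m + 1)\<^sup>2"
proof -
  have "pi * \<beta> * (real m + 1) \<le> pi * \<alpha> * (real m + 1)" using assms by (intro mult_mono) auto
  also have "\<dots> \<le> sinh (pi * \<alpha> * (real m + 1))" using assms by (intro sinh_ge_self) auto
  finally have "(pi * \<beta> * (real m + 1))\<^sup>2 \<le> (sinh (pi * \<alpha> * (real m + 1)))\<^sup>2"
    using assms by (intro power_mono) auto
  then have "1 / (sinh (pi * \<alpha> * (real m + 1)))\<^sup>2 \<le> 1 / (pi * \<beta> * (real m + 1))\<^sup>2"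
    using assms by (intro frac_le) auto
  then show ?thesis by (simp add: power_mult_distrib)
qed

lemma csch_sum_sums:
  assumes "\<alpha> > 0"
  shows "(\<lambda>m. 1 / (sinh (pi * \<alpha> * (real m + 1)))\<^sup>2) sums csch_sum \<alpha>"
proof -
  have "summable (\<lambda>m. 1 / (sinh (pi * \<alpha> * (real m + 1)))\<^sup>2)"
    by (rule summable_comparison_test'[OF summable_inverse_squares[of "1 / (pi * \<alpha>)\<^sup>2"]])
       (use csch_term_le[OF assms order_refl] in auto)
  then show ?thesis unfolding csch_sum_def by (rule summable_sums)
qed

text \<open>The subtracted difference is the integral of (A - y^2) / (A + y^2)^2 over
  [n - 1/2, n + 1/2], as y / (A + y^2) is an antiderivative. Exchanging the integral for the
  midpoint value costs only O((A + n^2)^-2), which is absolutely summable over the lattice.\<close>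

lemma lattice_term_diff_bound:
  fixes A n :: real
  assumes A: "A > 0" and n: "n \<ge> 1"
  shows "\<bar>(A - n\<^sup>2) / (A + n\<^sup>2)\<^sup>2 - ((n + 1/2) / (A + (n + 1/2)\<^sup>2) - (n - 1/2) / (A + (n - 1/2)\<^sup>2))\<bar>
      \<le> 64 / (A + n\<^sup>2)\<^sup>2"
proof -
  define B where "B = A + n\<^sup>2"
  define p where "p = A + (n + 1/2)\<^sup>2"
  define q where "q = A + (n - 1/2)\<^sup>2"
  have n2: "n\<^sup>2 \<ge> 1" using n by (simp add: one_le_power)
  have B: "B > 1" using A n2 by (simp add: B_def)
  have p: "p \<ge> B / 4" using A n by (simp add: p_def B_def power2_eq_square field_simps)
  \<comment> \<open>At least half of n survives the shift by 1/2, so both \<open>p\<close> and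
    \<open>q\<close> are at least \<open>B / 4\<close>; this leads to the constant 64 = 4 *
    16.\<close>
  have "(n - 1/2)\<^sup>2 \<ge> (n / 2)\<^sup>2" using n by (intro power_mono) auto
  then have q: "q \<ge> B / 4" using A by (simp add: q_def B_def power2_eq_square field_simps)
  have pq: "p * q = (B + 1/4)\<^sup>2 - n\<^sup>2"
    by (simp add: p_def q_def B_def power2_eq_square algebra_simps)
  have pq2: "p * q \<ge> B\<^sup>2 / 16"
    using mult_mono[OF p q] B p by (simp add: power2_eq_square)
  then have pq0: "p * q > 0" "p \<noteq> 0" "q \<noteq> 0" using B p q by (auto intro: less_le_trans[of 0 "B\<^sup>2 / 16"])
  have e1: "(n + 1/2) / p - (n - 1/2) / q = (A - n\<^sup>2 + 1/4) / (p * q)"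
    using pq0 by (simp add: divide_simps) (simp add: p_def q_def power2_eq_square algebra_simps)
  have "(A - n\<^sup>2) / B\<^sup>2 - (A - n\<^sup>2 + 1/4) / (p * q)
     = ((A - n\<^sup>2) * (p * q) - (A - n\<^sup>2 + 1/4) * B\<^sup>2) / (B\<^sup>2 * (p * q))"
    using pq0 B by (simp add: divide_simps)
  also have "(A - n\<^sup>2) * (p * q) - (A - n\<^sup>2 + 1/4) * B\<^sup>2 = (A - n\<^sup>2) * (B / 2 + 1/16 - n\<^sup>2) - B\<^sup>2 / 4"
    unfolding pq by (simp add: power2_eq_square algebra_simps)
  finally have eq: "(A - n\<^sup>2) / B\<^sup>2 - (A - n\<^sup>2 + 1/4) / (p * q)
     = ((A - n\<^sup>2) * (B / 2 + 1/16 - n\<^sup>2) - B\<^sup>2 / 4) / (B\<^sup>2 * (p * q))" .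
  have "\<bar>(A - n\<^sup>2) * (B / 2 + 1/16 - n\<^sup>2) - B\<^sup>2 / 4\<bar> \<le> \<bar>A - n\<^sup>2\<bar> * \<bar>B / 2 + 1/16 - n\<^sup>2\<bar> + B\<^sup>2 / 4"
    unfolding abs_mult[symmetric] by (rule order_trans[OF abs_triangle_ineq4]) simp
  also have "\<dots> \<le> B * (2 * B) + B\<^sup>2 / 4"
  proof (intro add_mono mult_mono)
    show "\<bar>A - n\<^sup>2\<bar> \<le> B" using A n2 by (simp add: B_def abs_le_iff)
    have "B / 2 + 1/16 - n\<^sup>2 \<le> 2 * B" "- (B / 2 + 1/16 - n\<^sup>2) \<le> 2 * B"
      using A B n2 B_def by linarith+
    then show "\<bar>B / 2 + 1/16 - n\<^sup>2\<bar> \<le> 2 * B" by linarith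
  qed (use B in auto)
  also have "\<dots> \<le> 4 * B\<^sup>2" by (simp add: power2_eq_square)
  finally have num: "\<bar>(A - n\<^sup>2) * (B / 2 + 1/16 - n\<^sup>2) - B\<^sup>2 / 4\<bar> \<le> 4 * B\<^sup>2" .
  have "\<bar>(A - n\<^sup>2) / B\<^sup>2 - (A - n\<^sup>2 + 1/4) / (p * q)\<bar> \<le> (4 * B\<^sup>2) / (B\<^sup>2 * (B\<^sup>2 / 16))"
    unfolding eq abs_divide
  proof (intro frac_le num)
    have "B\<^sup>2 * (B\<^sup>2 / 16) \<le> B\<^sup>2 * (p * q)" by (intro mult_left_mono pq2) auto
    also have "\<dots> = \<bar>B\<^sup>2 * (p * q)\<bar>" using B pq0 by simp
    finally show "B\<^sup>2 * (B\<^sup>2 / 16) \<le> \<bar>B\<^sup>2 * (p * q)\<bar>" .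
  qed (use B in auto)
  also have "\<dots> = 64 / B\<^sup>2" using B by (simp add: power2_eq_square field_simps)
  finally show ?thesis using e1 by (simp add: B_def p_def q_def)
qed

text \<open>The double series of Re 1 / (\<alpha> m + \<i> n)^2 converges only conditionally, and
  its two iterated sums differ. Subtracting from each term \<open>u\<close> its integral
  \<open>v\<close> over a unit interval leaves an absolutely convergent \<open>w\<close>, for which
  the summations may be interchanged. The \<open>v\<close> telescope in n, and their boundary terms
  produce the anomaly pi / (2 \<alpha>).\<close>

lemma csch_sum_reciprocity:
  assumes \<alpha>: "\<alpha> > 0"
  shows "pi\<^sup>2 / 2 * (csch_sum \<alpha> + csch_sum (1 / \<alpha>) / \<alpha>\<^sup>2) = pi\<^sup>2 / (12 * \<alpha>\<^sup>2) + pi\<^sup>2 / 12 - pi / (2 * \<alpha>)"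
proof -
  define u where "u = (\<lambda>m n. ((\<alpha> * (real m + 1))\<^sup>2 - (real n + 1)\<^sup>2) / ((\<alpha> * (real m + 1))\<^sup>2 + (real n + 1)\<^sup>2)\<^sup>2)"
  define b where "b = (\<lambda>m y. y / ((\<alpha> * (real m + 1))\<^sup>2 + y\<^sup>2))"
  define v where "v = (\<lambda>m n. b m (real n + 1 + 1/2) - b m (real n + 1 - 1/2))"
  define w where "w = (\<lambda>m n. u m n - v m n)"
  define \<beta> where "\<beta> = (\<lambda>y. (pi * cosh (pi * (y / \<alpha>)) / sinh (pi * (y / \<alpha>)) - \<alpha> / y) / (2 * \<alpha>))"
  define R where "R = (\<lambda>m. (pi\<^sup>2 / (sinh (pi * (\<alpha> * (real m + 1))))\<^sup>2 - 1 / (\<alpha> * (real m + 1))\<^sup>2) / 2)"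
  define C where "C = (\<lambda>n. - (1 / \<alpha>\<^sup>2) * ((pi\<^sup>2 / (sinh (pi * ((real n + 1) / \<alpha>)))\<^sup>2 - 1 / ((real n + 1) / \<alpha>)\<^sup>2) / 2))"
  have sq: "(\<lambda>n. 1 / (real n + 1)\<^sup>2) sums (pi\<^sup>2 / 6)" using inverse_squares_sums by (simp add: add_ac)
  have bd: "\<bar>w m n\<bar> \<le> (16 / \<alpha>\<^sup>2) / (real m + 1)\<^sup>2 * (1 / (real n + 1)\<^sup>2)" for m n
  proof -
    define M N where "M = \<alpha> * (real m + 1)" and "N = real n + 1"
    have MN: "M > 0" "N \<ge> 1" using \<alpha> by (auto simp: M_def N_def)
    have "\<bar>w m n\<bar> \<le> 64 / (M\<^sup>2 + N\<^sup>2)\<^sup>2"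
    proof -
      have "w m n = (M\<^sup>2 - N\<^sup>2) / (M\<^sup>2 + N\<^sup>2)\<^sup>2 - ((N + 1/2) / (M\<^sup>2 + (N + 1/2)\<^sup>2) - (N - 1/2) / (M\<^sup>2 + (N - 1/2)\<^sup>2))"
        by (simp add: w_def u_def v_def b_def M_def N_def)
      then show ?thesis using lattice_term_diff_bound[of "M\<^sup>2" N] MN by simp
    qed
    \<comment> \<open>The inequality of arithmetic and geometric means turns the bound into a
      product of a function of m and a function of n.\<close>
    also have "\<dots> \<le> 64 / (2 * M * N)\<^sup>2"
      using MN sum_squares_bound[of M N] by (intro frac_le power_mono) auto
    also have "\<dots> = (16 / \<alpha>\<^sup>2) / (real m + 1)\<^sup>2 * (1 / (real n + 1)\<^sup>2)"
      using \<alpha> by (simp add: M_def N_def power_mult_distrib)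
    finally show ?thesis .
  qed
  have swap: "(\<Sum>m. \<Sum>n. w m n) = (\<Sum>n. \<Sum>m. w m n)"
    by (rule suminf_swap_dominated(1)[OF bd summable_inverse_squares summable_inverse_squares]) auto
  have urow: "(\<lambda>n. u m n) sums R m" for m
    unfolding u_def R_def using \<alpha> by (intro csch_partial_fractions) auto
  have vrow: "(\<lambda>n. v m n) sums (0 - b m (1/2))" for m
  proof -
    have "(\<lambda>n. b m (real n + 1/2)) \<longlonglongrightarrow> 0" unfolding b_def by real_asymp
    from telescope_sums[OF this] show ?thesis unfolding v_def by (simp add: add_ac)
  qed
  have wrow: "(\<Sum>n. w m n) = R m + b m (1/2)" for m
    using sums_diff[OF urow[of m] vrow[of m]] unfolding w_def by (simp add: sums_iff)
  have bcol: "(\<lambda>m. b m y) sums \<beta> y" if y: "y > 0" for y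
  proof -
    have "(\<lambda>m. (1 / (2 * \<alpha>)) * (2 * (y / \<alpha>) / ((y / \<alpha>)\<^sup>2 + (real m + 1)\<^sup>2))) sums
       ((1 / (2 * \<alpha>)) * (pi * cosh (pi * (y / \<alpha>)) / sinh (pi * (y / \<alpha>)) - 1 / (y / \<alpha>)))"
      using y \<alpha> by (intro sums_mult coth_partial_fractions) auto
    moreover have "(1 / (2 * \<alpha>)) * (2 * (y / \<alpha>) / ((y / \<alpha>)\<^sup>2 + (real m + 1)\<^sup>2)) = b m y" for m
    proof -
      have "(y / \<alpha>)\<^sup>2 + (real m + 1)\<^sup>2 = (y\<^sup>2 + (\<alpha> * (real m + 1))\<^sup>2) / \<alpha>\<^sup>2"
        using \<alpha> by (simp add: field_simps power2_eq_square)
      then show ?thesis using \<alpha> y by (simp add: b_def power2_eq_square add_ac)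
    qed
    ultimately show ?thesis using \<alpha> y by (simp add: \<beta>_def)
  qed
  have ucol: "(\<lambda>m. u m n) sums C n" for n
  proof -
    have "(\<lambda>m. - (1 / \<alpha>\<^sup>2) * ((((real n + 1) / \<alpha>)\<^sup>2 - (real m + 1)\<^sup>2) / (((real n + 1) / \<alpha>)\<^sup>2 + (real m + 1)\<^sup>2)\<^sup>2)) sums C n"
      unfolding C_def using \<alpha> by (intro sums_mult csch_partial_fractions) auto
    moreover have "- (1 / \<alpha>\<^sup>2) * ((((real n + 1) / \<alpha>)\<^sup>2 - (real m + 1)\<^sup>2) / (((real n + 1) / \<alpha>)\<^sup>2 + (real m + 1)\<^sup>2)\<^sup>2) = u m n" for m
    proof -
      define M N where "M = real m + 1" and "N = real n + 1"
      have "M > 0" by (simp add: M_def)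
      then have nz: "N\<^sup>2 + (\<alpha> * M)\<^sup>2 > 0" using \<alpha> by (intro add_nonneg_pos) auto
      have e: "(N / \<alpha>)\<^sup>2 + M\<^sup>2 = (N\<^sup>2 + (\<alpha> * M)\<^sup>2) / \<alpha>\<^sup>2" "(N / \<alpha>)\<^sup>2 - M\<^sup>2 = (N\<^sup>2 - (\<alpha> * M)\<^sup>2) / \<alpha>\<^sup>2"
        using \<alpha> by (simp_all add: field_simps power2_eq_square)
      have "- (1 / \<alpha>\<^sup>2) * (((N / \<alpha>)\<^sup>2 - M\<^sup>2) / ((N / \<alpha>)\<^sup>2 + M\<^sup>2)\<^sup>2) = ((\<alpha> * M)\<^sup>2 - N\<^sup>2) / ((\<alpha> * M)\<^sup>2 + N\<^sup>2)\<^sup>2"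
        unfolding e using nz \<alpha> by (simp add: divide_simps add_ac)
      then show ?thesis by (simp add: u_def M_def N_def)
    qed
    ultimately show ?thesis by simp
  qed
  have wcol: "(\<Sum>m. w m n) = C n - (\<beta> (real n + 1 + 1/2) - \<beta> (real n + 1 - 1/2))" for n
    using sums_diff[OF ucol[of n] sums_diff[OF bcol[of "real n + 1 + 1/2"] bcol[of "real n + 1 - 1/2"]]]
    unfolding w_def v_def by (simp add: sums_iff)
  \<comment> \<open>For fixed m the boundary term at n = \<infinity> is 0, but summed over m first
    it tends to pi / (2 \<alpha>), as coth tends to 1. This discrepancy is the non-modular
    term.\<close>
  have \<beta>lim: "(\<lambda>n. \<beta> (real n + 1/2)) \<longlonglongrightarrow> pi / (2 * \<alpha>)"
  proof -
    have "(\<lambda>n. \<beta> (real n + 1/2)) \<longlonglongrightarrow> pi * inverse \<alpha> / 2"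
      unfolding \<beta>_def sinh_field_def cosh_field_def using \<alpha> by real_asymp
    then show ?thesis by (simp add: field_simps)
  qed
  have \<beta>tel: "(\<lambda>n. \<beta> (real n + 1 + 1/2) - \<beta> (real n + 1 - 1/2)) sums (pi / (2 * \<alpha>) - \<beta> (1/2))"
    using telescope_sums[OF \<beta>lim] by (simp add: add_ac)
  have Rsum: "R sums ((pi\<^sup>2 * csch_sum \<alpha> - (1 / \<alpha>\<^sup>2) * (pi\<^sup>2 / 6)) / 2)"
  proof -
    have "(\<lambda>m. (pi\<^sup>2 * (1 / (sinh (pi * \<alpha> * (real m + 1)))\<^sup>2) - (1 / \<alpha>\<^sup>2) * (1 / (real m + 1)\<^sup>2)) / 2) sums
       ((pi\<^sup>2 * csch_sum \<alpha> - (1 / \<alpha>\<^sup>2) * (pi\<^sup>2 / 6)) / 2)"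
      by (intro sums_divide sums_diff sums_mult csch_sum_sums sq \<alpha>)
    then show ?thesis unfolding R_def by (simp add: power_mult_distrib mult_ac)
  qed
  have Csum: "C sums (- (1 / \<alpha>\<^sup>2) * ((pi\<^sup>2 * csch_sum (1 / \<alpha>) - \<alpha>\<^sup>2 * (pi\<^sup>2 / 6)) / 2))"
  proof -
    have "(\<lambda>m. - (1 / \<alpha>\<^sup>2) * ((pi\<^sup>2 * (1 / (sinh (pi * (1 / \<alpha>) * (real m + 1)))\<^sup>2) - \<alpha>\<^sup>2 * (1 / (real m + 1)\<^sup>2)) / 2)) sums
       (- (1 / \<alpha>\<^sup>2) * ((pi\<^sup>2 * csch_sum (1 / \<alpha>) - \<alpha>\<^sup>2 * (pi\<^sup>2 / 6)) / 2))"
      using \<alpha> by (intro sums_divide sums_diff sums_mult csch_sum_sums sq) auto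
    then show ?thesis unfolding C_def by (simp add: power_mult_distrib power_divide mult_ac)
  qed
  have "(\<Sum>m. \<Sum>n. w m n) = (pi\<^sup>2 * csch_sum \<alpha> - (1 / \<alpha>\<^sup>2) * (pi\<^sup>2 / 6)) / 2 + \<beta> (1/2)"
    unfolding wrow using sums_add[OF Rsum bcol[of "1/2"]] by (simp add: sums_iff)
  moreover have "(\<Sum>n. \<Sum>m. w m n) = - (1 / \<alpha>\<^sup>2) * ((pi\<^sup>2 * csch_sum (1 / \<alpha>) - \<alpha>\<^sup>2 * (pi\<^sup>2 / 6)) / 2) - (pi / (2 * \<alpha>) - \<beta> (1/2))"
    unfolding wcol using sums_diff[OF Csum \<beta>tel] by (simp add: sums_iff)
  ultimately show ?thesis using swap \<alpha> by (simp add: field_simps)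
qed

text \<open>Logarithms of the factors give a double series in x^(n m) / m; summing over n first, as
  a geometric series, leaves a Lambert series.\<close>

lemma ln_phi_series:
  assumes \<alpha>: "\<alpha> > 0"
  shows "(\<lambda>m. - (1 / (real m + 1)) / (exp (2 * pi * \<alpha> * (real m + 1)) - 1)) sums ln (phi (exp (- 2 * pi * \<alpha>)))"
proof -
  define x where "x = exp (- 2 * pi * \<alpha>)"
  have x: "0 < x" "x < 1" using \<alpha> by (auto simp: x_def)
  define f where "f = (\<lambda>n m. x ^ (Suc n * Suc m) / (real m + 1))"
  have bd: "\<bar>f n m\<bar> \<le> x ^ n * x ^ m" for n m
  proof -
    have "\<bar>f n m\<bar> = x ^ (Suc n * Suc m) / (real m + 1)" unfolding f_def using x by (simp del: power_Suc mult_Suc)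
    also have "\<dots> \<le> x ^ (Suc n * Suc m) / 1" using x by (intro frac_le) (auto simp del: power_Suc mult_Suc)
    also have "\<dots> \<le> x ^ (n + m) / 1" using x
      by (intro divide_right_mono power_decreasing) (auto simp: algebra_simps simp del: power_Suc)
    finally show ?thesis by (simp add: power_add)
  qed
  have sg: "summable (\<lambda>n. x ^ n)" using x by (intro summable_geometric) auto
  note sw = suminf_swap_dominated[OF bd sg sg]
  have lnrow: "(\<lambda>m. f n m) sums (- ln (1 - x ^ Suc n))" for n
  proof -
    have y: "\<bar>x ^ Suc n\<bar> < 1" using x by (simp add: power_less_one_iff del: power_Suc)
    have "(\<lambda>m. (x ^ Suc n) ^ Suc m / real (Suc m)) sums (- ln (1 - x ^ Suc n))"
    proof -
      have "(\<lambda>m. - ((- (- (x ^ Suc n))) ^ m) / of_nat m) sums ln (1 + - (x ^ Suc n))"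
        by (rule ln_series') (use y in auto)
      then have "(\<lambda>m. - ((x ^ Suc n) ^ m / real m)) sums ln (1 - x ^ Suc n)"
        by (simp del: power_Suc)
      then have "(\<lambda>m. (x ^ Suc n) ^ m / real m) sums (- ln (1 - x ^ Suc n))"
        using sums_minus by fastforce
      then show ?thesis by (subst sums_Suc_iff) simp
    qed
    then show ?thesis by (simp add: f_def add_ac flip: power_mult del: power_Suc)
  qed
  have "(\<lambda>n. ln (1 - x ^ Suc n)) sums ln (phi x)"
    by (rule has_prod_imp_sums_ln_real'[OF phi_has_prod phi_nonneg_factor(1)]) (use x in auto)
  then have "(\<lambda>n. \<Sum>m. f n m) sums (- ln (phi x))"
    using sums_minus[of "\<lambda>n. ln (1 - x ^ Suc n)"] lnrow by (simp add: sums_iff)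
  then have tot: "(\<Sum>m. \<Sum>n. f n m) = - ln (phi x)"
    using sw(1) x by (simp add: sums_iff)
  have bd': "\<bar>f n m\<bar> \<le> x ^ m * x ^ n" for n m using bd[of n m] by (simp add: mult.commute)
  have "summable (\<lambda>m. \<Sum>n. f n m)"
    by (rule suminf_swap_dominated(2)[where A = "\<lambda>n. x ^ n" and B = "\<lambda>n. x ^ n"]) (use bd' sg x in auto)
  then have s1: "(\<lambda>m. \<Sum>n. f n m) sums (- ln (phi x))" using tot by (simp add: sums_iff)
  have col: "(\<Sum>n. f n m) = (1 / (real m + 1)) / (exp (2 * pi * \<alpha> * (real m + 1)) - 1)" for m
  proof -
    have y: "\<bar>x ^ Suc m\<bar> < 1" using x by (simp add: power_less_one_iff del: power_Suc)
    have "(\<lambda>n. x ^ Suc m * (x ^ Suc m) ^ n / (real m + 1)) sums (x ^ Suc m * (1 / (1 - x ^ Suc m)) / (real m + 1))"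
      using y by (intro sums_divide sums_mult geometric_sums) auto
    moreover have "x ^ Suc m * (x ^ Suc m) ^ n / (real m + 1) = f n m" for n
    proof -
      have "x ^ Suc m * (x ^ Suc m) ^ n = (x ^ Suc m) ^ Suc n" by (simp only: power_Suc)
      also have "\<dots> = x ^ (Suc n * Suc m)" by (simp only: power_mult[symmetric] mult.commute)
      finally show ?thesis unfolding f_def by simp
    qed
    moreover have "x ^ Suc m * (1 / (1 - x ^ Suc m)) = 1 / (exp (2 * pi * \<alpha> * (real m + 1)) - 1)"
    proof -
      define E where "E = exp (2 * pi * \<alpha> * (real m + 1))"
      have "x ^ Suc m = exp (- (2 * pi * \<alpha> * (real m + 1)))"
        unfolding x_def exp_of_nat_mult[symmetric] by (simp add: algebra_simps)
      then have "x ^ Suc m = 1 / E" by (simp add: E_def exp_minus inverse_eq_divide)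
      moreover have "E > 1" using \<alpha> by (simp add: E_def)
      moreover have "1 / E * (1 / (1 - 1 / E)) = 1 / (E - 1)" using \<open>E > 1\<close> by (simp add: field_simps)
      ultimately show ?thesis unfolding E_def[symmetric] by (simp only:)
    qed
    ultimately have "(\<lambda>n. f n m) sums (1 / (exp (2 * pi * \<alpha> * (real m + 1)) - 1) / (real m + 1))"
      by (simp only:)
    then show ?thesis by (simp add: sums_iff mult.commute)
  qed
  from sums_minus[OF s1] show ?thesis unfolding col by (simp add: x_def)
qed

text \<open>With E = exp (pi \<alpha> (m + 1)) the derivative of a term is 2 pi E^2 / (E^2 - 1)^2,
  that is pi / 2 divided by the square of a sinh. So the logarithmic derivative of
  \<open>phi\<close> is the lattice sum just treated.\<close>

lemma ln_phi_deriv: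
  assumes \<alpha>: "\<alpha> > 0"
  shows "((\<lambda>\<alpha>. ln (phi (exp (- 2 * pi * \<alpha>)))) has_field_derivative pi / 2 * csch_sum \<alpha>) (at \<alpha>)"
proof -
  define S where "S = {\<alpha> / 2<..<\<alpha> + 1}"
  have S: "\<alpha> \<in> S" "\<alpha> \<in> interior S" "convex S" "open S" using \<alpha> by (auto simp: S_def interior_open)
  define f where "f = (\<lambda>m \<alpha>. - (1 / (real m + 1)) / (exp (2 * pi * \<alpha> * (real m + 1)) - 1))"
  define f' where "f' = (\<lambda>m \<alpha>. pi / 2 * (1 / (sinh (pi * \<alpha> * (real m + 1)))\<^sup>2))"
  have der: "(f m has_field_derivative f' m y) (at y within S)" if y: "y \<in> S" for m y
  proof -
    define E where "E = exp (pi * y * (real m + 1))"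
    have y0: "y > 0" using y \<alpha> by (simp add: S_def)
    have E: "E > 1" using y0 by (simp add: E_def)
    have E2: "exp (2 * pi * y * (real m + 1)) = E\<^sup>2"
      unfolding E_def power2_eq_square mult_exp_exp by (simp add: algebra_simps)
    have E21: "E\<^sup>2 > 1" using E by (simp add: one_less_power)
    have "(f m has_field_derivative ((1 / (real m + 1)) * (exp (2 * pi * y * (real m + 1)) * (2 * pi * (real m + 1))) / (exp (2 * pi * y * (real m + 1)) - 1)\<^sup>2)) (at y within S)"
      unfolding f_def using E2 E21
      by (auto intro!: derivative_eq_intros simp: power2_eq_square)
    moreover have "(1 / (real m + 1)) * (E\<^sup>2 * (2 * pi * (real m + 1))) / (E\<^sup>2 - 1)\<^sup>2 = f' m y"
    proof -
      have "sinh (pi * y * (real m + 1)) = (E - 1 / E) / 2"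
        by (simp add: sinh_field_def E_def exp_minus inverse_eq_divide)
      also have "\<dots> = (E\<^sup>2 - 1) / (2 * E)" using E by (simp add: field_simps power2_eq_square)
      finally have sh: "sinh (pi * y * (real m + 1)) = (E\<^sup>2 - 1) / (2 * E)" .
      have "f' m y = pi / 2 * ((2 * E)\<^sup>2 / (E\<^sup>2 - 1)\<^sup>2)" unfolding f'_def sh by (simp add: power_divide)
      also have "\<dots> = 2 * pi * E\<^sup>2 / (E\<^sup>2 - 1)\<^sup>2" by (simp add: power_mult_distrib)
      also have "(1 / (real m + 1)) * (E\<^sup>2 * (2 * pi * (real m + 1))) = 2 * pi * E\<^sup>2" by simp
      ultimately show ?thesis by simp
    qed
    ultimately show ?thesis unfolding E2 by simp
  qed
  have bd: "\<bar>f' m y\<bar> \<le> (pi / 2 * (1 / (pi * (\<alpha> / 2))\<^sup>2)) / (real m + 1)\<^sup>2" if "y \<in> S" for m y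
  proof -
    have "\<bar>f' m y\<bar> = pi / 2 * (1 / (sinh (pi * y * (real m + 1)))\<^sup>2)" by (simp add: f'_def)
    also have "\<dots> \<le> pi / 2 * ((1 / (pi * (\<alpha> / 2))\<^sup>2) / (real m + 1)\<^sup>2)"
      using that \<alpha> by (intro mult_left_mono csch_term_le) (auto simp: S_def)
    finally show ?thesis by simp
  qed
  have unif: "uniformly_convergent_on S (\<lambda>N x. \<Sum>n<N. f' n x)"
    by (rule uniform_series_on[OF bd])
  have sums: "(\<lambda>m. f m y) sums ln (phi (exp (- 2 * pi * y)))" if "y > 0" for y
    unfolding f_def using ln_phi_series[OF that] .
  have d1: "((\<lambda>x. \<Sum>n. f n x) has_field_derivative (\<Sum>n. f' n \<alpha>)) (at \<alpha>)"
    by (rule has_field_derivative_series'(2)[OF S(3) der unif S(1) sums_summable[OF sums[OF \<alpha>]] S(2)])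
  have "(\<lambda>n. f' n \<alpha>) sums (pi / 2 * csch_sum \<alpha>)"
    unfolding f'_def by (intro sums_mult csch_sum_sums \<alpha>)
  then have "(\<Sum>n. f' n \<alpha>) = pi / 2 * csch_sum \<alpha>" by (rule sums_unique[symmetric])
  with d1 have d1: "((\<lambda>x. \<Sum>n. f n x) has_field_derivative (pi / 2 * csch_sum \<alpha>)) (at \<alpha>)"
    by (simp only:)
  show ?thesis
    by (rule has_field_derivative_transform_within_open[OF d1 S(4) S(1)])
       (use sums \<alpha> in \<open>simp add: S_def sums_iff\<close>)
qed

text \<open>\<open>K\<close>, the logarithm of the quotient of the two sides, has derivative zero by
  \<open>csch_sum_reciprocity\<close>, and it vanishes at the fixed point \<alpha> = 1 of the
  inversion.\<close>

lemma phi_modular: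
  assumes \<alpha>: "\<alpha> > 0"
  shows "phi (exp (- 2 * pi * \<alpha>)) = exp (- ln \<alpha> / 2 + pi * \<alpha> / 12 - pi / (12 * \<alpha>)) * phi (exp (- 2 * pi / \<alpha>))"
proof -
  define D where "D = (\<lambda>\<alpha>. ln (phi (exp (- 2 * pi * \<alpha>))))"
  define K where "K = (\<lambda>\<alpha>. D \<alpha> - D (1 / \<alpha>) + ln \<alpha> / 2 - pi * \<alpha> / 12 + pi / (12 * \<alpha>))"
  have dD: "(D has_field_derivative pi / 2 * csch_sum y) (at y)" if "y > 0" for y
    unfolding D_def by (rule ln_phi_deriv[OF that])
  have dK: "(K has_field_derivative 0) (at y within {0<..})" if y: "y \<in> {0<..}" for y
  proof -
    have y0: "y > 0" using y by simp
    have dinv: "((\<lambda>y. 1 / y) has_field_derivative - (1 / y\<^sup>2)) (at y)"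
      using y0 by (auto intro!: derivative_eq_intros simp: power2_eq_square)
    have dinv12: "((\<lambda>y. pi / (12 * y)) has_field_derivative - (pi / (12 * y\<^sup>2))) (at y)"
      using y0 by (auto intro!: derivative_eq_intros simp: power2_eq_square)
    have d2: "((\<lambda>y. D (1 / y)) has_field_derivative pi / 2 * csch_sum (1 / y) * - (1 / y\<^sup>2)) (at y)"
      using DERIV_chain2[OF dD dinv] y0 by simp
    have "(K has_field_derivative (pi / 2 * csch_sum y - pi / 2 * csch_sum (1 / y) * - (1 / y\<^sup>2)
        + 1 / y / 2 - pi / 12 + - (pi / (12 * y\<^sup>2)))) (at y)"
      unfolding K_def using y0
      by (intro DERIV_add DERIV_diff dD d2 dinv12) (auto intro!: derivative_eq_intros)
    moreover have "pi / 2 * csch_sum y - pi / 2 * csch_sum (1 / y) * - (1 / y\<^sup>2)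
        + 1 / y / 2 - pi / 12 + - (pi / (12 * y\<^sup>2)) = 0"
    proof -
      have "pi * (pi / 2 * csch_sum y - pi / 2 * csch_sum (1 / y) * - (1 / y\<^sup>2)
        + 1 / y / 2 - pi / 12 + - (pi / (12 * y\<^sup>2)))
        = pi\<^sup>2 / 2 * (csch_sum y + csch_sum (1 / y) / y\<^sup>2) - (pi\<^sup>2 / (12 * y\<^sup>2) + pi\<^sup>2 / 12 - pi / (2 * y))"
        by (simp add: algebra_simps power2_eq_square)
      also have "\<dots> = 0" using csch_sum_reciprocity[OF y0] by simp
      finally show ?thesis by simp
    qed
    ultimately show ?thesis by (auto intro: DERIV_subset)
  qed
  have "\<exists>c. \<forall>y\<in>{0<..}. K y = c"
    by (rule has_field_derivative_zero_constant[OF _ dK]) auto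
  then obtain c where c: "\<And>y. y > 0 \<Longrightarrow> K y = c" by auto
  have "K 1 = 0" by (simp add: K_def)
  then have "K \<alpha> = 0" using c[of 1] c[OF \<alpha>] by simp
  then have "ln (phi (exp (- 2 * pi * \<alpha>))) = (- ln \<alpha> / 2 + pi * \<alpha> / 12 - pi / (12 * \<alpha>)) + ln (phi (exp (- 2 * pi / \<alpha>)))"
    by (simp add: K_def D_def)
  then have "exp (ln (phi (exp (- 2 * pi * \<alpha>)))) = exp (- ln \<alpha> / 2 + pi * \<alpha> / 12 - pi / (12 * \<alpha>)) * exp (ln (phi (exp (- 2 * pi / \<alpha>))))"
    by (simp add: exp_add)
  moreover have "phi (exp (- 2 * pi * \<alpha>)) > 0" "phi (exp (- 2 * pi / \<alpha>)) > 0"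
    using \<alpha> by (intro phi_bounds(1); simp)+
  ultimately show ?thesis by simp
qed

text \<open>Both sides are holomorphic on the right half-plane, so the identity extends from the positive reals.\<close>
lemma Phi_modular:
  assumes s: "Re s > 0"
  shows "Phi (exp (- s)) = exp (of_real (ln (2 * pi)) / 2 - Ln s / 2 + s / 24 - of_real (pi\<^sup>2) / (6 * s)) * Phi (exp (- (of_real (4 * pi\<^sup>2) / s)))"
proof -
  define S where "S = {s. Re s > 0}"
  define F where "F = (\<lambda>s. Phi (exp (- s)) - exp (of_real (ln (2 * pi)) / 2 - Ln s / 2 + s / 24 - of_real (pi\<^sup>2) / (6 * s)) * Phi (exp (- (of_real (4 * pi\<^sup>2) / s))))"
  have S: "open S" "connected S" unfolding S_def
    by (auto simp: open_halfspace_Re_gt intro!: convex_connected convex_halfspace_Re_gt)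
  have nz: "s \<notin> \<real>\<^sub>\<le>\<^sub>0" "s \<noteq> 0" if "s \<in> S" for s using that by (auto simp: S_def complex_nonpos_Reals_iff)
  have re: "Re (of_real (4 * pi\<^sup>2) / s) > 0" if "s \<in> S" for s
  proof -
    have "(Re s)\<^sup>2 + (Im s)\<^sup>2 > 0" using that by (intro add_pos_nonneg) (auto simp: S_def)
    then show ?thesis using that by (auto simp: S_def Re_divide intro!: divide_pos_pos)
  qed
  have "F holomorphic_on S"
    unfolding F_def
    by (intro holomorphic_intros holomorphic_on_compose_gen[OF _ Phi_holomorphic, unfolded o_def])
       (use nz re in \<open>auto simp: S_def\<close>)
  moreover have "F z = 0" if "z \<in> of_real ` {0<..}" for z
  proof -
    obtain y where y: "z = of_real y" "y > 0" using \<open>z \<in> _\<close> by auto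
    define \<alpha> where "\<alpha> = y / (2 * pi)"
    have \<alpha>: "\<alpha> > 0" using y by (simp add: \<alpha>_def)
    have e: "- 2 * pi * \<alpha> = - y" "- 2 * pi / \<alpha> = - (4 * pi\<^sup>2 / y)" "pi * \<alpha> / 12 = y / 24"
       "pi / (12 * \<alpha>) = pi\<^sup>2 / (6 * y)" "- ln \<alpha> / 2 = ln (2 * pi) / 2 - ln y / 2"
      using y by (simp_all add: \<alpha>_def power2_eq_square ln_div field_simps)
    have eq: "phi (exp (- y)) = exp (ln (2 * pi) / 2 - ln y / 2 + y / 24 - pi\<^sup>2 / (6 * y)) * phi (exp (- (4 * pi\<^sup>2 / y)))"
      using phi_modular[OF \<alpha>] unfolding e .
    have "complex_of_real (phi (exp (- y))) = Phi (exp (- z))" "complex_of_real (phi (exp (- (4 * pi\<^sup>2 / y)))) = Phi (exp (- (of_real (4 * pi\<^sup>2) / z)))"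
      using y by (simp_all add: Phi_of_real[symmetric] exp_of_real[symmetric])
    moreover have "complex_of_real (exp (ln (2 * pi) / 2 - ln y / 2 + y / 24 - pi\<^sup>2 / (6 * y))) = exp (of_real (ln (2 * pi)) / 2 - Ln z / 2 + z / 24 - of_real (pi\<^sup>2) / (6 * z))"
      using y by (simp add: exp_of_real[symmetric] Ln_of_real)
    ultimately show ?thesis using arg_cong[OF eq, of complex_of_real] by (simp add: F_def)
  qed
  moreover have "(1::complex) islimpt of_real ` {0<..}"
  proof -
    have "(1::real) islimpt {0<..}" by (rule interior_limit_point) (simp add: interior_open)
    then have "complex_of_real 1 islimpt of_real ` {0<..}"
      by (rule islimpt_isCont_image) (auto simp: eventually_at_filter)
    then show ?thesis by simp
  qed
  ultimately have "F s = 0"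
    using s S by (intro analytic_continuation[of F S "of_real ` {0<..}" 1 s]) (auto simp: S_def)
  then show ?thesis by (simp add: F_def)
qed

section \<open>Sections at small nome\<close>

definition psi :: "real \<Rightarrow> real" where "psi x = (\<Prod>n. 1 + x ^ Suc n)"

text \<open>Factorwise 1 + y = (1 - y^2) / (1 - y). This links the product in the equation for
  \<open>Qstar\<close> to quotients of values of \<open>phi\<close>, hence of neighbouring
  coefficients of the denominator.\<close>

lemma psi_has_prod_phi:
  assumes "0 \<le> x" "x < 1" shows "(\<lambda>n. 1 + x ^ Suc n) has_prod (phi (x\<^sup>2) / phi x)"
proof -
  have x2: "\<bar>x\<^sup>2\<bar> < 1" using assms by (simp add: power_less_one_iff)
  have "(\<lambda>n. (1 - (x\<^sup>2) ^ Suc n) / (1 - x ^ Suc n)) has_prod (phi (x\<^sup>2) / phi x)"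
    using assms by (intro has_prod_divide phi_has_prod x2) auto
  moreover have "(1 - (x\<^sup>2) ^ Suc n) / (1 - x ^ Suc n) = 1 + x ^ Suc n" for n
  proof -
    have "(x\<^sup>2) ^ Suc n = x ^ Suc n * x ^ Suc n"
      by (metis power2_eq_square power_mult_distrib)
    then have "1 - (x\<^sup>2) ^ Suc n = (1 + x ^ Suc n) * (1 - x ^ Suc n)" by (simp add: algebra_simps)
    then show ?thesis using phi_nonneg_factor(1)[OF assms, of n] by (simp del: power_Suc)
  qed
  ultimately show ?thesis by simp
qed

lemma psi_has_prod:
  assumes "0 \<le> x" "x < 1" shows "(\<lambda>n. 1 + x ^ Suc n) has_prod psi x"
  using psi_has_prod_phi[OF assms] unfolding psi_def by (simp add: has_prod_iff)

lemma psi_eq: assumes "0 \<le> x" "x < 1" shows "psi x = phi (x\<^sup>2) / phi x"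
  using psi_has_prod[OF assms] psi_has_prod_phi[OF assms] has_prod_unique2 by blast

lemma psi_LIMSEQ:
  assumes "0 \<le> x" "x < 1" shows "(\<lambda>N. \<Prod>n<N. 1 + x ^ Suc n) \<longlonglongrightarrow> psi x"
  using has_prod_imp_tendsto[OF psi_has_prod[OF assms]] LIMSEQ_lessThan_iff_atMost by blast

lemma psi_mono:
  assumes "0 \<le> x" "x \<le> y" "y < 1" shows "psi x \<le> psi y"
proof (rule LIMSEQ_le)
  show "(\<lambda>N. \<Prod>n<N. 1 + x ^ Suc n) \<longlonglongrightarrow> psi x" "(\<lambda>N. \<Prod>n<N. 1 + y ^ Suc n) \<longlonglongrightarrow> psi y"
    using assms by (intro psi_LIMSEQ; simp)+
  show "\<exists>N. \<forall>n\<ge>N. (\<Prod>n<n. 1 + x ^ Suc n) \<le> (\<Prod>n<n. 1 + y ^ Suc n)"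
    using assms by (intro exI allI impI prod_mono conjI add_left_mono power_mono add_nonneg_nonneg) auto
qed

lemma psi_ge: assumes "0 \<le> x" "x < 1" shows "1 + x \<le> psi x"
proof (rule LIMSEQ_le_const[OF psi_LIMSEQ[OF assms]], intro exI allI impI)
  fix N :: nat assume N: "1 \<le> N"
  have "(\<Prod>n<1. 1 + x ^ Suc n) \<le> (\<Prod>n<N. 1 + x ^ Suc n)"
    using N assms by (intro prod_mono2) (auto intro: add_nonneg_nonneg)
  then show "1 + x \<le> (\<Prod>n<N. 1 + x ^ Suc n)" by simp
qed

text \<open>A strict inequality between partial products may be lost in the limit; splitting off the
  strictly increasing factor 1 + x preserves it.\<close>

lemma psi_strict_mono:
  assumes "0 \<le> x" "x < y" "y < 1" shows "psi x < psi y"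
proof -
  define t where "t = (\<lambda>x::real. \<Prod>n. 1 + x ^ Suc (Suc n))"
  have head: "psi x = (1 + x) * t x" "(\<lambda>N. \<Prod>n<N. 1 + x ^ Suc (Suc n)) \<longlonglongrightarrow> t x" if "0 \<le> x" "x < 1" for x
  proof -
    have c: "convergent_prod (\<lambda>n. 1 + x ^ Suc n)"
      using psi_has_prod[OF that] by (simp add: has_prod_iff)
    have nz: "1 + x ^ Suc n \<noteq> 0" for n
      using that zero_le_power[of x "Suc n"] by linarith
    show "psi x = (1 + x) * t x" unfolding psi_def t_def
      using prodinf_split_head[OF c] that by (simp add: add_nonneg_eq_0_iff)
    have "convergent_prod (\<lambda>n. 1 + x ^ Suc (Suc n))"
      using c convergent_prod_Suc_iff[of "\<lambda>n. 1 + x ^ Suc n"] nz[of 0] by simp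
    from has_prod_imp_tendsto[OF convergent_prod_has_prod[OF this]]
    show "(\<lambda>N. \<Prod>n<N. 1 + x ^ Suc (Suc n)) \<longlonglongrightarrow> t x"
      unfolding t_def using LIMSEQ_lessThan_iff_atMost by blast
  qed
  have "t x \<le> t y"
  proof (rule LIMSEQ_le)
    show "(\<lambda>N. \<Prod>n<N. 1 + x ^ Suc (Suc n)) \<longlonglongrightarrow> t x" "(\<lambda>N. \<Prod>n<N. 1 + y ^ Suc (Suc n)) \<longlonglongrightarrow> t y"
      using assms by (intro head; simp)+
    show "\<exists>N. \<forall>n\<ge>N. (\<Prod>n<n. 1 + x ^ Suc (Suc n)) \<le> (\<Prod>n<n. 1 + y ^ Suc (Suc n))"
      using assms by (intro exI allI impI prod_mono conjI add_left_mono power_mono add_nonneg_nonneg) auto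
  qed
  moreover have "t y > 0" using head(1)[of y] psi_ge[of y] assms
    by (smt (verit) zero_less_mult_iff)
  ultimately have "(1 + x) * t x < (1 + y) * t y" using assms
    by (intro mult_less_le_imp_less) (auto intro!: less_le_trans[OF _ \<open>t x \<le> t y\<close>]
       dest: head simp: zero_less_mult_iff, use head(1)[of x] psi_ge[of x] assms in \<open>smt (verit) zero_less_mult_iff\<close>)
  then show ?thesis using head(1)[of x] head(1)[of y] assms by simp
qed

text \<open>Factorwise, \<open>1 - y\<^bsup>m+2\<^esup> \<le> (1 + y\<^sup>i) (1 - y\<^bsup>m+1\<^esup>)\<close> whenever \<open>1 \<le> i \<le> m + 1\<close> and \<open>i \<le> 2\<close>.\<close>
lemma phi_step_le:
  assumes Q: "0 \<le> Q" "Q < 1" and i: "i = 1 \<or> i = 2" "i \<le> m + 1"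
  shows "phi (Q ^ (m + 2)) \<le> psi (Q ^ i) * phi (Q ^ (m + 1))"
proof (rule LIMSEQ_le)
  have pw: "0 \<le> Q ^ n" "Q ^ n < 1" if "n > 0" for n using Q that by (auto simp: power_less_one_iff)
  have i0: "i > 0" using i by auto
  show "(\<lambda>N. \<Prod>n<N. 1 - (Q ^ (m + 2)) ^ Suc n) \<longlonglongrightarrow> phi (Q ^ (m + 2))"
    using pw[of "m + 2"] by (intro phi_LIMSEQ) auto
  show "(\<lambda>N. (\<Prod>n<N. 1 + (Q ^ i) ^ Suc n) * (\<Prod>n<N. 1 - (Q ^ (m + 1)) ^ Suc n)) \<longlonglongrightarrow> psi (Q ^ i) * phi (Q ^ (m + 1))"
    using pw[of "m + 1"] pw[OF i0] by (intro tendsto_mult phi_LIMSEQ psi_LIMSEQ) auto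
  have fac: "1 - (Q ^ (m + 2)) ^ Suc n \<le> (1 + (Q ^ i) ^ Suc n) * (1 - (Q ^ (m + 1)) ^ Suc n)" for n
  proof -
    define y where "y = Q ^ Suc n"
    have y: "0 \<le> y" "y \<le> 1" using pw[of "Suc n"] by (auto simp: y_def)
    have e: "(Q ^ j) ^ Suc n = y ^ j" for j unfolding y_def by (simp only: power_mult[symmetric] mult.commute)
    have "y ^ (m + 1) \<le> y ^ i" using y i by (intro power_decreasing) auto
    moreover have "y ^ (m + 1 + i) \<le> y ^ (m + 2)" if "i = 1 \<or> i = 2" 
      using y that by (intro power_decreasing) auto
    ultimately have "0 \<le> y ^ i - y ^ (m + 1) + (y ^ (m + 2) - y ^ (m + 1 + i))" using i by auto
    then show ?thesis unfolding e by (simp add: algebra_simps power_add)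
  qed
  show "\<exists>N. \<forall>n\<ge>N. (\<Prod>n<n. 1 - (Q ^ (m + 2)) ^ Suc n) \<le> (\<Prod>n<n. 1 + (Q ^ i) ^ Suc n) * (\<Prod>n<n. 1 - (Q ^ (m + 1)) ^ Suc n)"
    unfolding prod.distrib[symmetric]
    using pw[of "m + 2"] phi_nonneg_factor(1)[of "Q ^ (m + 2)"]
    by (intro exI allI impI prod_mono conjI fac less_imp_le) auto
qed

definition rcoef :: "nat \<Rightarrow> real \<Rightarrow> real" where "rcoef k x = x * phi x ^ k"

lemma coef_of_real: "\<bar>x\<bar> < 1 \<Longrightarrow> coef k (of_real x) = of_real (rcoef k x)"
  by (simp add: coef_def rcoef_def Phi_of_real)

lemma rcoef_pos: "0 < x \<Longrightarrow> x < 1 \<Longrightarrow> 0 < rcoef k x"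
  by (simp add: rcoef_def phi_bounds)

lemma rcoef_le: "0 \<le> x \<Longrightarrow> x < 1 \<Longrightarrow> rcoef k x \<le> x"
  unfolding rcoef_def using phi_bounds[of x] by (intro mult_left_le power_le_one) auto

lemma rcoef_decreasing:
  assumes Q: "0 < Q" "Q < 1" and le: "Q * psi Q ^ k \<le> 1" and k: "k \<ge> 1"
  shows "rcoef k (Q ^ (m + 2)) \<le> rcoef k (Q ^ (m + 1))"
    and "m \<ge> 1 \<Longrightarrow> rcoef k (Q ^ (m + 2)) < rcoef k (Q ^ (m + 1))"
proof -
  have pw: "0 < Q ^ n" "Q ^ n < 1" if "n > 0" for n using Q that by (auto simp: power_less_one_iff)
  have step: "rcoef k (Q ^ (m + 2)) \<le> (Q * psi (Q ^ i) ^ k) * rcoef k (Q ^ (m + 1))" if "i = 1 \<or> i = 2" "i \<le> m + 1" for i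
  proof -
    have "phi (Q ^ (m + 2)) ^ k \<le> (psi (Q ^ i) * phi (Q ^ (m + 1))) ^ k"
      using phi_step_le[of Q i m] Q that pw[of "m + 2"] phi_bounds(1)[of "Q ^ (m + 2)"]
      by (intro power_mono) auto
    then have "Q ^ (m + 2) * phi (Q ^ (m + 2)) ^ k \<le> Q ^ (m + 2) * (psi (Q ^ i) * phi (Q ^ (m + 1))) ^ k"
      using Q by (intro mult_left_mono) auto
    then show ?thesis by (simp add: rcoef_def power_mult_distrib mult_ac)
  qed
  have g0: "rcoef k (Q ^ (m + 1)) > 0" using pw[of "m + 1"] by (intro rcoef_pos) auto
  show "rcoef k (Q ^ (m + 2)) \<le> rcoef k (Q ^ (m + 1))"
    using step[of 1] mult_right_mono[OF le less_imp_le[OF g0]] by simp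
  show "rcoef k (Q ^ (m + 2)) < rcoef k (Q ^ (m + 1))" if m: "m \<ge> 1"
  proof -
    have "psi (Q\<^sup>2) < psi Q" using Q pw[of 2] by (intro psi_strict_mono) (auto simp: power2_eq_square)
    moreover have "psi (Q\<^sup>2) \<ge> 0" using psi_ge[of "Q\<^sup>2"] pw[of 2] zero_le_power2[of Q] by linarith
    ultimately have "psi (Q\<^sup>2) ^ k < psi Q ^ k" using k by (intro power_strict_mono) auto
    then have "Q * psi (Q\<^sup>2) ^ k < 1" using Q le by (meson less_le_trans mult_strict_left_mono)
    then have "(Q * psi (Q\<^sup>2) ^ k) * rcoef k (Q ^ (m + 1)) < 1 * rcoef k (Q ^ (m + 1))"
      using g0 by (intro mult_strict_right_mono)
    then show ?thesis using step[of 2] m by simp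
  qed
qed

text \<open>The Enestrom--Kakeya argument: multiply the series by \<open>1 - z\<close>.\<close>
lemma decreasing_power_series_nonzero:
  fixes b :: "nat \<Rightarrow> real"
  assumes pos: "\<And>m. b m > 0" and dec: "\<And>m. b (Suc m) \<le> b m" and strict: "\<And>m. m \<ge> 1 \<Longrightarrow> b (Suc m) < b m"
    and sm: "summable b" and z: "norm z \<le> 1"
  shows "(\<Sum>m. complex_of_real (b m) * z ^ m) \<noteq> 0"
proof
  assume zero: "(\<Sum>m. complex_of_real (b m) * z ^ m) = 0"
  have bn: "norm (complex_of_real (b m) * z ^ m) \<le> b m" for m
    using pos[of m] z by (simp add: norm_mult norm_power mult_left_le power_le_one less_imp_le)
  have smz: "summable (\<lambda>m. complex_of_real (b m) * z ^ m)"
    by (rule summable_comparison_test'[OF sm]) (use bn in auto)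
  then have s0: "(\<lambda>m. complex_of_real (b m) * z ^ m) sums 0" using zero by (simp add: sums_iff)
  define \<delta> where "\<delta> = (\<lambda>m. b m - b (Suc m))"
  have \<delta>: "\<delta> m \<ge> 0" "m \<ge> 1 \<Longrightarrow> \<delta> m > 0" for m using dec[of m] strict[of m] by (auto simp: \<delta>_def)
  have b0: "b \<longlonglongrightarrow> 0" using sm by (rule summable_LIMSEQ_zero)
  have sd: "\<delta> sums b 0" using telescope_sums'[OF b0] unfolding \<delta>_def by simp
  have "(\<lambda>m. complex_of_real (b (Suc m)) * z ^ Suc m) sums (0 - complex_of_real (b 0) * z ^ 0)"
    using s0 by (subst sums_Suc_iff) simp
  from sums_diff[OF sums_mult[OF s0, of z] this]
  have "(\<lambda>m. complex_of_real (\<delta> m) * z ^ Suc m) sums complex_of_real (b 0)"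
    by (simp add: \<delta>_def algebra_simps)
  from sums_diff[OF sums_of_real[OF sd, where 'a = complex] this]
  have "(\<lambda>m. complex_of_real (\<delta> m) * (1 - z ^ Suc m)) sums 0" by (simp add: algebra_simps)
  from sums_Re[OF this] have re0: "(\<lambda>m. \<delta> m * (1 - Re (z ^ Suc m))) sums 0" by simp
  have rez: "Re (z ^ n) \<le> 1" for n
    using complex_Re_le_cmod[of "z ^ n"] power_le_one[OF norm_ge_zero z, of n] by (simp add: norm_power)
  have "\<delta> m * (1 - Re (z ^ Suc m)) = 0" for m
    using suminf_eq_zero_iff[OF sums_summable[OF re0]] re0 \<delta>(1) rez by (simp add: sums_iff del: power_Suc)
  then have Re1: "Re (z ^ Suc m) = 1" if "m \<ge> 1" for m using \<delta>(2)[OF that] by (metis diff_eq_eq diff_zero less_irrefl mult_eq_0_iff add_0)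
  have one: "z ^ Suc m = 1" if "m \<ge> 1" for m
  proof -
    have "norm (z ^ Suc m) \<le> 1" using power_le_one[OF norm_ge_zero z, of "Suc m"] by (simp add: norm_power del: power_Suc)
    then have "(Re (z ^ Suc m))\<^sup>2 + (Im (z ^ Suc m))\<^sup>2 \<le> 1"
      unfolding cmod_power2[symmetric] by (simp add: power_le_one)
    then have "Im (z ^ Suc m) = 0" using Re1[OF that] by simp
    then show ?thesis using Re1[OF that] by (simp add: complex_eq_iff)
  qed
  \<comment> \<open>The first step of the sequence may be an equality, so nothing is known about z
    itself; the exponents 2 and 3 come from m = 1, 2 and together force z = 1.\<close>
  have "z ^ 2 = 1" "z ^ 3 = 1" using one[of 1] one[of 2] by (simp_all add: numeral_eq_Suc)
  then have "z = 1" by (simp add: power2_eq_square power3_eq_cube)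
  then have "(\<lambda>m. complex_of_real (b m)) sums 0" using s0 by simp
  then have "b sums 0" using sums_of_real_iff[where 'a = complex, of b 0] by simp
  then show False using suminf_pos[OF sm pos] by (simp add: sums_iff)
qed

lemma J_den_nonzero:
  assumes q: "0 < q" "q < 1" and a: "a \<ge> 1" and k: "k \<ge> 1" and le: "q ^ a * psi (q ^ a) ^ k \<le> 1" and z: "norm z \<le> 1"
  shows "J_den a k z (complex_of_real q) \<noteq> 0"
proof -
  define Q where "Q = q ^ a"
  have Q: "0 < Q" "Q < 1" using q a by (auto simp: Q_def power_less_one_iff)
  define b where "b = (\<lambda>m. rcoef k (Q ^ (m + 1)))"
  have pw: "0 < Q ^ (m + 1)" "Q ^ (m + 1) < 1" for m using Q by (auto simp: power_less_one_iff simp del: power_Suc)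
  have "J_den a k z (complex_of_real q) = (\<Sum>m. complex_of_real (b m) * z ^ m)"
    unfolding J_den_coef
  proof (intro suminf_cong)
    fix m
    have "complex_of_real q ^ (a * (m + 1)) = of_real (Q ^ (m + 1))" unfolding Q_def power_mult by simp
    then show "z ^ m * coef k (complex_of_real q ^ (a * (m + 1))) = complex_of_real (b m) * z ^ m"
      using coef_of_real[of "Q ^ (m + 1)" k] pw[of m] by (simp add: b_def del: power_Suc)
  qed
  moreover have "(\<Sum>m. complex_of_real (b m) * z ^ m) \<noteq> 0"
  proof (rule decreasing_power_series_nonzero[OF _ _ _ _ z])
    show "b m > 0" for m unfolding b_def by (intro rcoef_pos pw)
    show "b (Suc m) \<le> b m" "m \<ge> 1 \<Longrightarrow> b (Suc m) < b m" for m
      using rcoef_decreasing[OF Q le[folded Q_def] k, of m] by (simp_all add: b_def)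
    show "summable b"
    proof (rule summable_comparison_test')
      show "summable (\<lambda>m. Q ^ m)" using Q by (intro summable_geometric) auto
      show "norm (b m) \<le> Q ^ m" for m
      proof -
        have "norm (b m) = b m" using rcoef_pos[OF pw[of m], of k] by (simp add: b_def)
        also have "b m \<le> Q ^ (m + 1)" unfolding b_def using pw[of m] by (intro rcoef_le) auto
        also have "\<dots> \<le> Q ^ m" using Q by (intro power_decreasing) auto
        finally show ?thesis .
      qed
    qed
  qed
  ultimately show ?thesis by simp
qed

section \<open>Averages over roots of unity and Taylor coefficients in z\<close>

lemma sum_roots_unity_power:
  assumes d: "d \<ge> 1"
  shows "(\<Sum>z | z ^ d = (1::complex). z ^ n) = (if d dvd n then of_nat d else 0)"
proof (cases "d dvd n")
  case True
  then obtain c where c: "n = d * c" by auto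
  have "(\<Sum>z | z ^ d = (1::complex). z ^ n) = (\<Sum>z | z ^ d = (1::complex). 1)"
    by (intro sum.cong) (auto simp: c power_mult)
  also have "\<dots> = of_nat d" using card_roots_unity_eq[of d] d by simp
  finally show ?thesis using True by simp
next
  case False
  define \<omega> where "\<omega> = cis (2 * pi / real d)"
  have \<omega>d: "\<omega> ^ d = 1"
  proof -
    have "\<omega> ^ d = cis (real d * (2 * pi / real d))" unfolding \<omega>_def by (rule Complex.DeMoivre)
    also have "real d * (2 * pi / real d) = 2 * pi" using d by simp
    finally show ?thesis by (simp add: complex_eq_iff)
  qed
  have \<omega>n: "\<omega> ^ n \<noteq> 1"
  proof
    assume "\<omega> ^ n = 1"
    then have "cis (2 * pi * real n / real d) = 1" by (simp add: \<omega>_def Complex.DeMoivre mult_ac)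
    then obtain j :: int where "2 * pi * real n / real d = 2 * pi * of_int j"
      by (auto simp: complex_eq_iff cos_one_2pi_int)
    then have "real n = of_int j * real d" using d by (simp add: field_simps)
    then have "int n = j * int d" by (metis of_int_eq_iff of_int_mult of_int_of_nat_eq)
    then have "int d dvd int n" by simp
    with False show False by simp
  qed
  \<comment> \<open>Multiplication by \<open>\<omega>\<close> permutes the roots of unity and
    multiplies the sum by \<open>\<omega> ^ n\<close>, which is not 1.\<close>
  have "(\<Sum>z | z ^ d = (1::complex). z ^ n) = (\<Sum>z | z ^ d = (1::complex). (\<omega> * z) ^ n)"
  proof (rule sum.reindex_bij_witness[of _ "\<lambda>z. \<omega> * z" "\<lambda>z. z / \<omega>"])
    have "\<omega> \<noteq> 0" by (simp add: \<omega>_def)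
    then show "\<And>a. a \<in> {z. z ^ d = 1} \<Longrightarrow> \<omega> * (a / \<omega>) = a" "\<And>a. a \<in> {z. z ^ d = 1} \<Longrightarrow> \<omega> * a / \<omega> = a"
      "\<And>a. a \<in> {z. z ^ d = 1} \<Longrightarrow> (\<omega> * (a / \<omega>)) ^ n = a ^ n" by auto
    show "\<And>a. a \<in> {z. z ^ d = 1} \<Longrightarrow> a / \<omega> \<in> {z. z ^ d = 1}"
         "\<And>a. a \<in> {z. z ^ d = 1} \<Longrightarrow> \<omega> * a \<in> {z. z ^ d = 1}"
      using \<omega>d by (auto simp: power_mult_distrib power_divide)
  qed
  also have "\<dots> = \<omega> ^ n * (\<Sum>z | z ^ d = (1::complex). z ^ n)"
    by (simp add: power_mult_distrib sum_distrib_left)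
  finally have "(\<omega> ^ n - 1) * (\<Sum>z | z ^ d = (1::complex). z ^ n) = 0" by (simp add: algebra_simps)
  then show ?thesis using \<omega>n False by simp
qed

lemma roots_unity_average_sums:
  assumes d: "d \<ge> 1" and f: "\<And>z. norm z = 1 \<Longrightarrow> (\<lambda>n. c n * z ^ n) sums f z"
  shows "(\<lambda>j. c (d * j)) sums ((1 / of_nat d) * (\<Sum>z | z ^ d = (1::complex). f z))"
proof -
  have "(\<lambda>n. (1 / of_nat d) * (\<Sum>z | z ^ d = (1::complex). c n * z ^ n)) sums ((1 / of_nat d) * (\<Sum>z | z ^ d = (1::complex). f z))"
    using norm_root_unity d by (intro sums_mult sums_sum f) auto
  moreover have "(1 / of_nat d) * (\<Sum>z | z ^ d = (1::complex). c n * z ^ n) = (if d dvd n then c n else 0)" for n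
    using sum_roots_unity_power[OF d, of n] d by (simp flip: sum_distrib_left)
  ultimately have *: "(\<lambda>n. if d dvd n then c n else 0) sums ((1 / of_nat d) * (\<Sum>z | z ^ d = (1::complex). f z))" by simp
  have "strict_mono (\<lambda>j. d * j)" using d by (intro strict_monoI) auto
  moreover have "(if d dvd n then c n else 0) = 0" if "n \<notin> range (\<lambda>j. d * j)" for n using that by (auto elim!: dvdE)
  ultimately have "(\<lambda>j. (\<lambda>n. if d dvd n then c n else 0) (d * j)) sums ((1 / of_nat d) * (\<Sum>z | z ^ d = (1::complex). f z))"
    using * by (subst sums_mono_reindex) auto
  then show ?thesis by simp
qed

lemma coef_series_in_z:
  assumes q: "norm q < 1" and z: "norm z * norm q ^ a < 1" and a: "a \<ge> 1" and b: "b \<ge> 1"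
  shows "summable (\<lambda>m. coef k (q ^ (a * m + b)) * z ^ m)"
proof (rule summable_comparison_test')
  define C where "C = exp (real k * (norm q / (1 - norm q)))"
  show "summable (\<lambda>m. C * (norm z * norm q ^ a) ^ m)"
    using z by (intro summable_mult summable_geometric) auto
  fix m
  have "norm (coef k (q ^ (a * m + b))) \<le> norm q ^ (a * m + b) * C"
    unfolding C_def using q b by (intro norm_coef_power_le) auto
  also have "\<dots> \<le> norm q ^ (a * m) * C"
    using q by (intro mult_right_mono power_decreasing) (auto simp: C_def)
  finally have "norm (coef k (q ^ (a * m + b))) * norm z ^ m \<le> norm q ^ (a * m) * C * norm z ^ m"
    by (intro mult_right_mono) auto
  then show "norm (coef k (q ^ (a * m + b)) * z ^ m) \<le> C * (norm z * norm q ^ a) ^ m"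
    by (simp add: norm_mult norm_power power_mult_distrib power_mult mult_ac)
qed

lemma J_num_in_z:
  assumes "norm q < 1" "norm z * norm q ^ a < 1" "a \<ge> 1"
  shows "(\<lambda>m. coef k (q ^ (a * m + 1)) * z ^ m) sums J_num a k z q"
  using summable_sums[OF coef_series_in_z[OF assms order_refl]] by (simp add: J_num_coef mult.commute)

lemma J_den_in_z:
  assumes "norm q < 1" "norm z * norm q ^ a < 1" "a \<ge> 1"
  shows "(\<lambda>m. coef k (q ^ (a * (m + 1))) * z ^ m) sums J_den a k z q"
  using summable_sums[OF coef_series_in_z[OF assms assms(3)]] by (simp add: J_den_coef mult.commute algebra_simps)

text \<open>Both series converge for |z| < |q|^-a, a disc larger than the unit disc, and by
  compactness the denominator stays nonzero in some neighbourhood of the closed unit disc. So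
  \<open>J\<close> is holomorphic in z on a disc of radius 1 + e, and the boundedness of its Taylor
  terms at \<open>r = 1 + e / 2\<close> gives the decay.\<close>

lemma J_power_series:
  assumes q: "0 < norm q" "norm q < 1" and a: "a \<ge> 1" and nz: "\<And>z. norm z \<le> 1 \<Longrightarrow> J_den a k z q \<noteq> 0"
  shows "\<exists>(c :: nat \<Rightarrow> complex) r M. r > 1 \<and> (\<forall>n. norm (c n) \<le> M / r ^ n) \<and>
    (\<forall>z. norm z \<le> 1 \<longrightarrow> (\<lambda>n. c n * z ^ n) sums J a k z q) \<and> c 0 = J a k 0 q"
proof -
  define R where "R = 1 / norm q ^ a"
  have qa: "0 < norm q ^ a" "norm q ^ a < 1" using q a by (auto simp: power_less_one_iff)
  have R1: "R > 1" using qa by (simp add: R_def field_simps)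
  have inR: "norm z * norm q ^ a < 1" if "z \<in> ball 0 R" for z :: complex
    using that qa by (simp add: R_def field_simps)
  have numh: "(\<lambda>z. J_num a k z q) holomorphic_on ball 0 R"
    by (rule power_series_holomorphic) (use J_num_in_z[OF q(2) inR a] in simp)
  have denh: "(\<lambda>z. J_den a k z q) holomorphic_on ball 0 R"
    by (rule power_series_holomorphic) (use J_den_in_z[OF q(2) inR a] in simp)
  define U where "U = {z \<in> ball 0 R. J_den a k z q \<noteq> 0}"
  have U: "open U"
  proof -
    have "open ((\<lambda>z. J_den a k z q) -` (- {0}) \<inter> ball 0 R)"
      using holomorphic_on_imp_continuous_on[OF denh] by (subst (asm) continuous_on_open_vimage) auto
    then show ?thesis by (simp add: U_def vimage_def Int_def conj_commute)
  qed
  have "cball 0 1 \<subseteq> U" using nz R1 by (auto simp: U_def)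
  then obtain e where e: "e > 0" "(\<Union>x\<in>cball 0 1. ball x e) \<subseteq> U"
    using compact_subset_open_imp_ball_epsilon_subset[OF compact_cball U] by blast
  define r where "r = 1 + e / 2"
  have subU: "ball 0 (1 + e) \<subseteq> U"
  proof
    fix z :: complex assume z: "z \<in> ball 0 (1 + e)"
    show "z \<in> U"
    proof (cases "norm z \<le> 1")
      case True then show ?thesis using \<open>cball 0 1 \<subseteq> U\<close> by auto
    next
      case False
      \<comment> \<open>Radial projection to the unit circle; its distance to z is |z| - 1 <
        e.\<close>
      define x where "x = z / of_real (norm z)"
      have "norm x = 1" using False by (auto simp: x_def norm_divide)
      moreover have "norm (z - x) < e"
      proof -
        have "z \<noteq> 0" using False by auto
        then have "z - x = x * of_real (norm z - 1)" by (simp add: x_def field_simps)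
        then have "norm (z - x) = \<bar>norm z - 1\<bar>" using \<open>norm x = 1\<close> by (simp only: norm_mult norm_of_real mult_1)
        then show ?thesis using z False by simp
      qed
      ultimately show ?thesis by (intro subsetD[OF e(2)] UN_I[of x]) (auto simp: dist_norm norm_minus_commute)
    qed
  qed
  have Jh: "(\<lambda>z. J a k z q) holomorphic_on ball 0 (1 + e)"
    unfolding J_def
    by (intro holomorphic_intros holomorphic_on_subset[OF numh] holomorphic_on_subset[OF denh])
       (use subU in \<open>auto simp: U_def\<close>)
  define c where "c = (\<lambda>n. (deriv ^^ n) (\<lambda>z. J a k z q) 0 / fact n)"
  have ser: "(\<lambda>n. c n * z ^ n) sums J a k z q" if "norm z < 1 + e" for z
    using holomorphic_power_series[OF Jh, of z] that by (simp add: c_def)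
  have r: "r > 1" using e by (simp add: r_def)
  have "(\<lambda>n. c n * of_real r ^ n) sums J a k (of_real r) q" using e r by (intro ser) (simp add: r_def del: of_real_add of_real_divide)
  then have "Bseq (\<lambda>n. c n * of_real r ^ n)"
    by (rule convergent_imp_Bseq[OF convergentI[OF summable_LIMSEQ_zero[OF sums_summable]]])
  then obtain M where M: "\<And>n. norm (c n * of_real r ^ n) \<le> M" by (auto elim!: BseqE)
  show ?thesis
  proof (intro exI conjI allI impI)
    show "r > 1" by fact
    show "norm (c n) \<le> M / r ^ n" for n using M[of n] r by (simp add: norm_mult norm_power field_simps)
    show "(\<lambda>n. c n * z ^ n) sums J a k z q" if "norm z \<le> 1" for z using that e by (intro ser) auto
    show "c 0 = J a k 0 q" by (simp add: c_def)
  qed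
qed

lemma J_at_0: "J a k 0 q = coef k q / coef k (q ^ a)"
proof -
  have s: "(\<Sum>m. 0 ^ m * f m) = f 0" for f :: "nat \<Rightarrow> complex"
  proof -
    have "(\<lambda>m. 0 ^ m * f m) = (\<lambda>m. if m = 0 then f 0 else 0)" by (auto simp: power_0_left)
    then show ?thesis using sums_single[of 0 "\<lambda>_. f 0"] by (simp add: sums_iff)
  qed
  show ?thesis unfolding J_def J_num_coef J_den_coef s by simp
qed

text \<open>Together with \<open>J_at_0\<close> this identifies T as the constant term of
  \<open>J\<close> in z, the one coefficient that the averages keep for every d.\<close>

lemma T_eq_coef:
  assumes "q \<noteq> 0" "a \<ge> 1" shows "T a k q = coef k q / coef k (q ^ a)"
proof -
  have "q powi (1 - int a) = q / q ^ a"
    using assms by (simp add: power_int_diff)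
  then show ?thesis by (simp add: T_def coef_def)
qed

lemma section_sum_tendsto_exponentially:
  assumes q: "0 < norm q" "norm q < 1" and a: "a \<ge> 1" and nz: "\<And>z. norm z \<le> 1 \<Longrightarrow> J_den a k z q \<noteq> 0"
  shows "tendsto_exponentially (\<lambda>d. W a d k q) (T a k q)"
proof -
  obtain c r M where r: "r > 1" and c: "\<And>n. norm (c n) \<le> M / r ^ n"
    "\<And>z. norm z \<le> 1 \<Longrightarrow> (\<lambda>n. c n * z ^ n) sums J a k z q" "c 0 = J a k 0 q"
    using J_power_series[OF q a nz] by blast
  have M: "M \<ge> 0" using order_trans[OF norm_ge_zero c(1)[of 0]] by simp
  have c0: "c 0 = T a k q" using c(3) q a T_eq_coef[of q a k] by (simp add: J_at_0)
  have bound: "norm (W a d k q - T a k q) \<le> M / (1 - 1 / r) * norm ((1 / r) ^ d)" if d: "d \<ge> 1" for d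
  proof -
    have "W a d k q = section_sum a d k q"
      using q a d nz norm_root_unity[OF _ d] by (intro W_eq_section_sum) auto
    then have "(\<lambda>j. c (d * j)) sums W a d k q"
      unfolding section_sum_def using roots_unity_average_sums[OF d, of c "\<lambda>z. J a k z q"] c(2) by simp
    then have "(\<lambda>j. c (d * Suc j)) sums (W a d k q - T a k q)"
      using c0 by (subst sums_Suc_iff) simp
    then have eq: "W a d k q - T a k q = (\<Sum>j. c (d * Suc j))" by (simp add: sums_iff)
    have rd: "1 / r ^ d \<le> 1 / r" "0 < 1 / r" "1 / r < 1" using r d power_increasing[of 1 d r] by (auto simp: field_simps)
    have le: "norm (c (d * Suc j)) \<le> M * (1 / r) ^ d * (1 / r) ^ j" for j
    proof -
      have "norm (c (d * Suc j)) \<le> M * (1 / r) ^ (d * Suc j)" using c(1)[of "d * Suc j"] by (simp add: power_one_over field_simps)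
      \<comment> \<open>Bounding the index below by d + j separates the decay in d from a geometric
        series in j.\<close>
      also have "d + j \<le> d * Suc j" using mult_le_mono1[OF d, of j] by simp
      then have "(1 / r) ^ (d * Suc j) \<le> (1 / r) ^ (d + j)" using rd by (intro power_decreasing) auto
      then have "M * (1 / r) ^ (d * Suc j) \<le> M * (1 / r) ^ (d + j)" using M by (intro mult_left_mono)
      finally show ?thesis by (simp add: power_add mult_ac)
    qed
    have gs: "(\<lambda>j. M * (1 / r) ^ d * (1 / r) ^ j) sums (M * (1 / r) ^ d * (1 / (1 - 1 / r)))"
      using rd by (intro sums_mult geometric_sums) auto
    have "norm (\<Sum>j. c (d * Suc j)) \<le> (\<Sum>j. M * (1 / r) ^ d * (1 / r) ^ j)"
      by (rule norm_suminf_le[OF le sums_summable[OF gs]])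
    also have "\<dots> = M / (1 - 1 / r) * norm ((1 / r) ^ d)" using gs r by (simp add: sums_iff)
    finally show ?thesis unfolding eq .
  qed
  show ?thesis unfolding tendsto_exponentially_def
  proof (intro exI conjI)
    show "0 < 1 / r" "1 / r < 1" using r by auto
    show "(\<lambda>d. norm (W a d k q - T a k q)) \<in> O(\<lambda>d. (1 / r) ^ d)"
      by (rule bigoI[where c = "M / (1 - 1 / r)"])
         (use bound in \<open>auto intro!: eventually_sequentiallyI[of 1]\<close>)
  qed
qed

lemma sections_of_small_nome:
  assumes q: "0 < q" "q < 1" and a: "a \<ge> 1" and k: "k \<ge> 1" and le: "q ^ a * psi (q ^ a) ^ k \<le> 1"
  shows "d \<ge> 1 \<Longrightarrow> \<not> is_pole (W a d k) (of_real q)"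
    and "d \<ge> 1 \<Longrightarrow> W a d k (of_real q) = section_sum a d k (of_real q)"
    and "tendsto_exponentially (\<lambda>d. W a d k (of_real q)) (T a k (of_real q))"
proof -
  have nz: "J_den a k z (complex_of_real q) \<noteq> 0" if "norm z \<le> 1" for z
    using J_den_nonzero[OF assms that] .
  show "\<not> is_pole (W a d k) (of_real q)" "W a d k (of_real q) = section_sum a d k (of_real q)" if d: "d \<ge> 1"
    using q a d nz norm_root_unity[OF _ d] by (intro W_eq_section_sum; simp)+
  show "tendsto_exponentially (\<lambda>d. W a d k (of_real q)) (T a k (of_real q))"
    using q a nz by (intro section_sum_tendsto_exponentially) auto
qed

section \<open>The threshold \<open>Qstar\<close>\<close>

lemma phi_continuous: "continuous_on {0..<1} phi"
  unfolding phi_def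
  by (intro continuous_intros continuous_on_compose2[OF holomorphic_on_imp_continuous_on[OF Phi_holomorphic]]) auto

lemma psi_continuous: "continuous_on {0..<1} psi"
proof -
  have "continuous_on {0..<1} (\<lambda>x. phi (x\<^sup>2) / phi x)"
    by (intro continuous_intros phi_continuous continuous_on_compose2[OF phi_continuous])
       (use phi_bounds(1) in \<open>force simp: power_less_one_iff\<close>)+
  then show ?thesis by (rule continuous_on_eq) (use psi_eq in auto)
qed

lemma is_Qstar_psi: "is_Qstar k Q \<longleftrightarrow> 0 < Q \<and> Q < 1 \<and> Q * psi Q ^ k = 1"
proof -
  have "(\<Prod>n. (1 + Q ^ Suc n) ^ k) = psi Q ^ k" if "0 < Q" "Q < 1"
    using has_prod_power[OF psi_has_prod[of Q], of k] that by (simp add: has_prod_iff)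
  then show ?thesis unfolding is_Qstar_def by auto
qed

lemma psi_power_strict_mono:
  assumes "0 < x" "x < y" "y < 1" shows "x * psi x ^ k < y * psi y ^ k"
proof -
  have "psi x \<ge> 1" using psi_ge[of x] assms by simp
  moreover have "psi x ^ k \<le> psi y ^ k" using assms psi_mono[of x y] \<open>psi x \<ge> 1\<close> by (intro power_mono) auto
  ultimately show ?thesis using assms by (intro mult_less_le_imp_less) (auto intro!: zero_less_power)
qed

lemma Qstar_ex1: assumes "k \<ge> 1" shows "\<exists>!Q. is_Qstar k Q"
proof (rule ex_ex1I)
  define f where "f = (\<lambda>x. x * psi x ^ k)"
  have cont: "continuous_on {0..9/10} f" unfolding f_def
    by (intro continuous_intros continuous_on_subset[OF psi_continuous]) auto
  \<comment> \<open>A point below 1 at which the value exceeds 1: at 9/10 the first factor of the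
    product already gives 9/10 * 19/10 > 1.\<close>
  have "psi (9/10) \<ge> 19/10" using psi_ge[of "9/10"] by simp
  then have "psi (9/10) ^ k \<ge> (19/10) ^ k" by (intro power_mono) auto
  moreover have "(19/10 :: real) ^ k \<ge> (19/10) ^ 1" using assms by (intro power_increasing) auto
  ultimately have "f (9/10) \<ge> 1" by (simp add: f_def)
  moreover have "f 0 \<le> 1" by (simp add: f_def)
  ultimately obtain x where x: "0 \<le> x" "x \<le> 9/10" "f x = 1"
    using IVT'[of f 0 1 "9/10"] cont by auto
  then have "x > 0" by (cases "x = 0") (auto simp: f_def)
  then show "\<exists>Q. is_Qstar k Q" using x by (auto simp: is_Qstar_psi f_def)
  show "x = y" if "is_Qstar k x" "is_Qstar k y" for x y
    using that psi_power_strict_mono[of x y k] psi_power_strict_mono[of y x k]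
    by (cases x y rule: linorder_cases) (auto simp: is_Qstar_psi)
qed

lemma le_Qstar_imp:
  assumes k: "k \<ge> 1" and a: "a \<ge> 1" and q: "0 < q" "q \<le> Qstar k powr (1 / real a)"
  shows "q < 1" "q ^ a * psi (q ^ a) ^ k \<le> 1"
proof -
  define Q where "Q = Qstar k"
  have Q: "0 < Q" "Q < 1" "Q * psi Q ^ k = 1"
    using theI'[OF Qstar_ex1[OF k]] by (auto simp: Q_def Qstar_def is_Qstar_psi)
  have "Q powr (1 / real a) < 1 powr (1 / real a)" using Q a by (intro powr_less_mono2) auto
  then show "q < 1" using q by (simp add: Q_def)
  have "q ^ a \<le> (Q powr (1 / real a)) ^ a" using q by (intro power_mono) (auto simp: Q_def)
  also have "\<dots> = Q" using Q a by (simp add: powr_power)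
  finally have "q ^ a \<le> Q" .
  then show "q ^ a * psi (q ^ a) ^ k \<le> 1"
    using psi_power_strict_mono[of "q ^ a" Q k] Q q by (cases "q ^ a = Q") auto
qed

theorem sections_below_Qstar:
  assumes "a \<ge> 2" "k \<ge> 1" "0 < q" "q \<le> Qstar k powr (1 / real a)"
  shows "\<forall>d\<ge>2. \<not> is_pole (W a d k) (of_real q)"
    "tendsto_exponentially (\<lambda>d. W a d k (of_real q)) (T a k (of_real q))"
  using sections_of_small_nome[of q a k] le_Qstar_imp[of k a q] assms by auto

section \<open>A summation formula in the sector\<close>

text \<open>The majorant with which the integrals along a ray and the rescaled saddle point
  integrals are compared.\<close>

lemma exp_abs_integrable: "integrable lborel (\<lambda>x::real. exp (- \<bar>x\<bar>))"
proof -
  have "integrable lborel (\<lambda>x::real. indicator {0..} x *\<^sub>R exp (- x))"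
  proof (rule integrableI_nn_integral_finite)
    have "(\<integral>\<^sup>+x. ennreal (exp (- x)) * indicator {0..} x \<partial>lborel) = ennreal (0 - (- exp (- 0)))"
    proof (rule nn_integral_FTC_atLeast)
      show "((\<lambda>x. - exp (- x)) has_real_derivative exp (- x)) (at x)" for x :: real
        by (auto intro!: derivative_eq_intros)
      show "((\<lambda>x::real. - exp (- x)) \<longlongrightarrow> 0) at_top" by real_asymp
    qed auto
    then show "(\<integral>\<^sup>+x. ennreal (indicator {0..} x *\<^sub>R exp (- x)) \<partial>lborel) = ennreal 1"
      by (simp add: ennreal_mult' ennreal_indicator mult.commute)
  qed auto
  then have i1: "integrable lborel (\<lambda>x::real. indicator {0..} x * exp (- x))" by simp
  have i2: "integrable lborel (\<lambda>x::real. indicator {0..} (0 + (-1) * x) * exp (- (0 + (-1) * x)))"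
    by (rule lborel_integrable_real_affine[OF i1]) simp
  show ?thesis
    by (rule Bochner_Integration.integrable_bound[OF Bochner_Integration.integrable_add[OF i1 i2]])
       (auto simp: indicator_def)
qed

text \<open>The ray of argument pi / 4 in the coordinate \<sigma> = ln |s|. Since ds = s d\<sigma>,
  integrands along it carry a factor \<open>ray \<sigma>\<close>.\<close>

definition ray :: "real \<Rightarrow> complex" where "ray \<sigma> = exp (Complex \<sigma> (pi / 4))"

lemma ray_altdef: "ray \<sigma> = of_real (exp \<sigma>) * cis (pi / 4)"
  by (simp add: ray_def exp_eq_polar)

lemma ray_simps [simp]: "norm (ray \<sigma>) = exp \<sigma>" "Re (ray \<sigma>) = exp \<sigma> * (sqrt 2 / 2)" "Im (ray \<sigma>) = exp \<sigma> * (sqrt 2 / 2)"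
  by (simp_all add: ray_altdef norm_mult cos_45 sin_45)

lemma ray_nonzero [simp]: "ray \<sigma> \<noteq> 0" by (simp add: ray_def)

lemma ray_measurable [measurable]: "ray \<in> borel_measurable borel"
  unfolding ray_altdef[abs_def] by (intro borel_measurable_continuous_onI continuous_intros)

definition sector :: "complex set" where "sector = {s. Re s > 0 \<and> \<bar>Im s\<bar> \<le> Re s}"

lemma ray_in_sector [simp]: "ray \<sigma> \<in> sector" "cnj (ray \<sigma>) \<in> sector" by (auto simp: sector_def)

lemma exp_in_sector: assumes "\<bar>Im w\<bar> \<le> pi / 4" shows "exp w \<in> sector"
proof -
  have "\<bar>sin (Im w)\<bar> \<le> cos (Im w)"
  proof -
    have c: "cos (Im w) \<ge> cos (pi / 4)" using assms cos_monotone_0_pi_le[of "\<bar>Im w\<bar>" "pi / 4"] by simp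
    have s: "\<bar>sin (Im w)\<bar> \<le> sin (pi / 4)"
    proof -
      have "sin \<bar>Im w\<bar> \<le> sin (pi / 4)" using assms by (intro sin_monotone_2pi_le) auto
      moreover have "\<bar>sin (Im w)\<bar> = sin \<bar>Im w\<bar>"
        using assms sin_ge_zero[of "\<bar>Im w\<bar>"] by (cases "Im w \<ge> 0") (auto simp: abs_if)
      ultimately show ?thesis by simp
    qed
    show ?thesis using c s by (simp add: cos_45 sin_45)
  qed
  moreover have "cos (Im w) > 0" using assms pi_gt_zero by (intro cos_gt_zero_pi) linarith+
  ultimately show ?thesis by (auto simp: sector_def Re_exp Im_exp abs_mult)
qed

text \<open>At height y the exponential has modulus exp (- 2 pi y), and 1 - exp (- X) \<ge> X / (1 +
  X). The bound is uniform in r and grows only like 1 / y towards the tip of the sector.\<close>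

lemma upper_kernel_bound:
  assumes y: "Im s = y" "y > 0"
  shows "1 / norm (1 - exp (2 * pi * \<i> * (s - of_real r))) \<le> 1 + 1 / (2 * pi * y)"
proof -
  have "norm (exp (2 * pi * \<i> * (s - of_real r))) = exp (- (2 * pi * y))" using y by simp
  then have "1 - exp (- (2 * pi * y)) \<le> norm (1 - exp (2 * pi * \<i> * (s - of_real r)))"
    using norm_triangle_ineq2[of 1 "exp (2 * pi * \<i> * (s - of_real r))"] by simp
  moreover have "exp (2 * pi * y) \<ge> 1 + 2 * pi * y" by (rule exp_ge_add_one_self)
  then have "exp (- (2 * pi * y)) \<le> 1 / (1 + 2 * pi * y)"
    using y by (simp add: exp_minus field_simps add_pos_pos)
  then have "1 - exp (- (2 * pi * y)) \<ge> 2 * pi * y / (1 + 2 * pi * y)"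
  proof -
    have "1 - 1 / (1 + X) = X / (1 + X)" if "X > 0" for X :: real using that by (simp add: field_simps)
    from this[of "2 * pi * y"] \<open>exp (- (2 * pi * y)) \<le> 1 / (1 + 2 * pi * y)\<close> show ?thesis using y by simp
  qed
  ultimately have le: "2 * pi * y / (1 + 2 * pi * y) \<le> norm (1 - exp (2 * pi * \<i> * (s - of_real r)))" by linarith
  have "0 < 2 * pi * y / (1 + 2 * pi * y)" using y by (simp add: add_pos_pos)
  then have "1 / norm (1 - exp (2 * pi * \<i> * (s - of_real r))) \<le> 1 / (2 * pi * y / (1 + 2 * pi * y))"
    using le by (intro frac_le) auto
  also have "\<dots> = 1 + 1 / (2 * pi * y)" using y by (simp add: field_simps)
  finally show ?thesis .
qed

text \<open>The kernel 1 / (1 - exp (2 pi \<i> (s - r))) has its poles exactly at s = r + m with m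
  an integer; the factor \<open>ray \<sigma>\<close> of the numerator is the Jacobian.\<close>

definition upterm :: "real \<Rightarrow> real \<Rightarrow> (complex \<Rightarrow> complex) \<Rightarrow> real \<Rightarrow> complex" where
  "upterm \<theta> r h \<sigma> = exp (\<i> * of_real \<theta> * (ray \<sigma> - of_real r)) * h (ray \<sigma>) * ray \<sigma> /
      (1 - exp (2 * pi * \<i> * (ray \<sigma> - of_real r)))"

definition upint :: "real \<Rightarrow> real \<Rightarrow> (complex \<Rightarrow> complex) \<Rightarrow> complex" where
  "upint \<theta> r h = (LINT \<sigma>|lborel. upterm \<theta> r h \<sigma>)"

lemma norm_upterm_le:
  assumes \<theta>: "\<theta> \<ge> 0"
  shows "norm (upterm \<theta> r h \<sigma>) \<le> norm (h (ray \<sigma>)) * (exp \<sigma> + 1)"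
proof -
  have "norm (exp (\<i> * of_real \<theta> * (ray \<sigma> - of_real r))) \<le> 1"
    using \<theta> by simp
  moreover have "1 / norm (1 - exp (2 * pi * \<i> * (ray \<sigma> - of_real r))) \<le> 1 + 1 / (2 * pi * (exp \<sigma> * (sqrt 2 / 2)))"
    by (rule upper_kernel_bound) simp_all
  moreover have "\<dots> \<le> 1 + 1 / exp \<sigma>"
  proof -
    have "2 * pi * (sqrt 2 / 2) \<ge> 1 * 1" 
      using pi_ge_two real_sqrt_ge_1_iff[of 2] mult_mono[of 1 pi 1 "sqrt 2"] by simp
    then have "exp \<sigma> * 1 \<le> exp \<sigma> * (2 * pi * (sqrt 2 / 2))" by (intro mult_left_mono) auto
    then have "1 / (2 * pi * (exp \<sigma> * (sqrt 2 / 2))) \<le> 1 / exp \<sigma>"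
      by (intro divide_left_mono) (auto simp: mult_ac)
    then show ?thesis by simp
  qed
  ultimately have "norm (exp (\<i> * of_real \<theta> * (ray \<sigma> - of_real r))) * norm (h (ray \<sigma>)) * exp \<sigma> * (1 / norm (1 - exp (2 * pi * \<i> * (ray \<sigma> - of_real r))))
      \<le> 1 * norm (h (ray \<sigma>)) * exp \<sigma> * (1 + 1 / exp \<sigma>)"
    by (intro mult_mono) (auto intro: order_trans)
  also have "\<dots> = norm (h (ray \<sigma>)) * (exp \<sigma> + 1)" by (simp add: field_simps)
  finally show ?thesis by (simp add: upterm_def norm_mult norm_divide)
qed

lemma exp_mul_bound:
  assumes c: "(c::real) > 0"
  obtains K where "K > 0" "\<And>\<sigma>. exp \<sigma> ^ 2 * exp (- c * exp \<sigma>) * (exp \<sigma> + 1) \<le> K * exp (- \<bar>\<sigma>\<bar>)"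
proof -
  \<comment> \<open>256 = 4^4 comes from (c u / 4)^4 \<le> exp (c u), used for u = exp \<sigma>
    \<ge> 1; the summand 2 covers u \<le> 1.\<close>
  define K where "K = 2 + 2 * (256 / c ^ 4)"
  have "K > 0" using c by (simp add: K_def add_pos_nonneg)
  moreover have "exp \<sigma> ^ 2 * exp (- c * exp \<sigma>) * (exp \<sigma> + 1) \<le> K * exp (- \<bar>\<sigma>\<bar>)" for \<sigma>
  proof (cases "\<sigma> \<le> 0")
    case True
    define u where "u = exp \<sigma>"
    have u: "0 < u" "u \<le> 1" using True by (auto simp: u_def)
    have "u ^ 2 * exp (- c * u) * (u + 1) \<le> u * 1 * 2"
      using u c by (intro mult_mono) (auto simp: power2_eq_square mult_left_le)
    also have "\<dots> \<le> K * u" using u c by (simp add: K_def algebra_simps)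
    finally show ?thesis using True by (simp add: u_def)
  next
    case False
    define u where "u = exp \<sigma>"
    have u: "u \<ge> 1" using False by (auto simp: u_def)
    have "c * u / 4 \<le> exp (c * u / 4)" using exp_ge_add_one_self[of "c * u / 4"] by linarith
    then have "(c * u / 4) ^ 4 \<le> exp (c * u / 4) ^ 4"
      using c u by (intro power_mono) auto
    also have "\<dots> = exp (real 4 * (c * u / 4))" by (rule exp_of_nat_mult[symmetric])
    finally have "c ^ 4 * u ^ 4 \<le> 256 * exp (c * u)" by (simp add: power_mult_distrib power_divide)
    then have e: "u ^ 4 * exp (- c * u) \<le> 256 / c ^ 4" using c by (simp add: exp_minus field_simps)
    have "u ^ 2 * exp (- c * u) * (u + 1) \<le> u ^ 2 * exp (- c * u) * (2 * u)"
      using u by (intro mult_left_mono) auto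
    also have "\<dots> = 2 * (u ^ 4 * exp (- c * u)) / u" using u by (simp add: eval_nat_numeral field_simps)
    also have "\<dots> \<le> 2 * (256 / c ^ 4) / u" using e u by (intro divide_right_mono mult_left_mono) auto
    also have "\<dots> \<le> K / u" using u by (intro divide_right_mono) (auto simp: K_def)
    finally show ?thesis using False by (simp add: u_def exp_minus field_simps)
  qed
  ultimately show ?thesis using that by blast
qed

text \<open>Quadratic decay at 0 compensates the kernel, which for r = 1 has a pole at the tip s = 0
  of the sector; exponential decay removes the outer arcs.\<close>

locale sector_decay =
  fixes h :: "complex \<Rightarrow> complex" and C c :: real
  assumes holo: "h holomorphic_on {s. Re s > 0}"
    and c_pos: "c > 0"
    and decay: "\<And>s. s \<in> sector \<Longrightarrow> norm (h s) \<le> C * norm s ^ 2 * exp (- c * norm s)"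
begin

lemma C_nonneg: "C \<ge> 0"
proof -
  have "0 \<le> C * norm (ray 0) ^ 2 * exp (- c * norm (ray 0))"
    using decay[OF ray_in_sector(1)[of 0]] norm_ge_zero order_trans by blast
  then show ?thesis by (simp add: zero_le_mult_iff)
qed

lemma h_ray_measurable [measurable]: "(\<lambda>\<sigma>. h (ray \<sigma>)) \<in> borel_measurable borel" "(\<lambda>\<sigma>. h (cnj (ray \<sigma>))) \<in> borel_measurable borel"
  unfolding ray_altdef[abs_def]
  by (rule borel_measurable_continuous_onI, intro continuous_on_compose2[OF holomorphic_on_imp_continuous_on[OF holo]] continuous_intros;
      auto simp: cos_45)+

lemma upterm_bound:
  obtains K where "K > 0" "\<And>\<theta> r \<sigma>. \<theta> \<ge> 0 \<Longrightarrow> norm (upterm \<theta> r h \<sigma>) \<le> K * exp (- \<bar>\<sigma>\<bar>)"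
proof -
  obtain K where K: "K > 0" "\<And>\<sigma>. exp \<sigma> ^ 2 * exp (- c * exp \<sigma>) * (exp \<sigma> + 1) \<le> K * exp (- \<bar>\<sigma>\<bar>)"
    using exp_mul_bound[OF c_pos] by blast
  have "norm (upterm \<theta> r h \<sigma>) \<le> ((C + 1) * K) * exp (- \<bar>\<sigma>\<bar>)" if "\<theta> \<ge> 0" for \<theta> r \<sigma>
  proof -
    have "norm (upterm \<theta> r h \<sigma>) \<le> norm (h (ray \<sigma>)) * (exp \<sigma> + 1)" by (rule norm_upterm_le[OF that])
    also have "norm (h (ray \<sigma>)) \<le> C * exp \<sigma> ^ 2 * exp (- c * exp \<sigma>)" using decay[of "ray \<sigma>"] by simp
    also have "\<dots> \<le> (C + 1) * exp \<sigma> ^ 2 * exp (- c * exp \<sigma>)" by (intro mult_right_mono) auto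
    finally have "norm (upterm \<theta> r h \<sigma>) \<le> (C + 1) * (exp \<sigma> ^ 2 * exp (- c * exp \<sigma>) * (exp \<sigma> + 1))"
      by (simp add: mult_right_mono mult_ac)
    also have "\<dots> \<le> (C + 1) * (K * exp (- \<bar>\<sigma>\<bar>))" using C_nonneg K(2) by (intro mult_left_mono) auto
    finally show ?thesis by simp
  qed
  moreover have "(C + 1) * K > 0" using K C_nonneg by simp
  ultimately show ?thesis using that by blast
qed

lemma upterm_measurable [measurable]: "upterm \<theta> r h \<in> borel_measurable borel"
  unfolding upterm_def[abs_def] by measurable

lemma upterm_integrable: assumes "\<theta> \<ge> 0" shows "integrable lborel (upterm \<theta> r h)"
proof -
  obtain K where K: "K > 0" "\<And>\<theta> r \<sigma>. \<theta> \<ge> 0 \<Longrightarrow> norm (upterm \<theta> r h \<sigma>) \<le> K * exp (- \<bar>\<sigma>\<bar>)"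
    using upterm_bound by blast
  show ?thesis
    by (rule Bochner_Integration.integrable_bound[OF integrable_mult_right[OF exp_abs_integrable, of K]])
       (use K assms in \<open>auto intro!: AE_I2\<close>)
qed

end

text \<open>The arcs \<open>\<bar>s\<bar> = M + r + 1/2\<close> stay away from the poles of the kernel.\<close>
lemma arc_kernel_bound:
  assumes s: "s \<in> sector" "norm s = real M + r + 1/2" and r: "r \<ge> 0" and \<theta>: "0 \<le> \<theta>" "\<theta> \<le> 2 * pi"
  shows "norm (exp (\<i> * of_real \<theta> * (s - of_real r))) \<le> 9 * norm (exp (2 * pi * \<i> * (s - of_real r)) - 1)"
proof -
  define y where "y = Im s"
  define E where "E = exp (2 * pi * \<i> * (s - of_real r))"
  have nE: "norm E = exp (- 2 * pi * y)" by (simp add: E_def y_def)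
  have nT: "norm (exp (\<i> * of_real \<theta> * (s - of_real r))) = exp (- \<theta> * y)" by (simp add: y_def)
  have tri: "\<bar>norm E - 1\<bar> \<le> norm (E - 1)" using norm_triangle_ineq3[of E 1] by simp
  have e1: "exp (pi / 2) \<ge> 2" using exp_ge_add_one_self[of "pi / 2"] pi_ge_two by linarith
  have e9: "exp (pi / 2) \<le> 9"
  proof -
    have "exp (pi / 2) \<le> exp (real 2 * 1)" using pi_less_4 by simp
    also have "\<dots> = exp 1 ^ 2" by (rule exp_of_nat_mult)
    also have "\<dots> \<le> 3 ^ 2" using exp_le by (intro power_mono) auto
    finally show ?thesis by simp
  qed
  \<comment> \<open>Away from the real axis |E| is bounded away from 1. Close to it, the radius M +
    r + 1/2 forces Re s - r - M into [1/4, 1/2], where the cosine is not positive, so Re E \<le>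
    0.\<close>
  consider "y \<ge> 1/4" | "y \<le> - 1/4" | "\<bar>y\<bar> < 1/4" by linarith
  then show ?thesis
  proof cases
    case 1
    then have "norm E \<le> exp (- (pi / 2))" using nE by (simp add: mult_left_mono)
    also have "\<dots> \<le> 1 / 2" using e1 by (simp add: exp_minus field_simps)
    finally have "1 / 2 \<le> norm (E - 1)" using tri by simp
    moreover have "exp (- \<theta> * y) \<le> 1" using 1 \<theta> by simp
    ultimately show ?thesis unfolding nT E_def[symmetric] by linarith
  next
    case 2
    then have "pi * (1/4) \<le> pi * (- y)" by (intro mult_left_mono) auto
    then have "norm E \<ge> exp (pi / 2)" using nE by simp
    then have "norm E \<ge> 2" using e1 by linarith
    then have "norm E / 2 \<le> norm (E - 1)" using tri by simp
    moreover have "exp (- \<theta> * y) \<le> norm E" using 2 \<theta> by (simp add: nE mult_right_mono_neg)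
    ultimately show ?thesis unfolding nT E_def[symmetric] using norm_ge_zero[of E] by linarith
  next
    case 3
    define R where "R = real M + r + 1/2"
    have R: "R \<ge> 1/2" using r by (simp add: R_def)
    have sq: "(Re s)\<^sup>2 + y\<^sup>2 = R\<^sup>2" using s(2) cmod_power2[of s] by (simp add: y_def R_def)
    have "Re s > 0" using s by (simp add: sector_def)
    have up: "Re s \<le> R" using complex_Re_le_cmod[of s] s(2) by (simp add: R_def)
    have "y\<^sup>2 \<le> (1/4)\<^sup>2" using 3 by (intro abs_le_square_iff[THEN iffD1]) auto
    moreover have "(R - 1/4)\<^sup>2 = R\<^sup>2 - R / 2 + (1/4)\<^sup>2" by (simp add: power2_eq_square field_simps)
    moreover have "(1/4 :: real)\<^sup>2 = 1/16" by (simp add: power2_eq_square)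
    ultimately have "(R - 1/4)\<^sup>2 \<le> (Re s)\<^sup>2" using sq R by linarith
    then have lo: "R - 1/4 \<le> Re s" using \<open>Re s > 0\<close> by (rule power2_le_imp_le[OF _ less_imp_le])
    define x where "x = Re s - r - real M"
    have x: "1/4 \<le> x" "x \<le> 1/2" using up lo by (auto simp: x_def R_def)
    have "cos (2 * pi * x) \<le> 0"
    proof -
      have "0 \<le> sin (2 * pi * x - pi / 2)"
      proof (rule sin_ge_zero)
        show "0 \<le> 2 * pi * x - pi / 2" using x pi_gt_zero by (simp add: field_simps)
        have "pi * x \<le> pi * (1/2)" using x by (intro mult_left_mono) auto
        then show "2 * pi * x - pi / 2 \<le> pi" using pi_gt_zero by linarith
      qed
      then show ?thesis by (simp add: sin_diff)
    qed
    moreover have "cos (2 * pi * (Re s - r)) = cos (2 * pi * x)"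
    proof -
      have "2 * pi * (Re s - r) = 2 * pi * x + 2 * real M * pi" by (simp add: x_def algebra_simps)
      then have "cos (2 * pi * (Re s - r)) = cos (2 * pi * x + 2 * real M * pi)" by (simp only:)
      then show ?thesis by (simp add: cos_add)
    qed
    ultimately have "Re E \<le> 0" by (simp add: E_def Re_exp mult_nonneg_nonpos)
    then have "1 \<le> norm (E - 1)" using abs_Re_le_cmod[of "E - 1"] by simp
    moreover have "exp (- \<theta> * y) \<le> 9"
    proof -
      have "- \<theta> * y \<le> \<theta> * \<bar>y\<bar>" using \<theta> by (simp add: abs_if mult_left_mono)
      also have "\<dots> \<le> (2 * pi) * (1/4)" using \<theta> 3 by (intro mult_mono) auto
      finally have "exp (- \<theta> * y) \<le> exp (pi / 2)" by simp
      then show ?thesis using e9 by linarith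
    qed
    ultimately show ?thesis unfolding nT E_def[symmetric] by linarith
  qed
qed

text \<open>For r < 1 the function exp (2 pi \<i> (s - r)) - 1 is nonzero at 0; for r = 1 it has a
  simple zero there, with derivative 2 pi \<i>. The linear lower bound covers both and costs one
  power of |s| on the inner arc.\<close>

lemma kernel_bound_near_0:
  assumes r: "0 < r" "r \<le> 1"
  obtains B \<delta> where "B > 0" "\<delta> > 0" "\<And>s. s \<noteq> 0 \<Longrightarrow> norm s < \<delta> \<Longrightarrow> norm s \<le> B * norm (exp (2 * pi * \<i> * (s - of_real r)) - 1)"
proof (cases "r = 1")
  case True
  define f where "f = (\<lambda>s. exp (2 * pi * \<i> * (s - of_real r)) - 1)"
  have "(f has_field_derivative 2 * pi * \<i> * exp (2 * pi * \<i> * (0 - of_real r))) (at 0)"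
    unfolding f_def by (auto intro!: derivative_eq_intros)
  moreover have e: "exp (2 * pi * \<i> * (0 - complex_of_real r)) = 1" unfolding True
    using exp_2pi_1_int[of "-1"] by (simp add: mult_ac)
  ultimately have "((\<lambda>s. (f s - f 0) / (s - 0)) \<longlongrightarrow> 2 * pi * \<i>) (at 0)"
    by (simp add: has_field_derivative_iff)
  moreover have "f 0 = 0" using e by (simp add: f_def)
  ultimately have "((\<lambda>s. norm (f s / s)) \<longlongrightarrow> norm (2 * pi * \<i>)) (at 0)" by (intro tendsto_norm) simp
  then have "\<forall>\<^sub>F s in at 0. norm (f s / s) > 1"
    using pi_gt3 by (intro order_tendstoD) (auto simp: norm_mult)
  then obtain \<delta> where "\<delta> > 0" "\<And>s. s \<noteq> 0 \<Longrightarrow> norm s < \<delta> \<Longrightarrow> norm (f s / s) > 1"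
    by (auto simp: eventually_at dist_norm)
  then have "norm s \<le> 1 * norm (f s)" if "s \<noteq> 0" "norm s < \<delta>" for s
    using that by (force simp: norm_divide field_simps)
  then show ?thesis using \<open>\<delta> > 0\<close> unfolding f_def by (intro that[of 1 \<delta>]) auto
next
  case False
  define f where "f = (\<lambda>s. exp (2 * pi * \<i> * (s - of_real r)) - 1)"
  have "f 0 \<noteq> 0"
  proof
    assume "f 0 = 0"
    then have "exp (2 * pi * \<i> * (0 - complex_of_real r)) = 1" by (simp add: f_def)
    then obtain n :: int where "Im (2 * pi * \<i> * (0 - complex_of_real r)) = of_int (2 * n) * pi"
      unfolding exp_eq_1 by blast
    then have "pi * r = pi * of_int (- n)" by simp
    then have "r = of_int (- n)" by (simp only: mult_cancel_left) simp
    then have "0 < - n" "- n \<le> 1" "- n \<noteq> 1" using r False by (auto simp: of_int_less_iff[symmetric] simp del: of_int_minus)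
    then show False by linarith
  qed
  have "(f \<longlongrightarrow> f 0) (at 0)" unfolding f_def by (intro tendsto_intros)
  then have "((\<lambda>s. norm (f s)) \<longlongrightarrow> norm (f 0)) (at 0)" by (rule tendsto_norm)
  then have "\<forall>\<^sub>F s in at 0. norm (f s) > norm (f 0) / 2"
    using \<open>f 0 \<noteq> 0\<close> by (intro order_tendstoD) auto
  then obtain \<delta> where d: "\<delta> > 0" "\<And>s. s \<noteq> 0 \<Longrightarrow> norm s < \<delta> \<Longrightarrow> norm (f s) > norm (f 0) / 2"
    by (auto simp: eventually_at dist_norm)
  show ?thesis
  proof (rule that[of "2 / norm (f 0)" "min \<delta> 1"])
    fix s :: complex assume "s \<noteq> 0" "norm s < min \<delta> 1"
    then have "norm s \<le> 1" "norm (f s) > norm (f 0) / 2" using d(2)[of s] by auto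
    then have "norm s * norm (f 0) \<le> 1 * (2 * norm (f s))" using mult_right_mono[of "norm s" 1 "norm (f 0)"] by simp
    then have "norm s \<le> 2 / norm (f 0) * norm (f s)" using \<open>f 0 \<noteq> 0\<close> by (simp add: field_simps)
    then show "norm s \<le> 2 / norm (f 0) * norm (exp (2 * pi * \<i> * (s - of_real r)) - 1)"
      unfolding f_def .
  qed (use d \<open>f 0 \<noteq> 0\<close> in auto)
qed

lemma residue_simple_zero_quotient:
  assumes f: "f holomorphic_on S" and g: "g holomorphic_on S" and S: "open S" "z \<in> S"
    and g': "(g has_field_derivative g') (at z)" and z: "g z = 0" "g' \<noteq> 0"
    and nz: "\<And>w. w \<in> S \<Longrightarrow> w \<noteq> z \<Longrightarrow> g w \<noteq> 0"
  shows "residue (\<lambda>w. f w / g w) z = f z / g'"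
proof (rule residue_simple')
  show "open S" "z \<in> S" by fact+
  show "(\<lambda>w. f w / g w) holomorphic_on (S - {z})"
    using nz by (intro holomorphic_intros holomorphic_on_subset[OF f] holomorphic_on_subset[OF g]) auto
  have "(f \<longlongrightarrow> f z) (at z)"
    using holomorphic_on_imp_continuous_on[OF f] S by (simp add: continuous_on_eq_continuous_at isCont_def)
  moreover have "((\<lambda>w. (g w - g z) / (w - z)) \<longlongrightarrow> g') (at z)" using g' by (simp add: has_field_derivative_iff)
  ultimately have "((\<lambda>w. f w / ((g w - g z) / (w - z))) \<longlongrightarrow> f z / g') (at z)" using z by (intro tendsto_divide)
  then show "((\<lambda>w. f w / g w * (w - z)) \<longlongrightarrow> f z / g') (at z)" using z by (simp add: divide_divide_eq_right)
qed

lemma contour_integral_linepath_same_Im: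
  assumes "x1 < x2"
  shows "contour_integral (linepath (Complex x1 y) (Complex x2 y)) f = integral {x1..x2} (\<lambda>x. f (Complex x y))"
proof -
  have "contour_integral (linepath (Complex x1 y) (Complex x2 y)) f =
     contour_integral (linepath (of_real x1) (of_real x2)) (\<lambda>w. f (w + \<i> * of_real y))"
  proof -
    have lp: "linepath (Complex x1 y) (Complex x2 y) t = linepath (of_real x1) (of_real x2) t + \<i> * of_real y" for t
      by (simp add: linepath_def complex_eq_iff algebra_simps)
    have "Complex x2 y - Complex x1 y = of_real x2 - of_real x1" by (simp add: complex_eq_iff)
    then show ?thesis unfolding contour_integral_integral vector_derivative_linepath_at lp by simp
  qed
  also have "\<dots> = integral {x1..x2} (\<lambda>x. f (of_real x + \<i> * of_real y))"
    using assms by (subst contour_integral_linepath_Reals_eq) auto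
  also have "(\<lambda>x. f (complex_of_real x + \<i> * of_real y)) = (\<lambda>x. f (Complex x y))"
    by (simp add: Complex_eq)
  finally show ?thesis .
qed

lemma set_integral_tendsto_whole:
  fixes f :: "real \<Rightarrow> complex"
  assumes f: "integrable lborel f" and a: "filterlim a at_bot sequentially" and b: "filterlim b at_top sequentially"
  shows "(\<lambda>n. integral {a n..b n} f) \<longlonglongrightarrow> (LINT x|lborel. f x)"
proof -
  have "(\<lambda>n. LINT x|lborel. indicator {a n..b n} x *\<^sub>R f x) \<longlonglongrightarrow> (LINT x|lborel. f x)"
  proof (rule integral_dominated_convergence[where w = "\<lambda>x. norm (f x)"])
    show "AE x in lborel. (\<lambda>n. indicator {a n..b n} x *\<^sub>R f x) \<longlonglongrightarrow> f x"
    proof (intro AE_I2)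
      fix x
      have "\<forall>\<^sub>F n in sequentially. a n \<le> x" "\<forall>\<^sub>F n in sequentially. x \<le> b n"
        using a b by (auto simp: filterlim_at_bot filterlim_at_top)
      then have "\<forall>\<^sub>F n in sequentially. indicator {a n..b n} x *\<^sub>R f x = f x"
        by eventually_elim auto
      then show "(\<lambda>n. indicator {a n..b n} x *\<^sub>R f x) \<longlonglongrightarrow> f x" by (rule tendsto_eventually)
    qed
    show "integrable lborel (\<lambda>x. norm (f x))" using f by (rule integrable_norm)
    show "AE x in lborel. norm (indicator {a n..b n} x *\<^sub>R f x) \<le> norm (f x)" for n
      by (intro AE_I2) (auto simp: indicator_def)
    show "f \<in> borel_measurable lborel" using f by (rule borel_measurable_integrable)
    then show "(\<lambda>x. indicator {a n..b n} x *\<^sub>R f x) \<in> borel_measurable lborel" for n by measurable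
  qed
  moreover have "(LINT x|lborel. indicator {a n..b n} x *\<^sub>R f x) = integral {a n..b n} f" for n
  proof -
    have "set_integrable lborel {a n..b n} f"
      unfolding set_integrable_def by (intro integrable_mult_indicator f) auto
    from set_borel_integral_eq_integral(2)[OF this] show ?thesis by (simp add: set_lebesgue_integral_def)
  qed
  ultimately show ?thesis by simp
qed

context sector_decay
begin

lemma arc_integral_tendsto_0:
  fixes F :: "complex \<Rightarrow> complex" and R :: "nat \<Rightarrow> real"
  assumes R: "\<And>n. R n > 0" and B: "\<forall>\<^sub>F n in sequentially. \<forall>\<phi>. \<bar>\<phi>\<bar> \<le> pi / 4 \<longrightarrow> norm (F (Complex (ln (R n)) \<phi>)) \<le> b n"
    and b: "b \<longlonglongrightarrow> 0" and int: "\<And>n. F contour_integrable_on linepath (Complex (ln (R n)) (- pi / 4)) (Complex (ln (R n)) (pi / 4))"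
  shows "(\<lambda>n. contour_integral (linepath (Complex (ln (R n)) (- pi / 4)) (Complex (ln (R n)) (pi / 4))) F) \<longlonglongrightarrow> 0"
proof (rule Lim_null_comparison)
  show "\<forall>\<^sub>F n in sequentially. norm (contour_integral (linepath (Complex (ln (R n)) (- pi / 4)) (Complex (ln (R n)) (pi / 4))) F) \<le> b n * (pi / 2)"
    using B
  proof eventually_elim
    case (elim n)
    have "norm (F (Complex (ln (R n)) 0)) \<le> b n" using elim by simp
    then have b0: "b n \<ge> 0" using norm_ge_zero order_trans by blast
    have "norm (contour_integral (linepath (Complex (ln (R n)) (- pi / 4)) (Complex (ln (R n)) (pi / 4))) F)
        \<le> b n * norm (Complex (ln (R n)) (pi / 4) - Complex (ln (R n)) (- pi / 4))"
    proof (rule contour_integral_bound_linepath[OF int b0])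
      fix x assume "x \<in> closed_segment (Complex (ln (R n)) (- pi / 4)) (Complex (ln (R n)) (pi / 4))"
      then have "Re x = ln (R n)" "\<bar>Im x\<bar> \<le> pi / 4"
        by (auto simp: closed_segment_same_Re closed_segment_eq_real_ivl)
      then show "norm (F x) \<le> b n" using elim by (metis complex_surj)
    qed
    also have "norm (Complex (ln (R n)) (pi / 4) - Complex (ln (R n)) (- pi / 4)) = pi / 2"
      by (simp add: cmod_def)
    finally show ?case .
  qed
  show "(\<lambda>n. b n * (pi / 2)) \<longlonglongrightarrow> 0" using tendsto_mult_left_zero[OF b] by simp
qed

text \<open>In logarithmic coordinates \<open>s = exp w\<close> the truncated sector is a rectangle; its horizontal edges give the
  two ray integrals, the vertical ones are arcs that disappear in the limit.\<close>
theorem sector_summation: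
  assumes sym: "\<And>s. Re s > 0 \<Longrightarrow> h (cnj s) = cnj (h s)"
    and r: "0 < r" "r \<le> 1" and \<theta>: "0 \<le> \<theta>" "\<theta> \<le> 2 * pi"
  shows "(\<lambda>m. exp (\<i> * of_real \<theta> * of_nat m) * h (of_real (real m + r))) sums (upint \<theta> r h + cnj (upint (2 * pi - \<theta>) r h))"
proof -
  define f where "f = (\<lambda>w. exp (\<i> * of_real \<theta> * (exp w - of_real r)) * h (exp w) * exp w)"
  define g where "g = (\<lambda>w. exp (2 * pi * \<i> * (exp w - of_real r)) - 1)"
  define F where "F = (\<lambda>w. f w / g w)"
  define H where "H = {w. \<bar>Im w\<bar> < pi / 2}"
  have H_alt: "H = {w. Im w < pi / 2} \<inter> {w. Im w > - (pi / 2)}" unfolding H_def by (intro set_eqI) (simp add: abs_less_iff, linarith)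
  have expH: "Re (exp w) > 0" if "w \<in> H" for w
  proof -
    have "cos (Im w) > 0" using that by (intro cos_gt_zero_pi) (auto simp: H_def abs_less_iff)
    then show ?thesis by (simp add: Re_exp)
  qed
  have Hin: "w \<in> H" if "\<bar>Im w\<bar> \<le> pi / 4" for w
    unfolding H_def mem_Collect_eq using that pi_gt_zero by linarith
  have Hopen: "open H" unfolding H_alt by (intro open_Int open_halfspace_Im_lt open_halfspace_Im_gt)
  have Hconvex: "convex H" unfolding H_alt by (intro convex_Int convex_halfspace_Im_lt convex_halfspace_Im_gt)
  have fH: "f holomorphic_on H" unfolding f_def
    by (intro holomorphic_intros holomorphic_on_compose_gen[OF _ holo, unfolded o_def]) (use expH in auto)
  have gH: "g holomorphic_on H" unfolding g_def by (intro holomorphic_intros)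
  have zeros: "\<exists>m::nat. w = of_real (ln (real m + r))" if w: "w \<in> H" "g w = 0" for w
  proof -
    have "exp (2 * pi * \<i> * (exp w - complex_of_real r)) = 1" using w(2) by (simp add: g_def)
    then obtain n :: int where n: "Re (2 * pi * \<i> * (exp w - complex_of_real r)) = 0"
        "Im (2 * pi * \<i> * (exp w - complex_of_real r)) = of_int (2 * n) * pi"
      unfolding exp_eq_1 by blast
    have "Im (exp w) = 0" using n(1) by simp
    moreover have "pi * (Re (exp w) - r) = pi * of_int n" using n(2) by simp
    then have "Re (exp w) - r = of_int n" by (simp only: mult_cancel_left) simp
    ultimately have e: "exp w = of_real (of_int n + r)" by (simp add: complex_eq_iff)
    then have pos: "of_int n + r > 0" using expH[OF w(1)] by simp
    then have "n \<ge> 0" using r by linarith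
    then obtain m :: nat where m: "n = int m" by (rule nonneg_int_cases)
    have "exp (Re w) * sin (Im w) = 0" using arg_cong[OF e, of Im] by (simp add: Im_exp)
    then have "Im w = 0" using w(1) sin_zero_pi_iff[of "Im w"] by (auto simp: H_def)
    moreover have "exp (Re w) = real m + r" using arg_cong[OF e, of Re] \<open>Im w = 0\<close> m by (simp add: Re_exp)
    then have "Re w = ln (real m + r)" using ln_exp[of "Re w"] by simp
    ultimately have "w = of_real (ln (real m + r))" by (simp add: complex_eq_iff)
    then show ?thesis by blast
  qed
  have expln: "exp (complex_of_real (ln (real m + r))) = of_real (real m + r)" for m
    using r by (simp add: exp_of_real add_nonneg_pos)
  have gz: "g (of_real (ln (real m + r))) = 0" for m
    unfolding g_def expln using exp_2pi_1_int[of "int m"] by (simp add: mult_ac)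
  \<comment> \<open>At its zeros \<open>g\<close> has derivative 2 pi \<i> (m + r), and the factor
    exp w = m + r of \<open>f\<close> cancels it, so each residue is the summand divided by 2 pi
    \<i>.\<close>
  have g': "(g has_field_derivative 2 * pi * \<i> * of_real (real m + r)) (at (of_real (ln (real m + r))))" for m
  proof -
    have "(g has_field_derivative exp (2 * pi * \<i> * (exp w - of_real r)) * (2 * pi * \<i> * exp w)) (at w)" for w
      unfolding g_def by (auto intro!: derivative_eq_intros)
    from this[of "of_real (ln (real m + r))"] show ?thesis
      using gz[of m] unfolding g_def expln by (simp add: mult_ac)
  qed
  \<comment> \<open>The outer radius lies midway between consecutive poles, the inner one below the
    first pole r; so both arcs avoid every zero of \<open>g\<close>.\<close>
  define R \<delta> where "R = (\<lambda>n::nat. real n + r + 1/2)" and "\<delta> = (\<lambda>n::nat. r / (real n + 2))"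
  have Rpos: "R n > 0" "\<delta> n > 0" for n using r by (auto simp: R_def \<delta>_def)
  define L where "L = (\<lambda>n. contour_integral (linepath (Complex (ln (\<delta> n)) (- pi / 4)) (Complex (ln (\<delta> n)) (pi / 4))) F)"
  define Rt where "Rt = (\<lambda>n. contour_integral (linepath (Complex (ln (R n)) (- pi / 4)) (Complex (ln (R n)) (pi / 4))) F)"
  define lo where "lo = (\<lambda>x. F (Complex x (- pi / 4)))"
  define up where "up = (\<lambda>x. F (Complex x (pi / 4)))"
  have cont: "continuous_on X F" if "X \<subseteq> H" "\<And>w. w \<in> X \<Longrightarrow> g w \<noteq> 0" for X
    unfolding F_def using that
    by (intro continuous_intros holomorphic_on_imp_continuous_on holomorphic_on_subset[OF fH] holomorphic_on_subset[OF gH]) auto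
  have nzIm: "g w \<noteq> 0" if "w \<in> H" "Im w \<noteq> 0" for w using zeros[OF that(1)] that(2) by auto
  have dR: "ln (\<delta> n) < ln (real m + r)" for n m :: nat
  proof -
    have "r * 1 < r * (real n + 2)" using r by (intro mult_strict_left_mono) auto
    then have "\<delta> n < r" by (simp add: \<delta>_def divide_less_eq)
    then have "\<delta> n < real m + r" by linarith
    then show ?thesis using Rpos(2)[of n] by (intro ln_less_cancel_iff[THEN iffD2]) linarith+
  qed
  have Rinj: "ln (R n) \<noteq> ln (real m + r)" "ln (\<delta> n) \<noteq> ln (real m + r)" for n m :: nat
  proof
    assume "ln (R n) = ln (real m + r)"
    then have "exp (ln (R n)) = exp (ln (real m + r))" by simp
    then have "R n = real m + r" using Rpos(1)[of n] r by (simp add: add_nonneg_pos)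
    then have "real (2 * n + 1) = real (2 * m)" by (simp add: R_def)
    then have "2 * n + 1 = 2 * m" by (simp only: of_nat_eq_iff)
    then show False by presburger
  next
    show "ln (\<delta> n) \<noteq> ln (real m + r)" using dR[of n m] by simp
  qed
  have nzarc: "g w \<noteq> 0" if wH: "w \<in> H" "Re w = ln (R n) \<or> Re w = ln (\<delta> n)" for w n
  proof
    assume "g w = 0"
    then obtain m :: nat where "w = of_real (ln (real m + r))" using zeros[OF wH(1)] by blast
    then have "Re w = ln (real m + r)" by simp
    then show False using wH(2) Rinj[of n m] by auto
  qed
  have segH: "closed_segment z1 z2 \<subseteq> H" if "\<bar>Im z1\<bar> \<le> pi / 4" "\<bar>Im z2\<bar> \<le> pi / 4" for z1 z2
    by (rule closed_segment_subset[OF Hin Hin Hconvex]) (use that in auto)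
  have ci: "F contour_integrable_on linepath z1 z2"
    if "\<bar>Im z1\<bar> \<le> pi / 4" "\<bar>Im z2\<bar> \<le> pi / 4" and nzseg: "\<And>w. w \<in> closed_segment z1 z2 \<Longrightarrow> g w \<noteq> 0" for z1 z2
  proof (rule contour_integrable_continuous_linepath[OF cont])
    show "closed_segment z1 z2 \<subseteq> H" by (rule segH) fact+
    show "g w \<noteq> 0" if "w \<in> closed_segment z1 z2" for w by (rule nzseg[OF that])
  qed
  have civ: "F contour_integrable_on linepath (Complex x (- pi / 4)) (Complex x (pi / 4))"
    if "x = ln (R n) \<or> x = ln (\<delta> n)" for x n
  proof (rule ci)
    fix w assume w: "w \<in> closed_segment (Complex x (- pi / 4)) (Complex x (pi / 4))"
    then have "w \<in> H" using segH[of "Complex x (- pi / 4)" "Complex x (pi / 4)"] by auto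
    moreover have "Re w = x" using w by (auto simp: closed_segment_same_Re)
    ultimately show "g w \<noteq> 0" using nzarc that by blast
  qed auto
  have cih: "F contour_integrable_on linepath (Complex x y) (Complex x' y)" if y: "\<bar>y\<bar> = pi / 4" for x x' y
  proof -
    have yb: "\<bar>y\<bar> \<le> pi / 4" "y \<noteq> 0" using y by auto
    show ?thesis
    proof (rule ci)
      fix w assume w: "w \<in> closed_segment (Complex x y) (Complex x' y)"
      then have "w \<in> H" using segH[of "Complex x y" "Complex x' y"] yb by auto
      moreover obtain u where "w = (1 - u) *\<^sub>R Complex x y + u *\<^sub>R Complex x' y" using w by (auto simp: in_segment)
      then have "Im w = (1 - u) * y + u * y" by simp
      then have "Im w = y" by (simp add: algebra_simps)
      ultimately show "g w \<noteq> 0" using nzIm[of w] yb by simp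
    qed (use yb in auto)
  qed
  have main: "(\<Sum>m\<le>n. exp (\<i> * of_real \<theta> * of_nat m) * h (of_real (real m + r))) =
     integral {ln (\<delta> n)..ln (R n)} lo - integral {ln (\<delta> n)..ln (R n)} up + Rt n / 1 - L n" for n
  proof -
    \<comment> \<open>Cutting the strip before the next pole m = n + 1 leaves exactly the poles 0,
      ..., n in the domain of the residue theorem.\<close>
    define S where "S = H \<inter> {w. Re w < ln (real n + 1 + r)}"
    define pts where "pts = (\<lambda>m. complex_of_real (ln (real m + r))) ` {..n}"
    define a1 a3 where "a1 = Complex (ln (\<delta> n)) (- pi / 4)" and "a3 = Complex (ln (R n)) (pi / 4)"
    have S: "open S" "connected S" unfolding S_def
      by (auto intro!: open_Int Hopen open_halfspace_Re_lt convex_connected convex_Int Hconvex convex_halfspace_Re_lt)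
    have lnmono: "ln (real m + r) < ln (real m' + r) \<longleftrightarrow> m < m'" for m m' :: nat using r by (simp add: add_nonneg_pos)
    have Rn: "ln (real m + r) < ln (R n)" if "m \<le> n" for m using that r by (simp add: R_def add_nonneg_pos)
    have Rn1: "ln (R n) < ln (real n + 1 + r)" using r by (simp add: R_def add_nonneg_pos)
    have dlR: "ln (\<delta> n) < ln (R n)" using dR[of n 0] Rn[of 0] by simp
    have zS: "g w \<noteq> 0" if wS: "w \<in> S - pts" for w
    proof
      assume "g w = 0"
      then obtain m where m: "w = of_real (ln (real m + r))" using zeros[of w] wS by (auto simp: S_def)
      then have "m \<le> n" using wS lnmono[of m "Suc n"] by (auto simp: S_def add_ac)
      then show False using wS m by (auto simp: pts_def)
    qed
    have cb: "cbox a1 a3 \<subseteq> S"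
    proof
      fix w assume "w \<in> cbox a1 a3"
      then have w: "\<bar>Im w\<bar> \<le> pi / 4" "Re w \<le> ln (R n)" by (auto simp: in_cbox_complex_iff a1_def a3_def)
      then show "w \<in> S" using Hin[OF w(1)] Rn1 by (simp add: S_def)
    qed
    have ptsbox: "pts \<subseteq> box a1 a3"
      using dR Rn pi_gt_zero by (auto simp: in_box_complex_iff a1_def a3_def pts_def)
    have "contour_integral (rectpath a1 a3) F = 2 * pi * \<i> * (\<Sum>p\<in>pts. winding_number (rectpath a1 a3) p * residue F p)"
    proof (rule Residue_theorem[OF S])
      show "finite pts" by (simp add: pts_def)
      show "F holomorphic_on S - pts" unfolding F_def
        by (intro holomorphic_on_divide holomorphic_on_subset[OF fH] holomorphic_on_subset[OF gH])
           (use zS in \<open>auto simp: S_def\<close>)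
      show "path_image (rectpath a1 a3) \<subseteq> S - pts"
        using cb ptsbox dlR path_image_rectpath_cbox_minus_box[of a1 a3] pi_gt_zero
        by (auto simp: a1_def a3_def)
      show "\<forall>z. z \<notin> S \<longrightarrow> winding_number (rectpath a1 a3) z = 0"
        using cb dlR pi_gt_zero by (intro allI impI winding_number_rectpath_outside) (auto simp: a1_def a3_def)
    qed auto
    also have "(\<Sum>p\<in>pts. winding_number (rectpath a1 a3) p * residue F p) = (\<Sum>p\<in>pts. residue F p)"
      using ptsbox winding_number_rectpath by (intro sum.cong) auto
    also have "\<dots> = (\<Sum>m\<le>n. residue F (complex_of_real (ln (real m + r))))"
      unfolding pts_def
    proof (rule sum.reindex[unfolded o_def])
      show "inj_on (\<lambda>m. complex_of_real (ln (real m + r))) {..n}"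
        using r by (intro inj_onI) (auto simp: add_nonneg_pos)
    qed
    also have "\<dots> = (\<Sum>m\<le>n. exp (\<i> * of_real \<theta> * of_nat m) * h (of_real (real m + r)) / (2 * pi * \<i>))"
    proof (rule sum.cong[OF refl])
      fix m assume "m \<in> {..n}"
      define z where "z = complex_of_real (ln (real m + r))"
      define Sm where "Sm = S \<inter> (- (pts - {z}))"
      have zin: "z \<in> S" using ptsbox cb box_subset_cbox[of a1 a3] \<open>m \<in> {..n}\<close> by (force simp: z_def pts_def)
      have rp: "complex_of_real (real m + r) \<noteq> 0" using r by (simp only: of_real_eq_0_iff)
      have "residue F z = f z / (2 * pi * \<i> * of_real (real m + r))" unfolding F_def
      proof (rule residue_simple_zero_quotient)
        show "f holomorphic_on Sm" "g holomorphic_on Sm"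
          by (auto intro!: holomorphic_on_subset[OF fH] holomorphic_on_subset[OF gH] simp: Sm_def S_def)
        have "closed (pts - {z})" by (rule finite_imp_closed) (simp add: pts_def)
        then show "open Sm" unfolding Sm_def by (intro open_Int S(1) open_Compl)
        show "z \<in> Sm" using zin by (simp add: Sm_def)
        show "(g has_field_derivative 2 * pi * \<i> * of_real (real m + r)) (at z)" unfolding z_def by (rule g')
        show "g z = 0" unfolding z_def by (rule gz)
        show "2 * pi * \<i> * complex_of_real (real m + r) \<noteq> 0" using rp by simp
        show "g w \<noteq> 0" if "w \<in> Sm" "w \<noteq> z" for w using zS[of w] that by (auto simp: Sm_def)
      qed
      also have "f z = exp (\<i> * of_real \<theta> * of_nat m) * h (of_real (real m + r)) * of_real (real m + r)"
        unfolding f_def z_def expln by simp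
      finally show "residue F (complex_of_real (ln (real m + r))) = exp (\<i> * of_real \<theta> * of_nat m) * h (of_real (real m + r)) / (2 * pi * \<i>)"
        unfolding z_def[symmetric] using rp by simp
    qed
    also have "2 * pi * \<i> * \<dots> = (\<Sum>m\<le>n. exp (\<i> * of_real \<theta> * of_nat m) * h (of_real (real m + r)))"
      by (simp add: sum_divide_distrib[symmetric])
    finally have eq1: "contour_integral (rectpath a1 a3) F = (\<Sum>m\<le>n. exp (\<i> * of_real \<theta> * of_nat m) * h (of_real (real m + r)))" .
    define a2 a4 where "a2 = Complex (ln (R n)) (- pi / 4)" and "a4 = Complex (ln (\<delta> n)) (pi / 4)"
    have "contour_integral (rectpath a1 a3) F = contour_integral (linepath a1 a2) F + (contour_integral (linepath a2 a3) F
        + (contour_integral (linepath a3 a4) F + contour_integral (linepath a4 a1) F))"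
    proof -
      have c: "F contour_integrable_on linepath a1 a2" "F contour_integrable_on linepath a2 a3"
         "F contour_integrable_on linepath a4 a3" "F contour_integrable_on linepath a1 a4"
        unfolding a1_def a2_def a3_def a4_def by (rule cih civ[of _ n]; simp)+
      then have c': "F contour_integrable_on linepath a3 a4" "F contour_integrable_on linepath a4 a1"
        using contour_integrable_reversepath[of "linepath a4 a3" F] contour_integrable_reversepath[of "linepath a1 a4" F] by simp_all
      have "rectpath a1 a3 = linepath a1 a2 +++ linepath a2 a3 +++ linepath a3 a4 +++ linepath a4 a1"
        by (simp add: rectpath_def Let_def a1_def a2_def a3_def a4_def)
      then show ?thesis using c c' by (simp add: valid_path_join contour_integrable_joinI)
    qed
    moreover have rev: "contour_integral (linepath a3 a4) F = - contour_integral (linepath a4 a3) F"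
      "contour_integral (linepath a4 a1) F = - contour_integral (linepath a1 a4) F"
      using contour_integral_reversepath[of "linepath a4 a3" F] contour_integral_reversepath[of "linepath a1 a4" F] by simp_all
    moreover have hor: "contour_integral (linepath a1 a2) F = integral {ln (\<delta> n)..ln (R n)} lo"
      "contour_integral (linepath a4 a3) F = integral {ln (\<delta> n)..ln (R n)} up"
      unfolding a1_def a2_def a3_def a4_def lo_def up_def by (rule contour_integral_linepath_same_Im[OF dlR])+
    moreover have ver: "contour_integral (linepath a2 a3) F = Rt n" "contour_integral (linepath a1 a4) F = L n"
      unfolding Rt_def L_def a1_def a2_def a3_def a4_def by (rule refl)+
    ultimately show ?thesis unfolding eq1 rev hor ver by (simp only: div_by_1) (simp only: diff_conv_add_uminus add.assoc add.commute add.left_commute)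
  qed
  have up_eq: "up x = - upterm \<theta> r h x" for x
  proof -
    have "a / (E - 1) = - (a / (1 - E))" for a E :: complex by (metis minus_diff_eq minus_divide_right)
    then show ?thesis unfolding up_def F_def f_def g_def upterm_def ray_def .
  qed
  \<comment> \<open>On the lower ray the kernel is conjugate to 1 / (1 / E - 1) = E / (1 - E). The
    factor E = exp (2 pi \<i> (s - r)) gained in this way turns the frequency - \<theta> into 2 pi -
    \<theta>, so the lower integral is again of the form \<open>upint\<close>.\<close>
  have lo_eq: "lo x = cnj (upterm (2 * pi - \<theta>) r h x)" for x
  proof -
    define s where "s = ray x"
    have "Complex x (- pi / 4) = cnj (Complex x (pi / 4))" by (simp add: complex_eq_iff)
    then have e: "exp (Complex x (- pi / 4)) = cnj s" unfolding s_def ray_def by (simp only: exp_cnj)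
    have hs: "h (cnj s) = cnj (h s)" by (rule sym) (simp add: s_def)
    define E where "E = exp (2 * pi * \<i> * (s - of_real r))"
    have E0: "E \<noteq> 0" by (simp add: E_def)
    have c1: "cnj (exp (\<i> * of_real \<theta> * (cnj s - of_real r))) = exp (- (\<i> * of_real \<theta> * (s - of_real r)))"
      unfolding exp_cnj by (rule arg_cong[of _ _ exp]) (simp add: complex_eq_iff)
    have "cnj (exp (2 * pi * \<i> * (cnj s - of_real r))) = exp (- (2 * pi * \<i> * (s - of_real r)))"
      unfolding exp_cnj by (rule arg_cong[of _ _ exp]) (simp add: complex_eq_iff)
    then have c2: "cnj (exp (2 * pi * \<i> * (cnj s - of_real r))) = 1 / E"
      unfolding E_def by (simp only: exp_minus inverse_eq_divide)
    have "cnj (lo x) = exp (- (\<i> * of_real \<theta> * (s - of_real r))) * h s * s / (1 / E - 1)"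
      unfolding lo_def F_def f_def g_def e hs E_def[symmetric]
      by (simp only: complex_cnj_divide complex_cnj_mult complex_cnj_diff complex_cnj_one c1 c2 complex_cnj_cnj)
    also have "\<dots> = E * exp (- (\<i> * of_real \<theta> * (s - of_real r))) * h s * s / (1 - E)"
    proof (cases "E = 1")
      case False
      have "a / (1 / E - 1) = E * a / (1 - E)" for a using E0 False by (simp add: field_simps)
      then show ?thesis by (simp only: mult.assoc)
    qed simp
    also have "E * exp (- (\<i> * of_real \<theta> * (s - of_real r))) = exp (\<i> * of_real (2 * pi - \<theta>) * (s - of_real r))"
      unfolding E_def mult_exp_exp by (rule arg_cong[of _ _ exp]) (simp add: algebra_simps)
    finally have "cnj (lo x) = upterm (2 * pi - \<theta>) r h x" by (simp add: upterm_def s_def E_def)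
    then show ?thesis by (metis complex_cnj_cnj)
  qed
  have intup: "integrable lborel up" "(LINT x|lborel. up x) = - upint \<theta> r h"
    unfolding up_eq upint_def using upterm_integrable[OF \<theta>(1)] by simp_all
  have intlo: "integrable lborel lo" "(LINT x|lborel. lo x) = cnj (upint (2 * pi - \<theta>) r h)"
    unfolding lo_eq upint_def using upterm_integrable[of "2 * pi - \<theta>"] \<theta> by simp_all
  have lim1: "filterlim (\<lambda>n. ln (\<delta> n)) at_bot sequentially"
    unfolding \<delta>_def using r by real_asymp
  have lim2: "filterlim (\<lambda>n. ln (R n)) at_top sequentially"
    unfolding R_def by real_asymp
  have normf: "norm (f w) \<le> norm (exp (\<i> * of_real \<theta> * (exp w - of_real r))) * (C * \<rho> ^ 3 * exp (- c * \<rho>))"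
    if "\<bar>Im w\<bar> \<le> pi / 4" "\<rho> = exp (Re w)" for w \<rho>
  proof -
    have "norm (h (exp w)) \<le> C * \<rho> ^ 2 * exp (- c * \<rho>)" using decay[OF exp_in_sector[OF that(1)]] that by simp
    then have "norm (h (exp w)) * \<rho> \<le> C * \<rho> ^ 2 * exp (- c * \<rho>) * \<rho>" using that by (intro mult_right_mono) auto
    then have "norm (exp (\<i> * of_real \<theta> * (exp w - of_real r))) * (norm (h (exp w)) * \<rho>) \<le> norm (exp (\<i> * of_real \<theta> * (exp w - of_real r))) * (C * \<rho> ^ 2 * exp (- c * \<rho>) * \<rho>)"
      by (intro mult_left_mono) auto
    then show ?thesis using that by (simp add: f_def norm_mult power2_eq_square power3_eq_cube mult_ac)
  qed
  have Rt0: "Rt \<longlonglongrightarrow> 0" unfolding Rt_def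
  proof (rule arc_integral_tendsto_0)
    show "\<forall>\<^sub>F n in sequentially. \<forall>\<phi>. \<bar>\<phi>\<bar> \<le> pi / 4 \<longrightarrow> norm (F (Complex (ln (R n)) \<phi>)) \<le> 9 * (C * R n ^ 3 * exp (- c * R n))"
    proof (intro always_eventually allI impI)
      fix n \<phi> assume \<phi>: "\<bar>\<phi>\<bar> \<le> pi / 4"
      define w where "w = Complex (ln (R n)) \<phi>"
      have w: "\<bar>Im w\<bar> \<le> pi / 4" "R n = exp (Re w)" using \<phi> Rpos[of n] by (auto simp: w_def)
      have "norm (exp (\<i> * of_real \<theta> * (exp w - of_real r))) \<le> 9 * norm (g w)" unfolding g_def
        by (rule arc_kernel_bound[OF exp_in_sector[OF w(1)] _ _ \<theta>, where M = n]) (use w r in \<open>auto simp: R_def\<close>)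
      then have "norm (f w) \<le> 9 * norm (g w) * (C * R n ^ 3 * exp (- c * R n))"
        using normf[OF w] C_nonneg Rpos[of n] by (meson order_trans mult_right_mono mult_nonneg_nonneg exp_ge_zero zero_le_power less_imp_le)
      moreover have "g w \<noteq> 0" using nzarc[of w n] Hin[OF w(1)] by (simp add: w_def)
      ultimately show "norm (F w) \<le> 9 * (C * R n ^ 3 * exp (- c * R n))" by (simp add: F_def norm_divide field_simps)
    qed
    have "filterlim R at_top sequentially" unfolding R_def by real_asymp
    moreover have "((\<lambda>x. 9 * (C * x ^ 3 * exp (- c * x))) \<longlongrightarrow> 0) at_top" using c_pos by real_asymp
    ultimately show "(\<lambda>n. 9 * (C * R n ^ 3 * exp (- c * R n))) \<longlonglongrightarrow> 0" by (rule filterlim_compose[rotated])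
    show "F contour_integrable_on linepath (Complex (ln (R n)) (- pi / 4)) (Complex (ln (R n)) (pi / 4))" for n
      by (rule civ[of _ n]) simp
  qed (rule Rpos)
  obtain B \<epsilon> where B: "B > 0" "\<epsilon> > 0" "\<And>s. s \<noteq> 0 \<Longrightarrow> norm s < \<epsilon> \<Longrightarrow> norm s \<le> B * norm (exp (2 * pi * \<i> * (s - of_real r)) - 1)"
    using kernel_bound_near_0[OF r] by blast
  have d0: "\<delta> \<longlonglongrightarrow> 0" unfolding \<delta>_def by real_asymp
  have L0: "L \<longlonglongrightarrow> 0" unfolding L_def
  proof (rule arc_integral_tendsto_0)
    show "\<forall>\<^sub>F n in sequentially. \<forall>\<phi>. \<bar>\<phi>\<bar> \<le> pi / 4 \<longrightarrow> norm (F (Complex (ln (\<delta> n)) \<phi>)) \<le> exp (2 * pi) * B * C * \<delta> n ^ 2"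
      using order_tendstoD(2)[OF d0 B(2)] order_tendstoD(2)[OF d0 zero_less_one]
    proof eventually_elim
      case (elim n)
      show ?case
      proof (intro allI impI)
        fix \<phi> assume \<phi>: "\<bar>\<phi>\<bar> \<le> pi / 4"
        define w where "w = Complex (ln (\<delta> n)) \<phi>"
        have w: "\<bar>Im w\<bar> \<le> pi / 4" "\<delta> n = exp (Re w)" using \<phi> Rpos[of n] by (auto simp: w_def)
        have B': "\<delta> n \<le> B * norm (g w)" using B(3)[of "exp w"] w elim by (simp add: g_def)
        have "norm (exp (\<i> * of_real \<theta> * (exp w - of_real r))) \<le> exp (2 * pi)"
        proof -
          have "norm (exp w) = \<delta> n" using w by simp
          then have "\<bar>Im (exp w)\<bar> \<le> 1" using abs_Im_le_cmod[of "exp w"] elim by linarith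
          then have "\<theta> * (- Im (exp w)) \<le> 2 * pi * 1" using \<theta> by (intro order_trans[OF mult_left_mono mult_right_mono]) auto
          then show ?thesis by simp
        qed
        then have "norm (f w) \<le> exp (2 * pi) * (C * \<delta> n ^ 3 * exp (- c * \<delta> n))"
          using normf[OF w] C_nonneg Rpos(2)[of n] by (meson order_trans mult_right_mono mult_nonneg_nonneg exp_ge_zero zero_le_power less_imp_le)
        also have "\<dots> \<le> exp (2 * pi) * (C * \<delta> n ^ 3 * 1)"
          using C_nonneg Rpos(2)[of n] c_pos by (intro mult_left_mono) auto
        also have "\<dots> = (exp (2 * pi) * C * \<delta> n ^ 2) * \<delta> n" by (simp add: power2_eq_square power3_eq_cube)
        also have "\<dots> \<le> (exp (2 * pi) * C * \<delta> n ^ 2) * (B * norm (g w))"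
          using B' C_nonneg by (intro mult_left_mono) auto
        finally have "norm (f w) \<le> (exp (2 * pi) * B * C * \<delta> n ^ 2) * norm (g w)" by (simp add: mult_ac)
        moreover have "g w \<noteq> 0" using nzarc[of w n] Hin[OF w(1)] by (simp add: w_def)
        ultimately show "norm (F w) \<le> exp (2 * pi) * B * C * \<delta> n ^ 2" by (simp add: F_def norm_divide pos_divide_le_eq)
      qed
    qed
    show "(\<lambda>n. exp (2 * pi) * B * C * \<delta> n ^ 2) \<longlonglongrightarrow> 0" using tendsto_mult_right_zero[OF tendsto_null_power[OF d0, of 2]] by simp
    show "F contour_integrable_on linepath (Complex (ln (\<delta> n)) (- pi / 4)) (Complex (ln (\<delta> n)) (pi / 4))" for n
      by (rule civ[of _ n]) simp
  qed (rule Rpos)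
  have "(\<lambda>n. integral {ln (\<delta> n)..ln (R n)} lo - integral {ln (\<delta> n)..ln (R n)} up + Rt n / 1 - L n) \<longlonglongrightarrow>
     (LINT x|lborel. lo x) - (LINT x|lborel. up x) + 0 / 1 - 0"
    by (intro tendsto_intros set_integral_tendsto_whole intup intlo lim1 lim2 Rt0 L0) simp
  then have "(\<lambda>n. \<Sum>m\<le>n. exp (\<i> * of_real \<theta> * of_nat m) * h (of_real (real m + r))) \<longlonglongrightarrow> upint \<theta> r h + cnj (upint (2 * pi - \<theta>) r h)"
    unfolding main intup(2) intlo(2) by (simp add: add.commute)
  then show ?thesis unfolding sums_def_le .
qed

end

section \<open>Saddle point asymptotics\<close>

definition \<omega>45 :: complex where "\<omega>45 = cis (- pi / 4)"

lemma Re_\<omega>45: "Re \<omega>45 = sqrt 2 / 2" and Im_\<omega>45: "Im \<omega>45 = - (sqrt 2 / 2)"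
  by (simp_all add: \<omega>45_def cos_45 sin_45)

text \<open>On the ray of argument pi / 4 the two parts \<i> \<theta> s and - \<beta> / s of the
  exponent are positive multiples of the same number - \<open>\<omega>45\<close>, so one real
  function controls both modulus and phase.\<close>

lemma \<omega>45_ray: "\<i> * cis (pi / 4) = - \<omega>45" "1 / cis (pi / 4) = \<omega>45"
proof -
  show "\<i> * cis (pi / 4) = - \<omega>45" by (simp add: complex_eq_iff Re_\<omega>45 Im_\<omega>45 cos_45 sin_45)
  show "1 / cis (pi / 4) = \<omega>45" using cis_inverse[of "pi / 4"] by (simp add: \<omega>45_def inverse_eq_divide)
qed

text \<open>A complex Gaussian integral, of modulus sqrt pi and argument pi / 8. It is a common
  factor of numerator and denominator of \<open>J\<close> and shifts the phase of the oscillation at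
  z = -1; \<open>fresnel_nonzero\<close> is the essential fact about it.\<close>

definition fresnel :: complex where "fresnel = (LINT x|lborel. exp (- \<omega>45 * (of_real x)\<^sup>2))"

text \<open>Completing the square in |x|: the growth exp (B |x|) is absorbed and a factor exp (-
  |x|) is left over as majorant.\<close>

lemma gauss_tail_bound:
  assumes "(\<kappa>::real) > 0"
  shows "exp (B * \<bar>x\<bar>) * exp (- (\<kappa> * x\<^sup>2)) \<le> exp ((B + 1)\<^sup>2 / (4 * \<kappa>)) * exp (- \<bar>x\<bar>)"
proof -
  have "(B + 1) * \<bar>x\<bar> - \<kappa> * x\<^sup>2 = (B + 1)\<^sup>2 / (4 * \<kappa>) - \<kappa> * (\<bar>x\<bar> - (B + 1) / (2 * \<kappa>))\<^sup>2"
    using assms by (simp add: power2_eq_square field_simps)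
  also have "\<dots> \<le> (B + 1)\<^sup>2 / (4 * \<kappa>)" using assms by simp
  finally have "B * \<bar>x\<bar> + - (\<kappa> * x\<^sup>2) \<le> (B + 1)\<^sup>2 / (4 * \<kappa>) + - \<bar>x\<bar>" by (simp add: algebra_simps)
  then show ?thesis by (simp only: mult_exp_exp exp_le_cancel_iff)
qed

lemma norm_fresnel_integrand: "norm (exp (- \<omega>45 * (of_real x)\<^sup>2)) = exp (- (sqrt 2 / 2 * x\<^sup>2))"
  by (simp add: Re_\<omega>45 Im_\<omega>45 power2_eq_square)

lemma fresnel_integrable: "integrable lborel (\<lambda>x. exp (- \<omega>45 * (complex_of_real x)\<^sup>2))"
proof (rule Bochner_Integration.integrable_bound[OF integrable_mult_right[OF exp_abs_integrable]])
  show "(\<lambda>x. exp (- \<omega>45 * (complex_of_real x)\<^sup>2)) \<in> borel_measurable lborel"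
    by measurable
  show "AE x in lborel. norm (exp (- \<omega>45 * (complex_of_real x)\<^sup>2)) \<le> norm (exp (1 / (4 * (sqrt 2 / 2))) * exp (- \<bar>x\<bar>))"
    unfolding norm_fresnel_integrand using gauss_tail_bound[of "sqrt 2 / 2" 0] by (intro AE_I2) simp
qed

text \<open>With \<open>u = x\<^sup>2 / \<surd>2\<close> the real part of the integrand exceeds \<open>(1 - 2 u) exp (- u)\<close>, the derivative of \<open>x exp (- u)\<close>.\<close>
lemma fresnel_nonzero: "fresnel \<noteq> 0"
proof
  assume z: "fresnel = 0"
  define \<kappa> :: real where "\<kappa> = sqrt 2 / 2"
  have \<kappa>: "\<kappa> > 0" by (simp add: \<kappa>_def)
  define f where "f = (\<lambda>x. exp (- (\<kappa> * x\<^sup>2)) * cos (\<kappa> * x\<^sup>2))"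
  define g where "g = (\<lambda>x. (1 - 2 * (\<kappa> * x\<^sup>2)) * exp (- (\<kappa> * x\<^sup>2)))"
  have feq: "(\<lambda>x. Re (exp (- \<omega>45 * (complex_of_real x)\<^sup>2))) = f"
    by (rule ext) (simp add: f_def Re_exp Re_\<omega>45 Im_\<omega>45 \<kappa>_def power2_eq_square)
  have intf: "integrable lborel f" unfolding feq[symmetric] by (rule integrable_Re[OF fresnel_integrable])
  have If: "(LINT x|lborel. f x) = 0"
    using integral_Re[OF fresnel_integrable] z unfolding feq fresnel_def[symmetric] by simp
  have intg: "integrable lborel g"
  proof (rule Bochner_Integration.integrable_bound[OF integrable_mult_right[OF exp_abs_integrable]])
    show "g \<in> borel_measurable lborel" unfolding g_def by measurable
    have "norm (g x) \<le> norm (exp ((2 + 1)\<^sup>2 / (4 * (\<kappa> / 2))) * 8 * exp (- \<bar>x\<bar>))" for x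
    proof -
      have "\<bar>1 - 2 * (\<kappa> * x\<^sup>2)\<bar> \<le> 8 * exp (\<kappa> / 2 * x\<^sup>2)"
      proof -
        define u where "u = \<kappa> * x\<^sup>2"
        have "1 + u / 2 \<le> exp (u / 2)" by (rule exp_ge_add_one_self)
        moreover have "0 \<le> u" using \<kappa> by (simp add: u_def)
        ultimately have "\<bar>1 - 2 * u\<bar> \<le> 8 * exp (u / 2)" unfolding abs_le_iff by linarith
        then show ?thesis by (simp add: u_def)
      qed
      then have "norm (g x) \<le> 8 * exp (\<kappa> / 2 * x\<^sup>2) * exp (- (\<kappa> * x\<^sup>2))"
        unfolding g_def real_norm_def abs_mult abs_exp_cancel by (rule mult_right_mono) simp
      also have "\<dots> = 8 * exp (- (\<kappa> / 2 * x\<^sup>2))" by (simp add: mult_exp_exp)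
      also have "exp (- (\<kappa> / 2 * x\<^sup>2)) \<le> exp (2 * \<bar>x\<bar>) * exp (- (\<kappa> / 2 * x\<^sup>2))"
        by (simp add: mult_exp_exp)
      also have "\<dots> \<le> exp ((2 + 1)\<^sup>2 / (4 * (\<kappa> / 2))) * exp (- \<bar>x\<bar>)"
        by (rule gauss_tail_bound) (use \<kappa> in simp)
      finally show ?thesis by simp
    qed
    then show "AE x in lborel. norm (g x) \<le> norm (exp ((2 + 1)\<^sup>2 / (4 * (\<kappa> / 2))) * 8 * exp (- \<bar>x\<bar>))" by simp
  qed
  have Ig: "(LINT x|lborel. g x) = 0"
  proof -
    define G where "G = (\<lambda>x. x * exp (- (\<kappa> * x\<^sup>2)))"
    have ft: "(g has_integral (G (real n) - G (- real n))) {- real n..real n}" for n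
    proof (rule fundamental_theorem_of_calculus)
      show "(G has_vector_derivative g x) (at x within {- real n..real n})" for x
        unfolding G_def g_def has_real_derivative_iff_has_vector_derivative[symmetric]
        by (auto intro!: derivative_eq_intros simp: algebra_simps power2_eq_square)
    qed simp
    have "(\<lambda>n. integral {- real n..real n} (\<lambda>x. complex_of_real (g x))) \<longlonglongrightarrow> (LINT x|lborel. complex_of_real (g x))"
      by (rule set_integral_tendsto_whole) (use intg in \<open>auto intro!: integrable_of_real filterlim_real_sequentially simp: filterlim_uminus_at_bot\<close>)
    moreover have "integral {- real n..real n} (\<lambda>x. complex_of_real (g x)) = of_real (G (real n) - G (- real n))" for n
      using has_integral_of_real[OF ft[of n], where 'b = complex] by (rule integral_unique)
    moreover have "(\<lambda>n. complex_of_real (G (real n) - G (- real n))) \<longlonglongrightarrow> of_real 0"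
    proof (rule tendsto_of_real)
      show "(\<lambda>n. G (real n) - G (- real n)) \<longlonglongrightarrow> 0" unfolding G_def using \<kappa> by real_asymp
    qed
    ultimately have "(LINT x|lborel. complex_of_real (g x)) = 0" using LIMSEQ_unique by fastforce
    then show ?thesis by simp
  qed
  have pos: "f x - g x > 0" if "x \<noteq> 0" for x
  proof -
    define u where "u = \<kappa> * x\<^sup>2"
    have u: "u > 0" using \<kappa> that by (simp add: u_def)
    \<comment> \<open>For u < 4 this follows from 1 - u^2 / 2 \<le> cos u; beyond that 1 - 2 u is
      below -1.\<close>
    have "cos u > 1 - 2 * u"
    proof (cases "u < 4")
      case True
      have "1 - u\<^sup>2 / 2 \<le> cos u"
      proof -
        have "\<bar>sin (u / 2)\<bar> \<le> \<bar>u / 2\<bar>" by (rule abs_sin_x_le_abs_x)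
        then have "(sin (u / 2))\<^sup>2 \<le> (u / 2)\<^sup>2" by (simp only: abs_le_square_iff)
        moreover have "cos u = 1 - 2 * (sin (u / 2))\<^sup>2" using cos_double_sin[of "u / 2"] by simp
        ultimately show ?thesis by (simp add: power_divide)
      qed
      moreover have "u * u < 4 * u" using True u by simp
      then have "u\<^sup>2 / 2 < 2 * u" by (simp add: power2_eq_square)
      ultimately show ?thesis by linarith
    next
      case False
      then show ?thesis using cos_ge_minus_one[of u] by linarith
    qed
    then have "exp (- u) * (cos u - (1 - 2 * u)) > 0" by simp
    then show ?thesis by (simp add: f_def g_def u_def algebra_simps)
  qed
  have nn: "AE x in lborel. 0 \<le> f x - g x"
    using AE_lborel_singleton[of 0] by eventually_elim (use pos in force)
  have "(LINT x|lborel. f x - g x) = 0" using If Ig intf intg by simp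
  then have "AE x in lborel. f x - g x = 0"
    using integral_nonneg_eq_0_iff_AE[OF Bochner_Integration.integrable_diff[OF intf intg] nn] by simp
  then have "AE x in (lborel :: real measure). False" using AE_lborel_singleton[of 0]
    by eventually_elim (use pos in force)
  then show False by (simp add: AE_iff_measurable[OF _ refl])
qed

lemma norm_exp_\<omega>45: "norm (exp (- \<omega>45 * of_real y)) = exp (- (sqrt 2 / 2 * y))"
  by (simp add: Re_\<omega>45)

text \<open>It makes exp (- \<beta> / s) flat at 0 throughout the closed sector, including the two
  boundary rays.\<close>

lemma sector_Re_inverse: assumes "s \<in> sector" shows "Re (1 / s) \<ge> 1 / (2 * norm s)"
proof -
  have s: "Re s > 0" "\<bar>Im s\<bar> \<le> Re s" using assms by (auto simp: sector_def)
  have n: "norm s > 0" using s by auto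
  have "(norm s)\<^sup>2 \<le> (2 * Re s)\<^sup>2"
  proof -
    have "(Im s)\<^sup>2 \<le> (Re s)\<^sup>2" using s by (intro abs_le_square_iff[THEN iffD1]) auto
    moreover have "(2 * Re s)\<^sup>2 = 4 * (Re s)\<^sup>2" by (simp add: power_mult_distrib)
    ultimately show ?thesis unfolding cmod_power2 using zero_le_power2[of "Re s"] by linarith
  qed
  then have le: "norm s \<le> 2 * Re s" by (rule power2_le_imp_le) (use s in simp)
  have "Re (1 / s) = Re s / (norm s)\<^sup>2" by (simp add: Re_divide cmod_power2)
  also have "\<dots> \<ge> (norm s / 2) / (norm s)\<^sup>2" using le by (intro divide_right_mono) auto
  also have "(norm s / 2) / (norm s)\<^sup>2 = 1 / (2 * norm s)" using n by (simp add: power2_eq_square)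
  finally show ?thesis .
qed

text \<open>\<open>H_lim\<close> says that \<open>H s\<close> behaves like \<open>s\<^bsup>-\<mu>\<^esup> exp (- \<beta> / s)\<close> near \<open>0\<close>: the power \<open>s\<^bsup>\<mu>\<^esup>\<close> on the ray is \<open>exp (\<mu> (\<sigma> + i \<pi> / 4))\<close>.\<close>
locale sector_flat =
  fixes H :: "complex \<Rightarrow> complex" and \<mu> \<beta> K c :: real
  assumes H_holo: "H holomorphic_on {s. Re s > 0}"
    and H_cnj: "\<And>s. Re s > 0 \<Longrightarrow> H (cnj s) = cnj (H s)"
    and pos: "\<mu> \<ge> 0" "\<beta> > 0" "c > 0" "K > 0"
    and H_bound: "\<And>s. s \<in> sector \<Longrightarrow> norm (H s) \<le> K * norm s powr (- \<mu>) * exp (- \<beta> * Re (1 / s)) * exp (- c * norm s)"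
    and H_lim: "((\<lambda>\<sigma>. H (ray \<sigma>) * exp (of_real \<mu> * Complex \<sigma> (pi / 4)) * exp (of_real \<beta> / ray \<sigma>)) \<longlongrightarrow> 1) at_bot"
begin

text \<open>The flat factor exp (- \<beta> / (2 |s|)) beats |s|^(- \<mu> - 2) for every \<mu>; the
  integer N \<ge> \<mu> + 2 reduces the comparison to an ordinary power.\<close>

lemma sector_decay_H: "\<exists>C. sector_decay H C c"
proof -
  define N where "N = nat \<lceil>\<mu>\<rceil> + 2"
  have N: "real N \<ge> \<mu> + 2" "N > 0" using real_nat_ceiling_ge[of \<mu>] by (auto simp: N_def)
  define b where "b = \<beta> / 2"
  have b: "b > 0" using pos by (simp add: b_def)
  have bd: "x powr (- \<mu> - 2) * exp (- \<beta> / (2 * x)) \<le> 1 + (real N / b) ^ N" if x: "x > 0" for x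
  proof -
    define y where "y = 1 / x"
    have y: "y > 0" using x by (simp add: y_def)
    have e: "x powr (- \<mu> - 2) = y powr (\<mu> + 2)"
    proof -
      have "x powr (- (\<mu> + 2)) = 1 / x powr (\<mu> + 2)" by (rule powr_minus_divide)
      also have "\<dots> = y powr (\<mu> + 2)" using x by (simp add: y_def powr_divide)
      finally show ?thesis by (simp add: algebra_simps)
    qed
    have "y powr (\<mu> + 2) \<le> 1 + y ^ N"
    proof (cases "y \<le> 1")
      case True
      have "y powr (\<mu> + 2) \<le> 1 powr (\<mu> + 2)" using True y pos by (intro powr_mono2) auto
      then show ?thesis using y by (simp add: add_increasing2)
    next
      case False
      have "y powr (\<mu> + 2) \<le> y powr real N" using False N by (intro powr_mono) auto
      then show ?thesis using y by (simp add: powr_realpow)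
    qed
    then have "y powr (\<mu> + 2) * exp (- (b * y)) \<le> (1 + y ^ N) * exp (- (b * y))" by (intro mult_right_mono) auto
    also have "\<dots> = exp (- (b * y)) + y ^ N * exp (- (b * y))" by (simp add: algebra_simps)
    also have "y ^ N * exp (- (b * y)) \<le> (real N / b) ^ N"
    proof -
      have "b * y / real N \<le> exp (b * y / real N)" using exp_ge_add_one_self[of "b * y / real N"] by linarith
      then have "(b * y / real N) ^ N \<le> exp (b * y / real N) ^ N" using b y by (intro power_mono) auto
      also have "\<dots> = exp (b * y)" using N by (simp flip: exp_of_nat_mult)
      finally have "y ^ N \<le> exp (b * y) * (real N / b) ^ N" using b N by (simp add: power_mult_distrib power_divide field_simps)
      then show ?thesis by (simp add: exp_minus field_simps)
    qed
    also have "exp (- (b * y)) \<le> 1" using b y by simp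
    finally show ?thesis unfolding e by (simp add: b_def y_def)
  qed
  have "sector_decay H (K * (1 + (real N / b) ^ N)) c"
  proof
    show "H holomorphic_on {s. Re s > 0}" "c > 0" by (fact H_holo, fact pos)
    fix s assume s: "s \<in> sector"
    have n: "norm s > 0" using s by (auto simp: sector_def)
    have "norm (H s) \<le> K * norm s powr (- \<mu>) * exp (- \<beta> * Re (1 / s)) * exp (- c * norm s)" by (rule H_bound[OF s])
    also have "\<dots> \<le> K * norm s powr (- \<mu>) * exp (- \<beta> / (2 * norm s)) * exp (- c * norm s)"
    proof -
      have "\<beta> * (1 / (2 * norm s)) \<le> \<beta> * Re (1 / s)" using sector_Re_inverse[OF s] pos by (intro mult_left_mono) auto
      then show ?thesis using pos by (intro mult_right_mono mult_left_mono) auto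
    qed
    also have "norm s powr (- \<mu>) = norm s powr (- \<mu> - 2) * norm s ^ 2"
      using n by (simp add: powr_diff)
    also have "K * (norm s powr (- \<mu> - 2) * norm s ^ 2) * exp (- \<beta> / (2 * norm s)) * exp (- c * norm s)
      = K * (norm s powr (- \<mu> - 2) * exp (- \<beta> / (2 * norm s))) * norm s ^ 2 * exp (- c * norm s)" by (simp add: mult_ac)
    also have "\<dots> \<le> K * (1 + (real N / b) ^ N) * norm s ^ 2 * exp (- c * norm s)"
      using bd[OF n] pos by (intro mult_right_mono mult_left_mono) auto
    finally show "norm (H s) \<le> K * (1 + (real N / b) ^ N) * norm s ^ 2 * exp (- c * norm s)" .
  qed
  then show ?thesis by blast
qed

lemma sector_decay_scaled:
  assumes P: "P > 0" shows "\<exists>C c'. sector_decay (\<lambda>s. H (of_real P * s)) C c'"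
proof -
  obtain C where "sector_decay H C c" using sector_decay_H by blast
  then interpret sector_decay H C c .
  have "sector_decay (\<lambda>s. H (of_real P * s)) (C * P\<^sup>2) (c * P)"
  proof
    show "(\<lambda>s. H (of_real P * s)) holomorphic_on {s. Re s > 0}"
      by (intro holomorphic_on_compose_gen[OF _ H_holo, unfolded o_def] holomorphic_intros) (use P in auto)
    show "c * P > 0" using P pos by simp
    fix s assume s: "s \<in> sector"
    have "of_real P * s \<in> sector" using s P by (auto simp: sector_def abs_mult)
    from decay[OF this] show "norm (H (of_real P * s)) \<le> C * P\<^sup>2 * norm s ^ 2 * exp (- (c * P) * norm s)"
      using P by (simp add: norm_mult power_mult_distrib mult_ac)
  qed
  then show ?thesis by blast
qed

definition A :: "real \<Rightarrow> real \<Rightarrow> real \<Rightarrow> complex" where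
  "A \<theta> r P = upint \<theta> r (\<lambda>s. H (of_real P * s))"

lemma H_sums:
  assumes P: "P > 0" and r: "0 < r" "r \<le> 1" and \<theta>: "0 \<le> \<theta>" "\<theta> \<le> 2 * pi"
  shows "(\<lambda>m. exp (\<i> * of_real \<theta> * of_nat m) * H (of_real (P * (real m + r)))) sums (A \<theta> r P + cnj (A (2 * pi - \<theta>) r P))"
proof -
  obtain C c' where "sector_decay (\<lambda>s. H (of_real P * s)) C c'" using sector_decay_scaled[OF P] by blast
  then interpret D: sector_decay "\<lambda>s. H (of_real P * s)" C c' .
  have "H (of_real P * cnj s) = cnj (H (of_real P * s))" if "Re s > 0" for s
    using H_cnj[of "of_real P * s"] that P by simp
  from D.sector_summation[OF this r \<theta>] show ?thesis by (simp add: A_def)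
qed

text \<open>The size of the integrand at the saddle for P = \<beta> \<theta> / \<Lambda>^2. The
  saddle is s = (\<Lambda> / \<theta>) exp (\<i> pi / 4), where P s = (\<beta> / \<Lambda>) exp
  (\<i> pi / 4). The factors are the power (P s)^-\<mu>, the Jacobian s, the exponential at the
  saddle, and the Gaussian width 1 / sqrt \<Lambda> in \<sigma>.\<close>

definition Nrm :: "real \<Rightarrow> real \<Rightarrow> complex" where
  "Nrm \<theta> \<Lambda> = exp (- of_real \<mu> * Complex (ln (\<beta> / \<Lambda>)) (pi / 4)) * ray (ln (\<Lambda> / \<theta>)) * exp (- \<omega>45 * of_real (2 * \<Lambda>)) / of_real (sqrt \<Lambda>)"

text \<open>The quotient of \<open>H\<close> by its model on the ray, which tends to 1 by
  \<open>H_lim\<close>; keeping it as a factor makes the following identities exact.\<close>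

definition E :: "real \<Rightarrow> complex" where
  "E \<sigma> = H (ray \<sigma>) * exp (of_real \<mu> * Complex \<sigma> (pi / 4)) * exp (of_real \<beta> / ray \<sigma>)"

lemma norm_E_le: "norm (E \<sigma>) \<le> K"
proof -
  have "norm (E \<sigma>) = norm (H (ray \<sigma>)) * exp (\<mu> * \<sigma>) * exp (\<beta> * Re (1 / ray \<sigma>))"
    by (simp add: E_def norm_mult Re_divide)
  also have "\<dots> \<le> (K * exp \<sigma> powr (- \<mu>) * exp (- \<beta> * Re (1 / ray \<sigma>)) * exp (- c * exp \<sigma>)) * exp (\<mu> * \<sigma>) * exp (\<beta> * Re (1 / ray \<sigma>))"
    using H_bound[of "ray \<sigma>"] by (intro mult_right_mono) auto
  also have "exp \<sigma> powr (- \<mu>) = exp (- (\<mu> * \<sigma>))" by (simp add: powr_def)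
  also have "(K * exp (- (\<mu> * \<sigma>)) * exp (- \<beta> * Re (1 / ray \<sigma>)) * exp (- c * exp \<sigma>)) * exp (\<mu> * \<sigma>) * exp (\<beta> * Re (1 / ray \<sigma>))
     = K * exp (- c * exp \<sigma>) * (exp (- (\<mu> * \<sigma>)) * exp (\<mu> * \<sigma>)) * (exp (- (\<beta> * Re (1 / ray \<sigma>))) * exp (\<beta> * Re (1 / ray \<sigma>)))"
    by (simp add: mult_ac)
  also have "\<dots> = K * exp (- c * exp \<sigma>)" by (simp add: mult_exp_exp)
  also have "\<dots> \<le> K * 1" using pos by (intro mult_left_mono) auto
  finally show ?thesis by simp
qed

definition kern :: "real \<Rightarrow> real \<Rightarrow> complex" where
  "kern r \<sigma> = 1 / (1 - exp (2 * pi * \<i> * (ray \<sigma> - of_real r)))"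

text \<open>What remains of the integrand after division by its size at the saddle and the
  substitution \<sigma> = ln (\<Lambda> / \<theta>) + x / sqrt \<Lambda>. In 1 - \<mu> the 1 stems
  from the Jacobian and the - \<mu> from the power of s.\<close>

definition lapl :: "real \<Rightarrow> real \<Rightarrow> real \<Rightarrow> real \<Rightarrow> complex" where
  "lapl \<theta> r \<Lambda> x = E (ln (\<beta> / \<Lambda>) + x / sqrt \<Lambda>) * exp (of_real ((1 - \<mu>) * (x / sqrt \<Lambda>)))
      * exp (- \<omega>45 * of_real (\<Lambda> * (2 * cosh (x / sqrt \<Lambda>) - 2))) * kern r (ln (\<Lambda> / \<theta>) + x / sqrt \<Lambda>)"

lemma ray_add: "ray (a + b) = ray a * of_real (exp b)"
  by (simp add: ray_altdef exp_add mult_ac)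

text \<open>With y measured from the saddle the two parts of the exponent are -
  \<open>\<omega>45\<close> \<Lambda> exp y and - \<open>\<omega>45\<close> \<Lambda> exp (- y), so
  they add up to - \<open>\<omega>45\<close> times 2 \<Lambda> cosh y.\<close>

lemma upterm_lapl:
  assumes \<theta>: "\<theta> > 0" and \<Lambda>: "\<Lambda> > 0"
  shows "upterm \<theta> r (\<lambda>s. H (of_real (\<beta> * \<theta> / \<Lambda>\<^sup>2) * s)) (ln (\<Lambda> / \<theta>) + x / sqrt \<Lambda>)
      = of_real (sqrt \<Lambda>) * Nrm \<theta> \<Lambda> * exp (- (\<i> * of_real (\<theta> * r))) * lapl \<theta> r \<Lambda> x"
proof -
  define y where "y = x / sqrt \<Lambda>"
  define \<sigma> where "\<sigma> = ln (\<Lambda> / \<theta>) + y"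
  define \<sigma>' where "\<sigma>' = ln (\<beta> / \<Lambda>) + y"
  have r1: "ray \<sigma> = of_real (\<Lambda> / \<theta> * exp y) * cis (pi / 4)"
    using \<theta> \<Lambda> by (simp add: ray_altdef \<sigma>_def exp_add)
  have r2: "ray \<sigma>' = of_real (\<beta> / \<Lambda> * exp y) * cis (pi / 4)"
    using pos \<Lambda> by (simp add: ray_altdef \<sigma>'_def exp_add)
  have arg: "of_real (\<beta> * \<theta> / \<Lambda>\<^sup>2) * ray \<sigma> = ray \<sigma>'"
    unfolding r1 r2 using \<theta> \<Lambda> by (simp add: power2_eq_square)
  have X1: "\<i> * of_real \<theta> * ray \<sigma> = - \<omega>45 * of_real (\<Lambda> * exp y)"
  proof -
    have "\<i> * of_real \<theta> * ray \<sigma> = (\<i> * cis (pi / 4)) * of_real (\<theta> * (\<Lambda> / \<theta> * exp y))" unfolding r1 by simp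
    also have "\<theta> * (\<Lambda> / \<theta> * exp y) = \<Lambda> * exp y" using \<theta> by simp
    finally show ?thesis by (simp add: \<omega>45_ray)
  qed
  have X2: "of_real \<beta> / ray \<sigma>' = \<omega>45 * of_real (\<Lambda> * exp (- y))"
  proof -
    have "of_real \<beta> / ray \<sigma>' = (1 / cis (pi / 4)) * of_real (\<beta> / (\<beta> / \<Lambda> * exp y))" unfolding r2 by simp
    also have "\<beta> / (\<beta> / \<Lambda> * exp y) = \<Lambda> * exp (- y)" using pos \<Lambda> by (simp add: exp_minus field_simps)
    finally show ?thesis by (simp add: \<omega>45_ray)
  qed
  have H: "H (ray \<sigma>') = E \<sigma>' * exp (- (of_real \<mu> * Complex \<sigma>' (pi / 4))) * exp (- (of_real \<beta> / ray \<sigma>'))"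
    by (simp add: E_def exp_minus field_simps)
  have C: "Complex \<sigma>' (pi / 4) = Complex (ln (\<beta> / \<Lambda>)) (pi / 4) + of_real y" by (simp add: \<sigma>'_def complex_eq_iff)
  have rs: "ray \<sigma> = ray (ln (\<Lambda> / \<theta>)) * exp (of_real y)" by (simp add: \<sigma>_def ray_add exp_of_real)
  have "upterm \<theta> r (\<lambda>s. H (of_real (\<beta> * \<theta> / \<Lambda>\<^sup>2) * s)) \<sigma>
    = exp (\<i> * of_real \<theta> * ray \<sigma> + - (\<i> * of_real (\<theta> * r))) * H (ray \<sigma>') * ray \<sigma> * kern r \<sigma>"
    unfolding upterm_def arg kern_def by (simp add: algebra_simps)
  also have "\<dots> = exp (- (\<i> * of_real (\<theta> * r))) * E \<sigma>' * ray (ln (\<Lambda> / \<theta>)) * kern r \<sigma> *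
      (exp (- \<omega>45 * of_real (\<Lambda> * exp y)) * exp (- (of_real \<mu> * (Complex (ln (\<beta> / \<Lambda>)) (pi / 4) + of_real y))) * exp (- (\<omega>45 * of_real (\<Lambda> * exp (- y)))) * exp (of_real y))"
    unfolding X1 unfolding exp_add unfolding H X2 C unfolding rs by (simp only: mult_ac)
  also have "exp (- \<omega>45 * of_real (\<Lambda> * exp y)) * exp (- (of_real \<mu> * (Complex (ln (\<beta> / \<Lambda>)) (pi / 4) + of_real y))) * exp (- (\<omega>45 * of_real (\<Lambda> * exp (- y)))) * exp (of_real y)
     = exp (- of_real \<mu> * Complex (ln (\<beta> / \<Lambda>)) (pi / 4)) * exp (- \<omega>45 * of_real (2 * \<Lambda>)) * (exp (of_real ((1 - \<mu>) * y)) * exp (- \<omega>45 * of_real (\<Lambda> * (2 * cosh y - 2))))"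
  proof -
    have "\<Lambda> * (2 * cosh y - 2) = \<Lambda> * exp y + \<Lambda> * exp (- y) - 2 * \<Lambda>" by (simp add: cosh_field_def algebra_simps)
    then show ?thesis unfolding mult_exp_exp by (intro arg_cong[of _ _ exp]) (simp add: algebra_simps)
  qed
  finally show ?thesis using \<Lambda> unfolding \<sigma>_def[symmetric] y_def[symmetric]
    by (simp add: lapl_def Nrm_def y_def[symmetric] \<sigma>_def[symmetric] \<sigma>'_def[symmetric] mult_ac)
qed

lemma A_lapl:
  assumes \<theta>: "\<theta> > 0" and \<Lambda>: "\<Lambda> > 0"
  shows "A \<theta> r (\<beta> * \<theta> / \<Lambda>\<^sup>2) / Nrm \<theta> \<Lambda> = exp (- (\<i> * of_real (\<theta> * r))) * (LINT x|lborel. lapl \<theta> r \<Lambda> x)"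
proof -
  have nz: "Nrm \<theta> \<Lambda> \<noteq> 0" using \<Lambda> by (simp add: Nrm_def)
  have "A \<theta> r (\<beta> * \<theta> / \<Lambda>\<^sup>2) = \<bar>1 / sqrt \<Lambda>\<bar> *\<^sub>R (LINT x|lborel. upterm \<theta> r (\<lambda>s. H (of_real (\<beta> * \<theta> / \<Lambda>\<^sup>2) * s)) (ln (\<Lambda> / \<theta>) + (1 / sqrt \<Lambda>) * x))"
    unfolding A_def upint_def by (rule lborel_integral_real_affine) (use \<Lambda> in simp)
  also have "(\<lambda>x. upterm \<theta> r (\<lambda>s. H (of_real (\<beta> * \<theta> / \<Lambda>\<^sup>2) * s)) (ln (\<Lambda> / \<theta>) + (1 / sqrt \<Lambda>) * x))
     = (\<lambda>x. (of_real (sqrt \<Lambda>) * Nrm \<theta> \<Lambda> * exp (- (\<i> * of_real (\<theta> * r)))) * lapl \<theta> r \<Lambda> x)"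
    using upterm_lapl[OF \<theta> \<Lambda>, of r] by (intro ext) simp
  also have "(LINT x|lborel. (of_real (sqrt \<Lambda>) * Nrm \<theta> \<Lambda> * exp (- (\<i> * of_real (\<theta> * r)))) * lapl \<theta> r \<Lambda> x)
     = (of_real (sqrt \<Lambda>) * Nrm \<theta> \<Lambda> * exp (- (\<i> * of_real (\<theta> * r)))) * (LINT x|lborel. lapl \<theta> r \<Lambda> x)"
    by (rule integral_mult_right_zero)
  finally show ?thesis using nz \<Lambda> by (simp add: scaleR_conv_of_real)
qed

lemma H_ray_measurable [measurable]: "(\<lambda>\<sigma>. H (ray \<sigma>)) \<in> borel_measurable borel"
proof -
  obtain C where "sector_decay H C c" using sector_decay_H by blast
  then interpret sector_decay H C c .
  show ?thesis by (rule h_ray_measurable)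
qed

lemma lapl_measurable: "lapl \<theta> r \<Lambda> \<in> borel_measurable borel"
proof -
  have c: "(\<lambda>\<sigma>. Complex \<sigma> (pi / 4)) \<in> borel_measurable borel"
    by (intro borel_measurable_continuous_onI continuous_intros)
  have [measurable]: "E \<in> borel_measurable borel" unfolding E_def[abs_def]
    using c by measurable
  have [measurable]: "kern r \<in> borel_measurable borel" unfolding kern_def[abs_def] by measurable
  have [measurable]: "(\<lambda>x. cosh (x / sqrt \<Lambda>)) \<in> borel_measurable borel"
    by (cases "sqrt \<Lambda> = 0") (auto intro!: borel_measurable_continuous_onI continuous_intros)
  show ?thesis unfolding lapl_def[abs_def] by measurable
qed

text \<open>The quadratic approximation of the exponent at the saddle is also a global lower bound,
  so the rescaled integrand has a Gaussian majorant on the whole line and the tails are covered as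
  well.\<close>

lemma cosh_quadratic_ge: "2 * cosh y - 2 \<ge> (y::real)\<^sup>2"
proof -
  have "cosh y = 1 + 2 * (sinh (y / 2))\<^sup>2"
    using cosh_double[of "y / 2"] cosh_square_eq[of "y / 2"] by simp
  moreover have "(y / 2)\<^sup>2 \<le> (sinh (y / 2))\<^sup>2"
  proof -
    have "\<bar>y / 2\<bar> \<le> sinh \<bar>y / 2\<bar>" by (rule sinh_ge_self) simp
    also have "sinh \<bar>y / 2\<bar> = \<bar>sinh (y / 2)\<bar>" by (cases "y \<ge> 0") (auto simp: abs_if)
    finally show ?thesis by (simp only: abs_le_square_iff)
  qed
  ultimately show ?thesis by (simp add: power_divide)
qed

lemma lapl_tendsto:
  assumes \<theta>: "\<theta> > 0"
  shows "((\<lambda>\<Lambda>. lapl \<theta> r \<Lambda> x) \<longlongrightarrow> exp (- \<omega>45 * (of_real x)\<^sup>2)) at_top"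
proof -
  have a1: "filterlim (\<lambda>\<Lambda>. ln (\<beta> / \<Lambda>) + x / sqrt \<Lambda>) at_bot at_top" using pos by real_asymp
  have "((\<lambda>\<Lambda>. E (ln (\<beta> / \<Lambda>) + x / sqrt \<Lambda>)) \<longlongrightarrow> 1) at_top"
    using filterlim_compose[OF H_lim a1] by (simp add: E_def)
  moreover have "((\<lambda>\<Lambda>. exp (complex_of_real ((1 - \<mu>) * (x / sqrt \<Lambda>)))) \<longlongrightarrow> exp (of_real 0)) at_top"
    by (intro tendsto_exp tendsto_of_real) real_asymp
  moreover have "((\<lambda>\<Lambda>. exp (- \<omega>45 * of_real (\<Lambda> * (2 * cosh (x / sqrt \<Lambda>) - 2)))) \<longlongrightarrow> exp (- \<omega>45 * of_real (x\<^sup>2))) at_top"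
  proof (intro tendsto_exp tendsto_mult tendsto_const tendsto_of_real)
    show "((\<lambda>\<Lambda>. \<Lambda> * (2 * cosh (x / sqrt \<Lambda>) - 2)) \<longlongrightarrow> x\<^sup>2) at_top"
      unfolding cosh_field_def by (real_asymp simp: power2_eq_square)
  qed
  moreover have "((\<lambda>\<Lambda>. kern r (ln (\<Lambda> / \<theta>) + x / sqrt \<Lambda>)) \<longlongrightarrow> 1 / (1 - 0)) at_top"
    unfolding kern_def
  proof (intro tendsto_divide tendsto_diff tendsto_const)
    show "((\<lambda>\<Lambda>. exp (2 * pi * \<i> * (ray (ln (\<Lambda> / \<theta>) + x / sqrt \<Lambda>) - of_real r))) \<longlongrightarrow> 0) at_top"
    proof (rule tendsto_norm_zero_cancel)
      have "((\<lambda>\<Lambda>. exp (- (2 * pi * (exp (ln (\<Lambda> / \<theta>) + x / sqrt \<Lambda>) * (sqrt 2 / 2))))) \<longlongrightarrow> 0) at_top"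
        using \<theta> by real_asymp
      then show "((\<lambda>\<Lambda>. norm (exp (2 * pi * \<i> * (ray (ln (\<Lambda> / \<theta>) + x / sqrt \<Lambda>) - of_real r)))) \<longlongrightarrow> 0) at_top"
        by simp
    qed
  qed auto
  ultimately have "((\<lambda>\<Lambda>. lapl \<theta> r \<Lambda> x) \<longlongrightarrow> 1 * exp (of_real 0) * exp (- \<omega>45 * of_real (x\<^sup>2)) * (1 / (1 - 0))) at_top"
    unfolding lapl_def by (intro tendsto_mult)
  then show ?thesis by simp
qed

lemma lapl_bound:
  assumes \<theta>: "\<theta> > 0" and \<Lambda>: "\<Lambda> \<ge> 1" "\<Lambda> \<ge> \<theta>"
  shows "norm (lapl \<theta> r \<Lambda> x) \<le> 2 * K * exp ((\<bar>1 - \<mu>\<bar> + 1 + 1)\<^sup>2 / (4 * (sqrt 2 / 2))) * exp (- \<bar>x\<bar>)"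
proof -
  have sl: "sqrt \<Lambda> \<ge> 1" using \<Lambda> by simp
  have xs: "\<bar>x / sqrt \<Lambda>\<bar> \<le> \<bar>x\<bar>" using sl by (simp add: divide_le_eq mult_left_le_one_le mult_right_le_one_le) (simp add: mult_le_cancel_left1)?
  have n2: "exp ((1 - \<mu>) * (x / sqrt \<Lambda>)) \<le> exp (\<bar>1 - \<mu>\<bar> * \<bar>x\<bar>)"
  proof -
    have "(1 - \<mu>) * (x / sqrt \<Lambda>) \<le> \<bar>1 - \<mu>\<bar> * \<bar>x / sqrt \<Lambda>\<bar>" by (metis abs_ge_self abs_mult)
    also have "\<dots> \<le> \<bar>1 - \<mu>\<bar> * \<bar>x\<bar>" using xs by (intro mult_left_mono) auto
    finally show ?thesis by simp
  qed
  have n3: "exp (- (sqrt 2 / 2 * (\<Lambda> * (2 * cosh (x / sqrt \<Lambda>) - 2)))) \<le> exp (- (sqrt 2 / 2 * x\<^sup>2))"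
  proof -
    have "\<Lambda> * (x / sqrt \<Lambda>)\<^sup>2 \<le> \<Lambda> * (2 * cosh (x / sqrt \<Lambda>) - 2)"
      using \<Lambda> by (intro mult_left_mono cosh_quadratic_ge) auto
    moreover have "\<Lambda> * (x / sqrt \<Lambda>)\<^sup>2 = x\<^sup>2" using \<Lambda> by (simp add: power_divide)
    ultimately show ?thesis by (simp add: mult_left_mono)
  qed
  \<comment> \<open>The kernel is large only towards the tip of the sector. As \<Lambda> \<ge>
    \<theta>, the saddle has modulus at least 1, and moving by x / sqrt \<Lambda> away from it costs
    at most a factor exp |x|.\<close>
  have n4: "norm (kern r (ln (\<Lambda> / \<theta>) + x / sqrt \<Lambda>)) \<le> 2 * exp \<bar>x\<bar>"
  proof -
    define \<sigma> where "\<sigma> = ln (\<Lambda> / \<theta>) + x / sqrt \<Lambda>"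
    have "norm (kern r \<sigma>) \<le> 1 + 1 / (2 * pi * (exp \<sigma> * (sqrt 2 / 2)))"
      unfolding kern_def norm_divide norm_one by (rule upper_kernel_bound) simp_all
    also have "\<dots> \<le> 1 + exp \<bar>x\<bar>"
    proof -
      have "exp (- \<bar>x\<bar>) \<le> exp \<sigma>"
      proof -
        have "ln (\<Lambda> / \<theta>) \<ge> 0" using \<Lambda> \<theta> by simp
        moreover have "- \<bar>x\<bar> \<le> x / sqrt \<Lambda>" using xs by linarith
        ultimately show ?thesis by (simp only: \<sigma>_def exp_le_cancel_iff)
      qed
      moreover have "1 \<le> 2 * pi * (sqrt 2 / 2)"
        using pi_ge_two mult_mono[of 1 pi 1 "sqrt 2"] by simp
      ultimately have "exp (- \<bar>x\<bar>) * 1 \<le> exp \<sigma> * (2 * pi * (sqrt 2 / 2))" by (intro mult_mono) auto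
      then have "1 / (2 * pi * (exp \<sigma> * (sqrt 2 / 2))) \<le> 1 / exp (- \<bar>x\<bar>)"
        by (intro frac_le) (auto simp: mult_ac)
      moreover have "1 / exp (- \<bar>x\<bar>) = exp \<bar>x\<bar>" by (simp add: exp_minus field_simps)
      ultimately show ?thesis by linarith
    qed
    also have "\<dots> \<le> 2 * exp \<bar>x\<bar>" by simp
    finally show ?thesis by (simp add: \<sigma>_def)
  qed
  have "norm (lapl \<theta> r \<Lambda> x) = norm (E (ln (\<beta> / \<Lambda>) + x / sqrt \<Lambda>)) * exp ((1 - \<mu>) * (x / sqrt \<Lambda>))
      * exp (- (sqrt 2 / 2 * (\<Lambda> * (2 * cosh (x / sqrt \<Lambda>) - 2)))) * norm (kern r (ln (\<Lambda> / \<theta>) + x / sqrt \<Lambda>))"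
    unfolding lapl_def norm_mult norm_exp_\<omega>45 by simp
  also have "\<dots> \<le> K * exp (\<bar>1 - \<mu>\<bar> * \<bar>x\<bar>) * exp (- (sqrt 2 / 2 * x\<^sup>2)) * (2 * exp \<bar>x\<bar>)"
    using pos by (intro mult_mono norm_E_le n2 n3 n4) auto
  also have "\<dots> = 2 * K * (exp ((\<bar>1 - \<mu>\<bar> + 1) * \<bar>x\<bar>) * exp (- (sqrt 2 / 2 * x\<^sup>2)))"
    by (simp add: mult_exp_exp algebra_simps)
  also have "\<dots> \<le> 2 * K * (exp ((\<bar>1 - \<mu>\<bar> + 1 + 1)\<^sup>2 / (4 * (sqrt 2 / 2))) * exp (- \<bar>x\<bar>))"
    using pos by (intro mult_left_mono gauss_tail_bound) auto
  finally show ?thesis by simp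
qed

text \<open>Dominated convergence for \<open>lapl\<close>. The saddle moves to infinity along the
  ray, where the kernel tends to 1, so that r survives only in the phase.\<close>

theorem A_asymptotics:
  assumes \<theta>: "\<theta> > 0"
  shows "((\<lambda>\<Lambda>. A \<theta> r (\<beta> * \<theta> / \<Lambda>\<^sup>2) / Nrm \<theta> \<Lambda>) \<longlongrightarrow> exp (- (\<i> * of_real (\<theta> * r))) * fresnel) at_top"
proof -
  have "((\<lambda>\<Lambda>. LINT x|lborel. lapl \<theta> r \<Lambda> x) \<longlongrightarrow> (LINT x|lborel. exp (- \<omega>45 * (of_real x)\<^sup>2))) at_top"
  proof (rule integral_dominated_convergence_at_top[where w = "\<lambda>x. 2 * K * exp ((\<bar>1 - \<mu>\<bar> + 1 + 1)\<^sup>2 / (4 * (sqrt 2 / 2))) * exp (- \<bar>x\<bar>)"])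
    show "(\<lambda>x. exp (- \<omega>45 * (complex_of_real x)\<^sup>2)) \<in> borel_measurable lborel"
      using fresnel_integrable by (rule borel_measurable_integrable)
    show "lapl \<theta> r \<Lambda> \<in> borel_measurable lborel" for \<Lambda> using lapl_measurable by simp
    show "integrable lborel (\<lambda>x. 2 * K * exp ((\<bar>1 - \<mu>\<bar> + 1 + 1)\<^sup>2 / (4 * (sqrt 2 / 2))) * exp (- \<bar>x\<bar>))"
      by (rule integrable_mult_right[OF exp_abs_integrable])
    show "\<forall>\<^sub>F \<Lambda> in at_top. AE x in lborel. norm (lapl \<theta> r \<Lambda> x) \<le> 2 * K * exp ((\<bar>1 - \<mu>\<bar> + 1 + 1)\<^sup>2 / (4 * (sqrt 2 / 2))) * exp (- \<bar>x\<bar>)"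
      using eventually_ge_at_top[of 1] eventually_ge_at_top[of \<theta>]
      by eventually_elim (intro AE_I2 lapl_bound \<theta>)
    show "AE x in lborel. ((\<lambda>\<Lambda>. lapl \<theta> r \<Lambda> x) \<longlongrightarrow> exp (- \<omega>45 * (of_real x)\<^sup>2)) at_top"
      by (intro AE_I2 lapl_tendsto \<theta>)
  qed
  then have "((\<lambda>\<Lambda>. exp (- (\<i> * of_real (\<theta> * r))) * (LINT x|lborel. lapl \<theta> r \<Lambda> x)) \<longlongrightarrow> exp (- (\<i> * of_real (\<theta> * r))) * fresnel) at_top"
    unfolding fresnel_def by (rule tendsto_mult_left)
  moreover have "\<forall>\<^sub>F \<Lambda> in at_top. exp (- (\<i> * of_real (\<theta> * r))) * (LINT x|lborel. lapl \<theta> r \<Lambda> x) = A \<theta> r (\<beta> * \<theta> / \<Lambda>\<^sup>2) / Nrm \<theta> \<Lambda>"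
    using eventually_gt_at_top[of 0] by eventually_elim (simp add: A_lapl[OF \<theta>])
  ultimately show ?thesis by (rule Lim_transform_eventually)
qed

end

section \<open>Both rays combined: the sums for frequencies from 0 to pi\<close>

context sector_flat
begin

definition S :: "real \<Rightarrow> real \<Rightarrow> real \<Rightarrow> complex" where
  "S \<theta> r P = (\<Sum>m. exp (\<i> * of_real \<theta> * of_nat m) * H (of_real (P * (real m + r))))"

lemma S_eq:
  assumes "P > 0" "0 < r" "r \<le> 1" "0 \<le> \<theta>" "\<theta> \<le> 2 * pi"
  shows "S \<theta> r P = A \<theta> r P + cnj (A (2 * pi - \<theta>) r P)"
  unfolding S_def using H_sums[OF assms] by (rule sums_unique[symmetric])

lemma norm_Nrm:
  assumes "\<Lambda> > 0" "\<theta> > 0"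
  shows "norm (Nrm \<theta> \<Lambda>) = exp (- (\<mu> * ln (\<beta> / \<Lambda>))) * (\<Lambda> / \<theta>) * exp (- (sqrt 2 * \<Lambda>)) / sqrt \<Lambda>"
  using assms by (simp add: Nrm_def norm_mult norm_divide Re_\<omega>45)

lemma Nrm_nonzero: "\<Lambda> > 0 \<Longrightarrow> Nrm \<theta> \<Lambda> \<noteq> 0" by (simp add: Nrm_def)

text \<open>For the same P the lower ray has the parameter \<kappa> \<Lambda> with \<kappa> = sqrt
  ((2 pi - \<theta>) / \<theta>), and the ratio of the normalisers is a constant times exp (- sqrt 2
  (\<kappa> - 1) \<Lambda>). It vanishes in the limit because \<theta> < pi means \<kappa> >
  1.\<close>

lemma S_asymptotics:
  assumes \<theta>: "0 < \<theta>" "\<theta> < pi" and r: "0 < r" "r \<le> 1"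
  shows "((\<lambda>\<Lambda>. S \<theta> r (\<beta> * \<theta> / \<Lambda>\<^sup>2) / Nrm \<theta> \<Lambda>) \<longlongrightarrow> exp (- (\<i> * of_real (\<theta> * r))) * fresnel) at_top"
proof -
  define \<theta>' where "\<theta>' = 2 * pi - \<theta>"
  define \<kappa> where "\<kappa> = sqrt (\<theta>' / \<theta>)"
  have \<theta>': "\<theta>' > \<theta>" "\<theta>' > 0" using \<theta> by (auto simp: \<theta>'_def)
  have \<kappa>: "\<kappa> > 1" "\<kappa>\<^sup>2 = \<theta>' / \<theta>" using \<theta> \<theta>' by (auto simp: \<kappa>_def)
  have lim: "filterlim (\<lambda>\<Lambda>. \<kappa> * \<Lambda>) at_top at_top" using \<kappa> by real_asymp
  have Peq: "\<beta> * \<theta>' / (\<kappa> * \<Lambda>)\<^sup>2 = \<beta> * \<theta> / \<Lambda>\<^sup>2" for \<Lambda>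
    using \<theta> \<theta>' by (simp add: power_mult_distrib \<kappa>(2))
  have c: "((\<lambda>\<Lambda>. A \<theta>' r (\<beta> * \<theta> / \<Lambda>\<^sup>2) / Nrm \<theta>' (\<kappa> * \<Lambda>)) \<longlongrightarrow> exp (- (\<i> * of_real (\<theta>' * r))) * fresnel) at_top"
    using filterlim_compose[OF A_asymptotics[OF \<theta>'(2), of r] lim] unfolding Peq .
  define D where "D = exp (\<mu> * ln \<kappa>) * sqrt \<kappa> * \<theta> / \<theta>'"
  have ratio: "norm (Nrm \<theta>' (\<kappa> * \<Lambda>) / Nrm \<theta> \<Lambda>) = D * exp (- (sqrt 2 * (\<kappa> - 1) * \<Lambda>))" if L: "\<Lambda> > 0" for \<Lambda>
  proof -
    have "ln (\<beta> / (\<kappa> * \<Lambda>)) = ln (\<beta> / \<Lambda>) - ln \<kappa>" using pos L \<kappa> by (simp add: ln_div ln_mult)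
    then have "- (\<mu> * ln (\<beta> / (\<kappa> * \<Lambda>))) = - (\<mu> * ln (\<beta> / \<Lambda>)) + \<mu> * ln \<kappa>"
      by (simp only:) (simp only: algebra_simps)
    then have e1: "exp (- (\<mu> * ln (\<beta> / (\<kappa> * \<Lambda>)))) = exp (- (\<mu> * ln (\<beta> / \<Lambda>))) * exp (\<mu> * ln \<kappa>)"
      by (simp only: mult_exp_exp)
    have e2: "exp (- (sqrt 2 * (\<kappa> * \<Lambda>))) = exp (- (sqrt 2 * \<Lambda>)) * exp (- (sqrt 2 * (\<kappa> - 1) * \<Lambda>))"
      by (simp add: mult_exp_exp algebra_simps)
    define a where "a = exp (- (\<mu> * ln (\<beta> / \<Lambda>)))"
    define b where "b = exp (- (sqrt 2 * \<Lambda>))"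
    have ab: "a > 0" "b > 0" by (auto simp: a_def b_def)
    have sk: "\<kappa> / sqrt \<kappa> = sqrt \<kappa>" using \<kappa> by (simp add: real_div_sqrt)
    have "norm (Nrm \<theta>' (\<kappa> * \<Lambda>) / Nrm \<theta> \<Lambda>) =
       (a * exp (\<mu> * ln \<kappa>) * (\<kappa> * \<Lambda> / \<theta>') * (b * exp (- (sqrt 2 * (\<kappa> - 1) * \<Lambda>))) / sqrt (\<kappa> * \<Lambda>)) / (a * (\<Lambda> / \<theta>) * b / sqrt \<Lambda>)"
      using L \<kappa> \<theta> \<theta>' unfolding norm_divide by (simp add: norm_Nrm e1 e2 a_def b_def)
    also have "\<dots> = exp (\<mu> * ln \<kappa>) * (\<kappa> / sqrt \<kappa>) * \<theta> / \<theta>' * exp (- (sqrt 2 * (\<kappa> - 1) * \<Lambda>))"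
      using L \<kappa> \<theta> \<theta>' ab by (simp add: real_sqrt_mult mult_ac)
    finally show ?thesis unfolding sk D_def .
  qed
  have r0: "((\<lambda>\<Lambda>. Nrm \<theta>' (\<kappa> * \<Lambda>) / Nrm \<theta> \<Lambda>) \<longlongrightarrow> 0) at_top"
  proof (rule tendsto_norm_zero_cancel)
    define b where "b = sqrt 2 * (\<kappa> - 1)"
    have "b > 0" using \<kappa> by (simp add: b_def)
    then have "((\<lambda>\<Lambda>. D * exp (- (b * \<Lambda>))) \<longlongrightarrow> 0) at_top" by real_asymp
    then have "((\<lambda>\<Lambda>. D * exp (- (sqrt 2 * (\<kappa> - 1) * \<Lambda>))) \<longlongrightarrow> 0) at_top" unfolding b_def .
    moreover have "\<forall>\<^sub>F \<Lambda> in at_top. D * exp (- (sqrt 2 * (\<kappa> - 1) * \<Lambda>)) = norm (Nrm \<theta>' (\<kappa> * \<Lambda>) / Nrm \<theta> \<Lambda>)"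
      using eventually_gt_at_top[of 0] by eventually_elim (simp only: ratio)
    ultimately show "((\<lambda>\<Lambda>. norm (Nrm \<theta>' (\<kappa> * \<Lambda>) / Nrm \<theta> \<Lambda>)) \<longlongrightarrow> 0) at_top" by (rule Lim_transform_eventually)
  qed
  have "((\<lambda>\<Lambda>. A \<theta>' r (\<beta> * \<theta> / \<Lambda>\<^sup>2) / Nrm \<theta>' (\<kappa> * \<Lambda>) * (Nrm \<theta>' (\<kappa> * \<Lambda>) / Nrm \<theta> \<Lambda>)) \<longlongrightarrow> 0) at_top"
    using tendsto_mult[OF c r0] by simp
  then have "((\<lambda>\<Lambda>. norm (A \<theta>' r (\<beta> * \<theta> / \<Lambda>\<^sup>2) / Nrm \<theta>' (\<kappa> * \<Lambda>) * (Nrm \<theta>' (\<kappa> * \<Lambda>) / Nrm \<theta> \<Lambda>))) \<longlongrightarrow> 0) at_top"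
    by (rule tendsto_norm_zero)
  moreover have "\<forall>\<^sub>F \<Lambda> in at_top. norm (A \<theta>' r (\<beta> * \<theta> / \<Lambda>\<^sup>2) / Nrm \<theta>' (\<kappa> * \<Lambda>) * (Nrm \<theta>' (\<kappa> * \<Lambda>) / Nrm \<theta> \<Lambda>)) = norm (cnj (A \<theta>' r (\<beta> * \<theta> / \<Lambda>\<^sup>2)) / Nrm \<theta> \<Lambda>)"
    using eventually_gt_at_top[of 0]
  proof eventually_elim
    case (elim \<Lambda>)
    then have "Nrm \<theta>' (\<kappa> * \<Lambda>) \<noteq> 0" using \<kappa> by (intro Nrm_nonzero) simp
    then show ?case by (simp add: norm_mult norm_divide)
  qed
  ultimately have "((\<lambda>\<Lambda>. norm (cnj (A \<theta>' r (\<beta> * \<theta> / \<Lambda>\<^sup>2)) / Nrm \<theta> \<Lambda>)) \<longlongrightarrow> 0) at_top" by (rule Lim_transform_eventually)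
  then have z: "((\<lambda>\<Lambda>. cnj (A \<theta>' r (\<beta> * \<theta> / \<Lambda>\<^sup>2)) / Nrm \<theta> \<Lambda>) \<longlongrightarrow> 0) at_top" by (rule tendsto_norm_zero_cancel)
  have "((\<lambda>\<Lambda>. A \<theta> r (\<beta> * \<theta> / \<Lambda>\<^sup>2) / Nrm \<theta> \<Lambda> + cnj (A \<theta>' r (\<beta> * \<theta> / \<Lambda>\<^sup>2)) / Nrm \<theta> \<Lambda>) \<longlongrightarrow> exp (- (\<i> * of_real (\<theta> * r))) * fresnel + 0) at_top"
    by (intro tendsto_add A_asymptotics \<theta> z)
  moreover have "\<forall>\<^sub>F \<Lambda> in at_top. A \<theta> r (\<beta> * \<theta> / \<Lambda>\<^sup>2) / Nrm \<theta> \<Lambda> + cnj (A \<theta>' r (\<beta> * \<theta> / \<Lambda>\<^sup>2)) / Nrm \<theta> \<Lambda> = S \<theta> r (\<beta> * \<theta> / \<Lambda>\<^sup>2) / Nrm \<theta> \<Lambda>"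
    using eventually_gt_at_top[of 0]
  proof eventually_elim
    case (elim \<Lambda>)
    have "S \<theta> r (\<beta> * \<theta> / \<Lambda>\<^sup>2) = A \<theta> r (\<beta> * \<theta> / \<Lambda>\<^sup>2) + cnj (A \<theta>' r (\<beta> * \<theta> / \<Lambda>\<^sup>2))"
      unfolding \<theta>'_def using elim pos \<theta> r by (intro S_eq) auto
    then show ?case by (simp add: add_divide_distrib)
  qed
  ultimately show ?thesis by (simp add: Lim_transform_eventually)
qed

lemma S_pi:
  assumes "P > 0" "0 < r" "r \<le> 1"
  shows "S pi r P = of_real (2 * Re (A pi r P))"
  using S_eq[OF assms, of pi] by (simp add: complex_eq_iff)

text \<open>The integral of \<open>H\<close> along the ray, with ds = s d\<sigma>; it takes the role
  of \<open>fresnel\<close> at frequency 0, where there is no saddle.\<close>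

definition mass :: complex where "mass = (LINT \<sigma>|lborel. H (ray \<sigma>) * ray \<sigma>)"

text \<open>Substituting s / P on the upper ray lets the kernel tend to 1 at fixed s, which leaves
  \<open>mass\<close>. The lower ray has frequency 2 pi, so \<open>A_asymptotics\<close> applies to
  it and shows it to be negligible.\<close>

lemma S_0_limit:
  assumes r: "0 < r" "r \<le> 1"
  shows "((\<lambda>P. of_real P * S 0 r P) \<longlongrightarrow> mass) (at_right 0)"
proof -
  obtain C where "sector_decay H C c" using sector_decay_H by blast
  then interpret D: sector_decay H C c .
  obtain M where M: "M > 0" "\<And>\<sigma>. exp \<sigma> ^ 2 * exp (- c * exp \<sigma>) * (exp \<sigma> + 1) \<le> M * exp (- \<bar>\<sigma>\<bar>)"
    using exp_mul_bound[OF pos(3)] by blast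
  define f where "f = (\<lambda>L \<sigma>. H (ray \<sigma>) * ray \<sigma> / (1 - exp (2 * pi * \<i> * (of_real L * ray \<sigma> - of_real r))))"
  have shift: "of_real P * A 0 r P = (LINT \<sigma>|lborel. f (1 / P) \<sigma>)" if P: "P > 0" for P
  proof -
    have "A 0 r P = \<bar>1\<bar> *\<^sub>R (LINT \<sigma>|lborel. upterm 0 r (\<lambda>s. H (of_real P * s)) (- ln P + 1 * \<sigma>))"
      unfolding A_def upint_def by (rule lborel_integral_real_affine) simp
    also have "(\<lambda>\<sigma>. upterm 0 r (\<lambda>s. H (of_real P * s)) (- ln P + 1 * \<sigma>)) = (\<lambda>\<sigma>. of_real (1 / P) * f (1 / P) \<sigma>)"
    proof
      fix \<sigma>
      have "ray (- ln P + \<sigma>) = of_real (1 / P) * ray \<sigma>" using P by (simp add: ray_altdef exp_diff)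
      then show "upterm 0 r (\<lambda>s. H (of_real P * s)) (- ln P + 1 * \<sigma>) = of_real (1 / P) * f (1 / P) \<sigma>"
        using P by (simp add: upterm_def f_def)
    qed
    also have "(LINT \<sigma>|lborel. of_real (1 / P) * f (1 / P) \<sigma>) = of_real (1 / P) * (LINT \<sigma>|lborel. f (1 / P) \<sigma>)"
      by (rule integral_mult_right_zero)
    finally show ?thesis using P by simp
  qed
  have fb: "norm (f L \<sigma>) \<le> (C + 1) * M * exp (- \<bar>\<sigma>\<bar>)" if L: "L \<ge> 1" for L \<sigma>
  proof -
    have "1 / norm (1 - exp (2 * pi * \<i> * (of_real L * ray \<sigma> - of_real r))) \<le> 1 + 1 / (2 * pi * (L * (exp \<sigma> * (sqrt 2 / 2))))"
      using L by (intro upper_kernel_bound) auto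
    also have "\<dots> \<le> 1 + 1 / exp \<sigma>"
    proof -
      have "2 * pi * (sqrt 2 / 2) \<ge> 1"
        using pi_ge_two mult_mono[of 1 pi 1 "sqrt 2"] by simp
      then have "L * (2 * pi * (sqrt 2 / 2)) \<ge> 1 * 1" using L by (intro mult_mono) auto
      then have "exp \<sigma> * 1 \<le> exp \<sigma> * (L * (2 * pi * (sqrt 2 / 2)))" by (intro mult_left_mono) auto
      then have "1 / (2 * pi * (L * (exp \<sigma> * (sqrt 2 / 2)))) \<le> 1 / exp \<sigma>"
        by (intro frac_le) (auto simp: mult_ac)
      then show ?thesis by simp
    qed
    finally have k: "1 / norm (1 - exp (2 * pi * \<i> * (of_real L * ray \<sigma> - of_real r))) \<le> 1 + 1 / exp \<sigma>" .
    have h: "norm (H (ray \<sigma>)) \<le> (C + 1) * exp \<sigma> ^ 2 * exp (- c * exp \<sigma>)"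
    proof -
      have "norm (H (ray \<sigma>)) \<le> C * exp \<sigma> ^ 2 * exp (- c * exp \<sigma>)" using D.decay[of "ray \<sigma>"] by simp
      also have "\<dots> \<le> (C + 1) * exp \<sigma> ^ 2 * exp (- c * exp \<sigma>)" by (intro mult_right_mono) auto
      finally show ?thesis .
    qed
    have "norm (f L \<sigma>) = norm (H (ray \<sigma>)) * exp \<sigma> * (1 / norm (1 - exp (2 * pi * \<i> * (of_real L * ray \<sigma> - of_real r))))"
      by (simp add: f_def norm_mult norm_divide)
    also have "\<dots> \<le> ((C + 1) * exp \<sigma> ^ 2 * exp (- c * exp \<sigma>)) * exp \<sigma> * (1 + 1 / exp \<sigma>)"
      using D.C_nonneg by (intro mult_mono h k) auto
    also have "\<dots> = (C + 1) * (exp \<sigma> ^ 2 * exp (- c * exp \<sigma>) * (exp \<sigma> + 1))" by (simp add: field_simps)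
    also have "\<dots> \<le> (C + 1) * (M * exp (- \<bar>\<sigma>\<bar>))" using D.C_nonneg by (intro mult_left_mono M) auto
    finally show ?thesis by simp
  qed
  have "((\<lambda>L. LINT \<sigma>|lborel. f L \<sigma>) \<longlongrightarrow> mass) at_top" unfolding mass_def
  proof (rule integral_dominated_convergence_at_top[where w = "\<lambda>\<sigma>. (C + 1) * M * exp (- \<bar>\<sigma>\<bar>)"])
    show "(\<lambda>\<sigma>. H (ray \<sigma>) * ray \<sigma>) \<in> borel_measurable lborel" by measurable
    show "f L \<in> borel_measurable lborel" for L unfolding f_def by measurable
    show "integrable lborel (\<lambda>\<sigma>. (C + 1) * M * exp (- \<bar>\<sigma>\<bar>))"
      by (rule integrable_mult_right[OF exp_abs_integrable])
    show "\<forall>\<^sub>F L in at_top. AE \<sigma> in lborel. norm (f L \<sigma>) \<le> (C + 1) * M * exp (- \<bar>\<sigma>\<bar>)"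
      using eventually_ge_at_top[of 1] by eventually_elim (intro AE_I2 fb)
    show "AE \<sigma> in lborel. ((\<lambda>L. f L \<sigma>) \<longlongrightarrow> H (ray \<sigma>) * ray \<sigma>) at_top"
    proof (intro AE_I2)
      fix \<sigma>
      have "((\<lambda>L. exp (2 * pi * \<i> * (of_real L * ray \<sigma> - of_real r))) \<longlongrightarrow> 0) at_top"
      proof (rule tendsto_norm_zero_cancel)
        have "exp \<sigma> > 0" by simp
        then have "((\<lambda>L. exp (- (2 * pi * (L * (exp \<sigma> * (sqrt 2 / 2)))))) \<longlongrightarrow> 0) at_top" by real_asymp
        then show "((\<lambda>L. norm (exp (2 * pi * \<i> * (of_real L * ray \<sigma> - of_real r)))) \<longlongrightarrow> 0) at_top" by simp
      qed
      then have "((\<lambda>L. f L \<sigma>) \<longlongrightarrow> H (ray \<sigma>) * ray \<sigma> / (1 - 0)) at_top"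
        unfolding f_def by (intro tendsto_divide tendsto_diff tendsto_const) auto
      then show "((\<lambda>L. f L \<sigma>) \<longlongrightarrow> H (ray \<sigma>) * ray \<sigma>) at_top" by simp
    qed
  qed
  then have "((\<lambda>P. LINT \<sigma>|lborel. f (1 / P) \<sigma>) \<longlongrightarrow> mass) (at_right 0)"
  proof (rule filterlim_compose)
    show "filterlim (\<lambda>P::real. 1 / P) at_top (at_right 0)" by real_asymp
  qed
  moreover have "\<forall>\<^sub>F P in at_right 0. (LINT \<sigma>|lborel. f (1 / P) \<sigma>) = of_real P * A 0 r P"
    using eventually_at_right_less[of "0::real"] by eventually_elim (simp only: shift)
  ultimately have l1: "((\<lambda>P. of_real P * A 0 r P) \<longlongrightarrow> mass) (at_right 0)" by (rule Lim_transform_eventually)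
  have l2: "((\<lambda>P. of_real P * A (2 * pi) r P) \<longlongrightarrow> 0) (at_right 0)"
  proof -
    have n0: "((\<lambda>\<Lambda>. of_real (\<beta> * (2 * pi) / \<Lambda>\<^sup>2) * Nrm (2 * pi) \<Lambda>) \<longlongrightarrow> 0) at_top"
    proof (rule tendsto_norm_zero_cancel)
      have "((\<lambda>\<Lambda>. (\<beta> * (2 * pi) / \<Lambda>\<^sup>2) * (exp (- (\<mu> * ln (\<beta> / \<Lambda>))) * (\<Lambda> / (2 * pi)) * exp (- (sqrt 2 * \<Lambda>)) / sqrt \<Lambda>)) \<longlongrightarrow> 0) at_top"
        using pos by real_asymp
      moreover have "\<forall>\<^sub>F \<Lambda> in at_top. (\<beta> * (2 * pi) / \<Lambda>\<^sup>2) * (exp (- (\<mu> * ln (\<beta> / \<Lambda>))) * (\<Lambda> / (2 * pi)) * exp (- (sqrt 2 * \<Lambda>)) / sqrt \<Lambda>) = norm (of_real (\<beta> * (2 * pi) / \<Lambda>\<^sup>2) * Nrm (2 * pi) \<Lambda>)"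
        using eventually_gt_at_top[of 0]
      proof eventually_elim
        case (elim \<Lambda>)
        have "norm (complex_of_real (\<beta> * (2 * pi) / \<Lambda>\<^sup>2)) = \<beta> * (2 * pi) / \<Lambda>\<^sup>2" using pos by (simp only: norm_of_real) simp
        then show ?case using norm_Nrm[OF elim, of "2 * pi"] unfolding norm_mult by simp
      qed
      ultimately show "((\<lambda>\<Lambda>. norm (of_real (\<beta> * (2 * pi) / \<Lambda>\<^sup>2) * Nrm (2 * pi) \<Lambda>)) \<longlongrightarrow> 0) at_top"
        by (rule Lim_transform_eventually)
    qed
    have "((\<lambda>\<Lambda>. (of_real (\<beta> * (2 * pi) / \<Lambda>\<^sup>2) * Nrm (2 * pi) \<Lambda>) * (A (2 * pi) r (\<beta> * (2 * pi) / \<Lambda>\<^sup>2) / Nrm (2 * pi) \<Lambda>)) \<longlongrightarrow> 0 * (exp (- (\<i> * of_real (2 * pi * r))) * fresnel)) at_top"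
      by (intro tendsto_mult n0 A_asymptotics) simp
    moreover have "\<forall>\<^sub>F \<Lambda> in at_top. (of_real (\<beta> * (2 * pi) / \<Lambda>\<^sup>2) * Nrm (2 * pi) \<Lambda>) * (A (2 * pi) r (\<beta> * (2 * pi) / \<Lambda>\<^sup>2) / Nrm (2 * pi) \<Lambda>)
        = of_real (\<beta> * (2 * pi) / \<Lambda>\<^sup>2) * A (2 * pi) r (\<beta> * (2 * pi) / \<Lambda>\<^sup>2)"
      using eventually_gt_at_top[of 0] by eventually_elim (use Nrm_nonzero in simp)
    ultimately have "((\<lambda>\<Lambda>. of_real (\<beta> * (2 * pi) / \<Lambda>\<^sup>2) * A (2 * pi) r (\<beta> * (2 * pi) / \<Lambda>\<^sup>2)) \<longlongrightarrow> 0) at_top"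
      by (simp add: Lim_transform_eventually)
    moreover have "filterlim (\<lambda>P. sqrt (\<beta> * (2 * pi) / P)) at_top (at_right 0)" using pos by real_asymp
    ultimately have "((\<lambda>P. of_real (\<beta> * (2 * pi) / (sqrt (\<beta> * (2 * pi) / P))\<^sup>2) * A (2 * pi) r (\<beta> * (2 * pi) / (sqrt (\<beta> * (2 * pi) / P))\<^sup>2)) \<longlongrightarrow> 0) (at_right 0)"
      by (rule filterlim_compose)
    moreover have "\<forall>\<^sub>F P in at_right 0. of_real (\<beta> * (2 * pi) / (sqrt (\<beta> * (2 * pi) / P))\<^sup>2) * A (2 * pi) r (\<beta> * (2 * pi) / (sqrt (\<beta> * (2 * pi) / P))\<^sup>2) = of_real P * A (2 * pi) r P"
      using eventually_at_right_less[of "0::real"]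
    proof eventually_elim
      case (elim P)
      have "\<beta> * (2 * pi) / (sqrt (\<beta> * (2 * pi) / P))\<^sup>2 = P" using elim pos by simp
      then show ?case by simp
    qed
    ultimately show ?thesis by (rule Lim_transform_eventually)
  qed
  have "((\<lambda>P. of_real P * A 0 r P + cnj (of_real P * A (2 * pi) r P)) \<longlongrightarrow> mass + cnj 0) (at_right 0)"
    by (intro tendsto_add tendsto_cnj l1 l2)
  moreover have "\<forall>\<^sub>F P in at_right 0. of_real P * A 0 r P + cnj (of_real P * A (2 * pi) r P) = of_real P * S 0 r P"
    using eventually_at_right_less[of "0::real"]
  proof eventually_elim
    case (elim P)
    have "S 0 r P = A 0 r P + cnj (A (2 * pi - 0) r P)" using elim r by (intro S_eq) auto
    then show ?case by (simp add: algebra_simps)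
  qed
  ultimately show ?thesis by (simp add: Lim_transform_eventually)
qed

end

section \<open>The coefficient function and its Euler derivative as instances\<close>

lemma sector_Re_ge: assumes "s \<in> sector" shows "Re s > 0" "norm s \<le> 2 * Re s"
proof -
  show "Re s > 0" using assms by (simp add: sector_def)
  have "norm s \<le> \<bar>Re s\<bar> + \<bar>Im s\<bar>" by (rule cmod_le)
  then show "norm s \<le> 2 * Re s" using assms by (simp add: sector_def)
qed

lemma powr_le_exp:
  assumes "(\<nu>::real) \<ge> 0"
  obtains M where "M > 0" "\<And>x. x \<ge> 1 \<Longrightarrow> x powr \<nu> \<le> M * exp (x / 4)"
proof -
  define N where "N = nat \<lceil>\<nu>\<rceil> + 1"
  have N: "real N \<ge> \<nu>" "N > 0" using real_nat_ceiling_ge[of \<nu>] by (auto simp: N_def)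
  have "x powr \<nu> \<le> (4 * real N) ^ N * exp (x / 4)" if x: "x \<ge> 1" for x
  proof -
    have "x powr \<nu> \<le> x powr real N" using x N by (intro powr_mono) auto
    also have "\<dots> = x ^ N" using x by (simp add: powr_realpow)
    also have "x ^ N = (4 * real N) ^ N * (x / (4 * real N)) ^ N" using N by (simp add: power_divide)
    also have "(x / (4 * real N)) ^ N \<le> exp (x / (4 * real N)) ^ N"
    proof (rule power_mono)
      show "x / (4 * real N) \<le> exp (x / (4 * real N))" using exp_ge_add_one_self[of "x / (4 * real N)"] by linarith
    qed (use x in simp)
    also have "exp (x / (4 * real N)) ^ N = exp (real N * (x / (4 * real N)))" by (rule exp_of_nat_mult[symmetric])
    also have "real N * (x / (4 * real N)) = x / 4" using N by simp
    finally show ?thesis by (simp add: mult_left_mono)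
  qed
  then show ?thesis using N by (intro that[of "(4 * real N) ^ N"]) auto
qed

text \<open>Near 0 the modular representation with bounded remainder \<open>B\<close> is used, far
  out the direct bound \<open>far\<close>; the regimes meet at |s| = 1. The rate 1/8 leaves room to
  absorb |s|^(\<mu> + 1) into exp (|s| / 4).\<close>

lemma sector_flatI:
  assumes holo: "H holomorphic_on {s. Re s > 0}" and cnj: "\<And>s. Re s > 0 \<Longrightarrow> H (cnj s) = cnj (H s)"
    and par: "\<mu> \<ge> 0" "\<beta> > 0"
    and rep: "\<And>s. Re s > 0 \<Longrightarrow> H s = exp (- (of_real \<mu> * Ln s) - of_real \<beta> / s) * B s"
    and near: "\<And>s. s \<in> sector \<Longrightarrow> norm s \<le> 1 \<Longrightarrow> norm (B s) \<le> K1" "K1 > 0"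
    and lim: "((\<lambda>\<sigma>. B (ray \<sigma>)) \<longlongrightarrow> 1) at_bot"
    and far: "\<And>s. s \<in> sector \<Longrightarrow> norm s \<ge> 1 \<Longrightarrow> norm (H s) \<le> K2 * norm s * exp (- (norm s / 2))" "K2 > 0"
  shows "\<exists>K. sector_flat H \<mu> \<beta> K (1 / 8)"
proof -
  obtain M where M: "M > 0" "\<And>x. x \<ge> 1 \<Longrightarrow> x powr (\<mu> + 1) \<le> M * exp (x / 4)"
    using powr_le_exp[of "\<mu> + 1"] par by auto
  define K where "K = max (K1 * exp (1 / 8)) (K2 * M * exp \<beta>)"
  have Kpos: "K > 0" using near(2) by (simp add: K_def less_max_iff_disj)
  have "sector_flat H \<mu> \<beta> K (1 / 8)"
  proof
    show "H holomorphic_on {s. Re s > 0}" "\<mu> \<ge> 0" "\<beta> > 0" "K > 0" "(0::real) < 1 / 8"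
      by (fact holo, fact par, fact par, fact Kpos, simp)
    show "H (cnj s) = cnj (H s)" if "Re s > 0" for s using cnj that .
    show "norm (H s) \<le> K * norm s powr - \<mu> * exp (- \<beta> * Re (1 / s)) * exp (- (1 / 8) * norm s)" if s: "s \<in> sector" for s
    proof -
      have s0: "Re s > 0" "s \<noteq> 0" "norm s > 0" using s by (auto simp: sector_def)
      show ?thesis
      proof (cases "norm s \<le> 1")
        case True
        have "norm (exp (- (of_real \<mu> * Ln s) - of_real \<beta> / s)) = exp (- (\<mu> * ln (norm s))) * exp (- \<beta> * Re (1 / s))"
          using s0 by (simp add: mult_exp_exp Re_divide)
        also have "exp (- (\<mu> * ln (norm s))) = norm s powr - \<mu>" using s0 by (simp add: powr_def)
        finally have e: "norm (H s) = norm s powr - \<mu> * exp (- \<beta> * Re (1 / s)) * norm (B s)"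
          using rep[OF s0(1)] by (simp add: norm_mult)
        have "norm (B s) \<le> K * exp (- (1 / 8) * norm s)"
        proof -
          have "norm (B s) \<le> K1 * exp (1 / 8) * exp (- (1 / 8))" using near(1)[OF s True] by (simp add: mult_exp_exp mult.assoc)
          also have "\<dots> \<le> K * exp (- (1 / 8) * norm s)"
          proof (rule mult_mono)
            show "K1 * exp (1 / 8) \<le> K" by (simp add: K_def)
          qed (use True Kpos in auto)
          finally show ?thesis .
        qed
        then have "norm s powr - \<mu> * exp (- \<beta> * Re (1 / s)) * norm (B s) \<le> norm s powr - \<mu> * exp (- \<beta> * Re (1 / s)) * (K * exp (- (1 / 8) * norm s))"
          by (intro mult_left_mono) auto
        then show ?thesis unfolding e by (simp add: mult_ac)
      next
        case False
        then have n1: "norm s \<ge> 1" by simp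
        have "norm (H s) \<le> K2 * norm s * exp (- (norm s / 2))" by (rule far(1)[OF s n1])
        also have "\<dots> = K2 * norm s powr - \<mu> * (norm s powr (\<mu> + 1)) * exp (- (norm s / 2))"
          using s0 by (simp add: powr_add powr_minus field_simps)
        also have "\<dots> \<le> K2 * norm s powr - \<mu> * (M * exp (norm s / 4)) * exp (- (norm s / 2))"
          using far(2) by (intro mult_right_mono mult_left_mono M n1) auto
        also have "\<dots> = K2 * M * norm s powr - \<mu> * (exp (norm s / 4) * exp (- (norm s / 2)))" by (simp add: mult_ac)
        also have "exp (norm s / 4) * exp (- (norm s / 2)) \<le> exp (- (1 / 8) * norm s)"
          by (simp add: mult_exp_exp)
        also have "K2 * M * norm s powr - \<mu> * exp (- (1 / 8) * norm s) \<le> (K2 * M * norm s powr - \<mu> * exp (- (1 / 8) * norm s)) * (exp \<beta> * exp (- \<beta> * Re (1 / s)))"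
        proof -
          have "Re (1 / s) \<le> norm (1 / s)" by (rule complex_Re_le_cmod)
          also have "\<dots> \<le> 1" using n1 by (simp add: norm_divide divide_le_eq)
          finally have "\<beta> * Re (1 / s) \<le> \<beta> * 1" using par by (intro mult_left_mono) auto
          then have "1 \<le> exp \<beta> * exp (- \<beta> * Re (1 / s))" by (simp add: mult_exp_exp)
          then have "(K2 * M * norm s powr - \<mu> * exp (- (1 / 8) * norm s)) * 1 \<le> (K2 * M * norm s powr - \<mu> * exp (- (1 / 8) * norm s)) * (exp \<beta> * exp (- \<beta> * Re (1 / s)))"
            using far(2) M(1) by (intro mult_left_mono) auto
          then show ?thesis by simp
        qed
        also have "\<dots> = (K2 * M * exp \<beta>) * norm s powr - \<mu> * exp (- \<beta> * Re (1 / s)) * exp (- (1 / 8) * norm s)" by (simp add: mult_ac)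
        also have "\<dots> \<le> K * norm s powr - \<mu> * exp (- \<beta> * Re (1 / s)) * exp (- (1 / 8) * norm s)"
          by (intro mult_right_mono) (auto simp: K_def)
        finally show ?thesis using far(2) M(1) by (simp add: mult_left_mono)
      qed
    qed
    have LnRay: "Ln (ray \<sigma>) = Complex \<sigma> (pi / 4)" for \<sigma>
    proof -
      have "- pi < pi / 4" "pi / 4 \<le> pi" using pi_gt_zero by linarith+
      then show ?thesis unfolding ray_def by (intro Ln_exp) simp_all
    qed
    have "H (ray \<sigma>) * exp (of_real \<mu> * Complex \<sigma> (pi / 4)) * exp (of_real \<beta> / ray \<sigma>) = B (ray \<sigma>)" for \<sigma>
    proof -
      have "H (ray \<sigma>) = exp (- (of_real \<mu> * Complex \<sigma> (pi / 4)) - of_real \<beta> / ray \<sigma>) * B (ray \<sigma>)"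
        using rep[of "ray \<sigma>"] by (simp add: LnRay)
      then have "H (ray \<sigma>) * exp (of_real \<mu> * Complex \<sigma> (pi / 4)) * exp (of_real \<beta> / ray \<sigma>) =
        B (ray \<sigma>) * (exp (- (of_real \<mu> * Complex \<sigma> (pi / 4)) - of_real \<beta> / ray \<sigma>) * exp (of_real \<mu> * Complex \<sigma> (pi / 4)) * exp (of_real \<beta> / ray \<sigma>))"
        by (simp only: mult_ac)
      also have "exp (- (of_real \<mu> * Complex \<sigma> (pi / 4)) - of_real \<beta> / ray \<sigma>) * exp (of_real \<mu> * Complex \<sigma> (pi / 4)) * exp (of_real \<beta> / ray \<sigma>) = 1"
        unfolding mult_exp_exp by simp
      finally show ?thesis by simp
    qed
    then show "((\<lambda>\<sigma>. H (ray \<sigma>) * exp (of_real \<mu> * Complex \<sigma> (pi / 4)) * exp (of_real \<beta> / ray \<sigma>)) \<longlongrightarrow> 1) at_bot"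
      using lim by simp
  qed
  then show ?thesis by blast
qed

text \<open>Constants of \<open>Gk_modular\<close>: \<open>cN k\<close> is (2 pi)^(k / 2),
  \<open>bk k\<close> is the \<beta> of the flat factor, and \<open>gam k\<close> collects exp (- s)
  and the factor exp (k s / 24) of the transformation; it vanishes for k = 24.\<close>

definition cN :: "nat \<Rightarrow> real" where "cN k = exp (real k / 2 * ln (2 * pi))"
definition Gk :: "nat \<Rightarrow> complex \<Rightarrow> complex" where "Gk k s = coef k (exp (- s))"
definition bk :: "nat \<Rightarrow> real" where "bk k = real k * pi\<^sup>2 / 6"
definition dual_nome :: "complex \<Rightarrow> complex" where "dual_nome s = exp (- (of_real (4 * pi\<^sup>2) / s))"
definition gam :: "nat \<Rightarrow> real" where "gam k = 1 - real k / 24"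

lemma cN_pos: "cN k > 0" by (simp add: cN_def)
lemma bk_pos: "k \<ge> 1 \<Longrightarrow> bk k > 0" by (simp add: bk_def)

lemma norm_dual_nome: "norm (dual_nome s) = exp (- (4 * pi\<^sup>2 * Re (1 / s)))"
  by (simp add: dual_nome_def Re_divide)

lemma norm_dual_nome_less: assumes "Re s > 0" shows "norm (dual_nome s) < 1"
proof -
  have "Re (1 / s) > 0" using assms by (simp add: Re_divide add_pos_nonneg)
  then show ?thesis unfolding norm_dual_nome by simp
qed

lemma norm_dual_nome_le: assumes "s \<in> sector" "norm s \<le> 1" shows "norm (dual_nome s) \<le> 1 / 2"
proof -
  have s0: "norm s > 0" using assms(1) by (auto simp: sector_def)
  have "1 / 2 \<le> 1 / (2 * norm s)" using assms(2) s0 by (simp add: field_simps)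
  then have "1 / 2 \<le> Re (1 / s)" using sector_Re_inverse[OF assms(1)] by linarith
  moreover have "4 * pi\<^sup>2 \<ge> 4 * 1" using pi_ge_two by (intro mult_left_mono) (auto simp: one_le_power)
  ultimately have "4 * (1 / 2) \<le> 4 * pi\<^sup>2 * Re (1 / s)" by (intro mult_mono) auto
  then have "norm (dual_nome s) \<le> exp (- 2)" unfolding norm_dual_nome by simp
  also have "\<dots> \<le> 1 / 2" using exp_ge_add_one_self[of "2 :: real"] by (simp add: exp_minus field_simps)
  finally show ?thesis .
qed

lemma dual_nome_ray_tendsto: "((\<lambda>\<sigma>. dual_nome (ray \<sigma>)) \<longlongrightarrow> 0) at_bot"
proof (rule tendsto_norm_zero_cancel)
  have "Re (1 / ray \<sigma>) = exp (- \<sigma>) * (sqrt 2 / 2)" for \<sigma>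
  proof -
    have "1 / ray \<sigma> = of_real (exp (- \<sigma>)) * \<omega>45" using \<omega>45_ray(2) by (simp add: ray_altdef exp_minus field_simps)
    then show ?thesis by (simp add: Re_\<omega>45)
  qed
  moreover have "((\<lambda>\<sigma>. exp (- (4 * pi\<^sup>2 * (exp (- \<sigma>) * (sqrt 2 / 2))))) \<longlongrightarrow> 0) at_bot" by real_asymp
  ultimately show "((\<lambda>\<sigma>. norm (dual_nome (ray \<sigma>))) \<longlongrightarrow> 0) at_bot" unfolding norm_dual_nome by (simp only:)
qed

lemma ray_tendsto_0: "(ray \<longlongrightarrow> 0) at_bot"
  by (rule tendsto_norm_zero_cancel) (simp, real_asymp)

lemma Gk_modular:
  assumes s: "Re s > 0"
  shows "Gk k s = of_real (cN k) * exp (- (of_real (real k / 2) * Ln s) - of_real (bk k) / s) * (exp (- (s * of_real (gam k))) * Phi (dual_nome s) ^ k)"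
proof -
  have s0: "s \<noteq> 0" using s by auto
  have "Phi (exp (- s)) ^ k = exp (of_nat k * (of_real (ln (2 * pi)) / 2 - Ln s / 2 + s / 24 - of_real (pi\<^sup>2) / (6 * s))) * Phi (dual_nome s) ^ k"
    unfolding Phi_modular[OF s] power_mult_distrib dual_nome_def by (simp only: exp_of_nat_mult)
  then have "Gk k s = (exp (- s) * exp (of_nat k * (of_real (ln (2 * pi)) / 2 - Ln s / 2 + s / 24 - of_real (pi\<^sup>2) / (6 * s)))) * Phi (dual_nome s) ^ k"
    by (simp add: Gk_def coef_def)
  also have "exp (- s) * exp (of_nat k * (of_real (ln (2 * pi)) / 2 - Ln s / 2 + s / 24 - of_real (pi\<^sup>2) / (6 * s)))
    = exp (of_real (real k / 2 * ln (2 * pi))) * exp (- (of_real (real k / 2) * Ln s) - of_real (bk k) / s) * exp (- (s * of_real (gam k)))"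
    unfolding mult_exp_exp using s0 by (intro arg_cong[of _ _ exp]) (simp add: bk_def gam_def field_simps)
  also have "exp (complex_of_real (real k / 2 * ln (2 * pi))) = of_real (cN k)" unfolding cN_def by (rule exp_of_real)
  finally show ?thesis by (simp add: mult_ac)
qed

lemma Gk_holo: "Gk k holomorphic_on {s. Re s > 0}"
  unfolding Gk_def[abs_def]
  by (intro holomorphic_on_compose_gen[OF _ coef_holomorphic, unfolded o_def] holomorphic_intros) auto

lemma Gk_cnj: assumes "Re s > 0" shows "Gk k (cnj s) = cnj (Gk k s)"
  using assms Phi_cnj[of "exp (- s)"] by (simp add: Gk_def coef_def exp_cnj)

lemma norm_exp_sector_le: assumes "s \<in> sector" shows "norm (exp (- s)) \<le> exp (- (norm s / 2))"
  using sector_Re_ge[OF assms] by simp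

lemma Gk_far:
  assumes s: "s \<in> sector" "norm s \<ge> 1"
  shows "norm (Gk k s) \<le> exp (real k * (exp (- (1 / 2)) / (1 - exp (- (1 / 2))))) * exp (- (norm s / 2))"
proof -
  have "norm (exp (- s)) \<le> exp (- (norm s / 2))" by (rule norm_exp_sector_le[OF s(1)])
  also have "\<dots> \<le> exp (- (1 / 2))" using s by simp
  finally have "norm (Gk k s) \<le> norm (exp (- s)) * exp (real k * (exp (- (1 / 2)) / (1 - exp (- (1 / 2)))))"
    unfolding Gk_def by (rule norm_coef_le) simp
  also have "\<dots> \<le> exp (- (norm s / 2)) * exp (real k * (exp (- (1 / 2)) / (1 - exp (- (1 / 2)))))"
    by (intro mult_right_mono norm_exp_sector_le s) auto
  finally show ?thesis by (simp add: mult.commute)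
qed

lemma norm_exp_gam_le: assumes "norm s \<le> 1" shows "norm (exp (- (s * complex_of_real (gam k)))) \<le> exp \<bar>gam k\<bar>"
proof -
  have "norm (exp (- (s * complex_of_real (gam k)))) \<le> exp (norm (- (s * complex_of_real (gam k))))" by (rule norm_exp)
  also have "norm (- (s * complex_of_real (gam k))) \<le> 1 * \<bar>gam k\<bar>" using assms by (simp add: norm_mult mult_left_le_one_le)
  finally show ?thesis by simp
qed

lemma norm_Phi_dual_le: assumes "s \<in> sector" "norm s \<le> 1" shows "norm (Phi (dual_nome s)) ^ j \<le> exp 1 ^ j"
proof (rule power_mono)
  show "norm (Phi (dual_nome s)) \<le> exp 1" using norm_Phi_le[OF norm_dual_nome_le[OF assms]] by simp
qed simp

lemma isCont_Phi_0: "isCont Phi 0"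
  using holomorphic_on_imp_continuous_on[OF Phi_holomorphic] by (simp add: continuous_on_eq_continuous_at)

lemma Phi_dual_ray_tendsto: "((\<lambda>\<sigma>. Phi (dual_nome (ray \<sigma>))) \<longlongrightarrow> 1) at_bot"
  using isCont_tendsto_compose[OF isCont_Phi_0 dual_nome_ray_tendsto] by (simp add: Phi_0)

lemma exp_gam_ray_tendsto: "((\<lambda>\<sigma>. exp (- (ray \<sigma> * complex_of_real (gam k)))) \<longlongrightarrow> 1) at_bot"
proof -
  have "((\<lambda>\<sigma>. exp (- (ray \<sigma> * complex_of_real (gam k)))) \<longlongrightarrow> exp (- (0 * complex_of_real (gam k)))) at_bot"
    by (intro tendsto_intros ray_tendsto_0)
  then show ?thesis by simp
qed

definition H1 :: "nat \<Rightarrow> complex \<Rightarrow> complex" where "H1 k s = Gk k s / of_real (cN k)"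

lemma sector_flat_H1: assumes k: "k \<ge> 1" shows "\<exists>K. sector_flat (H1 k) (real k / 2) (bk k) K (1 / 8)"
proof (rule sector_flatI[where B = "\<lambda>s. exp (- (s * of_real (gam k))) * Phi (dual_nome s) ^ k"
    and ?K1.0 = "exp \<bar>gam k\<bar> * exp 1 ^ k" and ?K2.0 = "exp (real k * (exp (- (1 / 2)) / (1 - exp (- (1 / 2))))) / cN k"])
  show "H1 k holomorphic_on {s. Re s > 0}" unfolding H1_def[abs_def] using cN_pos[of k] by (intro holomorphic_intros Gk_holo) auto
  show "H1 k (cnj s) = cnj (H1 k s)" if "Re s > 0" for s using that by (simp add: H1_def Gk_cnj)
  show "bk k > 0" by (rule bk_pos[OF k])
  show "H1 k s = exp (- (of_real (real k / 2) * Ln s) - of_real (bk k) / s) * (exp (- (s * of_real (gam k))) * Phi (dual_nome s) ^ k)" if "Re s > 0" for s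
    unfolding H1_def Gk_modular[OF that] using cN_pos[of k] by simp
  show "norm (exp (- (s * of_real (gam k))) * Phi (dual_nome s) ^ k) \<le> exp \<bar>gam k\<bar> * exp 1 ^ k" if "s \<in> sector" "norm s \<le> 1" for s
    unfolding norm_mult norm_power by (intro mult_mono norm_exp_gam_le norm_Phi_dual_le that) auto
  have "((\<lambda>\<sigma>. exp (- (ray \<sigma> * of_real (gam k))) * Phi (dual_nome (ray \<sigma>)) ^ k) \<longlongrightarrow> 1 * 1 ^ k) at_bot"
    by (intro tendsto_mult tendsto_power exp_gam_ray_tendsto Phi_dual_ray_tendsto)
  then show "((\<lambda>\<sigma>. exp (- (ray \<sigma> * of_real (gam k))) * Phi (dual_nome (ray \<sigma>)) ^ k) \<longlongrightarrow> 1) at_bot" by simp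
  show "norm (H1 k s) \<le> exp (real k * (exp (- (1 / 2)) / (1 - exp (- (1 / 2))))) / cN k * norm s * exp (- (norm s / 2))" if s: "s \<in> sector" "norm s \<ge> 1" for s
  proof -
    define D where "D = exp (real k * (exp (- (1 / 2)) / (1 - exp (- (1 / 2)))))"
    have "norm (H1 k s) \<le> D * exp (- (norm s / 2)) / cN k"
      using Gk_far[OF s, of k] cN_pos[of k] by (simp add: H1_def norm_divide divide_right_mono D_def)
    also have "\<dots> = (D / cN k * exp (- (norm s / 2))) * 1" by simp
    also have "\<dots> \<le> (D / cN k * exp (- (norm s / 2))) * norm s" using s cN_pos[of k] by (intro mult_left_mono) (auto simp: D_def)
    finally show ?thesis by (simp add: D_def mult_ac)
  qed
qed (use cN_pos[of k] in auto)

text \<open>The Euler derivative s G'(s). The derivative of G (n t) in t is s G'(s) / t at s = n t,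
  so the differentiated series again samples one function. The division makes the limit in
  \<open>H_lim\<close> equal to 1.\<close>

definition H2 :: "nat \<Rightarrow> complex \<Rightarrow> complex" where "H2 k s = s * deriv (Gk k) s / of_real (cN k * bk k)"

definition B2 :: "nat \<Rightarrow> complex \<Rightarrow> complex" where
  "B2 k s = exp (- (s * of_real (gam k))) * ((1 - of_real (real k / 2 / bk k) * s - of_real (gam k / bk k) * s\<^sup>2) * Phi (dual_nome s) ^ k
     + of_real (4 * pi\<^sup>2 * real k / bk k) * Phi (dual_nome s) ^ (k - 1) * deriv Phi (dual_nome s) * dual_nome s)"

lemma halfplane_open: "open {s::complex. Re s > 0}" by (rule open_halfspace_Re_gt)

text \<open>Of the terms of the product rule, \<beta> / s^2 from exp (- \<beta> / s) dominates and
  becomes the 1 in \<open>B2\<close>; all others carry a power of s or the dual nome.\<close>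

lemma H2_rep:
  assumes k: "k \<ge> 1" and s: "Re s > 0"
  shows "H2 k s = exp (- (of_real (real k / 2 + 1) * Ln s) - of_real (bk k) / s) * B2 k s"
proof -
  have s0: "s \<noteq> 0" using s by auto
  define y where "y = dual_nome s"
  define e where "e = exp (- (of_real (real k / 2) * Ln s) - of_real (bk k) / s)"
  define X where "X = exp (- (s * complex_of_real (gam k)))"
  have yd: "(dual_nome has_field_derivative y * (of_real (4 * pi\<^sup>2) / s\<^sup>2)) (at s)"
    unfolding dual_nome_def[abs_def] y_def using s0 by (auto intro!: derivative_eq_intros simp: power2_eq_square dual_nome_def)
  have y1: "y \<in> ball 0 1" using norm_dual_nome_less[OF s] by (simp add: y_def)
  have Pd: "((\<lambda>s. Phi (dual_nome s)) has_field_derivative deriv Phi y * (y * (of_real (4 * pi\<^sup>2) / s\<^sup>2))) (at s)"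
  proof (rule DERIV_chain2[OF _ yd])
    show "(Phi has_field_derivative deriv Phi y) (at (dual_nome s))"
      using holomorphic_derivI[OF Phi_holomorphic open_ball y1] by (simp add: y_def)
  qed
  have ed: "((\<lambda>s. exp (- (of_real (real k / 2) * Ln s) - of_real (bk k) / s)) has_field_derivative e * (- of_real (real k / 2) / s + of_real (bk k) / s\<^sup>2)) (at s)"
    unfolding e_def using s s0 by (auto intro!: derivative_eq_intros simp: power2_eq_square complex_nonpos_Reals_iff inverse_eq_divide)
  have Xd: "((\<lambda>s. exp (- (s * complex_of_real (gam k)))) has_field_derivative X * - of_real (gam k)) (at s)"
    unfolding X_def by (auto intro!: derivative_eq_intros)
  define D where "D = of_real (cN k) * (e * (- of_real (real k / 2) / s + of_real (bk k) / s\<^sup>2)) * (X * Phi y ^ k)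
     + of_real (cN k) * e * (X * - of_real (gam k) * Phi y ^ k + X * (of_nat k * Phi y ^ (k - 1) * (deriv Phi y * (y * (of_real (4 * pi\<^sup>2) / s\<^sup>2)))))"
  have "((\<lambda>s. of_real (cN k) * exp (- (of_real (real k / 2) * Ln s) - of_real (bk k) / s) * (exp (- (s * of_real (gam k))) * Phi (dual_nome s) ^ k)) has_field_derivative D) (at s)"
  proof -
    have Pk: "((\<lambda>s. Phi (dual_nome s) ^ k) has_field_derivative of_nat k * (deriv Phi y * (y * (of_real (4 * pi\<^sup>2) / s\<^sup>2)) * Phi y ^ (k - Suc 0))) (at s)"
      using DERIV_power[OF Pd, of k] by (simp add: y_def)
    show ?thesis
      by (rule DERIV_cong[OF DERIV_mult[OF DERIV_cmult[OF ed, of "of_real (cN k)"] DERIV_mult[OF Xd Pk]]])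
         (simp add: D_def e_def X_def y_def mult_ac add_ac)
  qed
  then have "(Gk k has_field_derivative D) (at s)"
    by (rule has_field_derivative_transform_within_open[OF _ halfplane_open]) (use s Gk_modular in auto)
  then have dG: "deriv (Gk k) s = D" by (rule DERIV_imp_deriv)
  have ee: "exp (- (of_real (real k / 2 + 1) * Ln s) - of_real (bk k) / s) = e / s"
  proof -
    have "exp (- (of_real (real k / 2 + 1) * Ln s) - of_real (bk k) / s) = exp ((- (of_real (real k / 2) * Ln s) - of_real (bk k) / s) - Ln s)"
      by (intro arg_cong[of _ _ exp]) (simp add: algebra_simps)
    also have "\<dots> = e / s" using s0 by (simp add: exp_diff e_def)
    finally show ?thesis .
  qed
  have nz: "complex_of_real (cN k) \<noteq> 0" "complex_of_real (bk k) \<noteq> 0" using cN_pos[of k] bk_pos[OF k] by auto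
  define p where "p = Phi y ^ (k - 1)"
  have pk: "Phi y ^ k = p * Phi y" using k by (simp add: p_def power_eq_if)
  have "s * D / of_real (cN k * bk k) = e / s * (X * ((1 - of_real (real k / 2 / bk k) * s - of_real (gam k / bk k) * s\<^sup>2) * (p * Phi y)
     + of_real (4 * pi\<^sup>2 * real k / bk k) * p * deriv Phi y * y))"
    unfolding D_def pk p_def[symmetric] using nz s0 by (simp add: field_simps power2_eq_square)
  then show ?thesis unfolding H2_def dG ee B2_def y_def[symmetric] X_def[symmetric] pk p_def[symmetric] .
qed

lemma Gk_deriv:
  assumes s: "Re s > 0" shows "deriv (Gk k) s = - exp (- s) * deriv (coef k) (exp (- s))"
proof -
  have e1: "((\<lambda>s. exp (- s)) has_field_derivative - exp (- s)) (at s)" by (auto intro!: derivative_eq_intros)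
  have "((\<lambda>s. coef k (exp (- s))) has_field_derivative deriv (coef k) (exp (- s)) * - exp (- s)) (at s)"
    by (rule DERIV_chain2[OF holomorphic_derivI[OF coef_holomorphic open_ball] e1]) (use s in simp)
  then show ?thesis unfolding Gk_def[abs_def] by (simp add: DERIV_imp_deriv)
qed

lemma holomorphic_bounded_cball:
  assumes "f holomorphic_on ball 0 1" "r < 1"
  obtains M :: real where "M > 0" "\<And>x. norm x \<le> r \<Longrightarrow> norm (f x) \<le> M"
proof -
  have "continuous_on (cball 0 r) f"
    using assms by (intro holomorphic_on_imp_continuous_on holomorphic_on_subset[OF assms(1)]) auto
  then have "bounded (f ` cball 0 r)" by (intro compact_imp_bounded compact_continuous_image) auto
  then obtain M where "M > 0" "\<forall>y\<in>f ` cball 0 r. norm y \<le> M" unfolding bounded_pos by blast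
  then show ?thesis by (intro that[of M]) auto
qed

lemma sector_flat_H2: assumes k: "k \<ge> 1" shows "\<exists>K. sector_flat (H2 k) (real k / 2 + 1) (bk k) K (1 / 8)"
proof -
  have dPhi: "deriv Phi holomorphic_on ball 0 1" by (intro holomorphic_deriv Phi_holomorphic open_ball)
  have dcoef: "deriv (coef k) holomorphic_on ball 0 1" by (intro holomorphic_deriv coef_holomorphic open_ball)
  obtain M1 where M1: "M1 > 0" "\<And>x. norm x \<le> 1/2 \<Longrightarrow> norm (deriv Phi x) \<le> M1"
    by (rule holomorphic_bounded_cball[OF dPhi, of "1/2"]) auto
  \<comment> \<open>For |s| \<ge> 1 in the sector Re s \<ge> |s| / 2 \<ge> 1/2, hence |exp (- s)|
    \<le> exp (- 1/2).\<close>
  obtain M2 where M2: "M2 > 0" "\<And>x. norm x \<le> exp (- (1/2)) \<Longrightarrow> norm (deriv (coef k) x) \<le> M2"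
    by (rule holomorphic_bounded_cball[OF dcoef, of "exp (- (1/2))"]) auto
  define a1 where "a1 = \<bar>real k / 2 / bk k\<bar>"
  define a2 where "a2 = \<bar>gam k / bk k\<bar>"
  define a3 where "a3 = 4 * pi\<^sup>2 * real k / bk k"
  have a: "a1 \<ge> 0" "a2 \<ge> 0" "a3 \<ge> 0" using bk_pos[OF k] by (auto simp: a1_def a2_def a3_def)
  define K1 where "K1 = exp \<bar>gam k\<bar> * ((1 + a1 + a2) * exp 1 ^ k + a3 * exp 1 ^ (k - 1) * M1)"
  have K1: "K1 > 0" unfolding K1_def using a M1 by (intro mult_pos_pos add_pos_nonneg) auto
  have cb: "cN k * bk k > 0" using cN_pos[of k] bk_pos[OF k] by simp
  show ?thesis
  proof (rule sector_flatI[where B = "B2 k" and ?K1.0 = K1 and ?K2.0 = "M2 / (cN k * bk k)"])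
    show "H2 k holomorphic_on {s. Re s > 0}" unfolding H2_def[abs_def]
      using cb by (intro holomorphic_intros holomorphic_deriv[OF Gk_holo halfplane_open]) auto
    show "H2 k (cnj s) = cnj (H2 k s)" if s: "Re s > 0" for s
    proof -
      have "(Gk k has_field_derivative deriv (Gk k) s) (at s)"
        using s by (intro holomorphic_derivI[OF Gk_holo halfplane_open]) auto
      then have "(cnj \<circ> Gk k \<circ> cnj has_field_derivative cnj (deriv (Gk k) s)) (at (cnj s))"
        by (intro has_field_derivative_cnj_cnj) simp
      then have "(Gk k has_field_derivative cnj (deriv (Gk k) s)) (at (cnj s))"
        by (rule has_field_derivative_transform_within_open[OF _ halfplane_open]) (use s Gk_cnj in \<open>auto simp: Gk_cnj\<close>)
      then have "deriv (Gk k) (cnj s) = cnj (deriv (Gk k) s)" by (rule DERIV_imp_deriv)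
      then show ?thesis by (simp add: H2_def)
    qed
    show "bk k > 0" by (rule bk_pos[OF k])
    show "H2 k s = exp (- (of_real (real k / 2 + 1) * Ln s) - of_real (bk k) / s) * B2 k s" if "Re s > 0" for s
      by (rule H2_rep[OF k that])
    show "norm (B2 k s) \<le> K1" if s: "s \<in> sector" "norm s \<le> 1" for s
    proof -
      have y: "norm (dual_nome s) \<le> 1/2" by (rule norm_dual_nome_le[OF s])
      have t1: "norm (1 - of_real (real k / 2 / bk k) * s - of_real (gam k / bk k) * s\<^sup>2) \<le> 1 + a1 + a2"
      proof -
        have "norm (1 - of_real (real k / 2 / bk k) * s - of_real (gam k / bk k) * s\<^sup>2) \<le> norm (1 - of_real (real k / 2 / bk k) * s) + norm (of_real (gam k / bk k) * s\<^sup>2)"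
          by (rule norm_triangle_ineq4)
        also have "norm (1 - of_real (real k / 2 / bk k) * s) \<le> norm (1::complex) + norm (of_real (real k / 2 / bk k) * s)"
          by (rule norm_triangle_ineq4)
        also have "norm (of_real (real k / 2 / bk k) * s) \<le> a1"
          unfolding norm_mult norm_of_real a1_def using s by (intro mult_left_le) auto
        also have "norm (of_real (gam k / bk k) * s\<^sup>2) \<le> a2"
          unfolding norm_mult norm_of_real norm_power a2_def using s by (intro mult_left_le power_le_one) auto
        finally show ?thesis by simp
      qed
      have t3: "norm (of_real (4 * pi\<^sup>2 * real k / bk k) * Phi (dual_nome s) ^ (k - 1) * deriv Phi (dual_nome s) * dual_nome s) \<le> a3 * exp 1 ^ (k - 1) * M1 * 1"
        unfolding norm_mult norm_power norm_of_real
      proof (intro mult_mono norm_Phi_dual_le s M1 y)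
        show "\<bar>4 * pi\<^sup>2 * real k / bk k\<bar> \<le> a3" using a by (simp add: a3_def)
        show "norm (dual_nome s) \<le> 1" using y by simp
      qed (use a M1 in auto)
      have "norm (B2 k s) \<le> exp \<bar>gam k\<bar> * ((1 + a1 + a2) * exp 1 ^ k + a3 * exp 1 ^ (k - 1) * M1 * 1)"
        unfolding B2_def norm_mult[of "exp (- (s * of_real (gam k)))"]
      proof (intro mult_mono norm_exp_gam_le s order_trans[OF norm_triangle_ineq] add_mono t3)
        show "norm ((1 - of_real (real k / 2 / bk k) * s - of_real (gam k / bk k) * s\<^sup>2) * Phi (dual_nome s) ^ k) \<le> (1 + a1 + a2) * exp 1 ^ k"
          unfolding norm_mult norm_power using a by (intro mult_mono t1 norm_Phi_dual_le s) auto
      qed auto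
      then show ?thesis by (simp add: K1_def)
    qed
    have "((B2 k \<circ> ray) \<longlongrightarrow> 1 * ((1 - of_real (real k / 2 / bk k) * 0 - of_real (gam k / bk k) * 0\<^sup>2) * 1 ^ k
     + of_real (4 * pi\<^sup>2 * real k / bk k) * 1 ^ (k - 1) * deriv Phi 0 * 0)) at_bot"
      unfolding B2_def o_def
    proof (intro tendsto_intros exp_gam_ray_tendsto Phi_dual_ray_tendsto ray_tendsto_0 dual_nome_ray_tendsto)
      have "isCont (deriv Phi) 0"
        using holomorphic_on_imp_continuous_on[OF dPhi] by (simp add: continuous_on_eq_continuous_at)
      then show "((\<lambda>\<sigma>. deriv Phi (dual_nome (ray \<sigma>))) \<longlongrightarrow> deriv Phi 0) at_bot"
        by (rule isCont_tendsto_compose[OF _ dual_nome_ray_tendsto])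
    qed
    then show "((\<lambda>\<sigma>. B2 k (ray \<sigma>)) \<longlongrightarrow> 1) at_bot" by (simp add: o_def)
    show "norm (H2 k s) \<le> M2 / (cN k * bk k) * norm s * exp (- (norm s / 2))" if s: "s \<in> sector" "norm s \<ge> 1" for s
    proof -
      have e: "norm (exp (- s)) \<le> exp (- (norm s / 2))" by (rule norm_exp_sector_le[OF s(1)])
      also have "\<dots> \<le> exp (- (1 / 2))" using s by simp
      finally have "norm (deriv (coef k) (exp (- s))) \<le> M2" by (rule M2)
      then have "norm (exp (- s)) * norm (deriv (coef k) (exp (- s))) \<le> exp (- (norm s / 2)) * M2"
        by (intro mult_mono e) auto
      then have "norm (deriv (Gk k) s) \<le> exp (- (norm s / 2)) * M2"
        using Gk_deriv[of s k] sector_Re_ge(1)[OF s(1)] by (simp add: norm_mult)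
      then have "norm s * norm (deriv (Gk k) s) / (cN k * bk k) \<le> norm s * (exp (- (norm s / 2)) * M2) / (cN k * bk k)"
        using cb by (intro divide_right_mono mult_left_mono) auto
      moreover have "norm (complex_of_real (cN k * bk k)) = cN k * bk k" using cb by (simp only: norm_of_real abs_of_pos)
      ultimately show ?thesis unfolding H2_def norm_divide norm_mult by (simp add: mult_ac)
    qed
  qed (use K1 M2 cb in auto)
qed

section \<open>Limits at one\<close>

lemma exp_nome_power: "complex_of_real (exp (- t)) ^ n = exp (- of_real (real n * t))"
  by (simp flip: exp_of_nat_mult exp_of_real)

lemma coef_exp_Gk: "coef k (complex_of_real (exp (- t)) ^ n) = Gk k (of_real (real n * t))"
  by (simp add: Gk_def exp_nome_power)

text \<open>Both functions have the same \<beta>, hence the same saddle and the same \<Lambda>.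
  Their exponents differ by one, which turns the phase by pi / 4 (\<open>F2_phase\<close>) and
  multiplies the amplitude by \<Lambda> / \<beta> (\<open>F2_amp\<close>).\<close>

locale two_flat = F1: sector_flat "H1 k" "real k / 2" "bk k" K1 "1 / 8" +
    F2: sector_flat "H2 k" "real k / 2 + 1" "bk k" K2 "1 / 8" for k :: nat and K1 K2 +
  fixes a :: nat
  assumes a2: "a \<ge> 2" and k1: "k \<ge> 1"
begin

lemma a_pos: "real a > 0" "a \<ge> 1" "0 < 1 / real a" "1 / real a \<le> 1" using a2 by auto

lemma exp_theta_power: "exp (\<i> * complex_of_real \<theta>) ^ m = exp (\<i> * of_real \<theta> * of_nat m)"
  by (simp add: mult.commute flip: exp_of_nat_mult)

text \<open>From (a m + 1) t = a t (m + 1 / a): with step P = a t the numerator has the shift r = 1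
  / a and the denominator r = 1. Nothing else distinguishes them.\<close>

lemma J_num_S:
  assumes t: "t > 0" and \<theta>: "0 \<le> \<theta>" "\<theta> \<le> 2 * pi"
  shows "J_num a k (exp (\<i> * of_real \<theta>)) (of_real (exp (- t))) = of_real (cN k) * F1.S \<theta> (1 / real a) (real a * t)"
proof -
  have "exp (\<i> * of_real \<theta>) ^ m * coef k (complex_of_real (exp (- t)) ^ (a * m + 1))
     = of_real (cN k) * (exp (\<i> * of_real \<theta> * of_nat m) * H1 k (of_real (real a * t * (real m + 1 / real a))))" for m
  proof -
    have e: "real (a * m + 1) * t = real a * t * (real m + 1 / real a)" using a_pos by (simp add: field_simps)
    show ?thesis unfolding coef_exp_Gk H1_def exp_theta_power e using cN_pos[of k] by simp
  qed
  moreover have "(\<Sum>m. of_real (cN k) * (exp (\<i> * of_real \<theta> * of_nat m) * H1 k (of_real (real a * t * (real m + 1 / real a))))) = of_real (cN k) * F1.S \<theta> (1 / real a) (real a * t)"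
    unfolding F1.S_def by (rule suminf_mult[OF sums_summable[OF F1.H_sums]]) (use t a_pos \<theta> in auto)
  ultimately show ?thesis unfolding J_num_coef by (simp only:)
qed

lemma J_den_S:
  assumes t: "t > 0" and \<theta>: "0 \<le> \<theta>" "\<theta> \<le> 2 * pi"
  shows "J_den a k (exp (\<i> * of_real \<theta>)) (of_real (exp (- t))) = of_real (cN k) * F1.S \<theta> 1 (real a * t)"
proof -
  have "exp (\<i> * of_real \<theta>) ^ m * coef k (complex_of_real (exp (- t)) ^ (a * (m + 1)))
     = of_real (cN k) * (exp (\<i> * of_real \<theta> * of_nat m) * H1 k (of_real (real a * t * (real m + 1))))" for m
  proof -
    have e: "real (a * (m + 1)) * t = real a * t * (real m + 1)" by (simp add: field_simps)
    show ?thesis unfolding coef_exp_Gk H1_def exp_theta_power e using cN_pos[of k] by simp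
  qed
  moreover have "(\<Sum>m. of_real (cN k) * (exp (\<i> * of_real \<theta> * of_nat m) * H1 k (of_real (real a * t * (real m + 1))))) = of_real (cN k) * F1.S \<theta> 1 (real a * t)"
    unfolding F1.S_def by (rule suminf_mult[OF sums_summable[OF F1.H_sums]]) (use t a_pos \<theta> in auto)
  ultimately show ?thesis unfolding J_den_coef by (simp only:)
qed

text \<open>At q = exp (- t) one has d/dq = - (1 / q) d/dt, and d/dt of a term yields s G'(s) / t
  with s = a t (m + 1). So the derivative of the denominator is again a sum of the type
  \<open>S\<close>, for \<open>H2\<close>.\<close>

lemma J_den_deriv:
  assumes t: "t > 0" and \<theta>: "0 \<le> \<theta>" "\<theta> \<le> 2 * pi"
  shows "(J_den a k (exp (\<i> * of_real \<theta>)) has_field_derivative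
      - (of_real (cN k * bk k / (t * exp (- t))) * F2.S \<theta> 1 (real a * t))) (at (of_real (exp (- t))))"
proof -
  define z where "z = exp (\<i> * complex_of_real \<theta>)"
  define q where "q = complex_of_real (exp (- t))"
  have nq: "norm q < 1" using t by (simp add: q_def)
  have q0: "q \<noteq> 0" by (simp add: q_def)
  have J: "J_den a k z = (\<lambda>q. \<Sum>m. z ^ m * coef k (q ^ (a * m + a)))"
    by (simp add: J_den_coef[abs_def] algebra_simps)
  have der: "(J_den a k z has_field_derivative (\<Sum>m. z ^ m * deriv (\<lambda>q. coef k (q ^ (a * m + a))) q)) (at q)"
    unfolding J by (rule coef_series_holomorphic(2)) (use a_pos nq in \<open>auto simp: z_def\<close>)
  have tm: "z ^ m * deriv (\<lambda>q. coef k (q ^ (a * m + a))) q =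
      - of_real (cN k * bk k / (t * exp (- t))) * (exp (\<i> * of_real \<theta> * of_nat m) * H2 k (of_real (real a * t * (real m + 1))))" for m
  proof -
    define n where "n = a * m + a"
    have n: "n \<ge> 1" using a_pos by (simp add: n_def)
    define s where "s = complex_of_real (real n * t)"
    have s: "Re s > 0" "s \<noteq> 0" using n t by (auto simp: s_def)
    have qn: "q ^ n = exp (- s)" unfolding q_def s_def by (rule exp_nome_power)
    have "((\<lambda>q. coef k (q ^ n)) has_field_derivative deriv (coef k) (q ^ n) * (of_nat n * q ^ (n - 1))) (at q)"
    proof (rule DERIV_chain2[where f = "coef k"])
      show "(coef k has_field_derivative deriv (coef k) (q ^ n)) (at (q ^ n))"
        by (rule holomorphic_derivI[OF coef_holomorphic open_ball]) (use s in \<open>simp add: qn\<close>)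
      show "((\<lambda>q. q ^ n) has_field_derivative of_nat n * q ^ (n - 1)) (at q)"
        by (auto intro!: derivative_eq_intros)
    qed
    then have "deriv (\<lambda>q. coef k (q ^ n)) q = deriv (coef k) (q ^ n) * (of_nat n * q ^ (n - 1))" by (rule DERIV_imp_deriv)
    also have "q ^ (n - 1) = q ^ n / q" using q0 n by (simp add: power_diff)
    also have "deriv (coef k) (q ^ n) * (of_nat n * (q ^ n / q)) = of_nat n / q * (exp (- s) * deriv (coef k) (exp (- s)))"
      by (simp add: qn)
    also have "exp (- s) * deriv (coef k) (exp (- s)) = - deriv (Gk k) s" using Gk_deriv[OF s(1), of k] by simp
    also have "deriv (Gk k) s = H2 k s * of_real (cN k * bk k) / s"
      using s cN_pos[of k] bk_pos[OF k1] by (simp add: H2_def)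
    also have "of_nat n / q * - (H2 k s * of_real (cN k * bk k) / s) = - of_real (cN k * bk k / (t * exp (- t))) * H2 k s"
      using t n q0 by (simp add: s_def q_def field_simps)
    finally have d: "deriv (\<lambda>q. coef k (q ^ n)) q = - of_real (cN k * bk k / (t * exp (- t))) * H2 k s" .
    have "real n * t = real a * t * (real m + 1)" by (simp add: n_def algebra_simps)
    then have s_eq: "s = of_real (real a * t * (real m + 1))" unfolding s_def by (simp only:)
    show ?thesis using d unfolding n_def s_eq z_def exp_theta_power by (simp only: mult_ac)
  qed
  have "(\<Sum>m. z ^ m * deriv (\<lambda>q. coef k (q ^ (a * m + a))) q) = - of_real (cN k * bk k / (t * exp (- t))) * F2.S \<theta> 1 (real a * t)"
    unfolding tm F2.S_def by (rule suminf_mult[OF sums_summable[OF F2.H_sums]]) (use t a_pos \<theta> in auto)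
  then show ?thesis using der by (simp add: z_def q_def)
qed

definition Lam :: "real \<Rightarrow> real \<Rightarrow> real" where "Lam \<theta> t = sqrt (bk k * \<theta> / (real a * t))"

lemma Lam_props:
  assumes "\<theta> > 0"
  shows "filterlim (Lam \<theta>) at_top (at_right 0)" "t > 0 \<Longrightarrow> bk k * \<theta> / (Lam \<theta> t)\<^sup>2 = real a * t" "t > 0 \<Longrightarrow> Lam \<theta> t > 0"
proof -
  show "filterlim (Lam \<theta>) at_top (at_right 0)"
    unfolding Lam_def using bk_pos[OF k1] a_pos(1) assms by real_asymp
  show "bk k * \<theta> / (Lam \<theta> t)\<^sup>2 = real a * t" "Lam \<theta> t > 0" if "t > 0"
    using that bk_pos[OF k1] a_pos assms by (simp_all add: Lam_def)
qed

text \<open>At frequency 0 all terms of the sum in \<open>S_0_limit\<close> are positive, and the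
  number of sample points in [1, 2] grows like 1 / P; this bounds the limit away from 0.\<close>

lemma mass_nonzero: "F1.mass \<noteq> 0"
proof
  assume z: "F1.mass = 0"
  have "((\<lambda>P. Re (of_real P * F1.S 0 1 P)) \<longlongrightarrow> Re 0) (at_right 0)"
    using F1.S_0_limit[of 1] z by (intro tendsto_Re) simp
  moreover have "filterlim (\<lambda>n. 1 / (real n + 1)) (at_right 0) sequentially" by real_asymp
  ultimately have lim: "(\<lambda>n. Re (of_real (1 / (real n + 1)) * F1.S 0 1 (1 / (real n + 1)))) \<longlonglongrightarrow> 0"
    using filterlim_compose by fastforce
  define f where "f = (\<lambda>x. rcoef k (exp (- x)) / cN k)"
  have H1f: "H1 k (of_real x) = of_real (f x)" if "x > 0" for x
  proof -
    have "coef k (complex_of_real (exp (- x))) = of_real (rcoef k (exp (- x)))" using that by (intro coef_of_real) simp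
    then show ?thesis by (simp add: H1_def Gk_def f_def exp_of_real[symmetric])
  qed
  have fpos: "f x > 0" if "x > 0" for x using that rcoef_pos[of "exp (- x)" k] cN_pos[of k] by (simp add: f_def)
  have "continuous_on {1..2} f"
    unfolding f_def rcoef_def using cN_pos[of k]
    by (intro continuous_intros continuous_on_compose2[OF phi_continuous]) auto
  then obtain x0 where x0: "x0 \<in> {1..2}" "\<And>x. x \<in> {1..2} \<Longrightarrow> f x0 \<le> f x"
    using continuous_attains_inf[of "{1..2::real}" f] by auto
  have "f x0 \<le> Re (of_real (1 / (real n + 1)) * F1.S 0 1 (1 / (real n + 1)))" for n
  proof -
    define P where "P = 1 / (real n + 1)"
    have P: "P > 0" by (simp add: P_def)
    have sm: "summable (\<lambda>m. exp (\<i> * of_real 0 * of_nat m) * H1 k (of_real (P * (real m + 1))))"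
      by (rule sums_summable[OF F1.H_sums]) (use P in auto)
    have tm: "exp (\<i> * of_real 0 * of_nat m) * H1 k (of_real (P * (real m + 1))) = of_real (f (P * (real m + 1)))" for m
      using H1f[of "P * (real m + 1)"] P by simp
    have sr: "summable (\<lambda>m. f (P * (real m + 1)))" using sm unfolding tm by (simp only: summable_of_real_iff)
    have "F1.S 0 1 P = (\<Sum>m. complex_of_real (f (P * (real m + 1))))" unfolding F1.S_def tm ..
    then have S: "Re (F1.S 0 1 P) = (\<Sum>m. f (P * (real m + 1)))" by (simp only: suminf_of_real[OF sr, symmetric] Re_complex_of_real)
    \<comment> \<open>With P = 1 / (n + 1) these n + 2 indices are exactly those for which P (m + 1)
      lies between 1 and 2.\<close>
    have "(\<Sum>m\<in>{n..<2*n+2}. f x0) \<le> (\<Sum>m\<in>{n..<2*n+2}. f (P * (real m + 1)))"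
    proof (rule sum_mono)
      fix m assume "m \<in> {n..<2*n+2}"
      then have "real n \<le> real m" "real m \<le> 2 * real n + 1" by auto
      then have "P * (real m + 1) \<in> {1..2}" by (simp add: P_def field_simps)
      then show "f x0 \<le> f (P * (real m + 1))" by (rule x0(2))
    qed
    also have "\<dots> \<le> (\<Sum>m. f (P * (real m + 1)))" 
    proof (rule sum_le_suminf[OF sr])
      show "0 \<le> f (P * (real m + 1))" for m using fpos[of "P * (real m + 1)"] P by (simp add: less_imp_le)
    qed simp
    finally have "(real n + 2) * f x0 \<le> Re (F1.S 0 1 P)" unfolding S by (simp add: algebra_simps)
    moreover have "f x0 > 0" using x0 by (intro fpos) auto
    ultimately have "(real n + 1) * f x0 \<le> Re (F1.S 0 1 P)" by (simp add: algebra_simps)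
    then have "P * ((real n + 1) * f x0) \<le> P * Re (F1.S 0 1 P)" using P by (intro mult_left_mono) auto
    then show ?thesis by (simp add: P_def)
  qed
  then have "f x0 \<le> 0" by (intro LIMSEQ_le_const[OF lim]) auto
  moreover have "f x0 > 0" using x0 by (intro fpos) auto
  ultimately show False by simp
qed

text \<open>Numerator and denominator share the normaliser \<open>N\<close> and the constant
  \<open>L\<close>, in the regime \<theta> = 0 as well as for \<theta> > 0; what remains of the
  quotient is exp (- \<i> \<theta> / a) / exp (- \<i> \<theta>).\<close>

lemma J_limit_upper:
  assumes \<theta>: "0 \<le> \<theta>" "\<theta> < pi"
  shows "\<forall>\<^sub>F t in at_right 0. J_den a k (exp (\<i> * of_real \<theta>)) (of_real (exp (- t))) \<noteq> 0"
    and "((\<lambda>t. J a k (exp (\<i> * of_real \<theta>)) (of_real (exp (- t)))) \<longlongrightarrow> exp (\<i> * of_real (\<theta> * (1 - 1 / real a)))) (at_right 0)"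
proof -
  have c0: "complex_of_real (cN k) \<noteq> 0" using cN_pos[of k] by simp
  obtain N :: "real \<Rightarrow> complex" and L where L: "L \<noteq> 0" and Nnz: "\<And>t. t > 0 \<Longrightarrow> N t \<noteq> 0"
    and lim: "\<And>r. 0 < r \<Longrightarrow> r \<le> 1 \<Longrightarrow> ((\<lambda>t. F1.S \<theta> r (real a * t) / N t) \<longlongrightarrow> exp (- (\<i> * of_real (\<theta> * r))) * L) (at_right 0)"
  proof (cases "\<theta> = 0")
    case True
    have fl: "filterlim (\<lambda>t. real a * t) (at_right 0) (at_right 0)" using a_pos(1) by real_asymp
    show ?thesis
    proof (rule that[of F1.mass "\<lambda>t. 1 / of_real (real a * t)"])
      show "F1.mass \<noteq> 0" by (rule mass_nonzero)
      show "1 / complex_of_real (real a * t) \<noteq> 0" if "t > 0" for t using that a_pos by simp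
      fix r :: real assume r: "0 < r" "r \<le> 1"
      have "((\<lambda>t. of_real (real a * t) * F1.S 0 r (real a * t)) \<longlongrightarrow> F1.mass) (at_right 0)"
        by (rule filterlim_compose[OF F1.S_0_limit[OF r] fl])
      then show "((\<lambda>t. F1.S \<theta> r (real a * t) / (1 / of_real (real a * t))) \<longlongrightarrow> exp (- (\<i> * of_real (\<theta> * r))) * F1.mass) (at_right 0)"
        using True by (simp add: mult.commute)
    qed
  next
    case False
    then have \<theta>0: "\<theta> > 0" using \<theta> by simp
    show ?thesis
    proof (rule that[of fresnel "\<lambda>t. F1.Nrm \<theta> (Lam \<theta> t)"])
      show "fresnel \<noteq> 0" by (rule fresnel_nonzero)
      show "F1.Nrm \<theta> (Lam \<theta> t) \<noteq> 0" if "t > 0" for t using Lam_props(3)[OF \<theta>0 that] by (rule F1.Nrm_nonzero)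
      fix r :: real assume r: "0 < r" "r \<le> 1"
      have "((\<lambda>t. F1.S \<theta> r (bk k * \<theta> / (Lam \<theta> t)\<^sup>2) / F1.Nrm \<theta> (Lam \<theta> t)) \<longlongrightarrow> exp (- (\<i> * of_real (\<theta> * r))) * fresnel) (at_right 0)"
        by (rule filterlim_compose[OF F1.S_asymptotics[OF \<theta>0 \<theta>(2) r] Lam_props(1)[OF \<theta>0]])
      moreover have "\<forall>\<^sub>F t in at_right 0. F1.S \<theta> r (bk k * \<theta> / (Lam \<theta> t)\<^sup>2) / F1.Nrm \<theta> (Lam \<theta> t) = F1.S \<theta> r (real a * t) / F1.Nrm \<theta> (Lam \<theta> t)"
        using eventually_at_right_less[of "0::real"] by eventually_elim (simp only: Lam_props(2)[OF \<theta>0])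
      ultimately show "((\<lambda>t. F1.S \<theta> r (real a * t) / F1.Nrm \<theta> (Lam \<theta> t)) \<longlongrightarrow> exp (- (\<i> * of_real (\<theta> * r))) * fresnel) (at_right 0)"
        by (rule Lim_transform_eventually)
    qed
  qed
  have l1: "((\<lambda>t. F1.S \<theta> 1 (real a * t) / N t) \<longlongrightarrow> exp (- (\<i> * of_real (\<theta> * 1))) * L) (at_right 0)" by (rule lim) auto
  have la: "((\<lambda>t. F1.S \<theta> (1 / real a) (real a * t) / N t) \<longlongrightarrow> exp (- (\<i> * of_real (\<theta> * (1 / real a)))) * L) (at_right 0)"
    by (rule lim) (use a_pos in auto)
  have "exp (- (\<i> * of_real (\<theta> * 1))) * L \<noteq> 0" using L by simp
  then have ev: "\<forall>\<^sub>F t in at_right 0. F1.S \<theta> 1 (real a * t) / N t \<noteq> 0"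
    by (rule tendsto_imp_eventually_ne[OF l1])
  show "\<forall>\<^sub>F t in at_right 0. J_den a k (exp (\<i> * of_real \<theta>)) (of_real (exp (- t))) \<noteq> 0"
    using ev eventually_at_right_less[of "0::real"]
  proof eventually_elim
    case (elim t)
    then show ?case using J_den_S[of t \<theta>] \<theta> c0 pi_gt_zero by auto
  qed
  have "((\<lambda>t. (F1.S \<theta> (1 / real a) (real a * t) / N t) / (F1.S \<theta> 1 (real a * t) / N t)) \<longlongrightarrow>
     (exp (- (\<i> * of_real (\<theta> * (1 / real a)))) * L) / (exp (- (\<i> * of_real (\<theta> * 1))) * L)) (at_right 0)"
    by (intro tendsto_divide la l1) (use L in simp)
  also have "(exp (- (\<i> * of_real (\<theta> * (1 / real a)))) * L) / (exp (- (\<i> * of_real (\<theta> * 1))) * L) = exp (\<i> * of_real (\<theta> * (1 - 1 / real a)))"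
  proof -
    have "exp (- (\<i> * of_real (\<theta> * (1 / real a)))) / exp (- (\<i> * of_real (\<theta> * 1))) = exp (\<i> * of_real (\<theta> * (1 - 1 / real a)))"
      unfolding exp_diff[symmetric] by (intro arg_cong[of _ _ exp]) (simp add: algebra_simps)
    then show ?thesis using L by simp
  qed
  finally have r: "((\<lambda>t. (F1.S \<theta> (1 / real a) (real a * t) / N t) / (F1.S \<theta> 1 (real a * t) / N t)) \<longlongrightarrow> exp (\<i> * of_real (\<theta> * (1 - 1 / real a)))) (at_right 0)" .
  show "((\<lambda>t. J a k (exp (\<i> * of_real \<theta>)) (of_real (exp (- t)))) \<longlongrightarrow> exp (\<i> * of_real (\<theta> * (1 - 1 / real a)))) (at_right 0)"
  proof (rule Lim_transform_eventually[OF r])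
    show "\<forall>\<^sub>F t in at_right 0. (F1.S \<theta> (1 / real a) (real a * t) / N t) / (F1.S \<theta> 1 (real a * t) / N t) = J a k (exp (\<i> * of_real \<theta>)) (of_real (exp (- t)))"
      using eventually_at_right_less[of "0::real"]
    proof eventually_elim
      case (elim t)
      have "\<theta> \<le> 2 * pi" using \<theta> pi_gt_zero by linarith
      then show ?case unfolding J_def J_num_S[OF elim \<theta>(1) \<open>\<theta> \<le> 2 * pi\<close>] J_den_S[OF elim \<theta>(1) \<open>\<theta> \<le> 2 * pi\<close>]
        using c0 Nnz[OF elim] by simp
    qed
  qed
qed

lemma coef_cnj: "norm x < 1 \<Longrightarrow> coef k (cnj x) = cnj (coef k x)"
  by (simp add: coef_def Phi_cnj)

lemma J_cnj:
  assumes z: "norm z \<le> 1" and x: "0 < x" "x < 1"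
  shows "J_num a k (cnj z) (of_real x) = cnj (J_num a k z (of_real x))" "J_den a k (cnj z) (of_real x) = cnj (J_den a k z (of_real x))"
proof -
  have c: "coef k (complex_of_real x ^ n) = cnj (coef k (complex_of_real x ^ n))" if "n \<ge> 1" for n
  proof -
    have "norm (complex_of_real x ^ n) < 1" using x that by (simp add: norm_power power_less_one_iff)
    from coef_cnj[OF this] show ?thesis by simp
  qed
  have zx: "norm (complex_of_real x) < 1" "norm z * norm (complex_of_real x) ^ a < 1" "norm (cnj z) * norm (complex_of_real x) ^ a < 1"
  proof -
    have "norm z * x ^ a \<le> 1 * x ^ a" using z x by (intro mult_right_mono) auto
    also have "\<dots> < 1" using x a_pos by (simp add: power_less_one_iff)
    finally show "norm (complex_of_real x) < 1" "norm z * norm (complex_of_real x) ^ a < 1" "norm (cnj z) * norm (complex_of_real x) ^ a < 1"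
      using x by auto
  qed
  have "(\<lambda>m. cnj (coef k (complex_of_real x ^ (a * m + 1)) * z ^ m)) sums cnj (J_num a k z (of_real x))"
    using J_num_in_z[OF zx(1,2) a_pos(2), of k] by (simp only: sums_cnj)
  moreover have "cnj (coef k (complex_of_real x ^ (a * m + 1)) * z ^ m) = coef k (complex_of_real x ^ (a * m + 1)) * cnj z ^ m" for m
    using c[of "a * m + 1"] by simp
  ultimately have "(\<lambda>m. coef k (complex_of_real x ^ (a * m + 1)) * cnj z ^ m) sums cnj (J_num a k z (of_real x))" by (simp only:)
  then show "J_num a k (cnj z) (of_real x) = cnj (J_num a k z (of_real x))"
    using J_num_in_z[OF zx(1,3) a_pos(2), of k] by (simp only: sums_unique2)
  have "(\<lambda>m. cnj (coef k (complex_of_real x ^ (a * (m + 1))) * z ^ m)) sums cnj (J_den a k z (of_real x))"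
    using J_den_in_z[OF zx(1,2) a_pos(2), of k] by (simp only: sums_cnj)
  moreover have "cnj (coef k (complex_of_real x ^ (a * (m + 1))) * z ^ m) = coef k (complex_of_real x ^ (a * (m + 1))) * cnj z ^ m" for m
    using c[of "a * (m + 1)"] a_pos by simp
  ultimately have "(\<lambda>m. coef k (complex_of_real x ^ (a * (m + 1))) * cnj z ^ m) sums cnj (J_den a k z (of_real x))" by (simp only:)
  then show "J_den a k (cnj z) (of_real x) = cnj (J_den a k z (of_real x))"
    using J_den_in_z[OF zx(1,3) a_pos(2), of k] by (simp only: sums_unique2)
qed

text \<open>The coefficients are real at real q, so conjugate z give conjugate values and the lower
  half circle follows. It matters that the argument is the principal one, as 1 - 1 / a is not an
  integer.\<close>

lemma J_limit:
  assumes z: "norm z = 1" "z \<noteq> - 1"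
  shows "\<forall>\<^sub>F x in at_left 1. J_den a k z (of_real x) \<noteq> 0"
    and "((\<lambda>x. J a k z (of_real x)) \<longlongrightarrow> exp (\<i> * of_real (Arg z * (1 - 1 / real a)))) (at_left 1)"
proof -
  define \<theta> where "\<theta> = \<bar>Arg z\<bar>"
  have z0: "z \<noteq> 0" using z by auto
  have zA: "z = exp (\<i> * of_real (Arg z))" using Arg_eq[OF z0] z by simp
  have "\<bar>Arg z\<bar> \<noteq> pi"
  proof
    assume "\<bar>Arg z\<bar> = pi"
    then have "Arg z = pi" using mpi_less_Arg[of z] by linarith
    then have "z = exp (\<i> * of_real pi)" using zA by simp
    then show False using z by (simp add: exp_Euler mult.commute)
  qed
  then have \<theta>: "0 \<le> \<theta>" "\<theta> < pi" using mpi_less_Arg[of z] Arg_le_pi[of z] by (auto simp: \<theta>_def abs_if)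
  define w where "w = exp (\<i> * of_real \<theta>)"
  have fl: "filterlim (\<lambda>x::real. - ln x) (at_right 0) (at_left 1)" by real_asymp
  have ev: "\<forall>\<^sub>F x in at_left (1::real). 0 < x \<and> x < 1"
    using eventually_at_left_real[of 0 "1::real"] by (auto elim: eventually_mono)
  have d1: "\<forall>\<^sub>F x in at_left 1. J_den a k w (of_real x) \<noteq> 0"
    using eventually_compose_filterlim[OF J_limit_upper(1)[OF \<theta>] fl] ev by eventually_elim (simp add: w_def)
  have l1: "((\<lambda>x. J a k w (of_real x)) \<longlongrightarrow> exp (\<i> * of_real (\<theta> * (1 - 1 / real a)))) (at_left 1)"
  proof (rule Lim_transform_eventually[OF filterlim_compose[OF J_limit_upper(2)[OF \<theta>] fl]])
    show "\<forall>\<^sub>F x in at_left 1. J a k (exp (\<i> * of_real \<theta>)) (of_real (exp (- (- ln x)))) = J a k w (of_real x)"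
      using ev by eventually_elim (simp add: w_def)
  qed
  have goal: "(\<forall>\<^sub>F x in at_left 1. J_den a k z (of_real x) \<noteq> 0) \<and>
     ((\<lambda>x. J a k z (of_real x)) \<longlongrightarrow> exp (\<i> * of_real (Arg z * (1 - 1 / real a)))) (at_left 1)"
  proof (cases "Arg z \<ge> 0")
    case True
    then have "\<theta> = Arg z" by (simp add: \<theta>_def)
    then show ?thesis using d1 l1 zA by (simp add: w_def)
  next
    case False
    then have \<theta>A: "\<theta> = - Arg z" by (simp add: \<theta>_def)
    have zw: "z = cnj w" using zA unfolding w_def \<theta>A by (simp add: exp_cnj)
    have nw: "norm w \<le> 1" by (simp add: w_def)
    have e: "\<forall>\<^sub>F x in at_left 1. J_den a k z (of_real x) \<noteq> 0"
      using d1 ev by eventually_elim (simp add: zw J_cnj(2)[OF nw])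
    have "((\<lambda>x. cnj (J a k w (of_real x))) \<longlongrightarrow> cnj (exp (\<i> * of_real (\<theta> * (1 - 1 / real a))))) (at_left 1)"
      by (rule tendsto_cnj[OF l1])
    moreover have "cnj (exp (\<i> * of_real (\<theta> * (1 - 1 / real a)))) = exp (\<i> * of_real (Arg z * (1 - 1 / real a)))"
      unfolding \<theta>A by (simp add: exp_cnj)
    moreover have "\<forall>\<^sub>F x in at_left 1. cnj (J a k w (of_real x)) = J a k z (of_real x)"
      using ev by eventually_elim (simp add: J_def zw J_cnj[OF nw])
    ultimately show ?thesis using e by (auto elim: Lim_transform_eventually)
  qed
  then show "\<forall>\<^sub>F x in at_left 1. J_den a k z (of_real x) \<noteq> 0"
    "((\<lambda>x. J a k z (of_real x)) \<longlongrightarrow> exp (\<i> * of_real (Arg z * (1 - 1 / real a)))) (at_left 1)" by auto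
qed

text \<open>For d = 2 n + 1 the principal arguments are 2 pi (j - n) / d, symmetric about 0, so the
  sum is a Dirichlet kernel sin (d \<phi>) / sin \<phi> with \<phi> = pi (1 - 1 / a) / d; and sin (d
  \<phi>) = sin (pi - pi / a).\<close>

lemma odd_roots_sum:
  assumes d: "odd d"
  shows "(\<Sum>z | z ^ d = (1::complex). exp (\<i> * of_real (Arg z * (1 - 1 / real a)))) = of_real (sin (pi / real a) / sin (pi * (real a - 1) / (real a * real d)))"
proof -
  define n where "n = d div 2"
  have dn: "d = 2 * n + 1" using d by (simp add: n_def)
  have d0: "real d > 0" using dn by simp
  define c where "c = 1 - 1 / real a"
  define f where "f = (\<lambda>j::nat. cis (2 * pi * (real j - real n) / real d))"
  have arg: "Arg (f j) = 2 * pi * (real j - real n) / real d" if j: "j < d" for j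
  proof (rule Arg_unique[of 1])
    show "complex_of_real 1 * exp (\<i> * of_real (2 * pi * (real j - real n) / real d)) = f j" by (simp add: f_def cis_conv_exp)
    have "- real d < 2 * (real j - real n)" "2 * (real j - real n) < real d" using j dn by auto
    then have "pi * (- real d) < pi * (2 * (real j - real n))" "pi * (2 * (real j - real n)) < pi * real d"
      by (intro mult_strict_left_mono; simp)+
    then show "- pi < 2 * pi * (real j - real n) / real d" "2 * pi * (real j - real n) / real d \<le> pi"
      using d0 by (simp_all add: field_simps)
  qed simp
  have "bij_betw f {..<d} {z. z ^ d = 1}"
  proof (rule bij_betwI')
    fix i j assume ij: "i \<in> {..<d}" "j \<in> {..<d}"
    show "f i = f j \<longleftrightarrow> i = j"
    proof
      assume "f i = f j"
      then have "2 * pi * (real i - real n) / real d = 2 * pi * (real j - real n) / real d" using arg ij by (metis lessThan_iff)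
      then show "i = j" using d0 by simp
    qed simp
  next
    fix j assume "j \<in> {..<d}"
    have "f j ^ d = cis (real d * (2 * pi * (real j - real n) / real d))" unfolding f_def by (rule Complex.DeMoivre)
    also have "real d * (2 * pi * (real j - real n) / real d) = 2 * pi * of_int (int j - int n)" using d0 by simp
    also have "cis (2 * pi * of_int (int j - int n)) = 1" by (rule cis_multiple_2pi) simp
    finally show "f j \<in> {z. z ^ d = 1}" by simp
  next
    fix z :: complex assume "z \<in> {z. z ^ d = 1}"
    then have z: "z ^ d = 1" by simp
    then have nz: "norm z = 1" using norm_root_unity[OF z] dn by simp
    have z0: "z \<noteq> 0" using nz by auto
    have zc: "z = cis (Arg z)" using Arg_eq[OF z0] nz by (simp add: cis_conv_exp)
    have "cis (real d * Arg z) = 1" using z unfolding Complex.DeMoivre[symmetric] zc[symmetric] .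
    then have "cos (real d * Arg z) = 1" by (simp add: complex_eq_iff)
    then obtain l :: int where l: "real d * Arg z = of_int l * 2 * pi" unfolding cos_one_2pi_int by auto
    then have A: "Arg z = 2 * pi * of_int l / real d" using d0 by (simp add: field_simps)
    have "of_int l * 2 * pi \<le> real d * pi" "- (real d * pi) < of_int l * 2 * pi"
      using l mult_left_mono[OF Arg_le_pi[of z], of "real d"] mult_strict_left_mono[OF mpi_less_Arg[of z] d0] by linarith+
    then have "pi * (2 * of_int l) \<le> pi * real d" "pi * (- real d) < pi * (2 * of_int l)" by (simp_all add: algebra_simps)
    then have "2 * of_int l \<le> real d" "- real d < 2 * of_int l" by (simp_all only: mult_le_cancel_left_pos mult_less_cancel_left_pos pi_gt_zero)
    then have "2 * l \<le> 2 * int n + 1" "- (2 * int n + 1) < 2 * l" using dn by linarith+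
    then have ln: "l \<le> int n" "- int n \<le> l" by linarith+
    define j where "j = nat (l + int n)"
    have "j \<in> {..<d}" using ln dn by (auto simp: j_def)
    moreover have "real j - real n = of_int l" using ln by (simp add: j_def)
    then have "z = f j" unfolding f_def using zc A by simp
    ultimately show "\<exists>j\<in>{..<d}. z = f j" by blast
  qed
  then have "(\<Sum>z | z ^ d = (1::complex). exp (\<i> * of_real (Arg z * c))) = (\<Sum>j<d. exp (\<i> * of_real (Arg (f j) * c)))"
    by (rule sum.reindex_bij_betw[symmetric])
  also have "\<dots> = (\<Sum>j<d. exp (\<i> * of_real (- 2 * pi * real n / real d * c)) * exp (\<i> * of_real (2 * pi / real d * c)) ^ j)"
  proof (intro sum.cong refl)
    fix j assume "j \<in> {..<d}"
    then have A: "Arg (f j) * c = - 2 * pi * real n / real d * c + real j * (2 * pi / real d * c)"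
      by (simp add: arg diff_divide_distrib algebra_simps)
    then show "exp (\<i> * of_real (Arg (f j) * c)) = exp (\<i> * of_real (- 2 * pi * real n / real d * c)) * exp (\<i> * of_real (2 * pi / real d * c)) ^ j"
      unfolding A exp_of_nat_mult[symmetric] mult_exp_exp of_real_add distrib_left by (simp add: mult.left_commute)
  qed
  finally have sum: "(\<Sum>z | z ^ d = (1::complex). exp (\<i> * of_real (Arg z * c))) =
     exp (\<i> * of_real (- 2 * pi * real n / real d * c)) * (\<Sum>j<d. exp (\<i> * of_real (2 * pi / real d * c)) ^ j)"
    by (simp add: sum_distrib_left)
  define \<phi> where "\<phi> = pi * c / real d"
  have c: "0 < c" "c < 1" using a2 by (auto simp: c_def)
  have sphi: "sin \<phi> > 0"
  proof (rule sin_gt_zero)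
    show "0 < \<phi>" using c d0 by (simp add: \<phi>_def)
    have "c / real d < 1" using c dn by (simp add: divide_less_eq)
    then have "pi * (c / real d) < pi * 1" by (intro mult_strict_left_mono) auto
    then show "\<phi> < pi" by (simp add: \<phi>_def)
  qed
  define w where "w = cis (2 * \<phi>)"
  have w: "exp (\<i> * of_real (2 * pi / real d * c)) = w" by (simp add: w_def \<phi>_def cis_conv_exp field_simps)
  have S: "exp (\<i> * of_real (- 2 * pi * real n / real d * c)) = cis (- 2 * real n * \<phi>)" by (simp add: \<phi>_def cis_conv_exp field_simps)
  \<comment> \<open>Both differences are rewritten by exp (2 \<i> y) - 1 = 2 \<i> sin y exp (\<i>
    y), for y = \<phi> and y = m \<phi>.\<close>
  have D: "sin (real m * \<phi>) * (w - 1) * cis (real m * \<phi>) = sin \<phi> * cis \<phi> * (w ^ m - 1)" for m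
  proof -
    have t: "cis (2 * y) - 1 = 2 * \<i> * of_real (sin y) * cis y" for y
      by (simp add: complex_eq_iff cos_double_sin sin_double power2_eq_square)
    have "w ^ m = cis (2 * (real m * \<phi>))" unfolding w_def Complex.DeMoivre by (simp add: algebra_simps)
    then show ?thesis unfolding w_def using t[of \<phi>] t[of "real m * \<phi>"] by (simp add: algebra_simps)
  qed
  have w1: "w \<noteq> 1"
  proof
    assume "w = 1"
    then have "cos (2 * \<phi>) = 1" by (simp add: w_def complex_eq_iff)
    then have "(sin \<phi>)\<^sup>2 = 0" using cos_double_sin[of \<phi>] by simp
    then show False using sphi by simp
  qed
  have geo: "(\<Sum>j<d. w ^ j) = (w ^ d - 1) / (w - 1)" using geometric_sum[OF w1, of d] by simp
  have "(w ^ d - 1) / (w - 1) = of_real (sin (real d * \<phi>) / sin \<phi>) * cis (real d * \<phi> - \<phi>)"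
  proof -
    have cz: "cis \<phi> \<noteq> 0" "w - 1 \<noteq> 0" "complex_of_real (sin \<phi>) \<noteq> 0" using w1 sphi by auto
    have "cis (real d * \<phi>) = cis (real d * \<phi> - \<phi>) * cis \<phi>" by (simp add: cis_mult)
    moreover define S where "S = complex_of_real (sin (real d * \<phi>) / sin \<phi>)"
    moreover have "complex_of_real (sin (real d * \<phi>)) = S * of_real (sin \<phi>)" using sphi by (simp add: S_def)
    ultimately have "of_real (sin \<phi>) * cis \<phi> * (w ^ d - 1) = of_real (sin \<phi>) * cis \<phi> * ((w - 1) * (S * cis (real d * \<phi> - \<phi>)))"
      using D[of d] by (simp only: mult_ac)
    then have "of_real (sin \<phi>) * cis \<phi> * (w ^ d - 1) = of_real (sin \<phi>) * cis \<phi> * ((w - 1) * (of_real (sin (real d * \<phi>) / sin \<phi>) * cis (real d * \<phi> - \<phi>)))"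
      unfolding S_def .
    moreover have "of_real (sin \<phi>) * cis \<phi> \<noteq> 0" using cz by simp
    ultimately have "w ^ d - 1 = (w - 1) * (of_real (sin (real d * \<phi>) / sin \<phi>) * cis (real d * \<phi> - \<phi>))" by (simp only: mult_cancel_left) simp
    then show ?thesis using cz by simp
  qed
  moreover have "real d * \<phi> - \<phi> = 2 * real n * \<phi>" using dn by (simp add: algebra_simps)
  moreover have "cis (- 2 * real n * \<phi>) * cis (2 * real n * \<phi>) = 1" by (simp add: cis_mult)
  ultimately have "(\<Sum>z | z ^ d = (1::complex). exp (\<i> * of_real (Arg z * c))) = of_real (sin (real d * \<phi>) / sin \<phi>)"
    unfolding sum w S geo by (simp add: mult.left_commute)
  moreover have "sin (real d * \<phi>) = sin (pi / real a)"
  proof -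
    have "real d * \<phi> = pi - pi / real a" using d0 by (simp add: \<phi>_def) (simp add: c_def right_diff_distrib)
    then show ?thesis by simp
  qed
  moreover have "\<phi> = pi * (real a - 1) / (real a * real d)" using a_pos by (simp add: \<phi>_def c_def field_simps)
  ultimately show ?thesis by (simp add: c_def)
qed

theorem section_limit_odd:
  assumes d: "odd d"
  shows "\<forall>\<^sub>F x in at_left (1::real). \<not> is_pole (W a d k) (of_real x)"
    and "((\<lambda>x::real. W a d k (of_real x)) \<longlongrightarrow> of_real (sin (pi / real a) / (real d * sin (pi * (real a - 1) / (real a * real d))))) (at_left 1)"
proof -
  have d1: "d \<ge> 1" using d by (cases d) auto
  have root: "norm z = 1" "z \<noteq> - 1" if "z ^ d = 1" for z :: complex
    using norm_root_unity[OF that d1] that d by auto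
  have fin: "finite {z::complex. z ^ d = 1}" using d1 by (intro finite_roots_unity) auto
  have ev: "\<forall>\<^sub>F x in at_left (1::real). 0 < x \<and> x < 1"
    using eventually_at_left_real[of 0 "1::real"] by (auto elim: eventually_mono)
  have "\<forall>\<^sub>F x in at_left (1::real). \<forall>z\<in>{z. z ^ d = 1}. J_den a k z (of_real x) \<noteq> 0"
    using fin J_limit(1) root by (intro eventually_ball_finite) auto
  with ev have nz: "\<forall>\<^sub>F x in at_left (1::real). W a d k (of_real x) = section_sum a d k (of_real x) \<and> \<not> is_pole (W a d k) (of_real x)"
  proof eventually_elim
    case (elim x)
    then show ?case using W_eq_section_sum[of a d "of_real x" k] a_pos d1 by auto
  qed
  then show "\<forall>\<^sub>F x in at_left (1::real). \<not> is_pole (W a d k) (of_real x)" by eventually_elim simp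
  have "((\<lambda>x::real. section_sum a d k (of_real x)) \<longlongrightarrow> (1 / of_nat d) * (\<Sum>z | z ^ d = (1::complex). exp (\<i> * of_real (Arg z * (1 - 1 / real a))))) (at_left 1)"
    unfolding section_sum_def using root by (intro tendsto_mult tendsto_const tendsto_sum J_limit(2)) auto
  also have "(1 / of_nat d) * (\<Sum>z | z ^ d = (1::complex). exp (\<i> * of_real (Arg z * (1 - 1 / real a)))) = of_real (sin (pi / real a) / (real d * sin (pi * (real a - 1) / (real a * real d))))"
    unfolding odd_roots_sum[OF d] by simp
  finally show "((\<lambda>x::real. W a d k (of_real x)) \<longlongrightarrow> of_real (sin (pi / real a) / (real d * sin (pi * (real a - 1) / (real a * real d))))) (at_left 1)"
    by (rule Lim_transform_eventually) (use nz in \<open>auto elim: eventually_mono\<close>)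
qed

end

section \<open>Real poles of the even sections\<close>

text \<open>The roots other than -1 contribute a function \<open>R\<close> analytic at q. Put over
  the common denominator, the average becomes N / g with N holomorphic, and N q is the numerator
  over d because \<open>g\<close> vanishes at q. Order and residue then follow from the simple zero
  of \<open>g\<close>.\<close>

lemma W_simple_pole:
  assumes a: "a \<ge> 1" and d: "even d" "d \<ge> 1" and q: "norm q < 1"
    and others: "\<And>z. z ^ d = 1 \<Longrightarrow> z \<noteq> - 1 \<Longrightarrow> J_den a k z q \<noteq> 0"
    and zero: "J_den a k (- 1) q = 0" and der: "(J_den a k (- 1) has_field_derivative g') (at q)" "g' \<noteq> 0"
    and num: "J_num a k (- 1) q \<noteq> 0"
  shows "is_pole (W a d k) q" "zorder (W a d k) q = - 1" "residue (W a d k) q = J_num a k (- 1) q / (of_nat d * g')"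
proof -
  define R where "R = (\<lambda>q. (1 / of_nat d) * (\<Sum>z | z ^ d = 1 \<and> z \<noteq> - 1. J a k z q))"
  define g where "g = J_den a k (- 1)"
  define N where "N = (\<lambda>q. J_num a k (- 1) q / of_nat d + R q * g q)"
  have fin: "finite {z::complex. z ^ d = 1}" using d by (intro finite_roots_unity) auto
  have split: "{z::complex. z ^ d = 1} = insert (- 1) {z. z ^ d = 1 \<and> z \<noteq> - 1}" using d by auto
  have ss: "section_sum a d k w = N w / g w" if "g w \<noteq> 0" for w
  proof -
    have "(\<Sum>z | z ^ d = 1. J a k z w) = J a k (- 1) w + (\<Sum>z | z ^ d = 1 \<and> z \<noteq> - 1. J a k z w)"
      unfolding split using fin by (subst sum.insert) auto
    then show ?thesis using that d by (simp add: section_sum_def N_def R_def g_def J_def field_simps)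
  qed
  have gh: "g holomorphic_on ball 0 1" "J_num a k (- 1) holomorphic_on ball 0 1"
    unfolding g_def using a by (auto intro!: J_den_holomorphic J_num_holomorphic)
  have "R analytic_on {q}"
    unfolding R_def using others norm_root_unity d(2) a q by (intro analytic_intros J_analytic) auto
  then obtain e1 where e1: "e1 > 0" "R holomorphic_on ball q e1" by (auto simp: analytic_on_def)
  define e where "e = min e1 (1 - norm q)"
  have e: "e > 0" "ball q e \<subseteq> ball q e1" "ball q e \<subseteq> ball 0 1"
  proof -
    show "e > 0" "ball q e \<subseteq> ball q e1" using e1 q by (auto simp: e_def)
    show "ball q e \<subseteq> ball 0 1"
    proof
      fix w assume "w \<in> ball q e"
      then have "norm (w - q) < 1 - norm q" by (simp add: e_def dist_norm norm_minus_commute)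
      then show "w \<in> ball 0 1" using norm_triangle_ineq[of q "w - q"] by simp
    qed
  qed
  have Nh: "N holomorphic_on ball q e" unfolding N_def using e d
    by (intro holomorphic_intros holomorphic_on_subset[OF gh(1)] holomorphic_on_subset[OF gh(2)] holomorphic_on_subset[OF e1(2)]) auto
  have gq: "g q = 0" "g holomorphic_on ball q e" "(g has_field_derivative g') (at q)"
    using zero der holomorphic_on_subset[OF gh(1) e(3)] by (auto simp: g_def)
  have Nq: "N q = J_num a k (- 1) q / of_nat d" by (simp add: N_def gq)
  then have Nq0: "N q \<noteq> 0" using num d by simp
  have ev: "\<forall>\<^sub>F w in at q. g w \<noteq> 0"
  proof -
    have "((\<lambda>w. (g w - g q) / (w - q)) \<longlongrightarrow> g') (at q)" using gq(3) by (simp add: has_field_derivative_iff)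
    then have "\<forall>\<^sub>F w in at q. (g w - g q) / (w - q) \<noteq> 0" by (rule tendsto_imp_eventually_ne) (rule der(2))
    then show ?thesis by eventually_elim (auto simp: gq)
  qed
  have eq: "\<forall>\<^sub>F w in at q. section_sum a d k w = N w / g w" using ev by eventually_elim (rule ss)
  have qe: "q \<in> ball q e" using e by simp
  have mer: "section_sum a d k meromorphic_on {q}"
    by (rule meromorphic_on_subset[OF section_sum_meromorphic]) (use a d q in auto)
  have iso: "isolated_singularity_at (section_sum a d k) q" by (rule meromorphic_on_isolated_singularity[OF mer])
  have "is_pole (\<lambda>w. N w / g w) q"
  proof (rule is_pole_divide)
    show "isCont N q" using holomorphic_on_imp_continuous_on[OF Nh] qe by (simp add: continuous_on_eq_continuous_at)
    have "g \<midarrow>q\<rightarrow> 0" using DERIV_isCont[OF gq(3)] by (simp add: isCont_def gq)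
    then show "filterlim g (at 0) (at q)" using ev by (auto simp: filterlim_at)
  qed (rule Nq0)
  then have "is_pole (section_sum a d k) q" using is_pole_cong[OF eq refl] by simp
  then show "is_pole (W a d k) q" unfolding W_altdef using iso by simp
  have "zorder (section_sum a d k) q = - 1"
    using porder_simple_pole_deriv[OF Nh gq(2) open_ball connected_ball qe gq(3) Nq0 gq(1) der(2)] zorder_cong[OF eq refl] by simp
  then show "zorder (W a d k) q = - 1" unfolding W_altdef using iso by simp
  have "residue (section_sum a d k) q = N q / g'"
    using residue_simple_pole_deriv[OF Nh gq(2) open_ball connected_ball qe gq(3) Nq0 gq(1) der(2)] residue_cong[OF eq refl] by simp
  then show "residue (W a d k) q = J_num a k (- 1) q / (of_nat d * g')" unfolding W_altdef using iso by (simp add: Nq)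
qed

text \<open>\<open>F\<close> and \<open>F'\<close> oscillate with phases \<open>\<pi> / 4\<close> apart, so within \<open>\<pi> / 8\<close> of a zero of the cosine \<open>F'\<close> cannot vanish, and
  elsewhere \<open>F\<close> cannot.\<close>
lemma oscillating_zeros:
  fixes F F' n m :: "real \<Rightarrow> real"
  assumes der: "\<And>y. y > Y \<Longrightarrow> (F has_real_derivative F' y) (at y)"
    and pos: "\<And>y. y > Y \<Longrightarrow> n y > 0" "\<And>y. y > Y \<Longrightarrow> m y > 0"
    and F: "((\<lambda>y. F y / n y + cos y) \<longlongrightarrow> 0) at_top"
    and F': "((\<lambda>y. F' y / m y - cos (y - pi / 4)) \<longlongrightarrow> 0) at_top"
  obtains j0 y where
    "\<And>j::nat. j \<ge> j0 \<Longrightarrow> pi * real j < y j \<and> y j < pi * (real j + 1) \<and> y j > Y \<and> F (y j) = 0 \<and> F' (y j) \<noteq> 0"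
    "\<And>y'. y' \<ge> pi * real j0 \<Longrightarrow> F y' = 0 \<Longrightarrow> \<exists>j\<ge>j0. y' = y j"
proof -
  define s where "s = sin (pi / 8)"
  have s: "s > 0" unfolding s_def by (rule sin_gt_zero) (use pi_gt_zero in auto)
  have "\<forall>\<^sub>F y in at_top. \<bar>F y / n y + cos y\<bar> < s \<and> \<bar>F' y / m y - cos (y - pi / 4)\<bar> < s \<and> y > Y"
    using order_tendstoD(2)[OF tendsto_rabs[OF F], of s] order_tendstoD(2)[OF tendsto_rabs[OF F'], of s] s
    by (intro eventually_conj eventually_gt_at_top) auto
  then obtain Y1 where Y1: "\<And>y. y \<ge> Y1 \<Longrightarrow> \<bar>F y / n y + cos y\<bar> < s" "\<And>y. y \<ge> Y1 \<Longrightarrow> \<bar>F' y / m y - cos (y - pi / 4)\<bar> < s"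
      "\<And>y. y \<ge> Y1 \<Longrightarrow> y > Y"
    unfolding eventually_at_top_linorder by blast
  obtain j0 :: nat where j0: "Y1 \<le> pi * real j0"
    using reals_Archimedean3[OF pi_gt_zero] by (metis less_imp_le mult.commute)
  \<comment> \<open>The zeros of the cosine, each in the middle of the interval from pi j to pi (j +
    1).\<close>
  define M where "M = (\<lambda>j::nat. pi * (real j + 1 / 2))"
  have cosM: "cos (M j + u) = - ((- 1) ^ j * sin u)" for j u
  proof -
    have "M j + u = real j * pi + (pi / 2 + u)" by (simp add: M_def algebra_simps)
    then have "cos (M j + u) = cos (real j * pi + (pi / 2 + u))" by (simp only:)
    also have "\<dots> = (- 1) ^ j * cos (pi / 2 + u)" unfolding cos_add[of "real j * pi"] cos_npi sin_npi by simp
    also have "cos (pi / 2 + u) = - sin u" by (simp add: cos_add)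
    finally show ?thesis by simp
  qed
  have MM: "M j = pi * real j + pi / 2" "pi * (real j + 1) = pi * real j + pi" for j by (simp_all add: M_def algebra_simps)
  have aM: "\<bar>cos (M j + u)\<bar> = \<bar>sin u\<bar>" for j u by (simp add: cosM abs_mult)
  have zone: "y \<ge> Y1" if "j \<ge> j0" "\<bar>y - M j\<bar> \<le> pi / 2" for j y
  proof -
    have "pi * real j0 \<le> pi * real j" using that by simp
    then show ?thesis using that j0 MM(1)[of j] by linarith
  qed
  have near: "\<bar>y - M j\<bar> < pi / 8" if j: "j \<ge> j0" and y: "\<bar>y - M j\<bar> \<le> pi / 2" "F y = 0" for j y
  proof (rule ccontr)
    assume "\<not> \<bar>y - M j\<bar> < pi / 8"
    then have "s \<le> sin \<bar>y - M j\<bar>" unfolding s_def using y by (intro sin_monotone_2pi_le) auto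
    also have "\<dots> \<le> \<bar>sin (y - M j)\<bar>"
    proof (cases "y - M j \<ge> 0")
      case False
      then have "\<bar>y - M j\<bar> = - (y - M j)" by simp
      then show ?thesis using abs_ge_minus_self[of "sin (y - M j)"] by (simp only: sin_minus)
    qed simp
    also have "\<dots> = \<bar>cos y\<bar>" using aM[of j "y - M j"] by simp
    finally show False using Y1(1)[OF zone[OF j y(1)]] y by simp
  qed
  \<comment> \<open>At distance at most pi / 8 from \<open>M j\<close> the argument of the shifted
    cosine is between pi / 8 and 3 pi / 8 away from a zero, so its modulus is at least s.\<close>
  have nz: "F' y \<noteq> 0" if j: "j \<ge> j0" and y: "\<bar>y - M j\<bar> \<le> pi / 8" for j y
  proof
    assume z: "F' y = 0"
    have "s \<le> sin (pi / 4 - (y - M j))" unfolding s_def by (intro sin_monotone_2pi_le) (use y pi_gt_zero in linarith)+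
    also have "\<dots> \<le> \<bar>sin ((y - M j) - pi / 4)\<bar>" using sin_minus[of "(y - M j) - pi / 4"] by simp
    also have "\<dots> = \<bar>cos (y - pi / 4)\<bar>" using aM[of j "y - M j - pi / 4"] by (simp add: algebra_simps)
    finally have "s \<le> \<bar>cos (y - pi / 4)\<bar>" .
    moreover have "\<bar>y - M j\<bar> \<le> pi / 2" using y pi_gt_zero by linarith
    ultimately show False using Y1(2)[OF zone[OF j, of y]] z by simp
  qed
  have cont: "continuous_on S F" if "\<And>y. y \<in> S \<Longrightarrow> y > Y" for S
    using DERIV_isCont[OF der] that by (intro continuous_at_imp_continuous_on) auto
  have ex: "\<exists>y. \<bar>y - M j\<bar> \<le> pi / 8 \<and> F y = 0" if j: "j \<ge> j0" for j
  proof -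
    \<comment> \<open>This sign makes the cosine equal to e s and - e s at the two ends, so e F
      changes from nonpositive to nonnegative whatever the parity of j.\<close>
    define e :: real where "e = (- 1) ^ j"
    have e: "e = 1 \<or> e = - 1" unfolding e_def by (cases "even j") auto
    define l where "l = M j + - (pi / 8)"
    define u where "u = M j + pi / 8"
    have lu: "l \<ge> Y1" "u \<ge> Y1" "l \<le> u" using zone[OF j, of l] zone[OF j, of u] by (auto simp: l_def u_def)
    have "cos l = e * s" "cos u = - (e * s)" unfolding l_def u_def cosM by (simp_all add: e_def s_def)
    then have "\<bar>F l / n l + e * s\<bar> < s" "\<bar>F u / n u - e * s\<bar> < s" using Y1(1)[OF lu(1)] Y1(1)[OF lu(2)] by simp_all
    then have "e * (F l / n l) < 0" "0 < e * (F u / n u)" using e by auto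
    then have "e * F l \<le> 0" "0 \<le> e * F u"
      using pos(1)[OF Y1(3)[OF lu(1)]] pos(1)[OF Y1(3)[OF lu(2)]] by (auto simp: divide_less_0_iff zero_less_divide_iff)
    moreover have "continuous_on {l..u} (\<lambda>y. e * F y)" using Y1(3) lu(1) by (intro continuous_intros cont) auto
    ultimately obtain y where "l \<le> y" "y \<le> u" "e * F y = 0" using IVT'[of "\<lambda>y. e * F y" l 0 u] lu(3) by blast
    moreover from this have "\<bar>y - M j\<bar> \<le> pi / 8" unfolding l_def u_def by linarith
    ultimately show ?thesis using e by (intro exI[of _ y]) auto
  qed
  \<comment> \<open>Two zeros in the same zone would give a zero of \<open>F'\<close> between them
    by Rolle's theorem, against \<open>nz\<close>.\<close>
  have less: False if j: "j \<ge> j0" and y: "\<bar>y - M j\<bar> \<le> pi / 8" "\<bar>y' - M j\<bar> \<le> pi / 8" "F y = 0" "F y' = 0" "y < y'" for j y y'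
  proof -
    have Y: "x > Y" "\<bar>x - M j\<bar> \<le> pi / 8" if "y \<le> x" "x \<le> y'" for x
    proof -
      show x: "\<bar>x - M j\<bar> \<le> pi / 8" using that y by linarith
      show "x > Y" by (rule Y1(3)[OF zone[OF j]]) (use x pi_gt_zero in linarith)
    qed
    have "\<exists>z>y. z < y' \<and> DERIV F z :> 0"
      by (rule Rolle) (use y Y der in \<open>auto intro!: cont simp: real_differentiable_def intro: less_imp_le\<close>)
    then obtain z where z: "y < z" "z < y'" "DERIV F z :> 0" by blast
    then have "F' z = 0" using der[OF Y(1)[of z]] DERIV_unique by fastforce
    then show False using nz[OF j Y(2)[of z]] z by simp
  qed
  have uniq: "y = y'" if "j \<ge> j0" "\<bar>y - M j\<bar> \<le> pi / 8" "\<bar>y' - M j\<bar> \<le> pi / 8" "F y = 0" "F y' = 0" for j y y'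
    
  proof (rule ccontr)
    assume "y \<noteq> y'"
    then consider "y < y'" | "y' < y" by linarith
    then show False by cases (use less[OF that(1,2,3,4,5)] less[OF that(1,3,2,5,4)] in blast)+
  qed
  define y where "y = (\<lambda>j. SOME y. \<bar>y - M j\<bar> \<le> pi / 8 \<and> F y = 0)"
  have y: "\<bar>y j - M j\<bar> \<le> pi / 8" "F (y j) = 0" if "j \<ge> j0" for j
    using someI_ex[OF ex[OF that]] by (auto simp: y_def)
  show thesis
  proof (rule that[of j0 y])
    fix j assume j: "j \<ge> j0"
    have "\<bar>y j - M j\<bar> < pi / 2" using y(1)[OF j] pi_gt_zero by linarith
    then have "pi * real j < y j" "y j < pi * (real j + 1)" using MM[of j] by linarith+
    then show "pi * real j < y j \<and> y j < pi * (real j + 1) \<and> y j > Y \<and> F (y j) = 0 \<and> F' (y j) \<noteq> 0"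
      using y[OF j] nz[OF j y(1)[OF j]] Y1(3)[OF zone[OF j, of "y j"]] \<open>\<bar>y j - M j\<bar> < pi / 2\<close> by simp
  next
    fix y' assume y': "y' \<ge> pi * real j0" "F y' = 0"
    define j where "j = nat \<lfloor>y' / pi\<rfloor>"
    have ge: "y' / pi \<ge> real j0" using y' by (simp add: pos_le_divide_eq mult.commute)
    have fl: "of_int \<lfloor>y' / pi\<rfloor> \<le> y' / pi" "y' / pi < of_int \<lfloor>y' / pi\<rfloor> + 1" by linarith+
    have "int j0 \<le> \<lfloor>y' / pi\<rfloor>" using ge by (simp add: le_floor_iff)
    then have j: "j \<ge> j0" "real j = of_int \<lfloor>y' / pi\<rfloor>" by (auto simp: j_def)
    have "pi * real j \<le> y'" "y' < pi * (real j + 1)" using fl unfolding j(2)[symmetric] by (simp_all add: pos_le_divide_eq pos_divide_less_eq mult.commute)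
    then have "\<bar>y' - M j\<bar> \<le> pi / 2" using MM[of j] by linarith
    from near[OF j(1) this y'(2)] have "y' = y j" using uniq[OF j(1)] y[OF j(1)] y'(2) by auto
    then show "\<exists>j\<ge>j0. y' = y j" using j by blast
  qed
qed

text \<open>Along the sequence sin (y j) is close to 1 or to -1, with undetermined sign. Expanding
  cos (y - \<alpha>) leaves sin \<alpha> sin y, and division by sin y removes the sign; in the
  residue both numerator and derivative are divided by it.\<close>

lemma quotient_sin_tendsto:
  fixes y b :: "nat \<Rightarrow> real"
  assumes c: "(\<lambda>j. cos (y j)) \<longlonglongrightarrow> 0" and b: "(\<lambda>j. b j - cos (y j - \<alpha>)) \<longlonglongrightarrow> 0"
  shows "\<forall>\<^sub>F j in sequentially. sin (y j) \<noteq> 0" "(\<lambda>j. b j / sin (y j)) \<longlonglongrightarrow> sin \<alpha>"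
proof -
  have "(\<lambda>j. sqrt (1 - (cos (y j))\<^sup>2)) \<longlonglongrightarrow> sqrt (1 - 0\<^sup>2)" by (intro tendsto_intros c)
  then have s1: "(\<lambda>j. \<bar>sin (y j)\<bar>) \<longlonglongrightarrow> 1" by (simp flip: sin_squared_eq)
  have "\<forall>\<^sub>F j in sequentially. \<bar>sin (y j)\<bar> \<noteq> 0" by (rule tendsto_imp_eventually_ne[OF s1]) simp
  then show ev: "\<forall>\<^sub>F j in sequentially. sin (y j) \<noteq> 0" by simp
  have z: "(\<lambda>j. g j / sin (y j)) \<longlonglongrightarrow> 0" if "g \<longlonglongrightarrow> 0" for g
  proof (rule tendsto_rabs_zero_cancel)
    have "(\<lambda>j. \<bar>g j\<bar> / \<bar>sin (y j)\<bar>) \<longlonglongrightarrow> \<bar>0\<bar> / 1" by (intro tendsto_divide tendsto_rabs that s1) simp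
    then show "(\<lambda>j. \<bar>g j / sin (y j)\<bar>) \<longlonglongrightarrow> 0" by simp
  qed
  have "(\<lambda>j. (b j - cos (y j - \<alpha>)) / sin (y j) + cos \<alpha> * (cos (y j) / sin (y j)) + sin \<alpha>) \<longlonglongrightarrow> 0 + cos \<alpha> * 0 + sin \<alpha>"
    by (intro tendsto_intros z b c)
  then have l: "(\<lambda>j. (b j - cos (y j - \<alpha>)) / sin (y j) + cos \<alpha> * (cos (y j) / sin (y j)) + sin \<alpha>) \<longlonglongrightarrow> sin \<alpha>" by simp
  show "(\<lambda>j. b j / sin (y j)) \<longlonglongrightarrow> sin \<alpha>"
    by (rule Lim_transform_eventually[OF l], use ev in eventually_elim) (simp add: cos_diff field_simps)
qed

lemma inverse_square_deriv:
  assumes "(y::real) > p"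
  shows "((\<lambda>y. C / (y - p)\<^sup>2) has_real_derivative - (2 * (C / (y - p)\<^sup>2) / (y - p))) (at y)"
proof -
  have "((\<lambda>y. C / (y - p)\<^sup>2) has_real_derivative (0 * (y - p)\<^sup>2 - C * (2 * (y - p))) / ((y - p)\<^sup>2 * (y - p)\<^sup>2)) (at y)"
    using assms by (auto intro!: derivative_eq_intros)
  then show ?thesis
  proof (rule DERIV_cong)
    have eq: "(0 * u\<^sup>2 - C * (2 * u)) / (u\<^sup>2 * u\<^sup>2) = - (2 * (C / u\<^sup>2) / u)" if "u \<noteq> 0" for u
      using that by (simp add: power2_eq_square mult_ac)
    show "(0 * (y - p)\<^sup>2 - C * (2 * (y - p))) / ((y - p)\<^sup>2 * (y - p)\<^sup>2) = - (2 * (C / (y - p)\<^sup>2) / (y - p))"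
      by (rule eq) (use assms in simp)
  qed
qed

section \<open>Oscillation at z = -1\<close>

context sector_flat
begin

text \<open>- \<mu> pi / 4 comes from the power of s, pi / 4 from the Jacobian at the saddle, the
  rest from the Gaussian integral.\<close>

definition phase :: real where "phase = pi / 4 * (1 - \<mu>) + Arg fresnel"
definition amp :: "real \<Rightarrow> real" where "amp \<Lambda> = norm (Nrm pi \<Lambda>) * norm fresnel"

lemma amp_pos: "\<Lambda> > 0 \<Longrightarrow> amp \<Lambda> > 0" by (simp add: amp_def Nrm_nonzero fresnel_nonzero)

lemma Nrm_fresnel:
  assumes "\<Lambda> > 0"
  shows "Nrm pi \<Lambda> * fresnel = of_real (amp \<Lambda>) * cis (sqrt 2 * \<Lambda> + phase)"
proof -
  have f: "fresnel = of_real (norm fresnel) * cis (Arg fresnel)"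
    using Arg_eq[OF fresnel_nonzero] by (simp add: cis_conv_exp)
  have e1: "exp (- of_real \<mu> * Complex (ln (\<beta> / \<Lambda>)) (pi / 4)) = of_real (exp (- (\<mu> * ln (\<beta> / \<Lambda>)))) * cis (- (\<mu> * pi / 4))"
    by (simp add: exp_eq_polar)
  have e2: "exp (- \<omega>45 * of_real (2 * \<Lambda>)) = of_real (exp (- (sqrt 2 * \<Lambda>))) * cis (sqrt 2 * \<Lambda>)"
    by (simp add: exp_eq_polar Re_\<omega>45 Im_\<omega>45)
  have e3: "ray (ln (\<Lambda> / pi)) = of_real (\<Lambda> / pi) * cis (pi / 4)" using assms by (simp add: ray_altdef)
  have "cis (sqrt 2 * \<Lambda> + phase) = cis (- (\<mu> * pi / 4)) * cis (pi / 4) * cis (sqrt 2 * \<Lambda>) * cis (Arg fresnel)"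
    unfolding cis_mult by (intro arg_cong[of _ _ cis]) (simp add: phase_def field_simps)
  moreover have "amp \<Lambda> = exp (- (\<mu> * ln (\<beta> / \<Lambda>))) * (\<Lambda> / pi) * exp (- (sqrt 2 * \<Lambda>)) / sqrt \<Lambda> * norm fresnel"
    unfolding amp_def norm_Nrm[OF assms pi_gt_zero] ..
  ultimately show ?thesis
    unfolding Nrm_def e1 e2 e3 by (subst f) (simp only: of_real_mult of_real_divide times_divide_eq_left times_divide_eq_right mult_ac)
qed

text \<open>The error is measured against the amplitude and not against the cosine, so that the
  statement remains meaningful at the zeros of the cosine.\<close>

lemma Re_A_pi_asymptotics:
  "((\<lambda>\<Lambda>. Re (A pi r (\<beta> * pi / \<Lambda>\<^sup>2)) / amp \<Lambda> - cos (sqrt 2 * \<Lambda> + phase - pi * r)) \<longlongrightarrow> 0) at_top"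
proof -
  define e where "e = exp (- (\<i> * of_real (pi * r)))"
  define f where "f = (\<lambda>\<Lambda>. A pi r (\<beta> * pi / \<Lambda>\<^sup>2))"
  have e: "e = cis (- (pi * r))" by (simp add: e_def cis_conv_exp)
  have "((\<lambda>\<Lambda>. f \<Lambda> / Nrm pi \<Lambda> - e * fresnel) \<longlongrightarrow> 0) at_top"
    unfolding f_def e_def by (rule LIM_zero[OF A_asymptotics]) simp
  then have "((\<lambda>\<Lambda>. norm (f \<Lambda> / Nrm pi \<Lambda> - e * fresnel) * (1 / norm fresnel)) \<longlongrightarrow> 0) at_top"
    by (intro tendsto_mult_left_zero tendsto_norm_zero)
  then have "((\<lambda>\<Lambda>. f \<Lambda> / of_real (amp \<Lambda>) - cis (sqrt 2 * \<Lambda> + phase - pi * r)) \<longlongrightarrow> 0) at_top"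
  proof (rule Lim_null_comparison[rotated], use eventually_gt_at_top[of "0::real"] in eventually_elim)
    fix \<Lambda> :: real assume L: "\<Lambda> > 0"
    have "cis (sqrt 2 * \<Lambda> + phase - pi * r) = e * cis (sqrt 2 * \<Lambda> + phase)" by (simp add: e cis_mult algebra_simps)
    also have "\<dots> = e * fresnel * (Nrm pi \<Lambda> / of_real (amp \<Lambda>))"
      using Nrm_fresnel[OF L] amp_pos[OF L] by (simp add: field_simps)
    finally have "f \<Lambda> / of_real (amp \<Lambda>) - cis (sqrt 2 * \<Lambda> + phase - pi * r) = (f \<Lambda> / Nrm pi \<Lambda> - e * fresnel) * (Nrm pi \<Lambda> / of_real (amp \<Lambda>))"
      using Nrm_nonzero[OF L, of pi] amp_pos[OF L] by (simp add: field_simps)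
    moreover have "norm (Nrm pi \<Lambda> / of_real (amp \<Lambda>)) = 1 / norm fresnel"
      using Nrm_nonzero[OF L] by (simp add: norm_divide norm_mult amp_def)
    ultimately show "norm (f \<Lambda> / of_real (amp \<Lambda>) - cis (sqrt 2 * \<Lambda> + phase - pi * r)) \<le> norm (f \<Lambda> / Nrm pi \<Lambda> - e * fresnel) * (1 / norm fresnel)"
      by (simp only: norm_mult order_refl)
  qed
  then have "((\<lambda>\<Lambda>. Re (f \<Lambda> / of_real (amp \<Lambda>) - cis (sqrt 2 * \<Lambda> + phase - pi * r))) \<longlongrightarrow> Re 0) at_top" by (rule tendsto_Re)
  then show ?thesis by (simp add: f_def Re_divide_of_real)
qed

end

context two_flat
begin

text \<open>The variable y = sqrt 2 \<Lambda> + phase makes the oscillation cos y.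
  \<open>Lamy\<close> recovers \<Lambda>, \<open>tt\<close> the t with a t = \<beta> pi /
  \<Lambda>^2, and \<open>X\<close> the nome exp (- t), which tends to 1 as y tends to
  infinity.\<close>

definition Lamy :: "real \<Rightarrow> real" where "Lamy y = (y - F1.phase) / sqrt 2"
definition tt :: "real \<Rightarrow> real" where "tt y = 2 * (bk k * pi / real a) / (y - F1.phase)\<^sup>2"
definition X :: "real \<Rightarrow> real" where "X y = exp (- tt y)"

lemma Lamy_props:
  assumes "y > F1.phase"
  shows "Lamy y > 0" "tt y > 0" "real a * tt y = bk k * pi / (Lamy y)\<^sup>2" "0 < X y" "X y < 1"
  using assms bk_pos[OF k1] a_pos by (simp_all add: Lamy_def tt_def X_def power_divide field_simps)

lemma F2_phase: "F2.phase = F1.phase - pi / 4"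
  unfolding F1.phase_def F2.phase_def by (simp add: field_simps)

lemma F2_amp:
  assumes "\<Lambda> > 0" shows "F2.amp \<Lambda> = \<Lambda> / bk k * F1.amp \<Lambda>"
proof -
  have b: "bk k > 0" by (rule bk_pos[OF k1])
  have "exp (- ((real k / 2 + 1) * ln (bk k / \<Lambda>))) = exp (- (real k / 2 * ln (bk k / \<Lambda>))) * exp (- ln (bk k / \<Lambda>))"
    by (simp add: mult_exp_exp algebra_simps)
  also have "exp (- ln (bk k / \<Lambda>)) = \<Lambda> / bk k" using b assms by (simp add: exp_minus)
  finally show ?thesis unfolding F1.amp_def F2.amp_def F1.norm_Nrm[OF assms pi_gt_zero] F2.norm_Nrm[OF assms pi_gt_zero]
    by (simp add: mult_ac)
qed

lemma filterlim_Lamy: "filterlim Lamy at_top at_top"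
  unfolding Lamy_def by real_asymp

lemma Re_A_y:
  "((\<lambda>y. Re (F1.A pi r (bk k * pi / (Lamy y)\<^sup>2)) / F1.amp (Lamy y) - cos (y - pi * r)) \<longlongrightarrow> 0) at_top"
  "((\<lambda>y. Re (F2.A pi r (bk k * pi / (Lamy y)\<^sup>2)) / F2.amp (Lamy y) - cos (y - pi / 4 - pi * r)) \<longlongrightarrow> 0) at_top"
  using filterlim_compose[OF F1.Re_A_pi_asymptotics[of r] filterlim_Lamy]
        filterlim_compose[OF F2.Re_A_pi_asymptotics[of r] filterlim_Lamy]
  by (simp_all add: F2_phase Lamy_def)

lemma J_minus_one:
  assumes "y > F1.phase"
  shows "J_num a k (- 1) (of_real (X y)) = of_real (cN k * (2 * Re (F1.A pi (1 / real a) (bk k * pi / (Lamy y)\<^sup>2))))"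
    "J_den a k (- 1) (of_real (X y)) = of_real (cN k * (2 * Re (F1.A pi 1 (bk k * pi / (Lamy y)\<^sup>2))))"
    "(J_den a k (- 1) has_field_derivative of_real (- (cN k * bk k / (tt y * X y) * (2 * Re (F2.A pi 1 (bk k * pi / (Lamy y)\<^sup>2)))))) (at (of_real (X y)))"
proof -
  note p = Lamy_props[OF assms]
  have P: "bk k * pi / (Lamy y)\<^sup>2 > 0" using p(2) a_pos unfolding p(3)[symmetric] by simp
  have pi2: "0 \<le> pi" "pi \<le> 2 * pi" using pi_gt_zero by linarith+
  show "J_num a k (- 1) (of_real (X y)) = of_real (cN k * (2 * Re (F1.A pi (1 / real a) (bk k * pi / (Lamy y)\<^sup>2))))"
    using J_num_S[OF p(2) pi2] F1.S_pi[OF P a_pos(3,4)] unfolding p(3) X_def[symmetric] exp_pi_i' by simp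
  show "J_den a k (- 1) (of_real (X y)) = of_real (cN k * (2 * Re (F1.A pi 1 (bk k * pi / (Lamy y)\<^sup>2))))"
    using J_den_S[OF p(2) pi2] F1.S_pi[OF P, of 1] unfolding p(3) X_def[symmetric] exp_pi_i' by simp
  show "(J_den a k (- 1) has_field_derivative of_real (- (cN k * bk k / (tt y * X y) * (2 * Re (F2.A pi 1 (bk k * pi / (Lamy y)\<^sup>2)))))) (at (of_real (X y)))"
    using J_den_deriv[OF p(2) pi2] F2.S_pi[OF P, of 1] unfolding p(3) X_def[symmetric] exp_pi_i' by simp
qed

lemma X_deriv:
  assumes "y > F1.phase"
  shows "(X has_real_derivative X y * (2 * tt y / (y - F1.phase))) (at y)"
proof -
  have "(tt has_real_derivative - (2 * tt y / (y - F1.phase))) (at y)"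
    unfolding tt_def[abs_def] by (rule inverse_square_deriv[OF assms])
  then show ?thesis unfolding X_def[abs_def] by (auto intro!: derivative_eq_intros)
qed

text \<open>The factor 1 / (t X) of the derivative in q cancels against the derivative of
  \<open>X\<close>, and only the oscillating integral for \<open>H2\<close> over y - phase
  remains.\<close>

lemma real_den_deriv:
  assumes "y > F1.phase"
  shows "((\<lambda>y. Re (J_den a k (- 1) (of_real (X y)))) has_real_derivative
     - (4 * cN k * bk k * Re (F2.A pi 1 (bk k * pi / (Lamy y)\<^sup>2)) / (y - F1.phase))) (at y)"
proof -
  define D where "D = - (cN k * bk k / (tt y * X y) * (2 * Re (F2.A pi 1 (bk k * pi / (Lamy y)\<^sup>2))))"
  have "((\<lambda>x. J_den a k (- 1) (of_real x)) has_vector_derivative of_real D) (at (X y))"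
    using J_minus_one(3)[OF assms] unfolding D_def by (rule has_vector_derivative_real_field)
  then have "((\<lambda>x. Re (J_den a k (- 1) (of_real x))) has_vector_derivative Re (of_real D)) (at (X y))"
    by (rule bounded_linear.has_vector_derivative[OF bounded_linear_Re])
  then have "((\<lambda>x. Re (J_den a k (- 1) (of_real x))) has_real_derivative D) (at (X y))"
    by (simp add: has_real_derivative_iff_has_vector_derivative)
  from DERIV_chain2[OF this X_deriv[OF assms]]
  show ?thesis by (rule DERIV_cong) (use Lamy_props[OF assms] in \<open>simp add: D_def\<close>)
qed

theorem section_poles_even:
  assumes d: "even d" "d \<ge> 2"
  shows "\<exists>(j0::nat) (q :: nat \<Rightarrow> real).
              inj_on q {j0..} \<and>
              (\<forall>j\<ge>j0. 0 < q j \<and> q j < 1 \<and>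
                  is_pole (W a d k) (of_real (q j)) \<and>
                  zorder (W a d k) (of_real (q j)) = -1) \<and>
              q \<longlonglongrightarrow> 1 \<and>
              (\<exists>\<epsilon>>0. \<forall>x::real. 1 - \<epsilon> < x \<longrightarrow> x < 1 \<longrightarrow> is_pole (W a d k) (of_real x) \<longrightarrow>
                  (\<exists>j\<ge>j0. x = q j)) \<and>
              (\<lambda>j. 1 - q j) \<sim>[at_top] (\<lambda>j. pi * real k / (3 * real a * real j ^ 2)) \<and>
              (\<lambda>j. residue (W a d k) (of_real (q j))) \<sim>[at_top]
                (\<lambda>j. of_real (2 * real k * sin (pi / real a) /
                        (3 * real a * real d * real j ^ 3)))"
proof -
  define F where "F = (\<lambda>y. Re (J_den a k (- 1) (of_real (X y))))"
  define F' where "F' = (\<lambda>y. - (4 * cN k * bk k * Re (F2.A pi 1 (bk k * pi / (Lamy y)\<^sup>2)) / (y - F1.phase)))"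
  define n where "n = (\<lambda>y. 2 * cN k * F1.amp (Lamy y))"
  define m where "m = (\<lambda>y. 4 * cN k * bk k * F2.amp (Lamy y) / (y - F1.phase))"
  note cN = cN_pos[of k] and bk = bk_pos[OF k1]
  have ev: "\<forall>\<^sub>F y in at_top. y > F1.phase" by (rule eventually_gt_at_top)
  have m: "m y > 0" and n: "n y > 0" if "y > F1.phase" for y
    using that cN bk F1.amp_pos[OF Lamy_props(1)[OF that]] F2.amp_pos[OF Lamy_props(1)[OF that]] by (simp_all add: m_def n_def)
  have limF: "((\<lambda>y. F y / n y + cos y) \<longlongrightarrow> 0) at_top"
  proof (rule Lim_transform_eventually[OF Re_A_y(1)[of 1]], use ev in eventually_elim)
    fix y assume y: "y > F1.phase"
    have "F y / n y = Re (F1.A pi 1 (bk k * pi / (Lamy y)\<^sup>2)) / F1.amp (Lamy y)"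
      unfolding F_def n_def J_minus_one(2)[OF y] using cN by simp
    then show "Re (F1.A pi 1 (bk k * pi / (Lamy y)\<^sup>2)) / F1.amp (Lamy y) - cos (y - pi * 1) = F y / n y + cos y" by simp
  qed
  have F'm: "F' y / m y = - (Re (F2.A pi 1 (bk k * pi / (Lamy y)\<^sup>2)) / F2.amp (Lamy y))" if y: "y > F1.phase" for y
    unfolding F'_def m_def using cN bk y by simp
  have limF': "((\<lambda>y. F' y / m y - cos (y - pi / 4)) \<longlongrightarrow> 0) at_top"
  proof (rule Lim_transform_eventually[OF tendsto_minus[OF Re_A_y(2)[of 1], simplified minus_zero]], use ev in eventually_elim)
    fix y assume y: "y > F1.phase"
    have "cos (y - pi / 4 - pi * 1) = - cos (y - pi / 4)" using cos_diff[of "y - pi / 4" pi] by simp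
    then show "- (Re (F2.A pi 1 (bk k * pi / (Lamy y)\<^sup>2)) / F2.amp (Lamy y) - cos (y - pi / 4 - pi * 1)) = F' y / m y - cos (y - pi / 4)"
      unfolding F'm[OF y] by simp
  qed
  obtain j1 y where y1: "\<And>j::nat. j \<ge> j1 \<Longrightarrow> pi * real j < y j \<and> y j < pi * (real j + 1) \<and> y j > F1.phase \<and> F (y j) = 0 \<and> F' (y j) \<noteq> 0"
    and uniq: "\<And>y'. y' \<ge> pi * real j1 \<Longrightarrow> F y' = 0 \<Longrightarrow> \<exists>j\<ge>j1. y' = y j"
    by (rule oscillating_zeros[of F1.phase F F' n m, OF _ n m limF limF'])
       (use real_den_deriv in \<open>auto simp: F_def F'_def\<close>)
  have evj: "\<forall>\<^sub>F j in sequentially. j \<ge> j1" by (rule eventually_ge_at_top)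
  have evj': "\<forall>\<^sub>F j in sequentially. y j > F1.phase" using evj by eventually_elim (use y1 in blast)
  have ylim: "(\<lambda>j. y j / real j) \<longlonglongrightarrow> pi"
  proof (rule tendsto_sandwich)
    show "\<forall>\<^sub>F j in sequentially. pi \<le> y j / real j" using evj eventually_gt_at_top[of "0::nat"]
    proof eventually_elim
      case (elim j)
      then show ?case using y1[of j] by (simp add: pos_le_divide_eq)
    qed
    show "\<forall>\<^sub>F j in sequentially. y j / real j \<le> pi + pi / real j" using evj eventually_gt_at_top[of "0::nat"]
    proof eventually_elim
      case (elim j)
      then show ?case using y1[of j] by (simp add: field_simps)
    qed
    show "(\<lambda>j. pi + pi / real j) \<longlonglongrightarrow> pi" by real_asymp
  qed simp
  have yinf: "filterlim y at_top sequentially"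
  proof (rule filterlim_at_top_mono)
    show "filterlim (\<lambda>j. pi * real j) at_top sequentially" using pi_gt_zero by real_asymp
    show "\<forall>\<^sub>F j in sequentially. pi * real j \<le> y j" using evj by eventually_elim (use y1 in \<open>auto intro: less_imp_le\<close>)
  qed
  define q where "q = (\<lambda>j. X (y j))"
  have "(\<lambda>j. y j / real j - F1.phase * (1 / real j)) \<longlonglongrightarrow> pi - F1.phase * 0"
    by (intro tendsto_intros ylim lim_1_over_n)
  then have ulim: "(\<lambda>j. (y j - F1.phase) / real j) \<longlonglongrightarrow> pi" by (simp add: diff_divide_distrib)
  \<comment> \<open>As y j lies between pi j and pi (j + 1), the quotient (y j - phase) / j tends to
    pi; with \<beta> = k pi^2 / 6 this makes t j^2 tend to pi k / (3 a).\<close>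
  have "(\<lambda>j. 2 * (bk k * pi / real a) / ((y j - F1.phase) / real j)\<^sup>2) \<longlonglongrightarrow> 2 * (bk k * pi / real a) / pi\<^sup>2"
    by (intro tendsto_intros ulim) simp
  moreover have "2 * (bk k * pi / real a) / pi\<^sup>2 = pi * real k / (3 * real a)"
    by (simp add: bk_def power2_eq_square)
  moreover have "2 * (bk k * pi / real a) / ((y j - F1.phase) / real j)\<^sup>2 = tt (y j) * (real j)\<^sup>2" for j
    by (simp add: tt_def power_divide)
  ultimately have tlim: "(\<lambda>j. tt (y j) * (real j)\<^sup>2) \<longlonglongrightarrow> pi * real k / (3 * real a)" by simp
  have tt0: "(tt \<longlongrightarrow> 0) at_top" unfolding tt_def by real_asymp
  have t0: "filterlim (\<lambda>j. tt (y j)) (at_right 0) sequentially"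
    unfolding filterlim_at
  proof
    show "\<forall>\<^sub>F j in sequentially. tt (y j) \<in> {0<..} \<and> tt (y j) \<noteq> 0" using evj'
    proof eventually_elim
      case (elim j)
      then show ?case using Lamy_props(2)[OF elim] by simp
    qed
    show "(\<lambda>j. tt (y j)) \<longlonglongrightarrow> 0" by (rule filterlim_compose[OF tt0 yinf])
  qed
  have qlim: "q \<longlonglongrightarrow> 1"
  proof -
    have "(\<lambda>j. exp (- tt (y j))) \<longlonglongrightarrow> exp (- 0)" by (intro tendsto_intros filterlim_compose[OF tt0 yinf])
    then show ?thesis by (simp add: q_def X_def)
  qed
  have q01: "0 < q j" "q j < 1" if "j \<ge> j1" for j using y1[OF that] Lamy_props(4,5)[of "y j"] by (auto simp: q_def)
  have q1: "\<forall>\<^sub>F j in sequentially. q j < 1" using evj by eventually_elim (rule q01)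
  have qat: "filterlim q (at_left 1) sequentially"
    unfolding filterlim_at using qlim q1 by (auto elim: eventually_mono)
  have fin: "finite {z::complex. z ^ d = 1}" using d by (intro finite_roots_unity) auto
  have d1: "d \<ge> 1" using d by simp
  have evo: "\<forall>\<^sub>F x in at_left (1::real). \<forall>z\<in>{z. z ^ d = 1 \<and> z \<noteq> - 1}. J_den a k z (of_real x) \<noteq> 0"
    using finite_subset[OF _ fin] J_limit(1) norm_root_unity[OF _ d1] by (intro eventually_ball_finite) auto
  have cos0: "(\<lambda>j. cos (y j)) \<longlonglongrightarrow> 0"
  proof (rule Lim_transform_eventually[OF filterlim_compose[OF limF yinf]], use evj in eventually_elim)
    fix j assume "j \<ge> j1"
    then show "F (y j) / n (y j) + cos (y j) = cos (y j)" using y1 by simp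
  qed
  \<comment> \<open>Numerator and derivative of the denominator relative to their amplitudes: at the
    zeros they behave like sin (pi / a) and sin (pi / 4) times the same sin (y j).\<close>
  define b1 where "b1 = (\<lambda>j. Re (F1.A pi (1 / real a) (bk k * pi / (Lamy (y j))\<^sup>2)) / F1.amp (Lamy (y j)))"
  define b2 where "b2 = (\<lambda>j. F' (y j) / m (y j))"
  have B1: "(\<lambda>j. b1 j / sin (y j)) \<longlonglongrightarrow> sin (pi / real a)"
    using filterlim_compose[OF Re_A_y(1)[of "1 / real a"] yinf] by (intro quotient_sin_tendsto(2)[OF cos0]) (simp add: b1_def)
  have B2: "(\<lambda>j. b2 j / sin (y j)) \<longlonglongrightarrow> sin (pi / 4)" and sin0: "\<forall>\<^sub>F j in sequentially. sin (y j) \<noteq> 0"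
    using quotient_sin_tendsto[OF cos0 filterlim_compose[OF limF' yinf]] by (simp_all only: b2_def)
  have sa: "sin (pi / real a) > 0" using a2 by (intro sin_gt_zero) (auto simp: divide_less_eq)
  have b1nz: "\<forall>\<^sub>F j in sequentially. b1 j / sin (y j) \<noteq> 0" by (rule tendsto_imp_eventually_ne[OF B1]) (use sa in simp)
  have "\<forall>\<^sub>F j in sequentially. j \<ge> j1 \<and> b1 j \<noteq> 0 \<and> (\<forall>z\<in>{z. z ^ d = 1 \<and> z \<noteq> - 1}. J_den a k z (of_real (q j)) \<noteq> 0)"
    using evj b1nz eventually_compose_filterlim[OF evo qat] by eventually_elim auto
  then obtain j0 where j0: "\<And>j. j \<ge> j0 \<Longrightarrow> j \<ge> j1 \<and> b1 j \<noteq> 0 \<and> (\<forall>z\<in>{z. z ^ d = 1 \<and> z \<noteq> - 1}. J_den a k z (of_real (q j)) \<noteq> 0)"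
    unfolding eventually_sequentially by blast
  define D where "D = (\<lambda>j. cN k * bk k / (tt (y j) * q j) * (2 * (b2 j * F2.amp (Lamy (y j)))))"
  have at_zero: "is_pole (W a d k) (of_real (q j))" "zorder (W a d k) (of_real (q j)) = - 1"
      "residue (W a d k) (of_real (q j)) = of_real (b1 j / b2 j * (tt (y j) * q j * sqrt 2 / (y j - F1.phase)) / real d)" if j: "j \<ge> j0" for j
  proof -
    have j1: "j \<ge> j1" using j0[OF j] by blast
    have yj: "y j > F1.phase" "F (y j) = 0" "F' (y j) \<noteq> 0" using y1[OF j1] by auto
    note p = Lamy_props[OF yj(1)]
    have amp: "F1.amp (Lamy (y j)) > 0" "F2.amp (Lamy (y j)) > 0" using F1.amp_pos[OF p(1)] F2.amp_pos[OF p(1)] by auto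
    have num: "J_num a k (- 1) (of_real (q j)) = of_real (cN k * (2 * (b1 j * F1.amp (Lamy (y j)))))"
      unfolding q_def J_minus_one(1)[OF yj(1)] b1_def using amp by simp
    have b2: "b2 j * F2.amp (Lamy (y j)) = - Re (F2.A pi 1 (bk k * pi / (Lamy (y j))\<^sup>2))"
      unfolding b2_def F'm[OF yj(1)] using amp by simp
    have der: "(J_den a k (- 1) has_field_derivative of_real (D j)) (at (of_real (q j)))"
      using J_minus_one(3)[OF yj(1)] unfolding D_def b2 q_def by simp
    have b20: "b2 j \<noteq> 0" using yj m[OF yj(1)] by (simp add: b2_def)
    have D0: "D j \<noteq> 0" using b20 amp p cN bk by (simp add: D_def q_def)
    have den: "J_den a k (- 1) (of_real (q j)) = 0" using yj(2) unfolding F_def q_def J_minus_one(2)[OF yj(1)] by simp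
    have nq: "norm (complex_of_real (q j)) < 1" using q01[OF j1] by simp
    have num0: "J_num a k (- 1) (of_real (q j)) \<noteq> 0" unfolding num using j0[OF j] cN amp by simp
    have D0': "complex_of_real (D j) \<noteq> 0" using D0 by simp
    have oth: "J_den a k z (of_real (q j)) \<noteq> 0" if "z ^ d = 1" "z \<noteq> - 1" for z using j0[OF j] that by blast
    have wp: "is_pole (W a d k) (of_real (q j))" "zorder (W a d k) (of_real (q j)) = - 1"
        "residue (W a d k) (of_real (q j)) = J_num a k (- 1) (of_real (q j)) / (of_nat d * of_real (D j))"
      by (rule W_simple_pole[OF a_pos(2) d(1) d1 nq oth den der D0' num0]; assumption)+
    show "is_pole (W a d k) (of_real (q j))" "zorder (W a d k) (of_real (q j)) = - 1" by (rule wp)+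
    \<comment> \<open>The amplitudes differ by the factor \<Lambda> / \<beta>, and \<Lambda> = (y -
      phase) / sqrt 2; this is the origin of sqrt 2 / (y - phase).\<close>
    have r: "cN k * (2 * (b1 j * F1.amp (Lamy (y j)))) / (real d * D j) = b1 j / b2 j * (tt (y j) * q j * sqrt 2 / (y j - F1.phase)) / real d"
    proof -
      have "D j = cN k * 2 * F1.amp (Lamy (y j)) * (b2 j * (y j - F1.phase) / (sqrt 2 * (tt (y j) * q j)))"
        unfolding D_def F2_amp[OF p(1)] using bk by (simp add: Lamy_def mult_ac)
      then show ?thesis using cN amp by (simp add: mult_ac)
    qed
    show "residue (W a d k) (of_real (q j)) = of_real (b1 j / b2 j * (tt (y j) * q j * sqrt 2 / (y j - F1.phase)) / real d)"
      unfolding wp(3) num r[symmetric] by simp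
  qed
  have inj: "inj_on q {j0..}"
  proof (rule inj_onI)
    fix i j assume ij: "i \<in> {j0..}" "j \<in> {j0..}" "q i = q j"
    then have y: "y i > F1.phase" "y j > F1.phase" "pi * real i < y i" "y i < pi * (real i + 1)" "pi * real j < y j" "y j < pi * (real j + 1)"
      using j0 y1 by auto
    have "tt (y i) = tt (y j)" using ij by (simp add: q_def X_def)
    then have "(y i - F1.phase)\<^sup>2 = (y j - F1.phase)\<^sup>2" using y(1,2) bk a_pos by (simp add: tt_def divide_cancel_left)
    then have "y i = y j" using y(1,2) by (simp add: power2_eq_iff)
    then have "pi * real i < pi * (real j + 1)" "pi * real j < pi * (real i + 1)" using y by linarith+
    then have "real i < real j + 1" "real j < real i + 1" by (simp_all only: mult_less_cancel_left_pos pi_gt_zero)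
    then show "i = j" by linarith
  qed
  have poles: "\<exists>\<epsilon>>0. \<forall>x::real. 1 - \<epsilon> < x \<longrightarrow> x < 1 \<longrightarrow> is_pole (W a d k) (of_real x) \<longrightarrow> (\<exists>j\<ge>j0. x = q j)"
  proof -
    define b where "b = 2 * (bk k * pi / real a)"
    have b: "b > 0" using bk a_pos by (simp add: b_def)
    define Y where "Y = (\<lambda>x::real. F1.phase + sqrt (b / (- ln x)))"
    have "filterlim Y at_top (at_left 1)" unfolding Y_def using b by real_asymp
    then have evY: "\<forall>\<^sub>F x in at_left 1. Y x \<ge> pi * real j0" by (auto simp: filterlim_at_top)
    have ev01: "\<forall>\<^sub>F x in at_left (1::real). 0 < x \<and> x < 1"
      using eventually_at_left_real[of 0 "1::real"] by (auto elim: eventually_mono)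
    have "\<forall>\<^sub>F x in at_left (1::real). is_pole (W a d k) (of_real x) \<longrightarrow> (\<exists>j\<ge>j0. x = q j)"
      using evo evY ev01
    proof eventually_elim
      case (elim x)
      show ?case
      proof
        assume pole: "is_pole (W a d k) (of_real x)"
        \<comment> \<open>Near 1 no other root has a vanishing denominator, so a pole can only come
          from z = -1 and corresponds to a zero of \<open>F\<close>.\<close>
        have "J_den a k (- 1) (of_real x) = 0"
        proof (rule ccontr)
          assume "J_den a k (- 1) (of_real x) \<noteq> 0"
          then have "J_den a k z (of_real x) \<noteq> 0" if "z ^ d = 1" for z using elim(1) that by (cases "z = - 1") auto
          then show False using W_eq_section_sum(2)[OF a_pos(2) d1, of "of_real x" k] elim(3) pole by simp
        qed
        moreover have Yx: "X (Y x) = x" "Y x > F1.phase"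
        proof -
          define l where "l = - ln x"
          have l: "l > 0" using elim(3) by (simp add: l_def)
          have "tt (Y x) = b / (sqrt (b / l))\<^sup>2" by (simp add: tt_def Y_def b_def l_def)
          also have "\<dots> = l" using b l by simp
          finally show "X (Y x) = x" using elim(3) by (simp add: X_def l_def)
          have "b / l > 0" using b l by simp
          then show "Y x > F1.phase" unfolding Y_def l_def by simp
        qed
        ultimately have F0: "F (Y x) = 0" by (simp add: F_def)
        have "j0 \<ge> j1" using j0[of j0] by simp
        then have "pi * real j1 \<le> pi * real j0" by simp
        then have "pi * real j1 \<le> Y x" using elim(2) by linarith
        from uniq[OF this F0] obtain j where j: "j \<ge> j1" "Y x = y j" by blast
        \<comment> \<open>\<open>uniq\<close> yields only j \<ge> j1; the sharper j \<ge> j0 follows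
          from Y x \<ge> pi j0 and y j < pi (j + 1).\<close>
        have "pi * real j0 < pi * (real j + 1)" using y1[OF j(1)] j(2) elim(2) by linarith
        then have "real j0 < real j + 1" by (simp only: mult_less_cancel_left_pos pi_gt_zero)
        then have "j \<ge> j0" by linarith
        moreover have "x = q j" using Yx(1) j(2) by (simp add: q_def)
        ultimately show "\<exists>j\<ge>j0. x = q j" by blast
      qed
    qed
    then obtain b where b: "b < 1" "\<And>x. b < x \<Longrightarrow> x < 1 \<Longrightarrow> is_pole (W a d k) (of_real x) \<longrightarrow> (\<exists>j\<ge>j0. x = q j)"
      unfolding eventually_at_left_field by blast
    show ?thesis by (rule exI[of _ "1 - b"]) (use b in auto)
  qed
  have asym1: "(\<lambda>j. 1 - q j) \<sim>[at_top] (\<lambda>j. pi * real k / (3 * real a * real j ^ 2))"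
  proof (rule asymp_equivI')
    define c where "c = pi * real k / (3 * real a)"
    have c: "c > 0" using k1 a_pos by (simp add: c_def)
    have "((\<lambda>t::real. (1 - exp (- t)) / t) \<longlongrightarrow> 1) (at_right 0)" by real_asymp
    from filterlim_compose[OF this t0]
    have "(\<lambda>j. (1 - exp (- tt (y j))) / tt (y j) * (tt (y j) * (real j)\<^sup>2) / c) \<longlonglongrightarrow> 1 * c / c"
      using tlim c unfolding c_def[symmetric] by (intro tendsto_mult tendsto_divide tendsto_const) auto
    moreover have "1 * c / c = 1" using c by simp
    ultimately have l: "(\<lambda>j. (1 - exp (- tt (y j))) / tt (y j) * (tt (y j) * (real j)\<^sup>2) / c) \<longlonglongrightarrow> 1" by (simp only:)
    show "(\<lambda>j. (1 - q j) / (pi * real k / (3 * real a * real j ^ 2))) \<longlonglongrightarrow> 1"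
    proof (rule Lim_transform_eventually[OF l], use evj' in eventually_elim)
      fix j assume "y j > F1.phase"
      then have "tt (y j) > 0" by (rule Lamy_props)
      then show "(1 - exp (- tt (y j))) / tt (y j) * (tt (y j) * (real j)\<^sup>2) / c = (1 - q j) / (pi * real k / (3 * real a * real j ^ 2))"
        by (simp add: q_def X_def c_def)
    qed
  qed
  have asym2: "(\<lambda>j. residue (W a d k) (of_real (q j))) \<sim>[at_top] (\<lambda>j. of_real (2 * real k * sin (pi / real a) / (3 * real a * real d * real j ^ 3)))"
  proof (rule asymp_equivI')
    define C where "C = 2 * real k * sin (pi / real a) / (3 * real a * real d)"
    have C: "C > 0" using k1 a_pos sa d by (simp add: C_def)
    have s4: "sin (pi / 4) \<noteq> 0" by (simp add: sin_45)
    \<comment> \<open>The factor sqrt 2 / sin (pi / 4) is the 2 of the residue formula; t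
      contributes j^-2 and 1 / (y - phase) another j^-1.\<close>
    have "(\<lambda>j. (b1 j / sin (y j)) / (b2 j / sin (y j)) * ((tt (y j) * (real j)\<^sup>2) * q j * sqrt 2 / ((y j - F1.phase) / real j)) / real d / C) \<longlonglongrightarrow>
       sin (pi / real a) / sin (pi / 4) * ((pi * real k / (3 * real a)) * 1 * sqrt 2 / pi) / real d / C"
      by (intro tendsto_intros B1 B2 tlim qlim ulim s4) (use C d in auto)
    moreover have "sin (pi / real a) / sin (pi / 4) * ((pi * real k / (3 * real a)) * 1 * sqrt 2 / pi) / real d / C = 1"
    proof -
      have "sin (pi / real a) / sin (pi / 4) * ((pi * real k / (3 * real a)) * 1 * sqrt 2 / pi) / real d = C"
        unfolding C_def sin_45 using a_pos d by (simp add: field_simps)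
      then show ?thesis using C by simp
    qed
    ultimately have "(\<lambda>j. (b1 j / sin (y j)) / (b2 j / sin (y j)) * ((tt (y j) * (real j)\<^sup>2) * q j * sqrt 2 / ((y j - F1.phase) / real j)) / real d / C) \<longlonglongrightarrow> 1" by (simp only:)
    from tendsto_of_real[OF this, where 'a = complex]
    have l: "(\<lambda>j. complex_of_real ((b1 j / sin (y j)) / (b2 j / sin (y j)) * ((tt (y j) * (real j)\<^sup>2) * q j * sqrt 2 / ((y j - F1.phase) / real j)) / real d / C)) \<longlonglongrightarrow> 1" by (simp only: of_real_1)
    show "(\<lambda>j. residue (W a d k) (of_real (q j)) / of_real (2 * real k * sin (pi / real a) / (3 * real a * real d * real j ^ 3))) \<longlonglongrightarrow> 1"
    proof (rule Lim_transform_eventually[OF l], use sin0 eventually_ge_at_top[of j0] eventually_gt_at_top[of "0::nat"] in eventually_elim)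
      fix j :: nat assume j: "sin (y j) \<noteq> 0" "j0 \<le> j" "0 < j"
      have "2 * real k * sin (pi / real a) / (3 * real a * real d * real j ^ 3) = C / real j ^ 3" by (simp add: C_def)
      moreover have "(b1 j / sin (y j)) / (b2 j / sin (y j)) * ((tt (y j) * (real j)\<^sup>2) * q j * sqrt 2 / ((y j - F1.phase) / real j)) / real d / C
         = (b1 j / b2 j * (tt (y j) * q j * sqrt 2 / (y j - F1.phase)) / real d) / (C / real j ^ 3)"
        using j by (simp add: power2_eq_square power3_eq_cube)
      ultimately show "complex_of_real ((b1 j / sin (y j)) / (b2 j / sin (y j)) * ((tt (y j) * (real j)\<^sup>2) * q j * sqrt 2 / ((y j - F1.phase) / real j)) / real d / C)
         = residue (W a d k) (of_real (q j)) / of_real (2 * real k * sin (pi / real a) / (3 * real a * real d * real j ^ 3))"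
        unfolding at_zero(3)[OF j(2)] by (simp only: of_real_divide)
    qed
  qed
  show ?thesis
    by (intro exI[of _ j0] exI[of _ q] conjI allI impI inj poles asym1 asym2 qlim at_zero q01; use j0 in blast)
qed

end

section \<open>The special nome\<close>

lemma phi_le: assumes "0 \<le> x" "x < 1" shows "phi x \<le> 1 - x"
proof (rule LIMSEQ_le_const2)
  show "(\<lambda>N. \<Prod>n<N. 1 - x ^ Suc n) \<longlonglongrightarrow> phi x" using assms by (intro phi_LIMSEQ) auto
  have "(\<Prod>n<Suc N. 1 - x ^ Suc n) \<le> 1 - x" for N
  proof -
    have "(\<Prod>n<N. 1 - x ^ Suc (Suc n)) \<le> 1"
      using assms by (intro prod_le_1) (auto simp: power_le_one mult_le_one)
    moreover have "(\<Prod>n<Suc N. 1 - x ^ Suc n) = (1 - x) * (\<Prod>n<N. 1 - x ^ Suc (Suc n))"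
      by (subst prod.lessThan_Suc_shift) simp
    ultimately show ?thesis using assms by (simp add: mult_left_le)
  qed
  then show "\<exists>N. \<forall>n\<ge>N. (\<Prod>n<n. 1 - x ^ Suc n) \<le> 1 - x"
    by (intro exI[of _ 1]) (metis One_nat_def Suc_le_D)
qed

lemma phi_ge: assumes "0 \<le> x" "x < 1" shows "1 - x / (1 - x) \<le> phi x"
proof (rule LIMSEQ_le_const)
  show "(\<lambda>N. \<Prod>n<N. 1 - x ^ Suc n) \<longlonglongrightarrow> phi x" using assms by (intro phi_LIMSEQ) auto
  have "1 - x / (1 - x) \<le> (\<Prod>n<N. 1 - x ^ Suc n)" for N
  proof -
    have "(\<lambda>n. x * x ^ n) sums (x * (1 / (1 - x)))" using assms by (intro sums_mult geometric_sums) auto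
    then have "(\<Sum>n<N. x ^ Suc n) \<le> x / (1 - x)"
      using sum_le_suminf[of "\<lambda>n. x ^ Suc n" "{..<N}"] assms by (auto simp: sums_iff)
    moreover have "1 - (\<Sum>n<N. x ^ Suc n) \<le> (\<Prod>n<N. 1 - x ^ Suc n)"
      using assms by (intro Weierstrass_prod_ineq) (auto intro!: power_le_one mult_le_one)
    ultimately show ?thesis by linarith
  qed
  then show "\<exists>N. \<forall>n\<ge>N. 1 - x / (1 - x) \<le> (\<Prod>n<n. 1 - x ^ Suc n)" by blast
qed

text \<open>Differentiability is known from \<open>Phi_holomorphic\<close>, so the derivative may be
  computed along the positive reals, where \<open>phi_le\<close> and \<open>phi_ge\<close> squeeze
  the difference quotient.\<close>

lemma Phi_deriv_0: "(Phi has_field_derivative - 1) (at 0)"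
proof -
  define D where "D = deriv Phi 0"
  have D: "(Phi has_field_derivative D) (at 0)"
    unfolding D_def by (rule holomorphic_derivI[OF Phi_holomorphic open_ball]) simp
  have "filterlim complex_of_real (at 0) (at_right 0)"
    unfolding filterlim_at
  proof
    show "\<forall>\<^sub>F x in at_right 0. complex_of_real x \<in> UNIV \<and> complex_of_real x \<noteq> 0"
      using eventually_at_right_less[of "0::real"] by eventually_elim simp
    show "(complex_of_real \<longlongrightarrow> 0) (at_right 0)" by (rule tendsto_eq_intros refl | simp)+
  qed
  with D have "((\<lambda>x. (Phi (of_real x) - Phi 0) / (of_real x - 0)) \<longlongrightarrow> D) (at_right 0)"
    unfolding has_field_derivative_iff by (rule filterlim_compose)
  moreover have ev: "\<forall>\<^sub>F x in at_right (0::real). 0 < x \<and> x < 1"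
    by (auto simp: eventually_at_right_field intro: exI[of _ 1])
  then have "\<forall>\<^sub>F x in at_right 0. (Phi (of_real x) - Phi 0) / (of_real x - 0) = of_real ((phi x - 1) / x)"
    by eventually_elim (simp add: Phi_of_real Phi_0)
  ultimately have l: "((\<lambda>x. complex_of_real ((phi x - 1) / x)) \<longlongrightarrow> D) (at_right 0)"
    by (rule Lim_transform_eventually)
  have "((\<lambda>x. (phi x - 1) / x) \<longlongrightarrow> - 1) (at_right 0)"
  proof (rule tendsto_sandwich)
    show "\<forall>\<^sub>F x in at_right 0. - 1 / (1 - x) \<le> (phi x - 1) / x" using ev
    proof eventually_elim
      case (elim x)
      have "- (x / (1 - x)) \<le> phi x - 1" using phi_ge[of x] elim by simp
      then have "- (x / (1 - x)) / x \<le> (phi x - 1) / x" using elim by (intro divide_right_mono) auto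
      then show ?case using elim by simp
    qed
    show "\<forall>\<^sub>F x in at_right 0. (phi x - 1) / x \<le> - 1" using ev
    proof eventually_elim
      case (elim x)
      then show ?case using phi_le[of x] by (simp add: divide_le_eq)
    qed
    show "((\<lambda>x::real. - 1 / (1 - x)) \<longlongrightarrow> - 1) (at_right 0)" by real_asymp
  qed simp
  from tendsto_of_real[OF this, where 'a = complex] have "D = of_real (- 1)"
    by (intro tendsto_unique[OF _ l]) auto
  then show ?thesis using D by simp
qed

text \<open>For k = 24 the coefficient function is x hh x. The expansion hh x = 1 - 24 x + O(x^2) is
  the source of the limits 24 and -24 below.\<close>

definition hh :: "real \<Rightarrow> real" where "hh x = phi x ^ 24"

lemma hh_bounds: assumes "0 \<le> x" "x < 1" shows "0 < hh x" "hh x \<le> 1"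
  using phi_bounds[OF assms] by (auto simp: hh_def power_le_one)

lemma hh_ge_half: assumes "0 \<le> x" "x \<le> 1 / 256" shows "1 / 2 \<le> hh x"
proof -
  have "x / (1 - x) \<le> 1 / 255" using assms by (simp add: divide_le_eq)
  moreover have "1 - x / (1 - x) \<le> phi x" using assms by (intro phi_ge) auto
  ultimately have p: "1 - 1 / 255 \<le> phi x" by linarith
  have "1 / 2 \<le> 1 + real 24 * (- 1 / 255)" by simp
  also have "\<dots> \<le> (1 + - 1 / 255) ^ 24" by (rule Bernoulli_inequality) simp
  also have "\<dots> \<le> phi x ^ 24" using p by (intro power_mono) auto
  finally show ?thesis by (simp add: hh_def)
qed

text \<open>hh x + 24 x extends to a holomorphic function whose derivative vanishes at 0, hence is
  O(|z|) on the disc of radius 1/2; the mean value inequality on the disc of radius M gives the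
  factor M. The factor |x - y| matters because arguments x and q x with q near 1 are
  compared.\<close>

lemma hh_estimate:
  "\<exists>C\<ge>0. \<forall>x y M. 0 \<le> x \<longrightarrow> 0 \<le> y \<longrightarrow> x \<le> M \<longrightarrow> y \<le> M \<longrightarrow> M \<le> 1 / 2 \<longrightarrow> \<bar>hh x - hh y + 24 * (x - y)\<bar> \<le> C * M * \<bar>x - y\<bar>"
proof -
  define f where "f = (\<lambda>z. Phi z ^ 24 + 24 * z)"
  have fh: "f holomorphic_on ball 0 1" unfolding f_def by (intro holomorphic_intros Phi_holomorphic)
  have f1: "deriv f holomorphic_on ball 0 1" and f2: "deriv (deriv f) holomorphic_on ball 0 1"
    using fh by (auto intro!: holomorphic_deriv)
  have "(f has_field_derivative (of_nat 24 * Phi 0 ^ 23 * - 1 + 24)) (at 0)"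
    unfolding f_def by (auto intro!: derivative_eq_intros Phi_deriv_0)
  then have d0: "deriv f 0 = 0" by (simp add: DERIV_imp_deriv Phi_0)
  have sub: "cball 0 (1 / 2) \<subseteq> ball (0::complex) 1" by auto
  have "bounded (deriv (deriv f) ` cball 0 (1 / 2))"
    by (intro compact_imp_bounded compact_continuous_image holomorphic_on_imp_continuous_on holomorphic_on_subset[OF f2 sub]) simp
  then obtain C where C: "C > 0" "\<And>z. z \<in> cball 0 (1 / 2) \<Longrightarrow> norm (deriv (deriv f) z) \<le> C"
    unfolding bounded_pos by blast
  have D: "(f has_field_derivative deriv f z) (at z within S)" "(deriv f has_field_derivative deriv (deriv f) z) (at z within S)"
    if "z \<in> cball 0 (1 / 2)" for z S
    using that sub holomorphic_derivI[OF fh open_ball] holomorphic_derivI[OF f1 open_ball] by (auto intro!: has_field_derivative_at_within)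
  have d1: "norm (deriv f z) \<le> C * norm z" if "z \<in> cball 0 (1 / 2)" for z
    using field_differentiable_bound[of "cball 0 (1 / 2)" "deriv f" "deriv (deriv f)" C z 0, OF convex_cball D(2) C(2)] that d0 by simp
  have "\<bar>hh x - hh y + 24 * (x - y)\<bar> \<le> C * M * \<bar>x - y\<bar>" if xy: "0 \<le> x" "0 \<le> y" "x \<le> M" "y \<le> M" "M \<le> 1 / 2" for x y M
  proof -
    have "norm (f (of_real x) - f (of_real y)) \<le> C * M * norm (complex_of_real x - of_real y)"
    proof (rule field_differentiable_bound[of "cball 0 M" f "deriv f"])
      fix z :: complex assume z: "z \<in> cball 0 M"
      then have z': "z \<in> cball 0 (1 / 2)" using xy by auto
      show "(f has_field_derivative deriv f z) (at z within cball 0 M)" by (rule D(1)[OF z'])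
      have "C * norm z \<le> C * M" using z C by (intro mult_left_mono) auto
      then show "norm (deriv f z) \<le> C * M" using d1[OF z'] by linarith
    qed (use xy in auto)
    moreover have "f (of_real x) = of_real (hh x + 24 * x)" if "0 \<le> x" "x \<le> 1 / 2" for x
      using that by (simp add: f_def hh_def Phi_of_real)
    then have "f (of_real x) - f (of_real y) = of_real (hh x - hh y + 24 * (x - y))" using xy by simp
    ultimately show ?thesis by (simp only: norm_of_real flip: of_real_diff)
  qed
  then show ?thesis using C(1) by (intro exI[of _ C]) auto
qed

text \<open>With \<open>w = z Q\<close>, \<open>Q = q\<^sup>a\<close>, the quotient \<open>J\<close> is \<open>q / Q\<close> times a quotient of two power series in \<open>w\<close>, with coefficients
  \<open>qc\<close>. Multiplying numerator and denominator by \<open>1 - w\<close> makes all their coefficients but the first ones small; the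
  factorisation \<open>qc q Q n = Q\<^bsup>n-1\<^esup> (1 - q) kk q Q n\<close> for \<open>n \<ge> 2\<close> splits off the order of magnitude.\<close>
definition Acoef :: "real \<Rightarrow> real \<Rightarrow> real fps" where "Acoef q Q = Abs_fps (\<lambda>n. hh (q * Q ^ n))"
definition Bcoef :: "real \<Rightarrow> real fps" where "Bcoef Q = Abs_fps (\<lambda>n. hh (Q ^ (n + 1)))"
definition qc :: "real \<Rightarrow> real \<Rightarrow> nat \<Rightarrow> real" where "qc q Q = fps_nth (Acoef q Q * inverse (Bcoef Q))"
text \<open>For i \<ge> 1 the coefficient of w^i in 1 - w times the denominator series is Q^i dd Q
  i. \<open>rr\<close> is the matching coefficient of the numerator, to which the contributions of
  \<open>qc q Q 0\<close> and \<open>qc q Q 1\<close> have been moved, on the scale of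
  \<open>kk\<close>.\<close>

definition dd :: "real \<Rightarrow> nat \<Rightarrow> real" where "dd Q i = (hh (Q ^ (i + 1)) - hh (Q ^ i)) / Q ^ i"
definition rr :: "real \<Rightarrow> real \<Rightarrow> nat \<Rightarrow> real" where
  "rr q Q n = (hh (q * Q ^ n) - hh (q * Q ^ (n - 1)) - qc q Q 0 * (Q ^ n * dd Q n) - qc q Q 1 * (Q ^ (n - 1) * dd Q (n - 1))) / (Q ^ (n - 1) * (1 - q))"
definition kk :: "real \<Rightarrow> real \<Rightarrow> nat \<Rightarrow> real" where "kk q Q n = qc q Q n / (Q ^ (n - 1) * (1 - q))"

context
  fixes q Q :: real
  assumes q: "0 < q" "q < 1" and Q: "0 < Q" "Q < 1"
begin

lemma qc_mult: "Acoef q Q * inverse (Bcoef Q) * Bcoef Q = Acoef q Q"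
proof -
  have "fps_nth (Bcoef Q) 0 \<noteq> 0" using hh_bounds[of Q] Q by (simp add: Bcoef_def)
  then have "inverse (Bcoef Q) * Bcoef Q = 1" by (rule inverse_mult_eq_1)
  then show ?thesis by (simp add: mult.assoc)
qed

lemma qc_sum: "(\<Sum>i\<le>n. qc q Q i * hh (Q ^ (n - i + 1))) = hh (q * Q ^ n)"
proof -
  have "fps_nth (Acoef q Q * inverse (Bcoef Q) * Bcoef Q) n = (\<Sum>i=0..n. qc q Q i * fps_nth (Bcoef Q) (n - i))"
    unfolding fps_mult_nth[of "Acoef q Q * inverse (Bcoef Q)"] qc_def ..
  then show ?thesis unfolding qc_mult by (simp add: Acoef_def Bcoef_def atLeast0AtMost)
qed

lemma qc_0: "qc q Q 0 = hh q / hh Q"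
  using qc_sum[of 0] hh_bounds[of Q] Q by (simp add: field_simps)

text \<open>Comparison of the coefficients of w^n in G B = (1 - w) A. The indices 0 and 1 scale
  differently from the others and go into \<open>rr\<close>; for the rest Q^(i - 1) Q^(n - i) = Q^(n
  - 1), so the normalising factor cancels throughout.\<close>

lemma kk_recurrence:
  assumes n: "n \<ge> 2"
  shows "hh Q * kk q Q n + (\<Sum>j\<in>{2..<n}. dd Q (n - j) * kk q Q j) = rr q Q n"
proof -
  define G where "G = Acoef q Q * inverse (Bcoef Q)"
  define B where "B = (1 - fps_X) * Bcoef Q"
  define e where "e = 1 - q"
  have e: "e > 0" using q by (simp add: e_def)
  have B0: "fps_nth B 0 = hh Q" by (simp add: B_def Bcoef_def)
  have Bn: "fps_nth B i = Q ^ i * dd Q i" if "i \<ge> 1" for i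
    using that Q by (cases i) (simp_all add: B_def Bcoef_def dd_def left_diff_distrib)
  have "G * B = (1 - fps_X) * Acoef q Q" using qc_mult by (simp add: G_def B_def mult_ac)
  then have "(\<Sum>i=0..n. fps_nth G i * fps_nth B (n - i)) = hh (q * Q ^ n) - hh (q * Q ^ (n - 1))"
    using n by (simp add: fps_mult_nth[symmetric] Acoef_def left_diff_distrib)
  moreover have "{0..n} = insert 0 (insert 1 (insert n {2..<n}))" using n by auto
  ultimately have "qc q Q 0 * fps_nth B n + (qc q Q 1 * fps_nth B (n - 1) + (qc q Q n * fps_nth B 0 + (\<Sum>i\<in>{2..<n}. qc q Q i * fps_nth B (n - i))))
      = hh (q * Q ^ n) - hh (q * Q ^ (n - 1))"
    using n by (simp add: qc_def G_def)
  then have main: "qc q Q n * hh Q + (\<Sum>i\<in>{2..<n}. qc q Q i * fps_nth B (n - i)) = rr q Q n * (Q ^ (n - 1) * e)"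
    using n Bn[of n] Bn[of "n - 1"] Q e by (simp add: rr_def B0 flip: e_def)
  have kq: "qc q Q i = kk q Q i * (Q ^ (i - 1) * e)" for i using Q e by (simp add: kk_def flip: e_def)
  have "(\<Sum>i\<in>{2..<n}. qc q Q i * fps_nth B (n - i)) = (\<Sum>i\<in>{2..<n}. dd Q (n - i) * kk q Q i) * (Q ^ (n - 1) * e)"
    unfolding sum_distrib_right
  proof (rule sum.cong[OF refl])
    fix i assume i: "i \<in> {2..<n}"
    have p: "Q ^ (i - 1) * Q ^ (n - i) = Q ^ (n - 1)" using i by (simp flip: power_add)
    have "qc q Q i * fps_nth B (n - i) = dd Q (n - i) * kk q Q i * ((Q ^ (i - 1) * Q ^ (n - i)) * e)"
    proof -
      have "n - i \<ge> 1" using i by auto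
      from Bn[OF this] show ?thesis by (simp add: kq[of i])
    qed
    then show "qc q Q i * fps_nth B (n - i) = dd Q (n - i) * kk q Q i * (Q ^ (n - 1) * e)" unfolding p .
  qed
  then have "(hh Q * kk q Q n + (\<Sum>j\<in>{2..<n}. dd Q (n - j) * kk q Q j)) * (Q ^ (n - 1) * e) = rr q Q n * (Q ^ (n - 1) * e)"
    using main by (simp add: kq[of n] algebra_simps)
  then show ?thesis using Q e by simp
qed

text \<open>In the application q tends to 1, so the errors in \<open>rr\<close> have to be small
  even after division by 1 - q. The two parts of \<eta> are Q, from the quadratic errors in
  \<open>hh\<close>, and the quotient of \<open>qc q Q 0\<close> by 1 - q.\<close>

lemma coefficient_bounds:
  fixes C :: real
  assumes Q': "Q \<le> 1 / 256" and C: "C \<ge> 0"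
    and est: "\<And>x y M. 0 \<le> x \<Longrightarrow> 0 \<le> y \<Longrightarrow> x \<le> M \<Longrightarrow> y \<le> M \<Longrightarrow> M \<le> 1 / 2 \<Longrightarrow> \<bar>hh x - hh y + 24 * (x - y)\<bar> \<le> C * M * \<bar>x - y\<bar>"
  defines "\<eta> \<equiv> 3 * (48 + C)\<^sup>2 * (Q + hh q / hh Q / (1 - q))"
  shows "\<bar>hh Q - 1\<bar> \<le> \<eta>" "i \<ge> 1 \<Longrightarrow> \<bar>dd Q i - 24\<bar> \<le> \<eta>" "n \<ge> 2 \<Longrightarrow> \<bar>rr q Q n + 24\<bar> \<le> \<eta>"
proof -
  define E where "E = 48 + C"
  define e where "e = 1 - q"
  define g where "g = hh q / hh Q / e"
  have e: "e > 0" "e < 1" using q by (auto simp: e_def)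
  have hQ: "hh Q \<ge> 1 / 2" "hh Q \<le> 1" "hh Q > 0" using hh_ge_half[of Q] hh_bounds[of Q] Q Q' by auto
  have g: "g \<ge> 0" using hh_bounds[of q] q hQ e by (auto simp: g_def)
  have E: "E \<ge> 48" "E \<le> E\<^sup>2" "E * 48 \<le> E\<^sup>2" 
  proof -
    show E: "E \<ge> 48" using C by (simp add: E_def)
    have "E * 1 \<le> E * E" "E * 48 \<le> E * E" using E by (intro mult_left_mono; simp)+
    then show "E \<le> E\<^sup>2" "E * 48 \<le> E\<^sup>2" by (simp_all add: power2_eq_square)
  qed
  have \<eta>: "\<eta> = 3 * E\<^sup>2 * Q + 3 * E\<^sup>2 * g" by (simp add: \<eta>_def E_def g_def e_def algebra_simps)
  have E2g: "0 \<le> E\<^sup>2 * g" using g by simp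
  have EQ\<eta>: "E * Q \<le> \<eta>"
  proof -
    have "E * Q \<le> E\<^sup>2 * Q" using E Q by (intro mult_right_mono) auto
    moreover have "0 \<le> E\<^sup>2 * Q" using Q by simp
    ultimately show ?thesis unfolding \<eta> using E2g by linarith
  qed
  have pw: "0 < Q ^ i" "Q ^ i \<le> Q" if "i \<ge> 1" for i
    using Q that power_decreasing[of 1 i Q] by auto
  have CQ: "C * Q \<le> C" "24 * Q \<le> 24" using C Q by (auto intro: mult_left_le)
  have h0: "hh 0 = 1" by (simp add: hh_def phi_def Phi_0)
  show "\<bar>hh Q - 1\<bar> \<le> \<eta>"
  proof -
    have "\<bar>hh Q - 1 + 24 * Q\<bar> \<le> C * Q * Q" using est[of Q 0 Q] Q Q' h0 by simp
    also have "\<dots> \<le> C * Q" using CQ Q by (intro mult_right_mono) auto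
    finally have "\<bar>hh Q - 1\<bar> \<le> 24 * Q + C * Q" using Q by linarith
    also have "\<dots> \<le> E * Q" using Q by (simp add: E_def algebra_simps)
    finally show ?thesis using EQ\<eta> by linarith
  qed
  have dd24: "\<bar>dd Q i - 24\<bar> \<le> (24 + C) * Q" if i: "i \<ge> 1" for i
  proof -
    have Qi: "Q ^ (i + 1) \<le> Q ^ i" using Q by (intro power_decreasing) auto
    have "\<bar>hh (Q ^ (i + 1)) - hh (Q ^ i) + 24 * (Q ^ (i + 1) - Q ^ i)\<bar> \<le> C * Q ^ i * \<bar>Q ^ (i + 1) - Q ^ i\<bar>"
      by (rule est) (use Q Q' Qi pw[OF i] in auto)
    also have "\<dots> \<le> C * Q ^ i * Q ^ i" using Qi Q C by (intro mult_left_mono) auto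
    also have "\<dots> \<le> C * Q * Q ^ i" using pw[OF i] C by (intro mult_right_mono mult_left_mono) auto
    finally have "\<bar>hh (Q ^ (i + 1)) - hh (Q ^ i) + 24 * (Q ^ (i + 1) - Q ^ i)\<bar> / Q ^ i \<le> C * Q"
      using pw[OF i] by (simp add: divide_le_eq)
    moreover have "dd Q i - 24 + 24 * Q = (hh (Q ^ (i + 1)) - hh (Q ^ i) + 24 * (Q ^ (i + 1) - Q ^ i)) / Q ^ i"
      using pw[OF i] by (simp add: dd_def field_simps)
    ultimately have "\<bar>dd Q i - 24 + 24 * Q\<bar> \<le> C * Q" using pw[OF i] by simp
    then show ?thesis using Q by (simp add: algebra_simps)
  qed
  show "\<bar>dd Q i - 24\<bar> \<le> \<eta>" if "i \<ge> 1"
  proof -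
    have "(24 + C) * Q \<le> E * Q" using Q by (intro mult_right_mono) (auto simp: E_def)
    then show ?thesis using dd24[OF that] EQ\<eta> by linarith
  qed
  have ddE: "\<bar>dd Q i\<bar> \<le> E" if "i \<ge> 1" for i
  proof -
    have "(24 + C) * Q \<le> 24 + C" using Q C by (intro mult_left_le) auto
    then show ?thesis using dd24[OF that] by (simp add: E_def)
  qed
  have step: "\<bar>hh (q * x) - hh x - 24 * e * x\<bar> \<le> C * e * x\<^sup>2" if x: "0 < x" "x \<le> Q" for x
  proof -
    have qx: "q * x \<le> x" using q x by (simp add: mult_left_le_one_le)
    have "\<bar>hh (q * x) - hh x + 24 * (q * x - x)\<bar> \<le> C * x * \<bar>q * x - x\<bar>"
      by (rule est) (use x qx q Q' in auto)
    also have "\<bar>q * x - x\<bar> = e * x" using qx by (simp add: e_def algebra_simps)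
    finally show ?thesis by (simp add: e_def algebra_simps power2_eq_square)
  qed
  \<comment> \<open>The coefficient of w is close to 1 even on the scale e = 1 - q, since hh (q Q) -
    hh Q carries a factor e and the constant term is e g.\<close>
  have g1: "\<bar>(qc q Q 1 - 1) / e\<bar> \<le> 2 * (E * Q + g)"
  proof -
    have "qc q Q 0 * hh (Q ^ 2) + qc q Q 1 * hh Q = hh (q * Q)" using qc_sum[of 1] by (simp add: power2_eq_square)
    then have "(qc q Q 1 - 1) * hh Q = (hh (q * Q) - hh Q) - e * g * hh (Q ^ 2)"
      using e by (simp add: qc_0 g_def algebra_simps)
    moreover have "\<bar>e * g * hh (Q ^ 2)\<bar> \<le> e * g"
      using hh_bounds[of "Q ^ 2"] Q e g by (simp add: abs_mult power_less_one_iff mult_left_le)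
    moreover have "\<bar>hh (q * Q) - hh Q\<bar> \<le> e * (E * Q)"
    proof -
      have "\<bar>hh (q * Q) - hh Q - 24 * e * Q\<bar> \<le> C * e * Q\<^sup>2" by (rule step) (use Q in auto)
      also have "\<dots> \<le> C * e * Q" using C e Q by (intro mult_left_mono) (auto simp: power2_eq_square mult_left_le)
      finally have "\<bar>hh (q * Q) - hh Q - 24 * e * Q\<bar> \<le> C * e * Q" .
      moreover have "0 \<le> 24 * e * Q" using e Q by simp
      ultimately have "\<bar>hh (q * Q) - hh Q\<bar> \<le> 24 * e * Q + C * e * Q" by linarith
      also have "\<dots> \<le> e * (E * Q)" using e Q by (simp add: E_def algebra_simps)
      finally show ?thesis .
    qed
    ultimately have "\<bar>(qc q Q 1 - 1) * hh Q\<bar> \<le> e * (E * Q) + e * g" by linarith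
    moreover have "\<bar>(qc q Q 1 - 1) * hh Q\<bar> = \<bar>qc q Q 1 - 1\<bar> * hh Q" using hQ by (simp add: abs_mult)
    ultimately have "\<bar>qc q Q 1 - 1\<bar> * hh Q \<le> e * (E * Q + g)" by (simp add: distrib_left)
    moreover have "\<bar>qc q Q 1 - 1\<bar> * (1 / 2) \<le> \<bar>qc q Q 1 - 1\<bar> * hh Q" using hQ by (intro mult_left_mono) auto
    ultimately have "\<bar>qc q Q 1 - 1\<bar> \<le> 2 * (E * Q + g) * e" by (simp add: algebra_simps)
    then show ?thesis using e by (simp add: divide_le_eq)
  qed
  show "\<bar>rr q Q n + 24\<bar> \<le> \<eta>" if n: "n \<ge> 2"
  proof -
    define m where "m = n - 1"
    have m: "m \<ge> 1" "n = m + 1" using n by (auto simp: m_def)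
    define x where "x = Q ^ m"
    have x: "0 < x" "x \<le> Q" unfolding x_def by (rule pw[OF m(1)])+
    have Qx: "0 < Q * x" "Q * x \<le> x" "Q * x \<le> Q" using Q x by (auto simp: mult_left_le_one_le intro: mult_left_le)
    have xx: "Q ^ n = Q * x" "Q ^ (n - 1) = x" using m by (auto simp: x_def)
    \<comment> \<open>Replacing \<open>qc q Q 1\<close> by 1 turns the main part of
      \<open>rr\<close> into this second difference, which is - 24 e x (1 - Q) up to errors of order
      e x^2; the deviation from 1 is controlled by \<open>g1\<close>.\<close>
    define U where "U = hh (q * (Q * x)) - hh (q * x) - hh (Q * x) + hh x"
    have dm: "x * dd Q m = hh (Q * x) - hh x" using x by (simp add: dd_def x_def)
    have "rr q Q n = (hh (q * (Q * x)) - hh (q * x) - e * g * (Q * x * dd Q n) - qc q Q 1 * (x * dd Q m)) / (x * e)"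
      unfolding rr_def xx using m e by (simp add: qc_0 g_def e_def)
    also have "\<dots> = (U - e * g * (Q * x * dd Q n) - (qc q Q 1 - 1) * (x * dd Q m)) / (x * e)"
      by (simp add: U_def dm algebra_simps)
    also have "\<dots> = U / (x * e) - g * Q * dd Q n - (qc q Q 1 - 1) / e * dd Q m"
      using x e by (simp add: field_simps)
    finally have r: "rr q Q n = U / (x * e) - g * Q * dd Q n - (qc q Q 1 - 1) / e * dd Q m" .
    have "\<bar>U + 24 * e * x - 24 * e * (Q * x)\<bar> \<le> C * e * (Q * x)\<^sup>2 + C * e * x\<^sup>2"
      using step[OF Qx(1,3)] step[OF x] unfolding U_def abs_le_iff by linarith
    also have "\<dots> \<le> C * e * x\<^sup>2 + C * e * x\<^sup>2"
      using Qx C e by (intro add_right_mono mult_left_mono power_mono) auto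
    also have "\<dots> = 2 * C * x * (x * e)" by (simp add: power2_eq_square)
    also have "\<dots> \<le> 2 * C * Q * (x * e)" using x C e by (intro mult_right_mono mult_left_mono) auto
    finally have "\<bar>U + 24 * e * x - 24 * e * (Q * x)\<bar> / (x * e) \<le> 2 * C * Q" using x e by (simp add: pos_divide_le_eq)
    moreover have "\<bar>U + 24 * e * x - 24 * e * (Q * x)\<bar> / (x * e) = \<bar>(U + 24 * e * x - 24 * e * (Q * x)) / (x * e)\<bar>"
      using x e by (simp add: abs_mult)
    moreover have "(U + 24 * e * x - 24 * e * (Q * x)) / (x * e) = U / (x * e) + 24 - 24 * Q" using x e by (simp add: field_simps)
    ultimately have u: "\<bar>U / (x * e) + 24 - 24 * Q\<bar> \<le> 2 * C * Q" by simp
    have "\<bar>g * Q * dd Q n\<bar> \<le> g * 1 * E" unfolding abs_mult using ddE[of n] n g Q E by (intro mult_mono) auto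
    moreover have "\<bar>(qc q Q 1 - 1) / e * dd Q m\<bar> \<le> 2 * (E * Q + g) * E"
      unfolding abs_mult using g1 ddE[OF m(1)] E g Q by (intro mult_mono) auto
    ultimately have "\<bar>rr q Q n + 24\<bar> \<le> 24 * Q + 2 * C * Q + g * E + 2 * (E * Q + g) * E"
      using u Q unfolding r by linarith
    also have "\<dots> \<le> 2 * E * Q + 3 * (E * g) + 2 * E\<^sup>2 * Q" using Q by (simp add: E_def algebra_simps power2_eq_square)
    also have "\<dots> \<le> \<eta>"
    proof -
      have "E * g \<le> E\<^sup>2 * g" using E g by (intro mult_right_mono) auto
      moreover have "E * 2 * Q \<le> E\<^sup>2 * Q" using E Q by (intro mult_right_mono) auto
      ultimately show ?thesis unfolding \<eta> by (simp add: algebra_simps)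
    qed
    finally show ?thesis .
  qed
qed

end

text \<open>The base 51 = 1 + 2 * 25 makes the induction close: 25 * 50 times the sum of 51^j over j
  < n is 25 (51^n - 1), the right side adds 25, and division by \<beta> \<ge> 1/2 doubles the
  result. A bound for all n at once is what the tail in \<open>section_expansion\<close>
  requires.\<close>

lemma recurrence_bound:
  fixes k r b :: "nat \<Rightarrow> real"
  assumes rec: "\<And>n. n \<ge> 2 \<Longrightarrow> \<beta> * k n + (\<Sum>j\<in>{2..<n}. b (n - j) * k j) = r n"
    and \<beta>: "\<beta> \<ge> 1 / 2" and b: "\<And>i. i \<ge> 1 \<Longrightarrow> \<bar>b i\<bar> \<le> 25" and r: "\<And>n. n \<ge> 2 \<Longrightarrow> \<bar>r n\<bar> \<le> 25"
    and n: "n \<ge> 2"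
  shows "\<bar>k n\<bar> \<le> 50 * 51 ^ n"
  using n
proof (induction n rule: less_induct)
  case (less n)
  have "\<bar>\<Sum>j\<in>{2..<n}. b (n - j) * k j\<bar> \<le> (\<Sum>j\<in>{2..<n}. \<bar>b (n - j) * k j\<bar>)" by (rule sum_abs)
  also have "\<dots> \<le> (\<Sum>j\<in>{2..<n}. 25 * (50 * 51 ^ j))"
    unfolding abs_mult using less.IH b by (intro sum_mono mult_mono) auto
  also have "\<dots> \<le> (\<Sum>j<n. 25 * (50 * 51 ^ j))" by (intro sum_mono2) auto
  also have "\<dots> = 25 * (51 ^ n - 1)" using geometric_sum[of "51::real" n] by (simp flip: sum_distrib_left)
  finally have "\<bar>\<beta> * k n\<bar> \<le> 25 * 51 ^ n" using rec[OF less.prems] r[OF less.prems] by (simp add: abs_le_iff)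
  moreover have "1 / 2 * \<bar>k n\<bar> \<le> \<beta> * \<bar>k n\<bar>" using \<beta> by (intro mult_right_mono) auto
  ultimately show ?case using \<beta> by (simp add: abs_mult)
qed

text \<open>For fixed n the recurrence is a finite sum, so limits pass through it by strong
  induction, and a geometric sum with ratio -23 remains.\<close>

lemma recurrence_limit:
  fixes k r b :: "'a \<Rightarrow> nat \<Rightarrow> real"
  assumes rec: "\<And>n. n \<ge> 2 \<Longrightarrow> \<forall>\<^sub>F a in F. \<beta> a * k a n + (\<Sum>j\<in>{2..<n}. b a (n - j) * k a j) = r a n"
    and \<beta>: "(\<beta> \<longlongrightarrow> 1) F" and b: "\<And>i. i \<ge> 1 \<Longrightarrow> ((\<lambda>a. b a i) \<longlongrightarrow> 24) F" and r: "\<And>n. n \<ge> 2 \<Longrightarrow> ((\<lambda>a. r a n) \<longlongrightarrow> - 24) F"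
    and n: "n \<ge> 2"
  shows "((\<lambda>a. k a n) \<longlongrightarrow> - 24 * (- 23) ^ (n - 2)) F"
  using n
proof (induction n rule: less_induct)
  case (less n)
  have "((\<lambda>a. (r a n - (\<Sum>j\<in>{2..<n}. b a (n - j) * k a j)) / \<beta> a) \<longlongrightarrow> (- 24 - (\<Sum>j\<in>{2..<n}. 24 * (- 24 * (- 23) ^ (j - 2)))) / 1) F"
    using less by (intro tendsto_intros \<beta> b r) auto
  moreover have "(- 24 - (\<Sum>j\<in>{2..<n}. 24 * (- 24 * (- 23) ^ (j - 2)))) / 1 = - 24 * (- 23 :: real) ^ (n - 2)"
  proof -
    have "(\<Sum>j\<in>{2..<n}. (- 23 :: real) ^ (j - 2)) = (\<Sum>j<n - 2. (- 23) ^ j)"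
      by (rule sum.reindex_bij_witness[of _ "\<lambda>j. j + 2" "\<lambda>j. j - 2"]) auto
    also have "\<dots> = ((- 23) ^ (n - 2) - 1) / (- 24)" using geometric_sum[of "- 23 :: real" "n - 2"] by simp
    finally have s: "(\<Sum>j\<in>{2..<n}. (- 23 :: real) ^ (j - 2)) = ((- 23) ^ (n - 2) - 1) / (- 24)" .
    show ?thesis by (simp only: s flip: sum_distrib_left) (simp add: field_simps)
  qed
  ultimately have l: "((\<lambda>a. (r a n - (\<Sum>j\<in>{2..<n}. b a (n - j) * k a j)) / \<beta> a) \<longlongrightarrow> - 24 * (- 23) ^ (n - 2)) F" by (simp only:)
  have "\<forall>\<^sub>F a in F. \<beta> a \<noteq> 0" by (rule tendsto_imp_eventually_ne[OF \<beta>]) simp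
  with rec[OF less.prems] have "\<forall>\<^sub>F a in F. (r a n - (\<Sum>j\<in>{2..<n}. b a (n - j) * k a j)) / \<beta> a = k a n"
    by eventually_elim (simp add: field_simps)
  with l show ?case by (rule Lim_transform_eventually)
qed

text \<open>As a times 2 pi / sqrt a is 2 pi sqrt a, this is the a-th power of
  \<open>q_special a\<close>; it is also its modular dual, under the exchange of 1 / sqrt a and sqrt
  a. This coincidence singles out the special nome.\<close>

definition Qa :: "nat \<Rightarrow> real" where "Qa a = exp (- 2 * pi * sqrt (real a))"

lemma special_nome:
  assumes "a \<ge> 2"
  shows "0 < q_special a" "q_special a < 1" "q_special a ^ a = Qa a" "0 < Qa a" "Qa a \<le> 1 / 256" "Qa a < 1"
    "hh (q_special a) / hh (Qa a) = real a ^ 6 * Qa a / q_special a"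
proof -
  define s where "s = sqrt (real a)"
  have s: "s > 0" "s * s = real a" using assms by (auto simp: s_def)
  show "0 < q_special a" "q_special a < 1" "0 < Qa a" using s by (auto simp: q_special_def Qa_def s_def)
  have "real a * (- 2 * pi / s) = - 2 * pi * s" using s(1) by (simp flip: s(2))
  then show "q_special a ^ a = Qa a" by (simp add: q_special_def Qa_def flip: exp_of_nat_mult s_def)
  have "sqrt 2 \<le> s" using assms by (simp add: s_def)
  \<comment> \<open>Crude bounds suffice: sqrt 2 \<ge> 4/3 and pi > 3 give pi s \<ge> 4, hence Qa a
    \<le> exp (- 8) \<le> 2^-8.\<close>
  moreover have "sqrt 2 \<ge> 4 / 3" by (rule real_le_rsqrt) (simp add: power2_eq_square)
  ultimately have "3 * (4 / 3) \<le> pi * s" using pi_gt3 by (intro mult_mono) auto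
  then have "Qa a \<le> exp (- 8)" by (simp add: Qa_def flip: s_def)
  also have "exp (- 8 :: real) = 1 / exp 1 ^ 8" by (simp add: exp_minus divide_inverse flip: exp_of_nat_mult)
  also have "\<dots> \<le> 1 / 2 ^ 8" using exp_ge_add_one_self[of 1] by (intro divide_left_mono power_mono) auto
  finally show Q: "Qa a \<le> 1 / 256" by simp
  then show Q1: "Qa a < 1" by simp
  have p0: "phi (Qa a) > 0" using phi_bounds[of "Qa a"] Q1 by (simp add: Qa_def)
  have "phi (q_special a) = exp (- ln (1 / s) / 2 + pi * (1 / s) / 12 - pi / (12 * (1 / s))) * phi (Qa a)"
    using phi_modular[of "1 / s"] s by (simp add: q_special_def Qa_def flip: s_def)
  then have "hh (q_special a) / hh (Qa a) = exp (- ln (1 / s) / 2 + pi * (1 / s) / 12 - pi / (12 * (1 / s))) ^ 24"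
    using p0 by (simp add: hh_def power_mult_distrib)
  also have "\<dots> = exp (real 24 * (- ln (1 / s) / 2 + pi * (1 / s) / 12 - pi / (12 * (1 / s))))" by (simp only: exp_of_nat_mult)
  also have "real 24 * (- ln (1 / s) / 2 + pi * (1 / s) / 12 - pi / (12 * (1 / s))) = real 12 * ln s + (- 2 * pi * s) - (- 2 * pi / s)"
    using s by (simp add: ln_div)
  also have "exp \<dots> = s ^ 12 * Qa a / q_special a"
    unfolding exp_diff exp_add exp_of_nat_mult using s by (simp add: Qa_def q_special_def flip: s_def)
  also have "s ^ 12 = (s * s) ^ 6" by (simp flip: power2_eq_square power_mult)
  finally show "hh (q_special a) / hh (Qa a) = real a ^ 6 * Qa a / q_special a" unfolding s(2) .
qed

text \<open>As hh (Qa a) \<ge> 1/2, one has Q psi (Q)^24 \<le> 2 Q \<le> 1, so the criterion for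
  small nomes applies with ample room; the limit T is q / Q times the quotient computed in
  \<open>special_nome\<close>.\<close>

theorem special_sections:
  assumes a: "a \<ge> 2"
  shows "\<And>d. d \<ge> 1 \<Longrightarrow> \<not> is_pole (W a d 24) (of_real (q_special a))"
    "\<And>d. d \<ge> 1 \<Longrightarrow> W a d 24 (of_real (q_special a)) = section_sum a d 24 (of_real (q_special a))"
    "\<And>z. norm z \<le> 1 \<Longrightarrow> J_den a 24 z (of_real (q_special a)) \<noteq> 0"
    "tendsto_exponentially (\<lambda>d. W a d 24 (of_real (q_special a))) (of_nat a ^ 6)"
proof -
  note s = special_nome[OF a]
  have Q0: "0 \<le> Qa a" "(Qa a)\<^sup>2 < 1" using s by (auto simp: power_less_one_iff)
  have "psi (Qa a) ^ 24 = hh ((Qa a)\<^sup>2) / hh (Qa a)" using psi_eq[of "Qa a"] s by (simp add: hh_def power_divide)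
  also have "\<dots> \<le> 1 / (1 / 2)"
    using hh_bounds[of "(Qa a)\<^sup>2"] Q0 hh_ge_half[of "Qa a"] s by (intro frac_le) auto
  finally have "Qa a * psi (Qa a) ^ 24 \<le> Qa a * 2" using s by (intro mult_left_mono) auto
  then have le: "q_special a ^ a * psi (q_special a ^ a) ^ 24 \<le> 1" unfolding s(3) using s(5) by linarith
  note sm = sections_of_small_nome[OF s(1,2) _ _ le]
  show "\<And>d. d \<ge> 1 \<Longrightarrow> \<not> is_pole (W a d 24) (of_real (q_special a))" using sm(1) a by simp
  show "\<And>d. d \<ge> 1 \<Longrightarrow> W a d 24 (of_real (q_special a)) = section_sum a d 24 (of_real (q_special a))" using sm(2) a by simp
  show "\<And>z. norm z \<le> 1 \<Longrightarrow> J_den a 24 z (of_real (q_special a)) \<noteq> 0"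
    using J_den_nonzero[OF s(1,2) _ _ le] a by simp
  have c: "coef 24 (complex_of_real x) = of_real (x * hh x)" if "0 < x" "x < 1" for x
    using coef_of_real[of x 24] that by (simp add: rcoef_def hh_def)
  have "T a 24 (of_real (q_special a)) = coef 24 (of_real (q_special a)) / coef 24 (of_real (Qa a))"
    using T_eq_coef[of "of_real (q_special a)" a 24] s a by (simp flip: of_real_power)
  also have "\<dots> = of_real (q_special a / Qa a * (hh (q_special a) / hh (Qa a)))"
    unfolding c[OF s(1,2)] c[OF s(4,6)] by simp
  also have "\<dots> = of_nat a ^ 6" unfolding s(7) using s by simp
  finally show "tendsto_exponentially (\<lambda>d. W a d 24 (of_real (q_special a))) (of_nat a ^ 6)" using sm(3) a by simp
qed

text \<open>After the constant term only the indices d, 2 d, 3 d, ... survive the averaging.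
  Division by \<nu> turns the coefficient of index d into \<open>kk\<close> exactly, and the bounds
  for the later ones gain at least a factor 51 Q^2 and are summed by a geometric series.\<close>

lemma section_expansion:
  assumes a: "a \<ge> 2" and d: "d \<ge> 2" and K: "\<And>n. n \<ge> 2 \<Longrightarrow> \<bar>kk (q_special a) (Qa a) n\<bar> \<le> 50 * 51 ^ n"
  defines "\<nu> \<equiv> q_special a * (1 - q_special a) * Qa a ^ (2 * d - 2)"
  shows "norm ((W a d 24 (of_real (q_special a)) - of_nat a ^ 6) / of_real \<nu> - of_real (kk (q_special a) (Qa a) d)) \<le> 100 * 51 ^ d * (51 * (Qa a)\<^sup>2)"
proof -
  define q where "q = q_special a"
  define Q where "Q = Qa a"
  define k where "k = kk q Q"
  define e where "e = 1 - q"
  \<comment> \<open>Undoing w = z Q: these are the Taylor coefficients of \<open>J\<close> in z,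
    including the prefactor q / Q.\<close>
  define c where "c = (\<lambda>n. q / Q * Q ^ n * qc q Q n)"
  note s = special_nome[OF a, folded q_def Q_def]
  have e: "e > 0" using s by (simp add: e_def)
  have K: "\<bar>k n\<bar> \<le> 50 * 51 ^ n" if "n \<ge> 2" for n using K[OF that] by (simp add: k_def q_def Q_def)
  define x where "x = 51 * Q\<^sup>2"
  have x: "0 < x" "x \<le> 1 / 2"
  proof -
    have "Q\<^sup>2 \<le> (1 / 256)\<^sup>2" using s by (intro power_mono) auto
    then show "x \<le> 1 / 2" by (simp add: x_def power2_eq_square)
    show "0 < x" using s by (simp add: x_def)
  qed
  have cn: "c n = q * e * (Q ^ (2 * n - 2) * k n)" if n2: "n \<ge> 2" for n
  proof -
    obtain m where m: "n = Suc m" using n2 by (cases n) auto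
    have "Q ^ (2 * n - 2) = Q ^ m * Q ^ m" by (simp add: m mult_2 flip: power_add)
    then show ?thesis using s e by (simp add: c_def k_def kk_def m flip: e_def)
  qed
  have c0: "c 0 = real a ^ 6" using s qc_0[of q Q] by (simp add: c_def)
  have cb: "\<bar>c n\<bar> \<le> q * e * (Q ^ (2 * n - 2) * (50 * 51 ^ n))" if "n \<ge> 2" for n
    unfolding cn[OF that] abs_mult using s e K[OF that] by (intro mult_mono) auto
  have cb': "\<bar>c n\<bar> \<le> q * e * 50 / Q\<^sup>2 * x ^ n" if "n \<ge> 2" for n
  proof -
    have "2 * n - 2 + 2 = 2 * n" using that by simp
    then have "Q ^ (2 * n - 2) * Q\<^sup>2 = Q ^ (2 * n)" by (simp only: flip: power_add)
    also have "\<dots> = (Q\<^sup>2) ^ n" by (simp add: power_mult)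
    finally have "Q ^ (2 * n - 2) = (Q\<^sup>2) ^ n / Q\<^sup>2" using s by (simp add: field_simps)
    then show ?thesis using cb[OF that] by (simp add: x_def power_mult_distrib mult_ac)
  qed
  have csum: "summable (\<lambda>n. \<bar>c n\<bar>)"
  proof (rule summable_comparison_test_ev)
    show "\<forall>\<^sub>F n in sequentially. norm \<bar>c n\<bar> \<le> q * e * 50 / Q\<^sup>2 * x ^ n"
      using eventually_ge_at_top[of 2] by eventually_elim (use cb' in simp)
    show "summable (\<lambda>n. q * e * 50 / Q\<^sup>2 * x ^ n)" using x by (intro summable_mult summable_geometric) auto
  qed
  have co: "coef 24 (complex_of_real y) = of_real (y * hh y)" if "0 < y" "y < 1" for y
    using coef_of_real[of y 24] that by (simp add: rcoef_def hh_def)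
  have Jsum: "(\<lambda>n. of_real (c n) * z ^ n) sums J a 24 z (of_real q)" if z: "norm z = 1" for z
  proof -
    have zx: "norm (complex_of_real q) < 1" "norm z * norm (complex_of_real q) ^ a < 1" "a \<ge> 1" using s z a by auto
    have n1: "coef 24 (complex_of_real q ^ (a * m + 1)) = of_real (q * Q ^ m * hh (q * Q ^ m))" for m
    proof -
      have "complex_of_real q ^ (a * m + 1) = of_real (q * Q ^ m)" by (simp add: power_mult flip: s(3))
      moreover have "q * Q ^ m < 1"
      proof -
        have "q * Q ^ m \<le> q * 1" using s by (intro mult_left_mono power_le_one) auto
        then show ?thesis using s(2) by linarith
      qed
      ultimately show ?thesis using co[of "q * Q ^ m"] s by simp
    qed
    have d1: "coef 24 (complex_of_real q ^ (a * (m + 1))) = of_real (Q ^ (m + 1) * hh (Q ^ (m + 1)))" for m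
    proof -
      have "complex_of_real q ^ (a * (m + 1)) = of_real (Q ^ (m + 1))" unfolding power_mult s(3)[symmetric] by simp
      moreover have "Q ^ (m + 1) < 1" using s by (simp add: power_less_one_iff del: power_Suc)
      ultimately show ?thesis using co[of "Q ^ (m + 1)"] s by simp
    qed
    define D where "D = (\<lambda>m. of_real (Q ^ (m + 1) * hh (Q ^ (m + 1))) * z ^ m)"
    have num: "(\<lambda>m. of_real (q * Q ^ m * hh (q * Q ^ m)) * z ^ m) sums J_num a 24 z (of_real q)"
      using J_num_in_z[OF zx, of 24] unfolding n1 .
    have den: "D sums J_den a 24 z (of_real q)" using J_den_in_z[OF zx, of 24] unfolding d1 D_def .
    have "summable (\<lambda>m. norm (D m))"
    proof (rule summable_comparison_test_ev)
      have "norm (norm (D m)) \<le> Q ^ m" for m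
      proof -
        have "norm (D m) = Q ^ (m + 1) * hh (Q ^ (m + 1))"
          using s z hh_bounds(1)[of "Q ^ (m + 1)"] by (simp add: D_def norm_mult norm_power power_less_one_iff del: power_Suc)
        also have "\<dots> \<le> Q ^ m * 1"
          using s hh_bounds[of "Q ^ (m + 1)"] by (intro mult_mono power_decreasing) (auto simp: power_less_one_iff simp del: power_Suc)
        finally show ?thesis by simp
      qed
      then show "\<forall>\<^sub>F m in sequentially. norm (norm (D m)) \<le> Q ^ m" by simp
      show "summable (\<lambda>m. Q ^ m)" using s by (intro summable_geometric) auto
    qed
    moreover have cs: "summable (\<lambda>n. norm (of_real (c n) * z ^ n))" using csum z by (simp add: norm_mult norm_power)
    \<comment> \<open>The expansion is verified by multiplication: its Cauchy product with the
      denominator reproduces the numerator by \<open>qc_sum\<close>, and the denominator is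
      nonzero.\<close>
    ultimately have "(\<lambda>n. \<Sum>i\<le>n. of_real (c i) * z ^ i * D (n - i)) sums ((\<Sum>n. of_real (c n) * z ^ n) * (\<Sum>m. D m))"
      by (intro Cauchy_product_sums)
    moreover have "(\<Sum>i\<le>n. of_real (c i) * z ^ i * D (n - i)) = of_real (q * Q ^ n * hh (q * Q ^ n)) * z ^ n" for n
    proof -
      have "of_real (c i) * z ^ i * D (n - i) = of_real (q * Q ^ n) * z ^ n * of_real (qc q Q i * hh (Q ^ (n - i + 1)))" if i: "i \<le> n" for i
      proof -
        have "z ^ i * z ^ (n - i) = z ^ n" "Q ^ i * Q ^ (n - i) = Q ^ n" using i by (simp_all flip: power_add)
        moreover have "c i * (Q ^ (n - i + 1) * hh (Q ^ (n - i + 1))) = q * (Q ^ i * Q ^ (n - i)) * (qc q Q i * hh (Q ^ (n - i + 1)))"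
          using s by (simp add: c_def)
        moreover have "of_real (c i) * z ^ i * D (n - i) = of_real (c i * (Q ^ (n - i + 1) * hh (Q ^ (n - i + 1)))) * (z ^ i * z ^ (n - i))"
          by (simp add: D_def)
        ultimately show ?thesis by (simp only: of_real_mult mult_ac)
      qed
      then have "(\<Sum>i\<le>n. of_real (c i) * z ^ i * D (n - i)) = of_real (q * Q ^ n) * z ^ n * of_real (\<Sum>i\<le>n. qc q Q i * hh (Q ^ (n - i + 1)))"
        unfolding of_real_sum sum_distrib_left by (intro sum.cong) auto
      then show ?thesis unfolding qc_sum[OF s(1,2,4,6)] by simp
    qed
    ultimately have "(\<lambda>n. of_real (q * Q ^ n * hh (q * Q ^ n)) * z ^ n) sums ((\<Sum>n. of_real (c n) * z ^ n) * (\<Sum>m. D m))" by simp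
    then have "J_num a 24 z (of_real q) = (\<Sum>n. of_real (c n) * z ^ n) * J_den a 24 z (of_real q)"
      using sums_unique2[OF num] sums_unique[OF den] by simp
    moreover have "J_den a 24 z (of_real q) \<noteq> 0" using special_sections(3)[OF a, of z] z by (simp add: q_def)
    ultimately have "J a 24 z (of_real q) = (\<Sum>n. of_real (c n) * z ^ n)" by (simp add: J_def)
    then show ?thesis using summable_sums[OF summable_norm_cancel[OF cs]] by simp
  qed
  have d1: "d \<ge> 1" using d by simp
  have shift: "(\<lambda>j. f (Suc j)) sums (L - f 0)" if "f sums L" for f :: "nat \<Rightarrow> complex" and L
    using that by (simp add: sums_Suc_iff)
  have "(\<lambda>j. complex_of_real (c (d * j))) sums W a d 24 (of_real q)"
    using roots_unity_average_sums[OF d1 Jsum] special_sections(2)[OF a d1] by (simp add: section_sum_def q_def)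
  \<comment> \<open>Two terms are split off in turn: the constant one, equal to a^6, and the one of
    index d.\<close>
  from shift[OF this] have S1: "(\<lambda>j. complex_of_real (c (d * Suc j))) sums (W a d 24 (of_real q) - of_nat a ^ 6)" by (simp add: c0)
  from shift[OF this] have S2: "(\<lambda>j. complex_of_real (c (d * Suc (Suc j)))) sums (W a d 24 (of_real q) - of_nat a ^ 6 - of_real (c d))" by simp
  have \<nu>: "\<nu> = q * e * Q ^ (2 * d - 2)" "\<nu> > 0" using s e by (auto simp: \<nu>_def q_def Q_def e_def)
  have tm: "norm (complex_of_real (c (d * Suc (Suc j)))) \<le> \<nu> * 50 * 51 ^ d * x * (1 / 2) ^ j" for j
  proof -
    define n where "n = d * Suc (Suc j)"
    have n: "n \<ge> 2" "n = d + d * Suc j" using d by (auto simp: n_def)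
    have "2 * n - 2 = (2 * d - 2) + 2 * (d * Suc j)" using n d by simp
    then have "Q ^ (2 * n - 2) = Q ^ (2 * d - 2) * (Q\<^sup>2) ^ (d * Suc j)" by (simp only: power_add power_mult)
    then have "q * e * (Q ^ (2 * n - 2) * (50 * 51 ^ n)) = \<nu> * 50 * 51 ^ d * x ^ (d * Suc j)"
      by (simp add: n(2) \<nu>(1) power_add x_def power_mult_distrib del: mult_Suc_right)
    also have "\<dots> \<le> \<nu> * 50 * 51 ^ d * (x * (1 / 2) ^ j)"
    proof (rule mult_left_mono)
      have "1 * Suc j \<le> d * Suc j" using d by (intro mult_right_mono) auto
      then have "x ^ (d * Suc j) \<le> x ^ Suc j" using x by (intro power_decreasing) auto
      also have "\<dots> \<le> x * (1 / 2) ^ j" using x by (simp add: power_mono mult_left_mono)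
      finally show "x ^ (d * Suc j) \<le> x * (1 / 2) ^ j" .
    qed (use \<nu> in auto)
    finally show ?thesis using cb[OF n(1)] by (simp add: n_def)
  qed
  have geo: "(\<lambda>j. \<nu> * 50 * 51 ^ d * x * (1 / 2) ^ j) sums (\<nu> * 50 * 51 ^ d * x * (1 / (1 - 1 / 2)))"
    by (intro sums_mult geometric_sums) simp
  have "norm (W a d 24 (of_real q) - of_nat a ^ 6 - of_real (c d)) \<le> \<nu> * 50 * 51 ^ d * x * (1 / (1 - 1 / 2))"
    using norm_sums_le[OF S2 geo tm] .
  then have b: "norm (W a d 24 (of_real q) - of_nat a ^ 6 - of_real (c d)) \<le> (100 * 51 ^ d * x) * \<nu>" by (simp add: mult_ac)
  have "c d = \<nu> * k d" using cn[OF d] by (simp add: \<nu>)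
  then have "(W a d 24 (of_real q) - of_nat a ^ 6) / of_real \<nu> - of_real (k d) = (W a d 24 (of_real q) - of_nat a ^ 6 - of_real (c d)) / of_real \<nu>"
    using \<nu>(2) by (simp add: field_simps)
  then have "norm ((W a d 24 (of_real q) - of_nat a ^ 6) / of_real \<nu> - of_real (k d)) = norm (W a d 24 (of_real q) - of_nat a ^ 6 - of_real (c d)) / \<nu>"
    using \<nu>(2) by (simp add: norm_divide)
  also have "\<dots> \<le> 100 * 51 ^ d * x" using b \<nu>(2) by (simp add: pos_divide_le_eq)
  finally show ?thesis by (simp add: q_def Q_def k_def x_def)
qed

theorem special_sections_asymptotics:
  assumes d: "d \<ge> 2"
  shows "(\<lambda>a::nat. W a d 24 (of_real (q_special a)) - of_nat a ^ 6) \<sim>[at_top]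
          (\<lambda>a. of_real (48 * pi * (-1) ^ (d - 1) * 23 ^ (d - 2) * real a powr (- 1 / 2) *
                  exp (- 4 * pi * (real d - 1) * sqrt (real a))))"
proof -
  obtain C where C: "C \<ge> 0" "\<And>x y M. 0 \<le> x \<Longrightarrow> 0 \<le> y \<Longrightarrow> x \<le> M \<Longrightarrow> y \<le> M \<Longrightarrow> M \<le> 1 / 2 \<Longrightarrow> \<bar>hh x - hh y + 24 * (x - y)\<bar> \<le> C * M * \<bar>x - y\<bar>"
    using hh_estimate by blast
  define \<eta> where "\<eta> = (\<lambda>a. 3 * (48 + C)\<^sup>2 * (Qa a + hh (q_special a) / hh (Qa a) / (1 - q_special a)))"
  define k where "k = (\<lambda>a. kk (q_special a) (Qa a))"
  have ev2: "\<forall>\<^sub>F a::nat in at_top. a \<ge> 2" by (rule eventually_ge_at_top)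
  have Q0: "(\<lambda>a. Qa a) \<longlonglongrightarrow> 0" unfolding Qa_def by real_asymp
  \<comment> \<open>The second part of \<eta> is a^6 Q / (q (1 - q)); it tends to 0 since
    \<open>Qa a\<close> decays faster than any power of a.\<close>
  have "(\<lambda>a. real a ^ 6 * Qa a / q_special a / (1 - q_special a)) \<longlonglongrightarrow> 0" unfolding Qa_def q_special_def by real_asymp
  then have g0: "(\<lambda>a. hh (q_special a) / hh (Qa a) / (1 - q_special a)) \<longlonglongrightarrow> 0"
    by (rule Lim_transform_eventually) (use ev2 in eventually_elim, simp add: special_nome(7))
  have "(\<lambda>a. 3 * (48 + C)\<^sup>2 * (Qa a + hh (q_special a) / hh (Qa a) / (1 - q_special a))) \<longlonglongrightarrow> 3 * (48 + C)\<^sup>2 * (0 + 0)"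
    by (intro tendsto_intros Q0 g0)
  then have \<eta>0: "\<eta> \<longlonglongrightarrow> 0" by (simp add: \<eta>_def)
  have bounds: "\<bar>hh (Qa a) - 1\<bar> \<le> \<eta> a" "\<And>i. i \<ge> 1 \<Longrightarrow> \<bar>dd (Qa a) i - 24\<bar> \<le> \<eta> a" "\<And>n. n \<ge> 2 \<Longrightarrow> \<bar>rr (q_special a) (Qa a) n + 24\<bar> \<le> \<eta> a" if a: "a \<ge> 2" for a
    using coefficient_bounds[OF special_nome(1,2,4,6,5)[OF a] C] by (simp_all add: \<eta>_def)
  have rec: "hh (Qa a) * k a n + (\<Sum>j\<in>{2..<n}. dd (Qa a) (n - j) * k a j) = rr (q_special a) (Qa a) n" if "a \<ge> 2" "n \<ge> 2" for a n
    unfolding k_def using special_nome[OF that(1)] by (intro kk_recurrence that) auto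
  have sq: "f \<longlonglongrightarrow> L" if "\<And>a. a \<ge> 2 \<Longrightarrow> \<bar>f a - L\<bar> \<le> \<eta> a" for f :: "nat \<Rightarrow> real" and L
  proof (rule LIM_zero_cancel, rule Lim_null_comparison[OF _ \<eta>0])
    show "\<forall>\<^sub>F a in sequentially. norm (f a - L) \<le> \<eta> a" using ev2 by eventually_elim (simp add: that)
  qed
  have klim: "(\<lambda>a. k a d) \<longlonglongrightarrow> - 24 * (- 23) ^ (d - 2)"
  proof (rule recurrence_limit[where \<beta> = "\<lambda>a. hh (Qa a)" and b = "\<lambda>a. dd (Qa a)" and r = "\<lambda>a. rr (q_special a) (Qa a)"])
    show "\<forall>\<^sub>F a in sequentially. hh (Qa a) * k a n + (\<Sum>j\<in>{2..<n}. dd (Qa a) (n - j) * k a j) = rr (q_special a) (Qa a) n" if "n \<ge> 2" for n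
      using ev2 by eventually_elim (rule rec[OF _ that])
    show "(\<lambda>a. hh (Qa a)) \<longlonglongrightarrow> 1" by (rule sq) (rule bounds(1))
    show "(\<lambda>a. dd (Qa a) i) \<longlonglongrightarrow> 24" if "i \<ge> 1" for i by (rule sq) (rule bounds(2)[OF _ that])
    show "(\<lambda>a. rr (q_special a) (Qa a) n) \<longlonglongrightarrow> - 24" if "n \<ge> 2" for n by (rule sq) (use bounds(3)[OF _ that] in simp)
  qed (rule d)
  define \<nu> where "\<nu> = (\<lambda>a. q_special a * (1 - q_special a) * Qa a ^ (2 * d - 2))"
  define f where "f = (\<lambda>a. W a d 24 (of_real (q_special a)) - of_nat a ^ 6)"
  have ev1: "\<forall>\<^sub>F a in at_top. \<eta> a < 1 / 2" using order_tendstoD(2)[OF \<eta>0, of "1 / 2"] by simp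
  have "(\<lambda>a. f a / of_real (\<nu> a) - of_real (k a d)) \<longlonglongrightarrow> 0"
  proof (rule Lim_null_comparison)
    show "\<forall>\<^sub>F a in sequentially. norm (f a / of_real (\<nu> a) - of_real (k a d)) \<le> 100 * 51 ^ d * (51 * (Qa a)\<^sup>2)"
      using ev1 ev2
    proof eventually_elim
      case (elim a)
      have "\<bar>k a n\<bar> \<le> 50 * 51 ^ n" if "n \<ge> 2" for n
      proof (rule recurrence_bound[OF rec[OF elim(2)] _ _ _ that])
        show "1 / 2 \<le> hh (Qa a)" using bounds(1)[OF elim(2)] elim(1) by linarith
        show "\<bar>dd (Qa a) i\<bar> \<le> 25" if "i \<ge> 1" for i using bounds(2)[OF elim(2) that] elim(1) by linarith
        show "\<bar>rr (q_special a) (Qa a) n\<bar> \<le> 25" if "n \<ge> 2" for n using bounds(3)[OF elim(2) that] elim(1) by linarith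
      qed
      then show ?case using section_expansion[OF elim(2) d] by (simp add: k_def f_def \<nu>_def)
    qed
    have "(\<lambda>a. 100 * 51 ^ d * (51 * (Qa a)\<^sup>2)) \<longlonglongrightarrow> 100 * 51 ^ d * (51 * 0\<^sup>2)" by (intro tendsto_intros Q0)
    then show "(\<lambda>a. 100 * 51 ^ d * (51 * (Qa a)\<^sup>2)) \<longlonglongrightarrow> 0" by simp
  qed
  from tendsto_add[OF this tendsto_of_real[OF klim]]
  have flim: "(\<lambda>a. f a / of_real (\<nu> a)) \<longlonglongrightarrow> of_real (- 24 * (- 23) ^ (d - 2))" by simp
  define \<kappa> :: real where "\<kappa> = 24 * (-1) ^ (d - 1) * 23 ^ (d - 2)"
  have \<kappa>: "- 24 * (- 23) ^ (d - 2) = \<kappa>" "\<kappa> \<noteq> 0"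
  proof -
    obtain m where m: "d = Suc (Suc m)" using d by (metis add_2_eq_Suc le_Suc_ex)
    show "- 24 * (- 23) ^ (d - 2) = \<kappa>" unfolding \<kappa>_def m using power_mult_distrib[of "- 1 :: real" 23 m] by simp
    show "\<kappa> \<noteq> 0" by (simp add: \<kappa>_def)
  qed
  define M where "M = (\<lambda>a. 48 * pi * (-1) ^ (d - 1) * 23 ^ (d - 2) * real a powr (- 1 / 2) * exp (- 4 * pi * (real d - 1) * sqrt (real a)))"
  \<comment> \<open>Here 1 - q is asymptotic to 2 pi / sqrt a; together with the 24 in
    \<open>\<kappa>\<close> this makes 48 pi a^(-1/2).\<close>
  have "(\<lambda>a::nat. 2 * pi * real a powr (- 1 / 2) / (exp (- 2 * pi / sqrt (real a)) * (1 - exp (- 2 * pi / sqrt (real a))))) \<longlonglongrightarrow> 1" by real_asymp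
  then have "(\<lambda>a. \<kappa> * (2 * pi * real a powr (- 1 / 2) / (q_special a * (1 - q_special a)))) \<longlonglongrightarrow> \<kappa> * 1"
    unfolding q_special_def by (intro tendsto_mult tendsto_const)
  moreover have "\<kappa> * (2 * pi * real a powr (- 1 / 2) / (q_special a * (1 - q_special a))) = M a / \<nu> a" for a
  proof -
    have "exp (- 4 * pi * (real d - 1) * sqrt (real a)) = exp (real (2 * d - 2) * (- 2 * pi * sqrt (real a)))"
      using d by (simp add: of_nat_diff algebra_simps)
    also have "\<dots> = Qa a ^ (2 * d - 2)" unfolding Qa_def exp_of_nat_mult ..
    finally have "M a = \<kappa> * (2 * pi * real a powr (- 1 / 2)) * Qa a ^ (2 * d - 2)" unfolding M_def \<kappa>_def by simp
    moreover have "Qa a ^ (2 * d - 2) \<noteq> 0" by (simp add: Qa_def)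
    ultimately show ?thesis by (simp add: \<nu>_def)
  qed
  ultimately have "(\<lambda>a. M a / \<nu> a) \<longlonglongrightarrow> \<kappa>" by simp
  from tendsto_divide[OF flim[unfolded \<kappa>(1)] tendsto_of_real[OF this]]
  have "(\<lambda>a. (f a / of_real (\<nu> a)) / of_real (M a / \<nu> a)) \<longlonglongrightarrow> of_real \<kappa> / of_real \<kappa>" using \<kappa>(2) by simp
  then have l: "(\<lambda>a. (f a / of_real (\<nu> a)) / of_real (M a / \<nu> a)) \<longlonglongrightarrow> 1" using \<kappa>(2) by simp
  have "f \<sim>[at_top] (\<lambda>a. of_real (M a))"
  proof (rule asymp_equivI', rule Lim_transform_eventually[OF l], use ev2 in eventually_elim)
    fix a :: nat assume a: "2 \<le> a"
    have "\<nu> a \<noteq> 0" using special_nome[OF a] by (simp add: \<nu>_def)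
    then show "f a / of_real (\<nu> a) / of_real (M a / \<nu> a) = f a / of_real (M a)" by simp
  qed
  then show ?thesis by (simp only: f_def M_def)
qed

theorem theorem1p1:
  shows
    "(\<forall>(a::nat) (d::nat) (k::nat). a \<ge> 2 \<longrightarrow> d \<ge> 2 \<longrightarrow> k \<ge> 1 \<longrightarrow>
        W a d k meromorphic_on {q. 0 < norm q \<and> norm q < 1})
   \<and> (\<forall>(a::nat) (d::nat) (k::nat). a \<ge> 2 \<longrightarrow> d \<ge> 2 \<longrightarrow> k \<ge> 1 \<longrightarrow>
        (odd d \<longrightarrow>
           (\<forall>\<^sub>F x in at_left (1::real). \<not> is_pole (W a d k) (of_real x)) \<and>
           ((\<lambda>x::real. W a d k (of_real x)) \<longlongrightarrow>
              of_real (sin (pi / real a) /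
                (real d * sin (pi * (real a - 1) / (real a * real d))))) (at_left 1)) \<and>
        (even d \<longrightarrow>
           (\<exists>(j0::nat) (q :: nat \<Rightarrow> real).
              inj_on q {j0..} \<and>
              (\<forall>j\<ge>j0. 0 < q j \<and> q j < 1 \<and>
                  is_pole (W a d k) (of_real (q j)) \<and>
                  zorder (W a d k) (of_real (q j)) = -1) \<and>
              q \<longlonglongrightarrow> 1 \<and>
              (\<exists>\<epsilon>>0. \<forall>x::real. 1 - \<epsilon> < x \<longrightarrow> x < 1 \<longrightarrow> is_pole (W a d k) (of_real x) \<longrightarrow>
                  (\<exists>j\<ge>j0. x = q j)) \<and>
              (\<lambda>j. 1 - q j) \<sim>[at_top] (\<lambda>j. pi * real k / (3 * real a * real j ^ 2)) \<and>
              (\<lambda>j. residue (W a d k) (of_real (q j))) \<sim>[at_top]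
                (\<lambda>j. of_real (2 * real k * sin (pi / real a) /
                        (3 * real a * real d * real j ^ 3))))))
   \<and> (\<forall>(a::nat) (k::nat). a \<ge> 2 \<longrightarrow> k \<ge> 1 \<longrightarrow>
        (\<exists>!Q. is_Qstar k Q) \<and>
        (\<forall>q::real. 0 < q \<longrightarrow> q \<le> Qstar k powr (1 / real a) \<longrightarrow>
           (\<forall>d\<ge>2. \<not> is_pole (W a d k) (of_real q)) \<and>
           tendsto_exponentially (\<lambda>d. W a d k (of_real q)) (T a k (of_real q))))
   \<and> (\<forall>a::nat. a \<ge> 2 \<longrightarrow>
        (\<forall>d\<ge>2. \<not> is_pole (W a d 24) (of_real (q_special a))) \<and>
        tendsto_exponentially (\<lambda>d. W a d 24 (of_real (q_special a))) (of_nat a ^ 6))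
   \<and> (\<forall>d::nat. d \<ge> 2 \<longrightarrow>
        (\<lambda>a::nat. W a d 24 (of_real (q_special a)) - of_nat a ^ 6) \<sim>[at_top]
          (\<lambda>a. of_real (48 * pi * (-1) ^ (d - 1) * 23 ^ (d - 2) * real a powr (- 1 / 2) *
                  exp (- 4 * pi * (real d - 1) * sqrt (real a)))))"
proof (intro conjI allI impI)
  fix a d k :: nat assume a: "a \<ge> 2" and d: "d \<ge> 2" and k: "k \<ge> 1"
  show "W a d k meromorphic_on {q. 0 < norm q \<and> norm q < 1}"
    by (rule meromorphic_on_subset[OF W_meromorphic]) (use a d in auto)
  obtain K1 where "sector_flat (H1 k) (real k / 2) (bk k) K1 (1 / 8)" using sector_flat_H1[OF k] by blast
  moreover obtain K2 where "sector_flat (H2 k) (real k / 2 + 1) (bk k) K2 (1 / 8)" using sector_flat_H2[OF k] by blast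
  ultimately interpret two_flat k K1 K2 a
    using a k by (auto simp: two_flat_def two_flat_axioms_def)
  show "\<forall>\<^sub>F x in at_left (1::real). \<not> is_pole (W a d k) (of_real x)"
    "((\<lambda>x::real. W a d k (of_real x)) \<longlongrightarrow> of_real (sin (pi / real a) / (real d * sin (pi * (real a - 1) / (real a * real d))))) (at_left 1)"
    if "odd d" by (rule section_limit_odd[OF that])+
  show "\<exists>(j0::nat) (q :: nat \<Rightarrow> real).
              inj_on q {j0..} \<and>
              (\<forall>j\<ge>j0. 0 < q j \<and> q j < 1 \<and>
                  is_pole (W a d k) (of_real (q j)) \<and>
                  zorder (W a d k) (of_real (q j)) = -1) \<and>
              q \<longlonglongrightarrow> 1 \<and>
              (\<exists>\<epsilon>>0. \<forall>x::real. 1 - \<epsilon> < x \<longrightarrow> x < 1 \<longrightarrow> is_pole (W a d k) (of_real x) \<longrightarrow>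
                  (\<exists>j\<ge>j0. x = q j)) \<and>
              (\<lambda>j. 1 - q j) \<sim>[at_top] (\<lambda>j. pi * real k / (3 * real a * real j ^ 2)) \<and>
              (\<lambda>j. residue (W a d k) (of_real (q j))) \<sim>[at_top]
                (\<lambda>j. of_real (2 * real k * sin (pi / real a) /
                        (3 * real a * real d * real j ^ 3)))"
    if "even d" by (rule section_poles_even[OF that d])
next
  fix a k :: nat assume "a \<ge> 2" "k \<ge> 1"
  then show "\<exists>!Q. is_Qstar k Q" by (intro Qstar_ex1)
next
  fix a k d :: nat and q :: real assume "a \<ge> 2" "k \<ge> 1" "0 < q" "q \<le> Qstar k powr (1 / real a)" "d \<ge> 2"
  then show "\<not> is_pole (W a d k) (of_real q)" using sections_below_Qstar(1) by blast
next
  fix a k :: nat and q :: real assume "a \<ge> 2" "k \<ge> 1" "0 < q" "q \<le> Qstar k powr (1 / real a)"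
  then show "tendsto_exponentially (\<lambda>d. W a d k (of_real q)) (T a k (of_real q))" by (rule sections_below_Qstar(2))
next
  fix a d :: nat assume "a \<ge> 2" "d \<ge> 2"
  then show "\<not> is_pole (W a d 24) (of_real (q_special a))" by (intro special_sections(1)) auto
next
  fix a :: nat assume "a \<ge> 2"
  then show "tendsto_exponentially (\<lambda>d. W a d 24 (of_real (q_special a))) (of_nat a ^ 6)" by (rule special_sections(4))
next
  fix d :: nat assume "d \<ge> 2"
  then show "(\<lambda>a::nat. W a d 24 (of_real (q_special a)) - of_nat a ^ 6) \<sim>[at_top]
          (\<lambda>a. of_real (48 * pi * (-1) ^ (d - 1) * 23 ^ (d - 2) * real a powr (- 1 / 2) *
                  exp (- 4 * pi * (real d - 1) * sqrt (real a))))"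
    by (rule special_sections_asymptotics)
qed

end
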